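(* Let $(\mathscr{C},\mathbb{E},\mathfrak{s})$ be an extriangulated category satisfying Condition (WIC), let $((\mathcal{S},\mathcal{T}),(\mathcal{U},\mathcal{V}))$ be a Hovey twin cotorsion pair on $\mathscr{C}$, and let $\widetilde{\mathscr{C}}=\mathscr{C}[\mathbb{W}^{-1}]$ be the associated localization. Then the shift functor $[1]\colon\widetilde{\mathscr{C}}\to\widetilde{\mathscr{C}}$ and the class of distinguished triangles defined in the context give a triangulation of $\widetilde{\mathscr{C}}$.
   Context: Extriangulated categories. Let $\mathscr{C}$ be an additive category and $\mathbb{E}\colon\mathscr{C}^{\mathrm{op}}\times\mathscr{C}\to\mathit{Ab}$ a functor. Elements $\delta\in\mathbb{E}(C,A)$ are called $\mathbb{E}$-extensions; for $a\colon A\to A'$ and $c\colon C'\to C$ put $a_*\delta=\mathbb{E}(C,a)(\delta)$ and $c^*\delta=\mathbb{E}(c,A)(\delta)$. A morphism $(a,c)\colon\delta\to\delta'$ from $\delta\in\mathbb{E}(C,A)$ to $\delta'\in\mathbb{E}(C',A')$ is a pair $a\colon A\to A'$, $c\colon C\to C'$ with $a_*\delta=c^*\delta'$. Sequences $A\xrightarrow{x}B\xrightarrow{y}C$ and $A\xrightarrow{x'}B'\xrightarrow{y'}C$ are equivalent if there is an isomorphism $b\colon B\to B'$ with $bx=x'$, $y'b=y$; the class is written $[A\xrightarrow{x}B\xrightarrow{y}C]$. A realization $\mathfrak{s}$ assigns to each $\delta\in\mathbb{E}(C,A)$ such a class $\mathfrak{s}(\delta)=[A\xrightarrow{x}B\xrightarrow{y}C]$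 so that for every morphism $(a,c)\colon\delta\to\delta'$, with $\mathfrak{s}(\delta')=[A'\xrightarrow{x'}B'\xrightarrow{y'}C']$, there is $b\colon B\to B'$ with $bx=x'a$, $y'b=cy$ (then $(a,b,c)$ is said to realize $(a,c)$). It is additive if $\mathfrak{s}(0)=[A\to A\oplus C\to C]$ (canonical inclusion and projection) and $\mathfrak{s}(\delta\oplus\delta')=[A\oplus A'\xrightarrow{x\oplus x'}B\oplus B'\xrightarrow{y\oplus y'}C\oplus C']$, where $\delta\oplus\delta'\in\mathbb{E}(C\oplus C',A\oplus A')$ corresponds to $(\delta,0,0,\delta')$. If $\mathfrak{s}(\delta)=[A\xrightarrow{x}B\xrightarrow{y}C]$, the sequence is called a conflation, $x$ an inflation, $y$ a deflation, and one speaks of the $\mathbb{E}$-triangle $A\xrightarrow{x}B\xrightarrow{y}C\overset{\delta}{\dashrightarrow}$. The triple $(\mathscr{C},\mathbb{E},\mathfrak{s})$ is an extriangulated category if: (ET1) $\mathbb{E}$ is biadditive; (ET2) $\mathfrak{s}$ is an additive realization; (ET3) for $\mathbb{E}$-triangles $A\xrightarrow{x}B\xrightarrow{y}C\overset{\delta}{\dashrightarrow}$, $A'\xrightarrow{x'}B'\xrightarrow{y'}C'\overset{\delta'}{\dashrightarrow}$ and $a,b$ with $bx=x'a$ there is $c$ such that $(a,c)\colon\delta\to\delta'$ is a morphism realized by $(a,b,c)$; (ET3)$^{\mathrm{op}}$ for $b,c$ with $y'b=cy$ there is $a$ such that $(a,c)\colon\delta\to\delta'$ is a morphism realized by $(a,b,c)$;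 (ET4) for $\mathbb{E}$-triangles $A\xrightarrow{f}B\xrightarrow{f'}D\overset{\delta}{\dashrightarrow}$ and $B\xrightarrow{g}C\xrightarrow{g'}F\overset{\delta'}{\dashrightarrow}$ there are an $\mathbb{E}$-triangle $A\xrightarrow{h}C\xrightarrow{h'}E\overset{\delta''}{\dashrightarrow}$ with $h=gf$ and $d\colon D\to E$, $e\colon E\to F$ with $df'=h'g$, $eh'=g'$, such that $D\xrightarrow{d}E\xrightarrow{e}F$ realizes $f'_*\delta'$, $d^*\delta''=\delta$ and $f_*\delta''=e^*\delta'$; (ET4)$^{\mathrm{op}}$ for $\mathbb{E}$-triangles $D\xrightarrow{f'}A\xrightarrow{f}B\overset{\delta}{\dashrightarrow}$ and $F\xrightarrow{g'}B\xrightarrow{g}C\overset{\delta'}{\dashrightarrow}$ there are an $\mathbb{E}$-triangle $E\xrightarrow{h'}A\xrightarrow{h}C\overset{\delta''}{\dashrightarrow}$ with $h=gf$ and $d\colon D\to E$, $e\colon E\to F$ with $h'd=f'$, $fh'=g'e$, such that $D\xrightarrow{d}E\xrightarrow{e}F$ realizes $g'^*\delta$, $\delta'=e_*\delta''$ and $d_*\delta=g^*\delta''$. Condition (WIC): for all composable $f\colon A\to B$, $g\colon B\to C$: if $gf$ is an inflation then so is $f$; if $gf$ is a deflation then so is $g$. Cotorsion pairs. A cotorsion pair on $\mathscr{C}$ is a pair $(\mathcal{U},\mathcal{V})$ of full additive subcategories closed under isomorphisms and direct summands such that $\mathbb{E}(U,V)=0$ for all $U\in\mathcal{U},V\in\mathcal{V}$,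 and every $C\in\mathscr{C}$ admits conflations $V^C\to U^C\to C$ and $C\to V_C\to U_C$ with $U^C,U_C\in\mathcal{U}$, $V^C,V_C\in\mathcal{V}$. A twin cotorsion pair is a pair $((\mathcal{S},\mathcal{T}),(\mathcal{U},\mathcal{V}))$ of cotorsion pairs with $\mathbb{E}(\mathcal{S},\mathcal{V})=0$. Let $\mathcal{N}^i$ (resp. $\mathcal{N}^f$) be the full subcategory of objects $X$ admitting a conflation $V\to S\to X$ (resp. $X\to V\to S$) with $V\in\mathcal{V},S\in\mathcal{S}$. The twin cotorsion pair is Hovey if $\mathcal{N}^i=\mathcal{N}^f$. Localization. $w\mathit{Fib}$ is the class of deflations $f\colon A\to B$ admitting a conflation $V\to A\xrightarrow{f}B$ with $V\in\mathcal{V}$; $w\mathit{Cof}$ is the class of inflations $f\colon A\to B$ admitting a conflation $A\xrightarrow{f}B\to S$ with $S\in\mathcal{S}$; $\mathbb{W}=w\mathit{Fib}\circ w\mathit{Cof}$ is the class of composites $p\circ i$, $i\in w\mathit{Cof}$, $p\in w\mathit{Fib}$; $\ell\colon\mathscr{C}\to\widetilde{\mathscr{C}}=\mathscr{C}[\mathbb{W}^{-1}]$ is the localization functor (identity on objects). Shift. Fix for each $A\in\mathscr{C}$ an $\mathbb{E}$-triangle $A\xrightarrow{v_A}V_A\xrightarrow{u_A}U_A\overset{\rho_A}{\dashrightarrow}$ with $V_A\in\mathcal{V}$, $U_A\in\mathcal{U}$. Put $A[1]=U_A$; for $f\colon A\to B$ choose $u_f\colon U_A\to U_B$ such that $(f,u_f)\colon\rho_A\to\rho_B$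 is a morphism of $\mathbb{E}$-extensions and put $f[1]=\ell(u_f)$. This is a well-defined functor $\mathscr{C}\to\widetilde{\mathscr{C}}$ that inverts $\mathbb{W}$, and so induces $[1]\colon\widetilde{\mathscr{C}}\to\widetilde{\mathscr{C}}$. Distinguished triangles. For $\delta\in\mathbb{E}(C,A)$ define $\widetilde{\ell}(\delta)\in\widetilde{\mathscr{C}}(C,A[1])$ by $\widetilde{\ell}(\delta)=\ell(d)\circ\ell(w)^{-1}$, where $C\xleftarrow{w}D\xrightarrow{d}U_A$ is any span with $w\in w\mathit{Fib}$ and $w^*\delta=d^*\rho_A$ (such spans exist and the result is independent of the choice). The standard triangle of an $\mathbb{E}$-triangle $A\xrightarrow{x}B\xrightarrow{y}C\overset{\delta}{\dashrightarrow}$ is $A\xrightarrow{\ell(x)}B\xrightarrow{\ell(y)}C\xrightarrow{\widetilde{\ell}(\delta)}A[1]$. A distinguished triangle in $\widetilde{\mathscr{C}}$ is a triangle isomorphic to a standard triangle. *)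

theory Defs
  imports "HOL-Algebra.Group"
begin

section \<open>Categories and functors\<close>

record ('o, 'm) cat =
  Obj :: "'o set"
  Arr :: "'m set"
  Dom :: "'m \<Rightarrow> 'o"
  Cod :: "'m \<Rightarrow> 'o"
  Idn :: "'o \<Rightarrow> 'm"
  Cmp :: "'m \<Rightarrow> 'm \<Rightarrow> 'm"  (infixr \<open>\<cdot>\<index>\<close> 75)

definition Hom :: "('o, 'm, 'z) cat_scheme \<Rightarrow> 'o \<Rightarrow> 'o \<Rightarrow> 'm set" where
  "Hom C A B = {f \<in> Arr C. Dom C f = A \<and> Cod C f = B}"

locale category =
  fixes C :: "('o, 'm, 'z) cat_scheme"
  assumes dom_obj: "f \<in> Arr C \<Longrightarrow> Dom C f \<in> Obj C"
    and cod_obj: "f \<in> Arr C \<Longrightarrow> Cod C f \<in> Obj C"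
    and idn_hom: "A \<in> Obj C \<Longrightarrow> Idn C A \<in> Hom C A A"
    and cmp_hom: "\<lbrakk>f \<in> Hom C A B; g \<in> Hom C B D\<rbrakk> \<Longrightarrow> g \<cdot>\<^bsub>C\<^esub> f \<in> Hom C A D"
    and idn_left: "f \<in> Hom C A B \<Longrightarrow> Idn C B \<cdot>\<^bsub>C\<^esub> f = f"
    and idn_right: "f \<in> Hom C A B \<Longrightarrow> f \<cdot>\<^bsub>C\<^esub> Idn C A = f"
    and cmp_assoc: "\<lbrakk>f \<in> Hom C A B; g \<in> Hom C B D; h \<in> Hom C D E\<rbrakk>
      \<Longrightarrow> h \<cdot>\<^bsub>C\<^esub> (g \<cdot>\<^bsub>C\<^esub> f) = (h \<cdot>\<^bsub>C\<^esub> g) \<cdot>\<^bsub>C\<^esub> f"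

definition inverse_arrows :: "('o, 'm, 'z) cat_scheme \<Rightarrow> 'm \<Rightarrow> 'm \<Rightarrow> bool" where
  "inverse_arrows C f g \<longleftrightarrow>
     f \<in> Arr C \<and> g \<in> Hom C (Cod C f) (Dom C f) \<and>
     g \<cdot>\<^bsub>C\<^esub> f = Idn C (Dom C f) \<and> f \<cdot>\<^bsub>C\<^esub> g = Idn C (Cod C f)"

definition iso_arr :: "('o, 'm, 'z) cat_scheme \<Rightarrow> 'm \<Rightarrow> bool" where
  "iso_arr C f \<longleftrightarrow> (\<exists>g. inverse_arrows C f g)"

definition inv_arr :: "('o, 'm, 'z) cat_scheme \<Rightarrow> 'm \<Rightarrow> 'm" where
  "inv_arr C f = (THE g. inverse_arrows C f g)"

definition zero_object :: "('o, 'm, 'z) cat_scheme \<Rightarrow> 'o \<Rightarrow> bool" where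
  "zero_object C Z \<longleftrightarrow>
     Z \<in> Obj C \<and> (\<forall>A\<in>Obj C. (\<exists>!f. f \<in> Hom C Z A) \<and> (\<exists>!f. f \<in> Hom C A Z))"

record ('o1, 'm1, 'o2, 'm2) func =
  OMap :: "'o1 \<Rightarrow> 'o2"
  AMap :: "'m1 \<Rightarrow> 'm2"

definition is_functor ::
    "('o1, 'm1, 'z1) cat_scheme \<Rightarrow> ('o2, 'm2, 'z2) cat_scheme
      \<Rightarrow> ('o1, 'm1, 'o2, 'm2) func \<Rightarrow> bool" where
  "is_functor C D F \<longleftrightarrow>
     (\<forall>A\<in>Obj C. OMap F A \<in> Obj D) \<and>
     (\<forall>f\<in>Arr C. AMap F f \<in> Hom D (OMap F (Dom C f)) (OMap F (Cod C f))) \<and>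
     (\<forall>A\<in>Obj C. AMap F (Idn C A) = Idn D (OMap F A)) \<and>
     (\<forall>f\<in>Arr C. \<forall>g\<in>Arr C. Cod C f = Dom C g \<longrightarrow>
        AMap F (g \<cdot>\<^bsub>C\<^esub> f) = AMap F g \<cdot>\<^bsub>D\<^esub> AMap F f)"

definition id_func :: "('o, 'm, 'o, 'm) func" where
  "id_func = \<lparr>OMap = \<lambda>A. A, AMap = \<lambda>f. f\<rparr>"

definition comp_func ::
    "('o2, 'm2, 'o3, 'm3) func \<Rightarrow> ('o1, 'm1, 'o2, 'm2) func \<Rightarrow> ('o1, 'm1, 'o3, 'm3) func" where
  "comp_func G F = \<lparr>OMap = \<lambda>A. OMap G (OMap F A), AMap = \<lambda>f. AMap G (AMap F f)\<rparr>"

definition naturally_isomorphic ::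
    "('o1, 'm1, 'z1) cat_scheme \<Rightarrow> ('o2, 'm2, 'z2) cat_scheme
      \<Rightarrow> ('o1, 'm1, 'o2, 'm2) func \<Rightarrow> ('o1, 'm1, 'o2, 'm2) func \<Rightarrow> bool" where
  "naturally_isomorphic C D F G \<longleftrightarrow>
     (\<exists>\<eta>. (\<forall>A\<in>Obj C. \<eta> A \<in> Hom D (OMap F A) (OMap G A) \<and> iso_arr D (\<eta> A)) \<and>
          (\<forall>f\<in>Arr C. \<eta> (Cod C f) \<cdot>\<^bsub>D\<^esub> AMap F f = AMap G f \<cdot>\<^bsub>D\<^esub> \<eta> (Dom C f)))"

definition auto_equivalence ::
    "('o, 'm, 'z) cat_scheme \<Rightarrow> ('o, 'm, 'o, 'm) func \<Rightarrow> bool" where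
  "auto_equivalence C F \<longleftrightarrow>
     is_functor C C F \<and>
     (\<exists>G. is_functor C C G \<and>
          naturally_isomorphic C C (comp_func G F) id_func \<and>
          naturally_isomorphic C C (comp_func F G) id_func)"


section \<open>Additive categories\<close>

record ('o, 'm) add_cat = "('o, 'm) cat" +
  hadd :: "'m \<Rightarrow> 'm \<Rightarrow> 'm"  (infixl \<open>\<plusminus>\<index>\<close> 65)
  hzero :: "'o \<Rightarrow> 'o \<Rightarrow> 'm"

definition hom_group :: "('o, 'm, 'z) add_cat_scheme \<Rightarrow> 'o \<Rightarrow> 'o \<Rightarrow> 'm monoid" where
  "hom_group C A B = \<lparr>carrier = Hom C A B, monoid.mult = hadd C, one = hzero C A B\<rparr>"

definition hneg :: "('o, 'm, 'z) add_cat_scheme \<Rightarrow> 'm \<Rightarrow> 'm" where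
  "hneg C f = inv\<^bsub>hom_group C (Dom C f) (Cod C f)\<^esub> f"

definition biproduct ::
    "('o, 'm, 'z) add_cat_scheme \<Rightarrow> 'o \<Rightarrow> 'o \<Rightarrow> 'o \<Rightarrow> 'm \<Rightarrow> 'm \<Rightarrow> 'm \<Rightarrow> 'm \<Rightarrow> bool" where
  "biproduct C A B P i j p q \<longleftrightarrow>
     A \<in> Obj C \<and> B \<in> Obj C \<and> P \<in> Obj C \<and>
     i \<in> Hom C A P \<and> j \<in> Hom C B P \<and> p \<in> Hom C P A \<and> q \<in> Hom C P B \<and>
     p \<cdot>\<^bsub>C\<^esub> i = Idn C A \<and> q \<cdot>\<^bsub>C\<^esub> j = Idn C B \<and>
     q \<cdot>\<^bsub>C\<^esub> i = hzero C A B \<and> p \<cdot>\<^bsub>C\<^esub> j = hzero C B A \<and>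
     (i \<cdot>\<^bsub>C\<^esub> p) \<plusminus>\<^bsub>C\<^esub> (j \<cdot>\<^bsub>C\<^esub> q) = Idn C P"

locale additive_category = category C for C :: "('o, 'm, 'z) add_cat_scheme" +
  assumes hom_comm_group: "\<lbrakk>A \<in> Obj C; B \<in> Obj C\<rbrakk> \<Longrightarrow> comm_group (hom_group C A B)"
    and cmp_add: "\<lbrakk>f \<in> Hom C A B; g \<in> Hom C B D; h \<in> Hom C B D\<rbrakk>
      \<Longrightarrow> (g \<plusminus>\<^bsub>C\<^esub> h) \<cdot>\<^bsub>C\<^esub> f = (g \<cdot>\<^bsub>C\<^esub> f) \<plusminus>\<^bsub>C\<^esub> (h \<cdot>\<^bsub>C\<^esub> f)"
    and add_cmp: "\<lbrakk>f \<in> Hom C A B; g \<in> Hom C A B; h \<in> Hom C B D\<rbrakk>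
      \<Longrightarrow> h \<cdot>\<^bsub>C\<^esub> (f \<plusminus>\<^bsub>C\<^esub> g) = (h \<cdot>\<^bsub>C\<^esub> f) \<plusminus>\<^bsub>C\<^esub> (h \<cdot>\<^bsub>C\<^esub> g)"
    and ex_zero_object: "\<exists>Z. zero_object C Z"
    and ex_biproduct: "\<lbrakk>A \<in> Obj C; B \<in> Obj C\<rbrakk> \<Longrightarrow> \<exists>P i j p q. biproduct C A B P i j p q"

definition additive_functor ::
    "('o1, 'm1, 'z1) add_cat_scheme \<Rightarrow> ('o2, 'm2, 'z2) add_cat_scheme
      \<Rightarrow> ('o1, 'm1, 'o2, 'm2) func \<Rightarrow> bool" where
  "additive_functor C D F \<longleftrightarrow>
     is_functor C D F \<and>
     (\<forall>A\<in>Obj C. \<forall>B\<in>Obj C. \<forall>f\<in>Hom C A B. \<forall>g\<in>Hom C A B.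
        AMap F (f \<plusminus>\<^bsub>C\<^esub> g) = AMap F f \<plusminus>\<^bsub>D\<^esub> AMap F g)"

text \<open>Full subcategories are given by their sets of objects.\<close>

definition additive_subcategory ::
    "('o, 'm, 'z) add_cat_scheme \<Rightarrow> 'o set \<Rightarrow> bool" where
  "additive_subcategory C U \<longleftrightarrow>
     U \<subseteq> Obj C \<and>
     (\<exists>Z\<in>U. zero_object C Z) \<and>
     (\<forall>A B P i j p q. biproduct C A B P i j p q \<and> A \<in> U \<and> B \<in> U \<longrightarrow> P \<in> U)"

definition closed_under_isos :: "('o, 'm, 'z) cat_scheme \<Rightarrow> 'o set \<Rightarrow> bool" where
  "closed_under_isos C U \<longleftrightarrow> (\<forall>f. iso_arr C f \<and> Dom C f \<in> U \<longrightarrow> Cod C f \<in> U)"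

definition closed_under_summands :: "('o, 'm, 'z) add_cat_scheme \<Rightarrow> 'o set \<Rightarrow> bool" where
  "closed_under_summands C U \<longleftrightarrow>
     (\<forall>A B P i j p q. biproduct C A B P i j p q \<and> P \<in> U \<longrightarrow> A \<in> U \<and> B \<in> U)"


section \<open>Extriangulated categories\<close>

text \<open>\<open>Ext X C A\<close> is the abelian group \<open>\<bbbE>(C, A)\<close>, written multiplicatively, and
  \<open>ExtMap X c a\<close> is \<open>\<bbbE>(c, a)\<close>. A sequence \<open>A \<rightarrow> B \<rightarrow> C\<close> is the pair \<open>(x, y)\<close> of its arrows,
  and \<open>Real X C A \<delta>\<close> is the equivalence class assigned to \<open>\<delta> \<in> \<bbbE>(C, A)\<close>.\<close>

record ('o, 'm, 'e) ext_cat = "('o, 'm) add_cat" +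
  Ext :: "'o \<Rightarrow> 'o \<Rightarrow> 'e monoid"
  ExtMap :: "'m \<Rightarrow> 'm \<Rightarrow> 'e \<Rightarrow> 'e"
  Real :: "'o \<Rightarrow> 'o \<Rightarrow> 'e \<Rightarrow> ('m \<times> 'm) set"

definition ext_functor :: "('o, 'm, 'e, 'z) ext_cat_scheme \<Rightarrow> bool" where
  "ext_functor X \<longleftrightarrow>
     (\<forall>C\<in>Obj X. \<forall>A\<in>Obj X. comm_group (Ext X C A)) \<and>
     (\<forall>c\<in>Arr X. \<forall>a\<in>Arr X.
        ExtMap X c a \<in> hom (Ext X (Cod X c) (Dom X a)) (Ext X (Dom X c) (Cod X a))) \<and>
     (\<forall>C\<in>Obj X. \<forall>A\<in>Obj X. \<forall>\<delta>\<in>carrier (Ext X C A). ExtMap X (Idn X C) (Idn X A) \<delta> = \<delta>) \<and>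
     (\<forall>c\<in>Arr X. \<forall>c'\<in>Arr X. \<forall>a\<in>Arr X. \<forall>a'\<in>Arr X.
        Cod X c' = Dom X c \<and> Cod X a = Dom X a' \<longrightarrow>
        (\<forall>\<delta>\<in>carrier (Ext X (Cod X c) (Dom X a)).
           ExtMap X (c \<cdot>\<^bsub>X\<^esub> c') (a' \<cdot>\<^bsub>X\<^esub> a) \<delta> = ExtMap X c' a' (ExtMap X c a \<delta>)))"

definition ext_biadditive :: "('o, 'm, 'e, 'z) ext_cat_scheme \<Rightarrow> bool" where
  "ext_biadditive X \<longleftrightarrow>
     (\<forall>C\<in>Obj X. \<forall>C'\<in>Obj X. \<forall>A\<in>Obj X. \<forall>A'\<in>Obj X.
      \<forall>c\<in>Hom X C' C. \<forall>a\<in>Hom X A A'. \<forall>\<delta>\<in>carrier (Ext X C A).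
        (\<forall>c2\<in>Hom X C' C. ExtMap X (c \<plusminus>\<^bsub>X\<^esub> c2) a \<delta>
            = ExtMap X c a \<delta> \<otimes>\<^bsub>Ext X C' A'\<^esub> ExtMap X c2 a \<delta>) \<and>
        (\<forall>a2\<in>Hom X A A'. ExtMap X c (a \<plusminus>\<^bsub>X\<^esub> a2) \<delta>
            = ExtMap X c a \<delta> \<otimes>\<^bsub>Ext X C' A'\<^esub> ExtMap X c a2 \<delta>))"

text \<open>\<open>push X C a \<delta>\<close> is \<open>a\<^sub>*\<delta>\<close> for \<open>\<delta> \<in> \<bbbE>(C, Dom a)\<close>, and \<open>pull X A c \<delta>\<close> is \<open>c\<^sup>*\<delta>\<close>
  for \<open>\<delta> \<in> \<bbbE>(Cod c, A)\<close>.\<close>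

definition push :: "('o, 'm, 'e, 'z) ext_cat_scheme \<Rightarrow> 'o \<Rightarrow> 'm \<Rightarrow> 'e \<Rightarrow> 'e" where
  "push X C a \<delta> = ExtMap X (Idn X C) a \<delta>"

definition pull :: "('o, 'm, 'e, 'z) ext_cat_scheme \<Rightarrow> 'o \<Rightarrow> 'm \<Rightarrow> 'e \<Rightarrow> 'e" where
  "pull X A c \<delta> = ExtMap X c (Idn X A) \<delta>"

text \<open>\<open>(a, c) : \<delta> \<rightarrow> \<delta>'\<close> is a morphism of extensions; the objects involved are the domains and
  codomains of \<open>a\<close> and \<open>c\<close>.\<close>

definition ext_morphism ::
    "('o, 'm, 'e, 'z) ext_cat_scheme \<Rightarrow> 'e \<Rightarrow> 'e \<Rightarrow> 'm \<Rightarrow> 'm \<Rightarrow> bool" where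
  "ext_morphism X \<delta> \<delta>' a c \<longleftrightarrow>
     a \<in> Arr X \<and> c \<in> Arr X \<and>
     \<delta> \<in> carrier (Ext X (Dom X c) (Dom X a)) \<and> \<delta>' \<in> carrier (Ext X (Cod X c) (Cod X a)) \<and>
     push X (Dom X c) a \<delta> = pull X (Cod X a) c \<delta>'"

definition is_sequence :: "('o, 'm, 'z) cat_scheme \<Rightarrow> 'm \<Rightarrow> 'm \<Rightarrow> bool" where
  "is_sequence C x y \<longleftrightarrow> x \<in> Arr C \<and> y \<in> Arr C \<and> Cod C x = Dom C y"

definition seq_class :: "('o, 'm, 'z) cat_scheme \<Rightarrow> 'm \<Rightarrow> 'm \<Rightarrow> ('m \<times> 'm) set" where
  "seq_class C x y =
     {(x', y'). is_sequence C x' y' \<and> Dom C x' = Dom C x \<and> Cod C y' = Cod C y \<and>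
        (\<exists>b\<in>Hom C (Cod C x) (Cod C x'). iso_arr C b \<and> b \<cdot>\<^bsub>C\<^esub> x = x' \<and> y' \<cdot>\<^bsub>C\<^esub> b = y)}"

definition etriangle :: "('o, 'm, 'e, 'z) ext_cat_scheme \<Rightarrow> 'm \<Rightarrow> 'm \<Rightarrow> 'e \<Rightarrow> bool" where
  "etriangle X x y \<delta> \<longleftrightarrow>
     is_sequence X x y \<and> \<delta> \<in> carrier (Ext X (Cod X y) (Dom X x)) \<and>
     Real X (Cod X y) (Dom X x) \<delta> = seq_class X x y"

definition conflation :: "('o, 'm, 'e, 'z) ext_cat_scheme \<Rightarrow> 'm \<Rightarrow> 'm \<Rightarrow> bool" where
  "conflation X x y \<longleftrightarrow> (\<exists>\<delta>. etriangle X x y \<delta>)"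

definition inflation :: "('o, 'm, 'e, 'z) ext_cat_scheme \<Rightarrow> 'm \<Rightarrow> bool" where
  "inflation X x \<longleftrightarrow> (\<exists>y. conflation X x y)"

definition deflation :: "('o, 'm, 'e, 'z) ext_cat_scheme \<Rightarrow> 'm \<Rightarrow> bool" where
  "deflation X y \<longleftrightarrow> (\<exists>x. conflation X x y)"

text \<open>\<open>b\<close> makes \<open>(a, b, c)\<close> a morphism of sequences from \<open>(x, y)\<close> to \<open>(x', y')\<close>.\<close>

definition seq_morphism ::
    "('o, 'm, 'z) cat_scheme \<Rightarrow> 'm \<Rightarrow> 'm \<Rightarrow> 'm \<Rightarrow> 'm \<Rightarrow> 'm \<Rightarrow> 'm \<Rightarrow> 'm \<Rightarrow> bool" where
  "seq_morphism C x y x' y' a b c \<longleftrightarrow>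
     a \<in> Hom C (Dom C x) (Dom C x') \<and> b \<in> Hom C (Cod C x) (Cod C x') \<and>
     c \<in> Hom C (Cod C y) (Cod C y') \<and>
     b \<cdot>\<^bsub>C\<^esub> x = x' \<cdot>\<^bsub>C\<^esub> a \<and> y' \<cdot>\<^bsub>C\<^esub> b = c \<cdot>\<^bsub>C\<^esub> y"

definition realization :: "('o, 'm, 'e, 'z) ext_cat_scheme \<Rightarrow> bool" where
  "realization X \<longleftrightarrow>
     (\<forall>C\<in>Obj X. \<forall>A\<in>Obj X. \<forall>\<delta>\<in>carrier (Ext X C A).
        \<exists>x y. Dom X x = A \<and> Cod X y = C \<and> etriangle X x y \<delta>) \<and>
     (\<forall>x y \<delta> x' y' \<delta>' a c.
        etriangle X x y \<delta> \<and> etriangle X x' y' \<delta>' \<and>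
        a \<in> Hom X (Dom X x) (Dom X x') \<and> c \<in> Hom X (Cod X y) (Cod X y') \<and>
        ext_morphism X \<delta> \<delta>' a c \<longrightarrow> (\<exists>b. seq_morphism X x y x' y' a b c))"

text \<open>The conditions quantify over all biproduct diagrams instead of fixing a choice of direct
  sums. In the second one, \<open>\<epsilon>\<close> is the element \<open>\<delta> \<oplus> \<delta>'\<close> of \<open>\<bbbE>(C \<oplus> C', A \<oplus> A')\<close>, the one
  with components \<open>(\<delta>, 0, 0, \<delta>')\<close>.\<close>

definition additive_realization :: "('o, 'm, 'e, 'z) ext_cat_scheme \<Rightarrow> bool" where
  "additive_realization X \<longleftrightarrow>
     realization X \<and>
     (\<forall>A C P i j p q. biproduct X A C P i j p q \<longrightarrow>
        Real X C A \<one>\<^bsub>Ext X C A\<^esub> = seq_class X i q) \<and>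
     (\<forall>x y \<delta> x' y' \<delta>' PA iA jA pA qA PB iB jB pB qB PC iC jC pC qC \<epsilon>.
        etriangle X x y \<delta> \<and> etriangle X x' y' \<delta>' \<and>
        biproduct X (Dom X x) (Dom X x') PA iA jA pA qA \<and>
        biproduct X (Cod X x) (Cod X x') PB iB jB pB qB \<and>
        biproduct X (Cod X y) (Cod X y') PC iC jC pC qC \<and>
        \<epsilon> \<in> carrier (Ext X PC PA) \<and>
        ExtMap X iC pA \<epsilon> = \<delta> \<and>
        ExtMap X iC qA \<epsilon> = \<one>\<^bsub>Ext X (Cod X y) (Dom X x')\<^esub> \<and>
        ExtMap X jC pA \<epsilon> = \<one>\<^bsub>Ext X (Cod X y') (Dom X x)\<^esub> \<and>
        ExtMap X jC qA \<epsilon> = \<delta>' \<longrightarrow>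
        Real X PC PA \<epsilon> =
          seq_class X ((iB \<cdot>\<^bsub>X\<^esub> x \<cdot>\<^bsub>X\<^esub> pA) \<plusminus>\<^bsub>X\<^esub> (jB \<cdot>\<^bsub>X\<^esub> x' \<cdot>\<^bsub>X\<^esub> qA))
                      ((iC \<cdot>\<^bsub>X\<^esub> y \<cdot>\<^bsub>X\<^esub> pB) \<plusminus>\<^bsub>X\<^esub> (jC \<cdot>\<^bsub>X\<^esub> y' \<cdot>\<^bsub>X\<^esub> qB)))"

locale extriangulated_category = additive_category X
    for X :: "('o, 'm, 'e, 'z) ext_cat_scheme" +
  assumes ext_functor: "ext_functor X"
    and ET1: "ext_biadditive X"
    and ET2: "additive_realization X"
    and ET3: "\<lbrakk>etriangle X x y \<delta>; etriangle X x' y' \<delta>';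
        a \<in> Hom X (Dom X x) (Dom X x'); b \<in> Hom X (Cod X x) (Cod X x');
        b \<cdot>\<^bsub>X\<^esub> x = x' \<cdot>\<^bsub>X\<^esub> a\<rbrakk>
      \<Longrightarrow> \<exists>c. ext_morphism X \<delta> \<delta>' a c \<and> seq_morphism X x y x' y' a b c"
    and ET3_op: "\<lbrakk>etriangle X x y \<delta>; etriangle X x' y' \<delta>';
        b \<in> Hom X (Dom X y) (Dom X y'); c \<in> Hom X (Cod X y) (Cod X y');
        y' \<cdot>\<^bsub>X\<^esub> b = c \<cdot>\<^bsub>X\<^esub> y\<rbrakk>
      \<Longrightarrow> \<exists>a. ext_morphism X \<delta> \<delta>' a c \<and> seq_morphism X x y x' y' a b c"
    and ET4: "\<lbrakk>etriangle X f f' \<delta>; etriangle X g g' \<delta>'; Cod X f = Dom X g;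
        A = Dom X f; B = Dom X g; C = Cod X g; D = Cod X f'; F = Cod X g'\<rbrakk>
      \<Longrightarrow> \<exists>E h h' \<delta>'' d e.
            etriangle X h h' \<delta>'' \<and> h = g \<cdot>\<^bsub>X\<^esub> f \<and> h' \<in> Hom X C E \<and>
            d \<in> Hom X D E \<and> e \<in> Hom X E F \<and>
            d \<cdot>\<^bsub>X\<^esub> f' = h' \<cdot>\<^bsub>X\<^esub> g \<and> e \<cdot>\<^bsub>X\<^esub> h' = g' \<and>
            etriangle X d e (push X F f' \<delta>') \<and>
            pull X A d \<delta>'' = \<delta> \<and>
            push X E f \<delta>'' = pull X B e \<delta>'"
    and ET4_op: "\<lbrakk>etriangle X f' f \<delta>; etriangle X g' g \<delta>'; Cod X f = Dom X g;
        D = Dom X f'; A = Dom X f; B = Cod X f; F = Dom X g'; C = Cod X g\<rbrakk>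
      \<Longrightarrow> \<exists>E h h' \<delta>'' d e.
            etriangle X h' h \<delta>'' \<and> h = g \<cdot>\<^bsub>X\<^esub> f \<and> h' \<in> Hom X E A \<and>
            d \<in> Hom X D E \<and> e \<in> Hom X E F \<and>
            h' \<cdot>\<^bsub>X\<^esub> d = f' \<and> f \<cdot>\<^bsub>X\<^esub> h' = g' \<cdot>\<^bsub>X\<^esub> e \<and>
            etriangle X d e (pull X D g' \<delta>) \<and>
            \<delta>' = push X C e \<delta>'' \<and>
            push X B d \<delta> = pull X E g \<delta>''"

definition WIC :: "('o, 'm, 'e, 'z) ext_cat_scheme \<Rightarrow> bool" where
  "WIC X \<longleftrightarrow>
     (\<forall>f\<in>Arr X. \<forall>g\<in>Arr X. Cod X f = Dom X g \<longrightarrow>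
        (inflation X (g \<cdot>\<^bsub>X\<^esub> f) \<longrightarrow> inflation X f) \<and>
        (deflation X (g \<cdot>\<^bsub>X\<^esub> f) \<longrightarrow> deflation X g))"


section \<open>Cotorsion pairs\<close>

definition ext_vanishes :: "('o, 'm, 'e, 'z) ext_cat_scheme \<Rightarrow> 'o set \<Rightarrow> 'o set \<Rightarrow> bool" where
  "ext_vanishes X U V \<longleftrightarrow> (\<forall>A\<in>U. \<forall>B\<in>V. carrier (Ext X A B) = {\<one>\<^bsub>Ext X A B\<^esub>})"

definition cotorsion_pair :: "('o, 'm, 'e, 'z) ext_cat_scheme \<Rightarrow> 'o set \<Rightarrow> 'o set \<Rightarrow> bool" where
  "cotorsion_pair X U V \<longleftrightarrow>
     additive_subcategory X U \<and> closed_under_isos X U \<and> closed_under_summands X U \<and>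
     additive_subcategory X V \<and> closed_under_isos X V \<and> closed_under_summands X V \<and>
     ext_vanishes X U V \<and>
     (\<forall>C\<in>Obj X.
        (\<exists>x y. conflation X x y \<and> Dom X x \<in> V \<and> Cod X x \<in> U \<and> Cod X y = C) \<and>
        (\<exists>x y. conflation X x y \<and> Dom X x = C \<and> Cod X x \<in> V \<and> Cod X y \<in> U))"

definition twin_cotorsion_pair ::
    "('o, 'm, 'e, 'z) ext_cat_scheme \<Rightarrow> 'o set \<Rightarrow> 'o set \<Rightarrow> 'o set \<Rightarrow> 'o set \<Rightarrow> bool" where
  "twin_cotorsion_pair X S T U V \<longleftrightarrow>
     cotorsion_pair X S T \<and> cotorsion_pair X U V \<and> ext_vanishes X S V"

definition Ni :: "('o, 'm, 'e, 'z) ext_cat_scheme \<Rightarrow> 'o set \<Rightarrow> 'o set \<Rightarrow> 'o set" where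
  "Ni X S V = {N \<in> Obj X. \<exists>x y. conflation X x y \<and> Dom X x \<in> V \<and> Cod X x \<in> S \<and> Cod X y = N}"

definition Nf :: "('o, 'm, 'e, 'z) ext_cat_scheme \<Rightarrow> 'o set \<Rightarrow> 'o set \<Rightarrow> 'o set" where
  "Nf X S V = {N \<in> Obj X. \<exists>x y. conflation X x y \<and> Dom X x = N \<and> Cod X x \<in> V \<and> Cod X y \<in> S}"

definition hovey_twin_cotorsion_pair ::
    "('o, 'm, 'e, 'z) ext_cat_scheme \<Rightarrow> 'o set \<Rightarrow> 'o set \<Rightarrow> 'o set \<Rightarrow> 'o set \<Rightarrow> bool" where
  "hovey_twin_cotorsion_pair X S T U V \<longleftrightarrow> twin_cotorsion_pair X S T U V \<and> Ni X S V = Nf X S V"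


section \<open>Localization\<close>

text \<open>The category \<open>C[W\<^sup>-\<^sup>1]\<close> is constructed as the quotient of the category of zigzags by the
  congruence \<open>zz_eq\<close>. Zigzags are lists in diagrammatic order, and \<open>Bwd w\<close> is the formal inverse
  of \<open>w\<close>.\<close>

datatype 'm letter = Fwd 'm | Bwd 'm

inductive zigzag :: "('o, 'm, 'z) cat_scheme \<Rightarrow> 'm set \<Rightarrow> 'o \<Rightarrow> 'm letter list \<Rightarrow> 'o \<Rightarrow> bool"
  for C W where
  zigzag_Nil: "A \<in> Obj C \<Longrightarrow> zigzag C W A [] A"
| zigzag_Fwd: "\<lbrakk>f \<in> Arr C; zigzag C W (Cod C f) r B\<rbrakk> \<Longrightarrow> zigzag C W (Dom C f) (Fwd f # r) B"
| zigzag_Bwd: "\<lbrakk>w \<in> W; w \<in> Arr C; zigzag C W (Dom C w) r B\<rbrakk>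
    \<Longrightarrow> zigzag C W (Cod C w) (Bwd w # r) B"

inductive zz_eq ::
    "('o, 'm, 'z) cat_scheme \<Rightarrow> 'm set \<Rightarrow> 'o \<Rightarrow> 'm letter list \<Rightarrow> 'm letter list \<Rightarrow> 'o \<Rightarrow> bool"
  for C W where
  zz_refl: "zigzag C W A r B \<Longrightarrow> zz_eq C W A r r B"
| zz_sym: "zz_eq C W A r s B \<Longrightarrow> zz_eq C W A s r B"
| zz_trans: "\<lbrakk>zz_eq C W A r s B; zz_eq C W A s t B\<rbrakk> \<Longrightarrow> zz_eq C W A r t B"
| zz_app: "\<lbrakk>zz_eq C W A r s B; zz_eq C W B r' s' D\<rbrakk> \<Longrightarrow> zz_eq C W A (r @ r') (s @ s') D"
| zz_idn: "A \<in> Obj C \<Longrightarrow> zz_eq C W A [Fwd (Idn C A)] [] A"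
| zz_cmp: "\<lbrakk>f \<in> Hom C A B; g \<in> Hom C B D\<rbrakk>
    \<Longrightarrow> zz_eq C W A [Fwd f, Fwd g] [Fwd (g \<cdot>\<^bsub>C\<^esub> f)] D"
| zz_inv_right: "\<lbrakk>w \<in> W; w \<in> Arr C\<rbrakk> \<Longrightarrow> zz_eq C W (Dom C w) [Fwd w, Bwd w] [] (Dom C w)"
| zz_inv_left: "\<lbrakk>w \<in> W; w \<in> Arr C\<rbrakk> \<Longrightarrow> zz_eq C W (Cod C w) [Bwd w, Fwd w] [] (Cod C w)"

type_synonym ('o, 'm) loc_arr = "'o \<times> 'm letter list set \<times> 'o"

definition zz_class ::
    "('o, 'm, 'z) cat_scheme \<Rightarrow> 'm set \<Rightarrow> 'o \<Rightarrow> 'm letter list \<Rightarrow> 'o \<Rightarrow> ('o, 'm) loc_arr" where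
  "zz_class C W A r B = (A, {s. zz_eq C W A r s B}, B)"

definition localization ::
    "('o, 'm, 'z) cat_scheme \<Rightarrow> 'm set \<Rightarrow> ('o, ('o, 'm) loc_arr) cat" where
  "localization C W =
     \<lparr>Obj = Obj C,
      Arr = {zz_class C W A r B | A r B. zigzag C W A r B},
      Dom = (\<lambda>(A, R, B). A),
      Cod = (\<lambda>(A, R, B). B),
      Idn = (\<lambda>A. zz_class C W A [] A),
      Cmp = (\<lambda>(B', S, D) (A, R, B). (A, {t. \<exists>r\<in>R. \<exists>s\<in>S. zz_eq C W A (r @ s) t D}, D))\<rparr>"

definition loc_functor ::
    "('o, 'm, 'z) cat_scheme \<Rightarrow> 'm set \<Rightarrow> ('o, 'm, 'o, ('o, 'm) loc_arr) func" where
  "loc_functor C W =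
     \<lparr>OMap = (\<lambda>A. A), AMap = (\<lambda>f. zz_class C W (Dom C f) [Fwd f] (Cod C f))\<rparr>"

abbreviation loc :: "('o, 'm, 'z) cat_scheme \<Rightarrow> 'm set \<Rightarrow> 'm \<Rightarrow> ('o, 'm) loc_arr" where
  "loc C W f \<equiv> AMap (loc_functor C W) f"

text \<open>The functor on \<open>C[W\<^sup>-\<^sup>1]\<close> induced by a functor \<open>F\<close> on \<open>C\<close> that inverts \<open>W\<close>. By the
  universal property of the localization (proved below) it exists and is unique on objects and
  arrows; the choice operator only disregards values outside the carriers.\<close>

definition induced_functor ::
    "('o, 'm, 'z) cat_scheme \<Rightarrow> 'm set \<Rightarrow> ('o2, 'm2, 'z2) cat_scheme
      \<Rightarrow> ('o, 'm, 'o2, 'm2) func \<Rightarrow> ('o, ('o, 'm) loc_arr, 'o2, 'm2) func" where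
  "induced_functor C W D F =
     (SOME G. is_functor (localization C W) D G \<and>
        (\<forall>A\<in>Obj C. OMap G A = OMap F A) \<and>
        (\<forall>f\<in>Arr C. AMap G (loc C W f) = AMap F f))"

subsection \<open>The universal property\<close>

lemma zigzag_endpoints:
  assumes "category C" "zigzag C W A r B"
  shows "A \<in> Obj C \<and> B \<in> Obj C"
  using assms(2)
  by induction (auto simp: category.dom_obj[OF assms(1)] category.cod_obj[OF assms(1)])

lemma zigzag_append:
  "\<lbrakk>zigzag C W A r B; zigzag C W B s D\<rbrakk> \<Longrightarrow> zigzag C W A (r @ s) D"
  by (induction rule: zigzag.induct) (auto intro: zigzag.intros)

lemma zigzag_letter:
  assumes "category C"
  shows "f \<in> Arr C \<Longrightarrow> zigzag C W (Dom C f) [Fwd f] (Cod C f)"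
    and "\<lbrakk>w \<in> W; w \<in> Arr C\<rbrakk> \<Longrightarrow> zigzag C W (Cod C w) [Bwd w] (Dom C w)"
  by (auto intro!: zigzag.intros category.dom_obj[OF assms] category.cod_obj[OF assms])

lemma zz_eq_zigzag:
  assumes "category C" "zz_eq C W A r s B"
  shows "zigzag C W A r B \<and> zigzag C W A s B"
  using assms(2)
proof induction
  case (zz_cmp f A B g D)
  have "g \<cdot>\<^bsub>C\<^esub> f \<in> Hom C A D" by (rule category.cmp_hom[OF assms(1) zz_cmp])
  then have "zigzag C W A [Fwd f] B" "zigzag C W B [Fwd g] D" "zigzag C W A [Fwd (g \<cdot>\<^bsub>C\<^esub> f)] D"
    using zz_cmp zigzag_letter(1)[OF assms(1), of f W] zigzag_letter(1)[OF assms(1), of g W]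
      zigzag_letter(1)[OF assms(1), of "g \<cdot>\<^bsub>C\<^esub> f" W]
    by (simp_all add: Hom_def)
  then show ?case using zigzag_append[of C W A "[Fwd f]" B "[Fwd g]" D] by simp
next
  case (zz_idn A)
  have "Idn C A \<in> Hom C A A" by (rule category.idn_hom[OF assms(1) zz_idn])
  then show ?case
    using zz_idn zigzag_letter(1)[OF assms(1), of "Idn C A" W] by (auto simp: Hom_def intro: zigzag.intros)
qed (auto intro!: zigzag.intros zigzag_append category.dom_obj[OF assms(1)] category.cod_obj[OF assms(1)])

lemma zz_class_eq_iff:
  assumes "zigzag C W A r B"
  shows "zz_class C W A r B = zz_class C W A s B \<longleftrightarrow> zz_eq C W A r s B"
  unfolding zz_class_def using assms by (auto intro: zz_refl zz_sym zz_trans)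

lemma localization_simps [simp]:
  "Obj (localization C W) = Obj C"
  "Dom (localization C W) (zz_class C W A r B) = A"
  "Cod (localization C W) (zz_class C W A r B) = B"
  "Idn (localization C W) A = zz_class C W A [] A"
  by (auto simp: localization_def zz_class_def)

lemma zz_class_hom: "zigzag C W A r B \<Longrightarrow> zz_class C W A r B \<in> Hom (localization C W) A B"
  unfolding Hom_def by simp (auto simp: localization_def)

lemma localization_homE:
  assumes "\<alpha> \<in> Hom (localization C W) A B"
  obtains r where "zigzag C W A r B" "\<alpha> = zz_class C W A r B"
  using assms unfolding Hom_def localization_def by (auto simp: zz_class_def)

lemma localization_cmp:
  assumes "zigzag C W A r B" "zigzag C W B s D"
  shows "zz_class C W B s D \<cdot>\<^bsub>localization C W\<^esub> zz_class C W A r B = zz_class C W A (r @ s) D"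
  using assms unfolding localization_def zz_class_def
  by (auto intro: zz_refl zz_trans[OF zz_app])

lemma category_localization:
  assumes "category C"
  shows "category (localization C W)"
proof
  fix f assume "f \<in> Arr (localization C W)"
  then have "f \<in> Hom (localization C W) (Dom (localization C W) f) (Cod (localization C W) f)"
    by (simp add: Hom_def)
  then show "Dom (localization C W) f \<in> Obj (localization C W)"
    "Cod (localization C W) f \<in> Obj (localization C W)"
    by (auto elim!: localization_homE dest: zigzag_endpoints[OF assms])
next
  fix A assume "A \<in> Obj (localization C W)"
  then show "Idn (localization C W) A \<in> Hom (localization C W) A A"
    by (auto intro: zz_class_hom zigzag_Nil)
next
  fix f g A B D assume "f \<in> Hom (localization C W) A B" "g \<in> Hom (localization C W) B D"
  then show "g \<cdot>\<^bsub>localization C W\<^esub> f \<in> Hom (localization C W) A D"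
    by (metis localization_homE localization_cmp zz_class_hom zigzag_append)
next
  fix f A B assume "f \<in> Hom (localization C W) A B"
  then obtain r where r: "zigzag C W A r B" "f = zz_class C W A r B" by (rule localization_homE)
  then have "zigzag C W A [] A" "zigzag C W B [] B"
    by (auto intro: zigzag_Nil dest: zigzag_endpoints[OF assms])
  with r show "Idn (localization C W) B \<cdot>\<^bsub>localization C W\<^esub> f = f"
    "f \<cdot>\<^bsub>localization C W\<^esub> Idn (localization C W) A = f"
    by (simp_all add: localization_cmp)
next
  fix f g h A B D E
  assume "f \<in> Hom (localization C W) A B" "g \<in> Hom (localization C W) B D"
    "h \<in> Hom (localization C W) D E"
  then show "h \<cdot>\<^bsub>localization C W\<^esub> (g \<cdot>\<^bsub>localization C W\<^esub> f)
      = (h \<cdot>\<^bsub>localization C W\<^esub> g) \<cdot>\<^bsub>localization C W\<^esub> f"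
    by (auto elim!: localization_homE simp: localization_cmp zigzag_append)
qed

lemma loc_eq: "loc C W f = zz_class C W (Dom C f) [Fwd f] (Cod C f)"
  by (simp add: loc_functor_def)

lemma loc_functor_is_functor:
  assumes "category C"
  shows "is_functor C (localization C W) (loc_functor C W)"
  unfolding is_functor_def
proof (intro conjI ballI impI)
  fix A assume A: "A \<in> Obj C"
  have "Idn C A \<in> Hom C A A" by (rule category.idn_hom[OF assms A])
  then show "loc C W (Idn C A) = Idn (localization C W) (OMap (loc_functor C W) A)"
    using zz_idn[OF A, of W] zigzag_letter(1)[OF assms, of "Idn C A" W]
    by (auto simp: loc_functor_def Hom_def zz_class_eq_iff)
next
  fix f g assume fg: "f \<in> Arr C" "g \<in> Arr C" "Cod C f = Dom C g"
  have z: "zigzag C W (Dom C f) [Fwd f] (Dom C g)" "zigzag C W (Dom C g) [Fwd g] (Cod C g)"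
    using fg zigzag_letter(1)[OF assms] by metis+
  have h: "f \<in> Hom C (Dom C f) (Dom C g)" "g \<in> Hom C (Dom C g) (Cod C g)"
    using fg by (auto simp: Hom_def)
  have gf: "g \<cdot>\<^bsub>C\<^esub> f \<in> Hom C (Dom C f) (Cod C g)" by (rule category.cmp_hom[OF assms h])
  show "loc C W (g \<cdot>\<^bsub>C\<^esub> f) = loc C W g \<cdot>\<^bsub>localization C W\<^esub> loc C W f"
    using gf fg localization_cmp[OF z] zz_cmp[OF h, of W] zigzag_append[OF z]
      zz_class_eq_iff[of C W "Dom C f" "[Fwd f, Fwd g]" "Cod C g" "[Fwd (g \<cdot>\<^bsub>C\<^esub> f)]"]
    by (auto simp: loc_eq Hom_def)
qed (auto simp: loc_functor_def intro: zz_class_hom[OF zigzag_letter(1)[OF assms]])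

lemma loc_inverse:
  assumes "category C" "w \<in> W" "w \<in> Arr C"
  shows "inverse_arrows (localization C W) (loc C W w) (zz_class C W (Cod C w) [Bwd w] (Dom C w))"
proof -
  note z = zigzag_letter(1)[OF assms(1,3), of W] zigzag_letter(2)[OF assms]
  show ?thesis
    unfolding inverse_arrows_def loc_eq
    using z zz_class_hom[OF z(1)] zz_class_hom[OF z(2)]
    by (auto simp: localization_cmp Hom_def
        zz_class_eq_iff[OF zigzag_append[OF z], simplified]
        zz_class_eq_iff[OF zigzag_append[OF z(2) z(1)], simplified]
        intro: zz_inv_left zz_inv_right assms)
qed

lemma inverse_arrows_unique:
  assumes "category D" "inverse_arrows D f g" "inverse_arrows D f h"
  shows "g = h"
proof -
  let ?A = "Dom D f" and ?B = "Cod D f"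
  have f: "f \<in> Hom D ?A ?B" and g: "g \<in> Hom D ?B ?A" and h: "h \<in> Hom D ?B ?A"
    using assms(2,3) by (auto simp: inverse_arrows_def Hom_def)
  have "g = g \<cdot>\<^bsub>D\<^esub> (f \<cdot>\<^bsub>D\<^esub> h)"
    using assms(2,3) category.idn_right[OF assms(1) g] by (simp add: inverse_arrows_def)
  also have "\<dots> = h"
    using assms(2) category.cmp_assoc[OF assms(1) h f g] category.idn_left[OF assms(1) h]
    by (simp add: inverse_arrows_def)
  finally show ?thesis .
qed

lemma inv_arr_inverse:
  assumes "category D" "iso_arr D f"
  shows "inverse_arrows D f (inv_arr D f)"
proof -
  from assms(2) obtain g where g: "inverse_arrows D f g" by (auto simp: iso_arr_def)
  show ?thesis
    unfolding inv_arr_def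
    by (rule theI[of "inverse_arrows D f" g]) (use g inverse_arrows_unique[OF assms(1)] in blast)+
qed

fun zz_eval :: "('o, 'm, 'z) cat_scheme \<Rightarrow> ('o2, 'm2, 'z2) cat_scheme
    \<Rightarrow> ('o, 'm, 'o2, 'm2) func \<Rightarrow> 'o \<Rightarrow> 'm letter list \<Rightarrow> 'm2" where
  "zz_eval C D F A [] = Idn D (OMap F A)"
| "zz_eval C D F A (Fwd f # r) = zz_eval C D F (Cod C f) r \<cdot>\<^bsub>D\<^esub> AMap F f"
| "zz_eval C D F A (Bwd w # r) = zz_eval C D F (Dom C w) r \<cdot>\<^bsub>D\<^esub> inv_arr D (AMap F w)"

theorem localization_universal_property:
  fixes C :: "('o, 'm, 'z) cat_scheme" and D :: "('o2, 'm2, 'z2) cat_scheme"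
  assumes C: "category C" and D: "category D" and F: "is_functor C D F"
    and inv: "\<And>w. \<lbrakk>w \<in> W; w \<in> Arr C\<rbrakk> \<Longrightarrow> iso_arr D (AMap F w)"
  shows "\<exists>G. is_functor (localization C W) D G \<and> (\<forall>A\<in>Obj C. OMap G A = OMap F A) \<and>
      (\<forall>f\<in>Arr C. AMap G (loc C W f) = AMap F f)"
    and "\<lbrakk>is_functor (localization C W) D G; is_functor (localization C W) D G';
      \<forall>f\<in>Arr C. AMap G (loc C W f) = AMap F f; \<forall>f\<in>Arr C. AMap G' (loc C W f) = AMap F f;
      \<forall>A\<in>Obj C. OMap G A = OMap F A; \<forall>A\<in>Obj C. OMap G' A = OMap F A;
      \<alpha> \<in> Arr (localization C W)\<rbrakk> \<Longrightarrow> AMap G \<alpha> = AMap G' \<alpha>"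
proof -
  let ?e = "zz_eval C D F" and ?L = "localization C W"
  have Fm: "AMap F f \<in> Hom D (OMap F (Dom C f)) (OMap F (Cod C f))" if "f \<in> Arr C" for f
    using F that by (simp add: is_functor_def)
  have Fo: "OMap F A \<in> Obj D" if "A \<in> Obj C" for A
    using F that by (simp add: is_functor_def)
  have Fi: "inverse_arrows D (AMap F w) (inv_arr D (AMap F w))" if "w \<in> W" "w \<in> Arr C" for w
    by (rule inv_arr_inverse[OF D inv[OF that]])
  have Fih: "inv_arr D (AMap F w) \<in> Hom D (OMap F (Cod C w)) (OMap F (Dom C w))"
    if "w \<in> W" "w \<in> Arr C" for w
    using Fi[OF that] Fm[OF that(2)] by (auto simp: inverse_arrows_def Hom_def)
  have eh: "?e A r \<in> Hom D (OMap F A) (OMap F B)" if "zigzag C W A r B" for A r B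
    using that
  proof induction
    case (zigzag_Nil A)
    then show ?case using category.idn_hom[OF D Fo] by simp
  next
    case (zigzag_Fwd f r B)
    then show ?case using category.cmp_hom[OF D Fm] by simp
  next
    case (zigzag_Bwd w r B)
    then show ?case using category.cmp_hom[OF D Fih] by simp
  qed
  have ea: "?e A (r @ s) = ?e B s \<cdot>\<^bsub>D\<^esub> ?e A r"
    if "zigzag C W A r B" "zigzag C W B s E" for A r B s E
    using that
  proof (induction)
    case (zigzag_Nil A)
    then show ?case using category.idn_right[OF D eh] by simp
  next
    case (zigzag_Fwd f r B)
    then show ?case using category.cmp_assoc[OF D Fm eh eh] by simp
  next
    case (zigzag_Bwd w r B)
    then show ?case using category.cmp_assoc[OF D Fih eh eh] by simp
  qed
  have ee: "?e A r = ?e A s" if "zz_eq C W A r s B" for A r s B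
    using that
  proof induction
    case (zz_app A r s B r' s' E)
    then show ?case using zz_eq_zigzag[OF C zz_app(1)] zz_eq_zigzag[OF C zz_app(2)]
      by (metis ea)
  next
    case (zz_idn A)
    have h: "Idn C A \<in> Hom C A A" by (rule category.idn_hom[OF C zz_idn])
    have "AMap F (Idn C A) = Idn D (OMap F A)" using F zz_idn by (simp add: is_functor_def)
    then show ?case
      using h category.idn_left[OF D category.idn_hom[OF D Fo[OF zz_idn]]] by (simp add: Hom_def)
  next
    case (zz_cmp f A B g E)
    have fg: "f \<in> Arr C" "g \<in> Arr C" "Cod C f = Dom C g" "Dom C f = A" "Cod C g = E" "Dom C g = B"
      using zz_cmp by (auto simp: Hom_def)
    have gf: "g \<cdot>\<^bsub>C\<^esub> f \<in> Hom C A E" by (rule category.cmp_hom[OF C zz_cmp])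
    have "AMap F (g \<cdot>\<^bsub>C\<^esub> f) = AMap F g \<cdot>\<^bsub>D\<^esub> AMap F f" using F fg by (simp add: is_functor_def)
    moreover have "AMap F f \<in> Hom D (OMap F A) (OMap F B)" "AMap F g \<in> Hom D (OMap F B) (OMap F E)"
      using Fm[of f] Fm[of g] fg by auto
    moreover have "Idn D (OMap F E) \<in> Hom D (OMap F E) (OMap F E)"
      using category.idn_hom[OF D Fo] category.cod_obj[OF C fg(2)] fg(5) by simp
    ultimately show ?case
      using gf fg category.cmp_assoc[OF D] by (simp add: Hom_def)
  next
    case (zz_inv_right w)
    then show ?case using Fi[of w] Fm[of w] Fih[of w] category.idn_left[OF D Fih[of w]]
      by (auto simp: inverse_arrows_def Hom_def)
  next
    case (zz_inv_left w)
    then show ?case using Fi[of w] Fm[of w] category.idn_left[OF D Fm[of w]]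
      by (auto simp: inverse_arrows_def Hom_def)
  qed auto
  define G :: "('o, ('o, 'm) loc_arr, 'o2, 'm2) func" where "G = \<lparr>OMap = OMap F, AMap = \<lambda>\<alpha>. ?e (fst \<alpha>) (SOME r. r \<in> fst (snd \<alpha>))\<rparr>"
  have Gz: "AMap G (zz_class C W A r B) = ?e A r" if "zigzag C W A r B" for A r B
  proof -
    have "(SOME s. zz_eq C W A r s B) \<in> {s. zz_eq C W A r s B}"
      using someI_ex[of "\<lambda>s. zz_eq C W A r s B"] zz_refl[OF that] by blast
    then show ?thesis using ee by (auto simp: G_def zz_class_def)
  qed
  have "is_functor ?L D G"
    unfolding is_functor_def
  proof (intro conjI ballI impI)
    fix A assume "A \<in> Obj ?L"
    then show "OMap G A \<in> Obj D" "AMap G (Idn ?L A) = Idn D (OMap G A)"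
      using Fo Gz[OF zigzag_Nil] by (auto simp: G_def)
  next
    fix \<alpha> assume "\<alpha> \<in> Arr ?L"
    then have "\<alpha> \<in> Hom ?L (Dom ?L \<alpha>) (Cod ?L \<alpha>)" by (simp add: Hom_def)
    then obtain r where r: "zigzag C W (Dom ?L \<alpha>) r (Cod ?L \<alpha>)"
      "\<alpha> = zz_class C W (Dom ?L \<alpha>) r (Cod ?L \<alpha>)" by (rule localization_homE)
    have "AMap G \<alpha> = ?e (Dom ?L \<alpha>) r" by (subst r(2)) (rule Gz[OF r(1)])
    then show "AMap G \<alpha> \<in> Hom D (OMap G (Dom ?L \<alpha>)) (OMap G (Cod ?L \<alpha>))"
      using eh[OF r(1)] by (simp add: G_def)
  next
    fix \<alpha> \<beta> assume "\<alpha> \<in> Arr ?L" "\<beta> \<in> Arr ?L" "Cod ?L \<alpha> = Dom ?L \<beta>"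
    then have "\<alpha> \<in> Hom ?L (Dom ?L \<alpha>) (Cod ?L \<alpha>)" "\<beta> \<in> Hom ?L (Cod ?L \<alpha>) (Cod ?L \<beta>)"
      by (simp_all add: Hom_def)
    then obtain r s A B E where rs: "zigzag C W A r B" "\<alpha> = zz_class C W A r B"
      "zigzag C W B s E" "\<beta> = zz_class C W B s E" by (metis localization_homE)
    then show "AMap G (\<beta> \<cdot>\<^bsub>?L\<^esub> \<alpha>) = AMap G \<beta> \<cdot>\<^bsub>D\<^esub> AMap G \<alpha>"
      using localization_cmp[OF rs(1,3)] Gz[OF rs(1)] Gz[OF rs(3)]
        Gz[OF zigzag_append[OF rs(1,3)]] ea[OF rs(1,3)] by simp
  qed
  moreover have "AMap G (loc C W f) = AMap F f" if f: "f \<in> Arr C" for f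
    unfolding loc_eq Gz[OF zigzag_letter(1)[OF C f]]
    using category.idn_left[OF D Fm[OF f]] by simp
  ultimately show "\<exists>G. is_functor ?L D G \<and> (\<forall>A\<in>Obj C. OMap G A = OMap F A) \<and>
      (\<forall>f\<in>Arr C. AMap G (loc C W f) = AMap F f)"
    by (intro exI[of _ G]) (simp add: G_def)

  have L: "category ?L" by (rule category_localization[OF C])
  have *: "AMap H (zz_class C W A r B) = ?e A r"
    if z: "zigzag C W A r B" and H: "is_functor ?L D H" "\<forall>f\<in>Arr C. AMap H (loc C W f) = AMap F f"
      "\<forall>A\<in>Obj C. OMap H A = OMap F A" for A r B H
    using z
  proof induction
    case (zigzag_Nil A)
    then show ?case using H by (auto simp: is_functor_def)
  next
    case (zigzag_Fwd f r B)
    have z1: "zigzag C W (Dom C f) [Fwd f] (Cod C f)" by (rule zigzag_letter(1)[OF C zigzag_Fwd(1)])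
    have "AMap H (zz_class C W (Cod C f) r B \<cdot>\<^bsub>?L\<^esub> loc C W f)
        = AMap H (zz_class C W (Cod C f) r B) \<cdot>\<^bsub>D\<^esub> AMap H (loc C W f)"
      using H(1) zz_class_hom[OF z1] zz_class_hom[OF zigzag_Fwd(2)]
      by (simp add: is_functor_def loc_eq Hom_def)
    then show ?case
      using localization_cmp[OF z1 zigzag_Fwd(2)] zigzag_Fwd H(2) by (simp add: loc_eq)
  next
    case (zigzag_Bwd w r B)
    let ?v = "zz_class C W (Cod C w) [Bwd w] (Dom C w)"
    have z1: "zigzag C W (Cod C w) [Bwd w] (Dom C w)"
      by (rule zigzag_letter(2)[OF C zigzag_Bwd(1,2)])
    have z2: "zigzag C W (Dom C w) [Fwd w] (Cod C w)"
      by (rule zigzag_letter(1)[OF C zigzag_Bwd(2)])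
    have iv: "inverse_arrows ?L (loc C W w) ?v" by (rule loc_inverse[OF C zigzag_Bwd(1,2)])
    have ob: "Dom C w \<in> Obj C" "Cod C w \<in> Obj C"
      using category.dom_obj[OF C zigzag_Bwd(2)] category.cod_obj[OF C zigzag_Bwd(2)] by auto
    have arrs: "?v \<in> Arr ?L" "loc C W w \<in> Arr ?L"
      using zz_class_hom[OF z1] zz_class_hom[OF z2] by (auto simp: Hom_def loc_eq)
    have "AMap H (?v \<cdot>\<^bsub>?L\<^esub> loc C W w) = AMap H ?v \<cdot>\<^bsub>D\<^esub> AMap H (loc C W w)"
      "AMap H (loc C W w \<cdot>\<^bsub>?L\<^esub> ?v) = AMap H (loc C W w) \<cdot>\<^bsub>D\<^esub> AMap H ?v"
      using H(1) arrs by (simp_all add: is_functor_def loc_eq)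
    moreover have "AMap H (Idn ?L A) = Idn D (OMap F A)" if "A \<in> Obj C" for A
      using H(1,3) that unfolding is_functor_def by (metis localization_simps(1))
    moreover have "AMap H ?v \<in> Hom D (OMap F (Cod C w)) (OMap F (Dom C w))"
      using H(1,3) arrs(1) ob unfolding is_functor_def by (metis localization_simps(2,3))
    ultimately have "inverse_arrows D (AMap F w) (AMap H ?v)"
      using iv H(2) zigzag_Bwd(2) Fm[OF zigzag_Bwd(2)] ob
      by (simp add: inverse_arrows_def Hom_def loc_eq del: localization_simps(4))
    then have "AMap H ?v = inv_arr D (AMap F w)"
      using Fi[OF zigzag_Bwd(1,2)] inverse_arrows_unique[OF D] by blast
    moreover have "AMap H (zz_class C W (Dom C w) r B \<cdot>\<^bsub>?L\<^esub> ?v)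
        = AMap H (zz_class C W (Dom C w) r B) \<cdot>\<^bsub>D\<^esub> AMap H ?v"
      using H(1) zz_class_hom[OF z1] zz_class_hom[OF zigzag_Bwd(3)]
      by (simp add: is_functor_def Hom_def)
    ultimately show ?case
      using localization_cmp[OF z1 zigzag_Bwd(3)] zigzag_Bwd by simp
  qed
  show "AMap G \<alpha> = AMap G' \<alpha>"
    if "is_functor ?L D G" "is_functor ?L D G'"
      "\<forall>f\<in>Arr C. AMap G (loc C W f) = AMap F f" "\<forall>f\<in>Arr C. AMap G' (loc C W f) = AMap F f"
      "\<forall>A\<in>Obj C. OMap G A = OMap F A" "\<forall>A\<in>Obj C. OMap G' A = OMap F A"
      "\<alpha> \<in> Arr ?L" for G G'
  proof -
    have "\<alpha> \<in> Hom ?L (Dom ?L \<alpha>) (Cod ?L \<alpha>)" using that by (simp add: Hom_def)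
    then obtain r where r: "zigzag C W (Dom ?L \<alpha>) r (Cod ?L \<alpha>)"
      "\<alpha> = zz_class C W (Dom ?L \<alpha>) r (Cod ?L \<alpha>)" by (rule localization_homE)
    show ?thesis
      using *[OF r(1) that(1,3,5)] *[OF r(1) that(2,4,6)] r(2) by simp
  qed
qed

section \<open>Localization at a twin cotorsion pair, shift and distinguished triangles\<close>

definition wFib :: "('o, 'm, 'e, 'z) ext_cat_scheme \<Rightarrow> 'o set \<Rightarrow> 'm set" where
  "wFib X V = {f. deflation X f \<and> (\<exists>x. conflation X x f \<and> Dom X x \<in> V)}"

definition wCof :: "('o, 'm, 'e, 'z) ext_cat_scheme \<Rightarrow> 'o set \<Rightarrow> 'm set" where
  "wCof X S = {f. inflation X f \<and> (\<exists>y. conflation X f y \<and> Cod X y \<in> S)}"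

definition weq :: "('o, 'm, 'e, 'z) ext_cat_scheme \<Rightarrow> 'o set \<Rightarrow> 'o set \<Rightarrow> 'm set" where
  "weq X S V = {p \<cdot>\<^bsub>X\<^esub> i | p i. i \<in> wCof X S \<and> p \<in> wFib X V \<and> Cod X i = Dom X p}"

text \<open>\<open>v A\<close>, \<open>u A\<close>, \<open>\<rho> A\<close> are the chosen triangle \<open>A \<rightarrow> V\<^sub>A \<rightarrow> U\<^sub>A\<close>, so that \<open>U\<^sub>A = Cod X (u A)\<close>,
  and \<open>uf f\<close> is the chosen \<open>u\<^sub>f : U\<^sub>A \<rightarrow> U\<^sub>B\<close>.\<close>

definition shift_choice ::
    "('o, 'm, 'e, 'z) ext_cat_scheme \<Rightarrow> 'o set \<Rightarrow> 'o set
      \<Rightarrow> ('o \<Rightarrow> 'm) \<Rightarrow> ('o \<Rightarrow> 'm) \<Rightarrow> ('o \<Rightarrow> 'e) \<Rightarrow> ('m \<Rightarrow> 'm) \<Rightarrow> bool" where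
  "shift_choice X U V v u \<rho> uf \<longleftrightarrow>
     (\<forall>A\<in>Obj X. etriangle X (v A) (u A) (\<rho> A) \<and>
        Dom X (v A) = A \<and> Cod X (v A) \<in> V \<and> Cod X (u A) \<in> U) \<and>
     (\<forall>f\<in>Arr X. uf f \<in> Hom X (Cod X (u (Dom X f))) (Cod X (u (Cod X f))) \<and>
        ext_morphism X (\<rho> (Dom X f)) (\<rho> (Cod X f)) f (uf f))"

definition pre_shift ::
    "('o, 'm, 'z) cat_scheme \<Rightarrow> 'm set \<Rightarrow> ('o \<Rightarrow> 'm) \<Rightarrow> ('m \<Rightarrow> 'm)
      \<Rightarrow> ('o, 'm, 'o, ('o, 'm) loc_arr) func" where
  "pre_shift X W u uf = \<lparr>OMap = (\<lambda>A. Cod X (u A)), AMap = (\<lambda>f. loc X W (uf f))\<rparr>"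

definition shift ::
    "('o, 'm, 'z) cat_scheme \<Rightarrow> 'm set \<Rightarrow> ('o \<Rightarrow> 'm) \<Rightarrow> ('m \<Rightarrow> 'm)
      \<Rightarrow> ('o, ('o, 'm) loc_arr, 'o, ('o, 'm) loc_arr) func" where
  "shift X W u uf = induced_functor X W (localization X W) (pre_shift X W u uf)"

definition ltilde ::
    "('o, 'm, 'e, 'z) ext_cat_scheme \<Rightarrow> 'o set \<Rightarrow> 'o set \<Rightarrow> ('o \<Rightarrow> 'm) \<Rightarrow> ('o \<Rightarrow> 'e)
      \<Rightarrow> 'o \<Rightarrow> 'o \<Rightarrow> 'e \<Rightarrow> ('o, 'm) loc_arr" where
  "ltilde X S V u \<rho> C A \<delta> =
     (let W = weq X S V; L = localization X W in
      THE h. \<exists>w d. w \<in> wFib X V \<and> Cod X w = C \<and> d \<in> Hom X (Dom X w) (Cod X (u A)) \<and>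
        pull X A w \<delta> = pull X A d (\<rho> A) \<and>
        h = loc X W d \<cdot>\<^bsub>L\<^esub> inv_arr L (loc X W w))"

text \<open>A triangle \<open>A \<rightarrow> B \<rightarrow> C \<rightarrow> F A\<close> is the triple of its arrows.\<close>

definition triangle ::
    "('o, 'm, 'z) cat_scheme \<Rightarrow> ('o, 'm, 'o, 'm) func \<Rightarrow> 'm \<times> 'm \<times> 'm \<Rightarrow> bool" where
  "triangle C F = (\<lambda>(f, g, h).
     f \<in> Arr C \<and> g \<in> Arr C \<and> h \<in> Arr C \<and>
     Cod C f = Dom C g \<and> Cod C g = Dom C h \<and> Cod C h = OMap F (Dom C f))"

definition triangle_morphism ::
    "('o, 'm, 'z) cat_scheme \<Rightarrow> ('o, 'm, 'o, 'm) func
      \<Rightarrow> 'm \<times> 'm \<times> 'm \<Rightarrow> 'm \<times> 'm \<times> 'm \<Rightarrow> 'm \<times> 'm \<times> 'm \<Rightarrow> bool" where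
  "triangle_morphism C F = (\<lambda>(f, g, h) (f', g', h') (a, b, c).
     a \<in> Hom C (Dom C f) (Dom C f') \<and> b \<in> Hom C (Dom C g) (Dom C g') \<and>
     c \<in> Hom C (Dom C h) (Dom C h') \<and>
     b \<cdot>\<^bsub>C\<^esub> f = f' \<cdot>\<^bsub>C\<^esub> a \<and> c \<cdot>\<^bsub>C\<^esub> g = g' \<cdot>\<^bsub>C\<^esub> b \<and> AMap F a \<cdot>\<^bsub>C\<^esub> h = h' \<cdot>\<^bsub>C\<^esub> c)"

definition triangle_iso ::
    "('o, 'm, 'z) cat_scheme \<Rightarrow> ('o, 'm, 'o, 'm) func
      \<Rightarrow> 'm \<times> 'm \<times> 'm \<Rightarrow> 'm \<times> 'm \<times> 'm \<Rightarrow> bool" where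
  "triangle_iso C F t t' \<longleftrightarrow>
     triangle C F t \<and> triangle C F t' \<and>
     (\<exists>a b c. triangle_morphism C F t t' (a, b, c) \<and> iso_arr C a \<and> iso_arr C b \<and> iso_arr C c)"

definition standard_triangles ::
    "('o, 'm, 'e, 'z) ext_cat_scheme \<Rightarrow> 'o set \<Rightarrow> 'o set \<Rightarrow> ('o \<Rightarrow> 'm) \<Rightarrow> ('o \<Rightarrow> 'e)
      \<Rightarrow> (('o, 'm) loc_arr \<times> ('o, 'm) loc_arr \<times> ('o, 'm) loc_arr) set" where
  "standard_triangles X S V u \<rho> =
     {(loc X (weq X S V) x, loc X (weq X S V) y, ltilde X S V u \<rho> (Cod X y) (Dom X x) \<delta>)
        | x y \<delta>. etriangle X x y \<delta>}"

definition distinguished_triangles ::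
    "('o, 'm, 'e, 'z) ext_cat_scheme \<Rightarrow> 'o set \<Rightarrow> 'o set
      \<Rightarrow> ('o \<Rightarrow> 'm) \<Rightarrow> ('o \<Rightarrow> 'e) \<Rightarrow> ('m \<Rightarrow> 'm)
      \<Rightarrow> (('o, 'm) loc_arr \<times> ('o, 'm) loc_arr \<times> ('o, 'm) loc_arr) set" where
  "distinguished_triangles X S V u \<rho> uf =
     {t. \<exists>t'\<in>standard_triangles X S V u \<rho>.
        triangle_iso (localization X (weq X S V)) (shift X (weq X S V) u uf) t t'}"


section \<open>Triangulated categories\<close>

locale triangulated_category = additive_category T
    for T :: "('o, 'm, 'z) add_cat_scheme" +
  fixes F :: "('o, 'm, 'o, 'm) func"
    and \<Delta> :: "('m \<times> 'm \<times> 'm) set"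
  assumes shift_additive: "additive_functor T T F"
    and shift_equivalence: "auto_equivalence T F"
    and dist_triangle: "t \<in> \<Delta> \<Longrightarrow> triangle T F t"
    and TR1_iso: "\<lbrakk>t \<in> \<Delta>; triangle_iso T F t t'\<rbrakk> \<Longrightarrow> t' \<in> \<Delta>"
    and TR1_idn: "\<lbrakk>A \<in> Obj T; zero_object T Z\<rbrakk>
      \<Longrightarrow> (Idn T A, hzero T A Z, hzero T Z (OMap F A)) \<in> \<Delta>"
    and TR1_ex: "f \<in> Arr T \<Longrightarrow> \<exists>g h. (f, g, h) \<in> \<Delta>"
    and TR2: "triangle T F (f, g, h)
      \<Longrightarrow> (f, g, h) \<in> \<Delta> \<longleftrightarrow> (g, h, hneg T (AMap F f)) \<in> \<Delta>"
    and TR3: "\<lbrakk>(f, g, h) \<in> \<Delta>; (f', g', h') \<in> \<Delta>;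
        a \<in> Hom T (Dom T f) (Dom T f'); b \<in> Hom T (Cod T f) (Cod T f');
        b \<cdot>\<^bsub>T\<^esub> f = f' \<cdot>\<^bsub>T\<^esub> a\<rbrakk>
      \<Longrightarrow> \<exists>c. triangle_morphism T F (f, g, h) (f', g', h') (a, b, c)"
    and TR4: "\<lbrakk>Cod T f = Dom T g;
        (f, f', f'') \<in> \<Delta>; (g, g', g'') \<in> \<Delta>; (g \<cdot>\<^bsub>T\<^esub> f, h', h'') \<in> \<Delta>\<rbrakk>
      \<Longrightarrow> \<exists>d e. d \<in> Hom T (Cod T f') (Cod T h') \<and> e \<in> Hom T (Cod T h') (Cod T g') \<and>
            (d, e, AMap F f' \<cdot>\<^bsub>T\<^esub> g'') \<in> \<Delta> \<and>
            d \<cdot>\<^bsub>T\<^esub> f' = h' \<cdot>\<^bsub>T\<^esub> g \<and> h'' \<cdot>\<^bsub>T\<^esub> d = f'' \<and>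
            e \<cdot>\<^bsub>T\<^esub> h' = g' \<and> g'' \<cdot>\<^bsub>T\<^esub> e = AMap F f \<cdot>\<^bsub>T\<^esub> h''"

text \<open>Being additive is a property of a category: the addition of arrows is determined by the
  biproducts. So \<open>(F, \<Delta>)\<close> is a triangulation of a bare category if it is one for the category
  with its addition.\<close>

definition triangulation ::
    "('o, 'm) cat \<Rightarrow> ('o, 'm, 'o, 'm) func \<Rightarrow> ('m \<times> 'm \<times> 'm) set \<Rightarrow> bool" where
  "triangulation D F \<Delta> \<longleftrightarrow>
     (\<exists>add zero. triangulated_category (cat.extend D (add_cat.fields add zero)) F \<Delta>)"

end

theory Submission
  imports Defs
begin

text \<open>Let \<open>N\<close> be the common value of \<open>N\<^sup>i\<close> and \<open>N\<^sup>f\<close>. Every object \<open>A\<close> has a trivial fibration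
  \<open>QA \<rightarrow> A\<close> with \<open>QA \<in> U\<close> and a trivial cofibration \<open>QA \<rightarrow> ZA\<close> with \<open>ZA \<in> U \<inter> T\<close>. An arrow
  \<open>A \<rightarrow> B\<close> induces an arrow \<open>ZA \<rightarrow> ZB\<close>, unique up to arrows factoring through \<open>N\<close>; weak
  equivalences induce arrows invertible modulo this ideal because of the Hovey condition. Hence, for
  \<open>A \<in> U\<close> and \<open>B \<in> T\<close>, the arrows \<open>A \<rightarrow> B\<close> of the localization are the arrows of the original
  category modulo those factoring through \<open>N\<close>. In particular the localization is additive and
  commutative squares in it lift to strictly commutative squares between suitably replaced objects.
  The quasi-inverse of the shift is built from the triangles \<open>T\<^sub>C \<rightarrow> S\<^sub>C \<rightarrow> C\<close>. Each arrow is modelled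
  by an inflation \<open>A \<rightarrow> B \<oplus> V\<^sub>A\<close>, rotation comes from the pushout of \<open>A \<rightarrow> B \<rightarrow> C\<close> with
  \<open>A \<rightarrow> V\<^sub>A \<rightarrow> U\<^sub>A\<close>, and the octahedral axiom from (ET4).\<close>

section \<open>Categories and additive categories\<close>

text \<open>Arrows of the localization are classes of words, so their equality cannot be read off
  directly. It is detected by a functor: classes of arrows between replacements form a category
  \<open>K\<close>, the universal property extends the functor into \<open>K\<close> to the
  localization, and faithfulness follows. The hard point is that trivial cofibrations become
  invertible in \<open>K\<close>. Their place is taken by cones of arrows
  \<open>A \<rightarrow> V \<oplus> B\<close>, obtained with (ET4) from the graph of
  \<open>A \<rightarrow> B\<close>. The graph contributes one sign, and adding two extensions in a
  pushout contributes another, which becomes the sign of the rotation axiom. A square that commutes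
  only in the localization commutes in the category up to an arrow through \<open>V\<close>. To
  remove this error it has to extend along the inflation of the source; a summand \<open>V1\<close>
  added to the middle term of the source makes it extend.\<close>

locale ccat = category C for C :: "('o, 'm, 'z) cat_scheme" (structure)
begin

abbreviation hm :: "'o \<Rightarrow> 'o \<Rightarrow> 'm set" where "hm A B \<equiv> Hom C A B"

lemma hm_iff: "f \<in> hm A B \<longleftrightarrow> f \<in> Arr C \<and> Dom C f = A \<and> Cod C f = B"
  by (simp add: Hom_def)

lemma hm_obj: "f \<in> hm A B \<Longrightarrow> A \<in> Obj C" "f \<in> hm A B \<Longrightarrow> B \<in> Obj C"
  using dom_obj cod_obj by (auto simp: hm_iff)

lemma arr_cmp [simp]:
  assumes "f \<in> Arr C" "g \<in> Arr C" "Cod C f = Dom C g"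
  shows "g \<cdot> f \<in> Arr C" "Dom C (g \<cdot> f) = Dom C f" "Cod C (g \<cdot> f) = Cod C g"
  using cmp_hom[of f "Dom C f" "Cod C f" g "Cod C g"] assms by (auto simp: hm_iff)

lemma arr_obj [simp]: "f \<in> Arr C \<Longrightarrow> Dom C f \<in> Obj C" "f \<in> Arr C \<Longrightarrow> Cod C f \<in> Obj C"
  by (auto intro: dom_obj cod_obj)

lemma arr_idn [simp]:
  assumes "A \<in> Obj C"
  shows "Idn C A \<in> Arr C" "Dom C (Idn C A) = A" "Cod C (Idn C A) = A"
  using idn_hom[OF assms] by (auto simp: hm_iff)

lemma cmp_idn [simp]:
  "\<lbrakk>f \<in> Arr C; Cod C f = B\<rbrakk> \<Longrightarrow> Idn C B \<cdot> f = f" "\<lbrakk>f \<in> Arr C; Dom C f = A\<rbrakk> \<Longrightarrow> f \<cdot> Idn C A = f"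
  using idn_left idn_right by (auto simp: hm_iff)

lemma assoc [simp]:
  "\<lbrakk>f \<in> Arr C; g \<in> Arr C; h \<in> Arr C; Cod C f = Dom C g; Cod C g = Dom C h\<rbrakk>
    \<Longrightarrow> (h \<cdot> g) \<cdot> f = h \<cdot> (g \<cdot> f)"
  using cmp_assoc[of f "Dom C f" "Cod C f" g "Cod C g" h "Cod C h"] by (auto simp: hm_iff)

text \<open>\<open>assoc\<close> normalises composites to the right and so hides
  \<open>g \<cdot> f\<close> inside a longer composite; this rule lets a known equation for
  \<open>g \<cdot> f\<close> act there.\<close>

lemma reassoc:
  "\<lbrakk>g \<cdot> f = h; k \<in> Arr C; f \<in> Arr C; g \<in> Arr C; Cod C f = Dom C g; Cod C k = Dom C f\<rbrakk>
    \<Longrightarrow> g \<cdot> (f \<cdot> k) = h \<cdot> k"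
  by (metis assoc)

text \<open>Source and target are arguments, so that rules about isomorphisms combine by unification
  instead of by computing \<open>Dom\<close> and \<open>Cod\<close> of composites.\<close>

definition iso_hm :: "'o \<Rightarrow> 'o \<Rightarrow> 'm \<Rightarrow> bool" where
  "iso_hm A B f \<longleftrightarrow> f \<in> hm A B \<and> (\<exists>g\<in>hm B A. g \<cdot> f = Idn C A \<and> f \<cdot> g = Idn C B)"

lemma iso_hmI: "\<lbrakk>f \<in> hm A B; g \<in> hm B A; g \<cdot> f = Idn C A; f \<cdot> g = Idn C B\<rbrakk> \<Longrightarrow> iso_hm A B f"
  by (auto simp: iso_hm_def)

lemma iso_hm_hm: "iso_hm A B f \<Longrightarrow> f \<in> hm A B"
  by (simp add: iso_hm_def)

lemma iso_hmE:
  assumes "iso_hm A B f"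
  obtains g where "f \<in> hm A B" "g \<in> hm B A" "g \<cdot> f = Idn C A" "f \<cdot> g = Idn C B" "iso_hm B A g"
  using assms by (auto simp: iso_hm_def)

lemma inverse_arrows_iff:
  "inverse_arrows C f g \<longleftrightarrow> (\<exists>A B. f \<in> hm A B \<and> g \<in> hm B A \<and> g \<cdot> f = Idn C A \<and> f \<cdot> g = Idn C B)"
  by (auto simp: inverse_arrows_def hm_iff)

lemma iso_arr_iff: "iso_arr C f \<longleftrightarrow> (\<exists>A B. iso_hm A B f)"
  by (auto simp: iso_arr_def inverse_arrows_iff iso_hm_def)

lemma iso_arr_hm: "f \<in> hm A B \<Longrightarrow> iso_arr C f \<longleftrightarrow> iso_hm A B f"
  by (auto simp: iso_arr_iff iso_hm_def hm_iff)

lemma inv_arr_eq: "\<lbrakk>f \<in> hm A B; g \<in> hm B A; g \<cdot> f = Idn C A; f \<cdot> g = Idn C B\<rbrakk> \<Longrightarrow> inv_arr C f = g"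
  by (meson category_axioms inverse_arrows_iff inverse_arrows_unique inv_arr_inverse iso_arr_def)

lemma inv_arr_props:
  assumes "iso_hm A B f"
  shows "inv_arr C f \<in> hm B A" "inv_arr C f \<cdot> f = Idn C A" "f \<cdot> inv_arr C f = Idn C B"
    "iso_hm B A (inv_arr C f)"
  using assms inv_arr_eq by (auto simp: iso_hm_def)

lemma iso_idn [simp]: "A \<in> Obj C \<Longrightarrow> iso_hm A A (Idn C A)"
  by (rule iso_hmI[of _ _ _ "Idn C A"]) (auto simp: hm_iff)

lemma iso_cmp:
  assumes "iso_hm A B f" "iso_hm B D g"
  shows "iso_hm A D (g \<cdot> f)"
proof -
  from assms obtain f' g' where fg: "f \<in> hm A B" "f' \<in> hm B A" "f' \<cdot> f = Idn C A" "f \<cdot> f' = Idn C B"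
    "g \<in> hm B D" "g' \<in> hm D B" "g' \<cdot> g = Idn C B" "g \<cdot> g' = Idn C D"
    by (meson iso_hmE)
  show ?thesis
    by (rule iso_hmI[of _ _ _ "f' \<cdot> g'"])
      (use fg in \<open>auto simp: hm_iff reassoc[OF fg(3)] reassoc[OF fg(4)] reassoc[OF fg(7)] reassoc[OF
          fg(8)]\<close>)
qed

lemma iso_cancel_left:
  assumes "iso_hm B D g" "f \<in> hm A B" "f' \<in> hm A B" "g \<cdot> f = g \<cdot> f'"
  shows "f = f'"
proof -
  from assms(1) obtain g' where g': "g \<in> hm B D" "g' \<in> hm D B" "g' \<cdot> g = Idn C B" by (auto simp:
      iso_hm_def)
  then have "g' \<cdot> (g \<cdot> f) = f" "g' \<cdot> (g \<cdot> f') = f'"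
    using assms(2,3) by (simp_all add: hm_iff reassoc[OF g'(3)])
  then show ?thesis using assms(4) by metis
qed

lemma iso_cancel_right:
  assumes "iso_hm A B g" "f \<in> hm B D" "f' \<in> hm B D" "f \<cdot> g = f' \<cdot> g"
  shows "f = f'"
proof -
  from assms(1) obtain g' where g': "g \<in> hm A B" "g' \<in> hm B A" "g \<cdot> g' = Idn C B" by (auto simp:
      iso_hm_def)
  have "(f \<cdot> g) \<cdot> g' = f" "(f' \<cdot> g) \<cdot> g' = f'"
    using assms(2,3) g' by (simp_all add: hm_iff)
  then show ?thesis using assms(4) by metis
qed

lemma iso_of_cmp_left:
  assumes "iso_hm A B f" "g \<in> hm B D" "iso_hm A D (g \<cdot> f)"
  shows "iso_hm B D g"
proof -
  from assms(1) obtain f' where f: "f \<in> hm A B" "f' \<in> hm B A" "f \<cdot> f' = Idn C B" "iso_hm B A f'" by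
      (meson iso_hmE)
  have "(g \<cdot> f) \<cdot> f' = g" using f assms by (simp add: hm_iff)
  then show ?thesis using iso_cmp[OF f(4) assms(3)] by simp
qed

lemma iso_of_cmp_right:
  assumes "iso_hm B D g" "f \<in> hm A B" "iso_hm A D (g \<cdot> f)"
  shows "iso_hm A B f"
proof -
  from assms(1) obtain g' where g: "g \<in> hm B D" "g' \<in> hm D B" "g' \<cdot> g = Idn C B" "iso_hm D B g'" by
      (meson iso_hmE)
  have "g' \<cdot> (g \<cdot> f) = f" using g assms by (simp add: hm_iff reassoc[OF g(3)])
  then show ?thesis using iso_cmp[OF assms(3) g(4)] by simp
qed

end

locale acat = additive_category C for C :: "('o, 'm, 'z) add_cat_scheme" (structure)

sublocale acat \<subseteq> ccat C by unfold_locales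

context acat
begin

abbreviation hz :: "'o \<Rightarrow> 'o \<Rightarrow> 'm" where "hz A B \<equiv> hzero C A B"
abbreviation hn :: "'m \<Rightarrow> 'm" where "hn f \<equiv> hneg C f"

lemma hom_group_simps [simp]:
  "carrier (hom_group C A B) = hm A B" "monoid.mult (hom_group C A B) = hadd C"
  "one (hom_group C A B) = hz A B"
  by (simp_all add: hom_group_def)

lemma hom_group: "f \<in> hm A B \<Longrightarrow> comm_group (hom_group C A B)"
  by (meson hom_comm_group hm_obj)

lemma hz_hm: "\<lbrakk>A \<in> Obj C; B \<in> Obj C\<rbrakk> \<Longrightarrow> hz A B \<in> hm A B"
  using monoid.one_closed[of "hom_group C A B"] hom_comm_group[of A B]
  by (simp add: comm_group_def group_def)

lemma add_hm: "\<lbrakk>f \<in> hm A B; g \<in> hm A B\<rbrakk> \<Longrightarrow> f \<plusminus> g \<in> hm A B"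
  using monoid.m_closed[of "hom_group C A B" f g] hom_group[of f A B]
  by (simp add: comm_group_def group_def)

lemma neg_hm: "f \<in> hm A B \<Longrightarrow> hn f \<in> hm A B"
  using group.inv_closed[of "hom_group C A B" f] hom_group[of f A B]
  by (simp add: comm_group_def hneg_def hm_iff)

lemma arr_hz [simp]:
  assumes "A \<in> Obj C" "B \<in> Obj C"
  shows "hz A B \<in> Arr C" "Dom C (hz A B) = A" "Cod C (hz A B) = B"
  using hz_hm[OF assms] by (auto simp: hm_iff)

lemma arr_add [simp]:
  assumes "f \<in> Arr C" "g \<in> Arr C" "Dom C f = Dom C g" "Cod C f = Cod C g"
  shows "f \<plusminus> g \<in> Arr C" "Dom C (f \<plusminus> g) = Dom C g" "Cod C (f \<plusminus> g) = Cod C g"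
  using add_hm[of f "Dom C f" "Cod C f" g] assms by (auto simp: hm_iff)

lemma arr_neg [simp]:
  assumes "f \<in> Arr C"
  shows "hn f \<in> Arr C" "Dom C (hn f) = Dom C f" "Cod C (hn f) = Cod C f"
  using neg_hm[of f "Dom C f" "Cod C f"] assms by (auto simp: hm_iff)

lemma aassoc:
  assumes "f \<in> Arr C" "g \<in> Arr C" "h \<in> Arr C" "Dom C f = Dom C g" "Cod C f = Cod C g"
    "Dom C g = Dom C h" "Cod C g = Cod C h"
  shows "(f \<plusminus> g) \<plusminus> h = f \<plusminus> (g \<plusminus> h)"
  using monoid.m_assoc[of "hom_group C (Dom C f) (Cod C f)" f g h] hom_group[of f "Dom C f" "Cod C
      f"] assms
  by (simp add: comm_group_def group_def hm_iff)

lemma acomm: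
  assumes "f \<in> Arr C" "g \<in> Arr C" "Dom C f = Dom C g" "Cod C f = Cod C g"
  shows "f \<plusminus> g = g \<plusminus> f"
  using comm_monoid.m_comm[of "hom_group C (Dom C f) (Cod C f)" f g] hom_group[of f "Dom C f" "Cod C
      f"] assms
  by (simp add: comm_group_def hm_iff)

lemma alcomm:
  assumes "f \<in> Arr C" "g \<in> Arr C" "h \<in> Arr C" "Dom C f = Dom C g" "Cod C f = Cod C g"
    "Dom C g = Dom C h" "Cod C g = Cod C h"
  shows "f \<plusminus> (g \<plusminus> h) = g \<plusminus> (f \<plusminus> h)"
  using assms aassoc[of f g h] aassoc[of g f h] acomm[of f g] by simp

lemma add_zero [simp]:
  "\<lbrakk>f \<in> Arr C; Dom C f = A; Cod C f = B\<rbrakk> \<Longrightarrow> f \<plusminus> hz A B = f"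
  "\<lbrakk>f \<in> Arr C; Dom C f = A; Cod C f = B\<rbrakk> \<Longrightarrow> hz A B \<plusminus> f = f"
  using monoid.r_one[of "hom_group C A B" f] monoid.l_one[of "hom_group C A B" f] hom_group[of f A
      B]
  by (auto simp: comm_group_def group_def hm_iff)

lemma add_neg [simp]:
  "\<lbrakk>f \<in> Arr C\<rbrakk> \<Longrightarrow> f \<plusminus> hn f = hz (Dom C f) (Cod C f)"
  "\<lbrakk>f \<in> Arr C\<rbrakk> \<Longrightarrow> hn f \<plusminus> f = hz (Dom C f) (Cod C f)"
  using group.r_inv[of "hom_group C (Dom C f) (Cod C f)" f] group.l_inv[of "hom_group C (Dom C f)
      (Cod C f)" f]
    hom_group[of f "Dom C f" "Cod C f"]
  by (auto simp: comm_group_def hneg_def hm_iff)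

lemma add_neg_cancel [simp]:
  assumes "f \<in> Arr C" "g \<in> Arr C" "Dom C f = Dom C g" "Cod C f = Cod C g"
  shows "f \<plusminus> (hn f \<plusminus> g) = g" "hn f \<plusminus> (f \<plusminus> g) = g"
  using assms by (simp_all flip: aassoc)


lemma neg_unique:
  assumes "f \<in> hm A B" "g \<in> hm A B" "f \<plusminus> g = hz A B"
  shows "f = hn g"
proof -
  have "f \<plusminus> (g \<plusminus> hn g) = (f \<plusminus> g) \<plusminus> hn g" using assms(1,2) by (simp add: aassoc hm_iff)
  then show ?thesis using assms hm_obj[OF assms(1)] by (simp add: hm_iff)
qed

lemma diff_zero_eq: "\<lbrakk>f \<in> hm A B; g \<in> hm A B; f \<plusminus> hn g = hz A B\<rbrakk> \<Longrightarrow> f = g"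
  using add_neg_cancel(1)[of g f] acomm[of f "hn g"] by (simp add: hm_iff)

lemma neg_neg [simp]: "f \<in> Arr C \<Longrightarrow> hn (hn f) = f"
  using neg_unique[of f "Dom C f" "Cod C f" "hn f"] by (simp add: hm_iff)

lemma neg_zero [simp]: "\<lbrakk>A \<in> Obj C; B \<in> Obj C\<rbrakk> \<Longrightarrow> hn (hz A B) = hz A B"
  using neg_unique[of "hz A B" A B "hz A B"] by (simp add: hm_iff)

lemma cmp_add_left:
  "\<lbrakk>f \<in> Arr C; g \<in> Arr C; h \<in> Arr C; Dom C g = Dom C h; Cod C g = Cod C h; Cod C f = Dom C h\<rbrakk>
   \<Longrightarrow> (g \<plusminus> h) \<cdot> f = (g \<cdot> f) \<plusminus> (h \<cdot> f)"
  using cmp_add[of f "Dom C f" "Cod C f" g "Cod C g" h] by (auto simp: hm_iff)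

lemma cmp_add_right:
  "\<lbrakk>f \<in> Arr C; g \<in> Arr C; h \<in> Arr C; Dom C f = Dom C g; Cod C f = Cod C g; Cod C g = Dom C h\<rbrakk>
   \<Longrightarrow> h \<cdot> (f \<plusminus> g) = (h \<cdot> f) \<plusminus> (h \<cdot> g)"
  using add_cmp[of f "Dom C f" "Cod C f" g h "Cod C h"] by (auto simp: hm_iff)

lemma idem_zero: "\<lbrakk>f \<in> hm A B; f \<plusminus> f = f\<rbrakk> \<Longrightarrow> f = hz A B"
  using add_neg_cancel(2)[of f f] by (simp add: hm_iff)

lemma cmp_zero [simp]:
  assumes "f \<in> Arr C" "A \<in> Obj C"
  shows "Dom C f = D \<Longrightarrow> f \<cdot> hz A D = hz A (Cod C f)" "Cod C f = D \<Longrightarrow> hz D A \<cdot> f = hz (Dom C f) A"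
proof -
  assume [simp]: "Dom C f = D"
  have [simp]: "D \<in> Obj C" using arr_obj(1)[OF assms(1)] by simp
  have "f \<cdot> hz A D \<plusminus> f \<cdot> hz A D = f \<cdot> hz A D"
    using cmp_add_right[of "hz A D" "hz A D" f] assms by simp
  then show "f \<cdot> hz A D = hz A (Cod C f)" using assms by (intro idem_zero) (auto simp: hm_iff)
next
  assume [simp]: "Cod C f = D"
  have [simp]: "D \<in> Obj C" using arr_obj(2)[OF assms(1)] by simp
  have "hz D A \<cdot> f \<plusminus> hz D A \<cdot> f = hz D A \<cdot> f"
    using cmp_add_left[of f "hz D A" "hz D A"] assms by simp
  then show "hz D A \<cdot> f = hz (Dom C f) A" using assms by (intro idem_zero) (auto simp: hm_iff)
qed

lemma cmp_neg [simp]: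
  assumes "f \<in> Arr C" "g \<in> Arr C" "Cod C f = Dom C g"
  shows "g \<cdot> hn f = hn (g \<cdot> f)" "hn g \<cdot> f = hn (g \<cdot> f)"
proof -
  have "g \<cdot> hn f \<plusminus> g \<cdot> f = hz (Dom C f) (Cod C g)" using cmp_add_right[of "hn f" f g] assms by simp
  then show "g \<cdot> hn f = hn (g \<cdot> f)" using assms by (intro neg_unique[of _ "Dom C f" "Cod C g"])
      (auto simp: hm_iff)
  have "hn g \<cdot> f \<plusminus> g \<cdot> f = hz (Dom C f) (Cod C g)" using cmp_add_left[of f "hn g" g] assms by simp
  then show "hn g \<cdot> f = hn (g \<cdot> f)" using assms by (intro neg_unique[of _ "Dom C f" "Cod C g"])
      (auto simp: hm_iff)
qed

lemma neg_add:
  assumes "f \<in> hm A B" "g \<in> hm A B"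
  shows "hn (f \<plusminus> g) = hn f \<plusminus> hn g"
proof -
  have "(hn f \<plusminus> hn g) \<plusminus> (f \<plusminus> g) = hz A B"
    using assms hm_obj[OF assms(1)] by (simp add: hm_iff aassoc alcomm[of "hn g" f g])
  then show ?thesis using assms by (intro neg_unique[symmetric, of _ A B]) (auto simp: hm_iff)
qed

lemmas distrib = cmp_add_left cmp_add_right

lemma iso_neg:
  assumes "iso_hm A B f" shows "iso_hm A B (hn f)"
proof -
  from assms obtain g where "f \<in> hm A B" "g \<in> hm B A" "g \<cdot> f = Idn C A" "f \<cdot> g = Idn C B" by (meson
      iso_hmE)
  then show ?thesis by (intro iso_hmI[of _ _ _ "hn g"]) (auto simp: hm_iff)
qed

lemma zero_obj_hm:
  assumes "zero_object C Z" "f \<in> hm A Z" shows "f = hz A Z"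
  using assms hz_hm[of A Z] unfolding zero_object_def by (metis hm_obj(1))

lemma zero_obj_hm':
  assumes "zero_object C Z" "f \<in> hm Z A" shows "f = hz Z A"
  using assms hz_hm[of Z A] unfolding zero_object_def by (metis hm_obj(2))

lemma zero_obj_idn: "zero_object C Z \<Longrightarrow> Idn C Z = hz Z Z"
  by (metis zero_obj_hm idn_hom zero_object_def)

lemma biproductD:
  assumes "biproduct C A B P i j p q"
  shows "A \<in> Obj C" "B \<in> Obj C" "P \<in> Obj C"
   "i \<in> Arr C" "Dom C i = A" "Cod C i = P" "j \<in> Arr C" "Dom C j = B" "Cod C j = P"
   "p \<in> Arr C" "Dom C p = P" "Cod C p = A" "q \<in> Arr C" "Dom C q = P" "Cod C q = B"
   "p \<cdot> i = Idn C A" "q \<cdot> j = Idn C B" "q \<cdot> i = hz A B" "p \<cdot> j = hz B A" "i \<cdot> p \<plusminus> j \<cdot> q = Idn C P"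
  using assms by (auto simp: biproduct_def hm_iff)

lemma biproduct_re:
  assumes "biproduct C A B P i j p q" "k \<in> Arr C"
  shows "Cod C k = A \<Longrightarrow> p \<cdot> (i \<cdot> k) = k" "Cod C k = B \<Longrightarrow> q \<cdot> (j \<cdot> k) = k"
    "Cod C k = A \<Longrightarrow> q \<cdot> (i \<cdot> k) = hz (Dom C k) B" "Cod C k = B \<Longrightarrow> p \<cdot> (j \<cdot> k) = hz (Dom C k) A"
  using biproductD[OF assms(1)] assms(2)
  by (auto simp: reassoc[of p i] reassoc[of q j] reassoc[of q i] reassoc[of p j])

lemma biproduct_swap: "biproduct C A B P i j p q \<Longrightarrow> biproduct C B A P j i q p"
  unfolding biproduct_def using acomm[of "i \<cdot> p" "j \<cdot> q"] by (auto simp: hm_iff)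

lemma biproduct_zero_right:
  assumes "A \<in> Obj C" "zero_object C Z"
  shows "biproduct C A Z A (Idn C A) (hz Z A) (Idn C A) (hz A Z)"
  using assms zero_obj_idn[OF assms(2)] by (auto simp: biproduct_def hm_iff zero_object_def)

lemma biproduct_zero_left:
  assumes "A \<in> Obj C" "zero_object C Z"
  shows "biproduct C Z A A (hz Z A) (Idn C A) (hz A Z) (Idn C A)"
  by (rule biproduct_swap[OF biproduct_zero_right[OF assms]])

end

section \<open>Extriangulated categories\<close>

locale xcat = extriangulated_category X for X :: "('o, 'm, 'e, 'z) ext_cat_scheme" (structure)

sublocale xcat \<subseteq> acat X by unfold_locales

context xcat
begin

abbreviation EE :: "'o \<Rightarrow> 'o \<Rightarrow> 'e set" where "EE C A \<equiv> carrier (Ext X C A)"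
abbreviation Eo :: "'o \<Rightarrow> 'o \<Rightarrow> 'e" where "Eo C A \<equiv> \<one>\<^bsub>Ext X C A\<^esub>"
abbreviation Em :: "'m \<Rightarrow> 'm \<Rightarrow> 'e \<Rightarrow> 'e" where "Em \<equiv> ExtMap X"

subsection \<open>The bifunctor of extensions\<close>

lemma ext_group: "\<lbrakk>C \<in> Obj X; A \<in> Obj X\<rbrakk> \<Longrightarrow> comm_group (Ext X C A)"
  using ext_functor by (simp add: ext_functor_def)

lemma ext_grp: "\<lbrakk>C \<in> Obj X; A \<in> Obj X\<rbrakk> \<Longrightarrow> group (Ext X C A)"
  using ext_group by (simp add: comm_group_def)

lemma eo_in [simp]: "\<lbrakk>C \<in> Obj X; A \<in> Obj X\<rbrakk> \<Longrightarrow> Eo C A \<in> EE C A"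
  using ext_grp[of C A] by (simp add: group.is_monoid)

lemma em_hom: "\<lbrakk>c \<in> Arr X; a \<in> Arr X\<rbrakk> \<Longrightarrow> Em c a \<in> hom (Ext X (Cod X c) (Dom X a)) (Ext X (Dom X c)
    (Cod X a))"
  using ext_functor by (simp add: ext_functor_def)

lemma em_in [simp]:
  "\<lbrakk>c \<in> Arr X; a \<in> Arr X; \<delta> \<in> EE (Cod X c) (Dom X a); Dom X c = C; Cod X a = A\<rbrakk> \<Longrightarrow> Em c a \<delta> \<in> EE C A"
  using em_hom[of c a] by (auto simp: hom_def)

lemma em_mult:
  "\<lbrakk>c \<in> Arr X; a \<in> Arr X; Cod X c = C; Dom X a = A; \<delta> \<in> EE C A; \<epsilon> \<in> EE C A\<rbrakk>
    \<Longrightarrow> Em c a (\<delta> \<otimes>\<^bsub>Ext X C A\<^esub> \<epsilon>) = Em c a \<delta> \<otimes>\<^bsub>Ext X (Dom X c) (Cod X a)\<^esub> Em c a \<epsilon>"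
  using em_hom[of c a] by (auto simp: hom_def)

lemma em_one [simp]:
  assumes "c \<in> Arr X" "a \<in> Arr X" "Cod X c = C" "Dom X a = A"
  shows "Em c a (Eo C A) = Eo (Dom X c) (Cod X a)"
  using em_hom[of c a] assms ext_grp[of "Cod X c" "Dom X a"] ext_grp[of "Dom X c" "Cod X a"]
  by (auto intro: hom_one)

lemma em_id [simp]: "\<lbrakk>C \<in> Obj X; A \<in> Obj X; \<delta> \<in> EE C A\<rbrakk> \<Longrightarrow> Em (Idn X C) (Idn X A) \<delta> = \<delta>"
  using ext_functor by (simp add: ext_functor_def)

lemma em_em [simp]:
  "\<lbrakk>c \<in> Arr X; c' \<in> Arr X; a \<in> Arr X; a' \<in> Arr X; Cod X c' = Dom X c; Cod X a = Dom X a';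
    \<delta> \<in> EE (Cod X c) (Dom X a)\<rbrakk> \<Longrightarrow> Em c' a' (Em c a \<delta>) = Em (c \<cdot> c') (a' \<cdot> a) \<delta>"
  using ext_functor unfolding ext_functor_def by (metis (no_types, lifting))

lemma em_biadd:
  assumes "c \<in> hm C' C" "a \<in> hm A A'" "\<delta> \<in> EE C A"
  shows "c2 \<in> hm C' C \<Longrightarrow> Em (c \<plusminus> c2) a \<delta> = Em c a \<delta> \<otimes>\<^bsub>Ext X C' A'\<^esub> Em c2 a \<delta>"
    "a2 \<in> hm A A' \<Longrightarrow> Em c (a \<plusminus> a2) \<delta> = Em c a \<delta> \<otimes>\<^bsub>Ext X C' A'\<^esub> Em c a2 \<delta>"
  using ET1 assms hm_obj[OF assms(1)] hm_obj[OF assms(2)] unfolding ext_biadditive_def by blast+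

lemma em_add_left:
  "\<lbrakk>c \<in> Arr X; c' \<in> Arr X; a \<in> Arr X; Dom X c = Dom X c'; Cod X c = Cod X c'; \<delta> \<in> EE (Cod X c') (Dom
      X a)\<rbrakk>
   \<Longrightarrow> Em (c \<plusminus> c') a \<delta> = Em c a \<delta> \<otimes>\<^bsub>Ext X (Dom X c') (Cod X a)\<^esub> Em c' a \<delta>"
  using em_biadd(1)[of c "Dom X c'" "Cod X c'" a "Dom X a" "Cod X a" \<delta> c'] by (simp add: hm_iff)

lemma em_add_right:
  "\<lbrakk>c \<in> Arr X; a' \<in> Arr X; a \<in> Arr X; Dom X a = Dom X a'; Cod X a = Cod X a'; \<delta> \<in> EE (Cod X c) (Dom
      X a')\<rbrakk>
   \<Longrightarrow> Em c (a \<plusminus> a') \<delta> = Em c a \<delta> \<otimes>\<^bsub>Ext X (Dom X c) (Cod X a')\<^esub> Em c a' \<delta>"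
  using em_biadd(2)[of c "Dom X c" "Cod X c" a "Dom X a'" "Cod X a'" \<delta> a'] by (simp add: hm_iff)

lemma ext_idem_one:
  assumes "C \<in> Obj X" "A \<in> Obj X" "\<delta> \<in> EE C A" "\<delta> \<otimes>\<^bsub>Ext X C A\<^esub> \<delta> = \<delta>" shows "\<delta> = Eo C A"
  using group.l_cancel_one[OF ext_grp[OF assms(1,2)] assms(3,3)] assms(4) by simp

text \<open>The zero arrow equals its own double, so by biadditivity the value is idempotent in a
  group.\<close>

lemma em_zero [simp]:
  assumes "\<delta> \<in> EE C (Dom X a)" "a \<in> Arr X" "B \<in> Obj X" "C \<in> Obj X"
  shows "Em (hz B C) a \<delta> = Eo B (Cod X a)"
  using assms em_add_left[of "hz B C" "hz B C" a \<delta>] by (intro ext_idem_one) auto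

lemma em_zero' [simp]:
  assumes "\<delta> \<in> EE (Cod X c) A" "c \<in> Arr X" "B \<in> Obj X" "A \<in> Obj X"
  shows "Em c (hz A B) \<delta> = Eo (Dom X c) B"
  using assms em_add_right[of c "hz A B" "hz A B" \<delta>] by (intro ext_idem_one) auto

lemma ext_one [simp]:
  assumes "C \<in> Obj X" "A \<in> Obj X" "\<delta> \<in> EE C A"
  shows "\<delta> \<otimes>\<^bsub>Ext X C A\<^esub> Eo C A = \<delta>" "Eo C A \<otimes>\<^bsub>Ext X C A\<^esub> \<delta> = \<delta>"
  using assms ext_grp[of C A] by (simp_all add: group.is_monoid)

lemma em_neg_cancel:
  assumes "c \<in> Arr X" "a \<in> Arr X" "\<delta> \<in> EE (Cod X c) (Dom X a)"
  shows "Em (hn c) a \<delta> \<otimes>\<^bsub>Ext X (Dom X c) (Cod X a)\<^esub> Em c a \<delta> = Eo (Dom X c) (Cod X a)"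
    "Em c (hn a) \<delta> \<otimes>\<^bsub>Ext X (Dom X c) (Cod X a)\<^esub> Em c a \<delta> = Eo (Dom X c) (Cod X a)"
  using assms em_add_left[of "hn c" c a \<delta>] em_add_right[of c a "hn a" \<delta>] by auto

lemma ext_cancel:
  assumes "C \<in> Obj X" "A \<in> Obj X" "\<delta> \<in> EE C A" "\<epsilon> \<in> EE C A" "\<eta> \<in> EE C A"
   "\<delta> \<otimes>\<^bsub>Ext X C A\<^esub> \<eta> = \<epsilon> \<otimes>\<^bsub>Ext X C A\<^esub> \<eta>"
  shows "\<delta> = \<epsilon>"
  using group.right_cancel[OF ext_grp[OF assms(1,2)] assms(5,3,4)] assms(6) by simp

text \<open>Both sides are inverse to \<open>Em c a \<delta>\<close>. The rule moves a sign between
  the two variables of the bifunctor.\<close>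

lemma em_neg:
  assumes "c \<in> Arr X" "a \<in> Arr X" "\<delta> \<in> EE (Cod X c) (Dom X a)"
  shows "Em (hn c) a \<delta> = Em c (hn a) \<delta>"
proof (rule ext_cancel[of "Dom X c" "Cod X a" _ _ "Em c a \<delta>"])
  show "Em (hn c) a \<delta> \<otimes>\<^bsub>Ext X (Dom X c) (Cod X a)\<^esub> Em c a \<delta>
      = Em c (hn a) \<delta> \<otimes>\<^bsub>Ext X (Dom X c) (Cod X a)\<^esub> Em c a \<delta>"
    by (rule trans[OF em_neg_cancel(1)[OF assms] em_neg_cancel(2)[OF assms, symmetric]])
qed (use assms in simp_all)

subsection \<open>Triangles with named objects\<close>

text \<open>Naming the three objects lets the axioms be applied by unification. In the versions of
  the axioms below, pushing and pulling are written as \<open>Em\<close> with one identity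
  argument.\<close>

definition tri :: "'o \<Rightarrow> 'o \<Rightarrow> 'o \<Rightarrow> 'm \<Rightarrow> 'm \<Rightarrow> 'e \<Rightarrow> bool" where
  "tri A B C x y \<delta> \<longleftrightarrow> x \<in> hm A B \<and> y \<in> hm B C \<and> etriangle X x y \<delta>"

lemma etriangle_tri: "etriangle X x y \<delta> \<Longrightarrow> tri (Dom X x) (Cod X x) (Cod X y) x y \<delta>"
  by (simp add: tri_def etriangle_def is_sequence_def hm_iff)

lemma triD:
  assumes "tri A B C x y \<delta>"
  shows "A \<in> Obj X" "B \<in> Obj X" "C \<in> Obj X" "x \<in> Arr X" "Dom X x = A" "Cod X x = B"
    "y \<in> Arr X" "Dom X y = B" "Cod X y = C" "\<delta> \<in> EE C A"
  using assms unfolding tri_def etriangle_def by (auto simp: hm_iff intro: dom_obj cod_obj)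

lemma tri_hm: "tri A B C x y \<delta> \<Longrightarrow> x \<in> hm A B" "tri A B C x y \<delta> \<Longrightarrow> y \<in> hm B C"
  by (auto simp: tri_def)

lemma tri_etriangle: "tri A B C x y \<delta> \<Longrightarrow> etriangle X x y \<delta>"
  by (simp add: tri_def)

lemma tri_conflation: "tri A B C x y \<delta> \<Longrightarrow> conflation X x y"
  by (auto simp: tri_def conflation_def)

lemma conflation_tri: "\<lbrakk>conflation X x y; Dom X x = A; Cod X x = B; Cod X y = C\<rbrakk> \<Longrightarrow> \<exists>\<delta>. tri A B C x y
    \<delta>"
  using etriangle_tri by (auto simp: conflation_def)

lemma tri_ex:
  assumes "C \<in> Obj X" "A \<in> Obj X" "\<delta> \<in> EE C A"
  shows "\<exists>B x y. tri A B C x y \<delta>"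
proof -
  have "\<forall>C\<in>Obj X. \<forall>A\<in>Obj X. \<forall>\<delta>\<in>carrier (Ext X C A). \<exists>x y. Dom X x = A \<and> Cod X y = C \<and> etriangle X x
      y \<delta>"
    using ET2 unfolding additive_realization_def realization_def by (elim conjE)
  then obtain x y where "Dom X x = A" "Cod X y = C" "etriangle X x y \<delta>"
    using assms by meson
  then show ?thesis using etriangle_tri[of x y \<delta>] by blast
qed

section \<open>Equivalence of sequences and uniqueness of the middle term\<close>

lemma seq_class_iff:
  assumes "x \<in> hm A B" "y \<in> hm B C"
  shows "(x', y') \<in> seq_class X x y \<longleftrightarrow>
    (\<exists>B' b. x' \<in> hm A B' \<and> y' \<in> hm B' C \<and> iso_hm B B' b \<and> b \<cdot> x = x' \<and> y' \<cdot> b = y)"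
proof -
  have *: "b \<in> hm B (Cod X x') \<and> iso_arr X b \<longleftrightarrow> iso_hm B (Cod X x') b" for b
    using iso_arr_hm[of b B "Cod X x'"] iso_hm_hm[of B "Cod X x'" b] by argo
  have t: "Dom X x = A" "Cod X x = B" "Cod X y = C" using assms by (auto simp: hm_iff)
  show ?thesis
  proof
    assume "(x', y') \<in> seq_class X x y"
    then obtain b where b: "x' \<in> Arr X" "y' \<in> Arr X" "Cod X x' = Dom X y'" "Dom X x' = A" "Cod X y'
        = C"
       "b \<in> hm B (Cod X x')" "iso_arr X b" "b \<cdot> x = x'" "y' \<cdot> b = y"
      unfolding seq_class_def is_sequence_def t by blast
    show "\<exists>B' b. x' \<in> hm A B' \<and> y' \<in> hm B' C \<and> iso_hm B B' b \<and> b \<cdot> x = x' \<and> y' \<cdot> b = y"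
      using b *[of b] by (intro exI[of _ "Cod X x'"] exI[of _ b]) (simp add: hm_iff)
  next
    assume "\<exists>B' b. x' \<in> hm A B' \<and> y' \<in> hm B' C \<and> iso_hm B B' b \<and> b \<cdot> x = x' \<and> y' \<cdot> b = y"
    then obtain B' b where b: "x' \<in> hm A B'" "y' \<in> hm B' C" "iso_hm B B' b" "b \<cdot> x = x'" "y' \<cdot> b =
        y" by blast
    then have "b \<in> hm B (Cod X x') \<and> iso_arr X b" using * by (simp add: hm_iff)
    then show "(x', y') \<in> seq_class X x y"
      unfolding seq_class_def is_sequence_def t using b(1,2,4,5) by (auto simp: hm_iff)
  qed
qed

lemma seq_class_mono:
  assumes "x \<in> hm A B" "y \<in> hm B C" "x' \<in> hm A B'" "y' \<in> hm B' C" "iso_hm B B' b" "b \<cdot> x = x'" "y' \<cdot>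
      b = y"
  shows "seq_class X x' y' \<subseteq> seq_class X x y"
proof safe
  fix p q assume "(p, q) \<in> seq_class X x' y'"
  then obtain B'' c where c: "p \<in> hm A B''" "q \<in> hm B'' C" "iso_hm B' B'' c" "c \<cdot> x' = p" "q \<cdot> c =
      y'"
    using seq_class_iff assms by metis
  have h: "c \<in> hm B' B''" "b \<in> hm B B'" using c assms iso_hm_hm by auto
  have "(c \<cdot> b) \<cdot> x = p" "q \<cdot> (c \<cdot> b) = y"
    using h c(1,2,4,5) assms(1-4,6,7) reassoc[OF c(5)] by (auto simp: hm_iff)
  then show "(p, q) \<in> seq_class X x y"
    using seq_class_iff[OF assms(1,2)] c iso_cmp[OF assms(5) c(3)] by blast
qed

lemma seq_class_eqI:
  assumes "x \<in> hm A B" "y \<in> hm B C" "x' \<in> hm A B'" "y' \<in> hm B' C" "iso_hm B B' b" "b \<cdot> x = x'" "y' \<cdot>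
      b = y"
  shows "seq_class X x' y' = seq_class X x y"
proof
  from assms(5) obtain b' where b': "b \<in> hm B B'" "b' \<in> hm B' B" "b' \<cdot> b = Idn X B" "b \<cdot> b' = Idn X
      B'" "iso_hm B' B b'"
    by (meson iso_hmE)
  have "b' \<cdot> x' = x" "y \<cdot> b' = y'"
    using assms(1-4) assms(6,7)[symmetric] b' by (auto simp: hm_iff reassoc[OF b'(3)])
  then show "seq_class X x y \<subseteq> seq_class X x' y'" using seq_class_mono assms(1-4) b'(5) by metis
qed (rule seq_class_mono[OF assms])

lemma seq_class_self:
  assumes "x \<in> hm A B" "y \<in> hm B C" shows "(x, y) \<in> seq_class X x y"
proof -
  have "B \<in> Obj X" using hm_obj assms by blast
  then have "iso_hm B B (Idn X B)" "Idn X B \<cdot> x = x" "y \<cdot> Idn X B = y"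
    using assms by (simp_all add: hm_iff)
  then show ?thesis using seq_class_iff[OF assms] assms by blast
qed

text \<open>\<open>Real\<close> gives both sequences the same class. Later this identifies middle
  terms: an object lies in \<open>N\<close> as soon as it realizes the same extension as an object
  of \<open>N\<close>.\<close>

lemma tri_mid_unique:
  assumes "tri A B C x y \<delta>" "tri A B' C x' y' \<delta>"
  shows "\<exists>b. iso_hm B B' b \<and> b \<cdot> x = x' \<and> y' \<cdot> b = y"
proof -
  note t = assms[THEN tri_hm(1)] assms[THEN tri_hm(2)]
  have "seq_class X x y = seq_class X x' y'"
    using triD[OF assms(1)] triD[OF assms(2)] tri_etriangle[OF assms(1)] tri_etriangle[OF assms(2)]
    by (simp add: etriangle_def)
  then have "(x', y') \<in> seq_class X x y" using seq_class_self[OF t(2,4)] by simp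
  then obtain B'' b where "x' \<in> hm A B''" "iso_hm B B'' b \<and> b \<cdot> x = x' \<and> y' \<cdot> b = y"
    using seq_class_iff[OF t(1,3)] by blast
  moreover have "B'' = B'" using calculation(1) t(2) by (simp add: hm_iff)
  ultimately show ?thesis by blast
qed

lemma tri_mid_iso:
  assumes "tri A B C x y \<delta>" "iso_hm B B' b" "x' \<in> hm A B'" "y' \<in> hm B' C" "b \<cdot> x = x'" "y' \<cdot> b = y"
  shows "tri A B' C x' y' \<delta>"
proof -
  have "seq_class X x' y' = seq_class X x y"
    by (rule seq_class_eqI[OF tri_hm(1)[OF assms(1)] tri_hm(2)[OF assms(1)] assms(3,4,2,5,6)])
  then show ?thesis
    using triD[OF assms(1)] tri_etriangle[OF assms(1)] assms(3,4)
    by (simp add: tri_def etriangle_def hm_iff is_sequence_def)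
qed

section \<open>The axioms for triangles with named objects\<close>

lemma tri_realize:
  assumes "tri A B C x y \<delta>" "tri A' B' C' x' y' \<delta>'" "a \<in> hm A A'" "c \<in> hm C C'"
    "Em (Idn X C) a \<delta> = Em c (Idn X A') \<delta>'"
  shows "\<exists>b\<in>hm B B'. b \<cdot> x = x' \<cdot> a \<and> y' \<cdot> b = c \<cdot> y"
proof -
  note t = triD[OF assms(1)] triD[OF assms(2)]
  have "ext_morphism X \<delta> \<delta>' a c"
    using t assms by (simp add: ext_morphism_def push_def pull_def hm_iff)
  moreover have "\<forall>x y \<delta> x' y' \<delta>' a c.
        etriangle X x y \<delta> \<and> etriangle X x' y' \<delta>' \<and>
        a \<in> Hom X (Dom X x) (Dom X x') \<and> c \<in> Hom X (Cod X y) (Cod X y') \<and>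
        ext_morphism X \<delta> \<delta>' a c \<longrightarrow> (\<exists>b. seq_morphism X x y x' y' a b c)"
    using ET2 unfolding additive_realization_def realization_def by (elim conjE)
  ultimately have "\<exists>b. seq_morphism X x y x' y' a b c"
    using t assms tri_etriangle by blast
  then show ?thesis using t by (auto simp: seq_morphism_def)
qed

lemma ET3':
  assumes "tri A B C x y \<delta>" "tri A' B' C' x' y' \<delta>'" "a \<in> hm A A'" "b \<in> hm B B'" "b \<cdot> x = x' \<cdot> a"
  shows "\<exists>c\<in>hm C C'. Em (Idn X C) a \<delta> = Em c (Idn X A') \<delta>' \<and> y' \<cdot> b = c \<cdot> y"
proof -
  note t = triD[OF assms(1)] triD[OF assms(2)]
  have "\<exists>c. ext_morphism X \<delta> \<delta>' a c \<and> seq_morphism X x y x' y' a b c"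
    by (rule ET3[OF assms(1,2)[THEN tri_etriangle] _ _ assms(5)]) (use assms(3,4) t in simp_all)
  then show ?thesis
    using t assms(3) by (auto simp: ext_morphism_def seq_morphism_def push_def pull_def hm_iff)
qed

lemma ET3_op':
  assumes "tri A B C x y \<delta>" "tri A' B' C' x' y' \<delta>'" "b \<in> hm B B'" "c \<in> hm C C'" "y' \<cdot> b = c \<cdot> y"
  shows "\<exists>a\<in>hm A A'. Em (Idn X C) a \<delta> = Em c (Idn X A') \<delta>' \<and> b \<cdot> x = x' \<cdot> a"
proof -
  note t = triD[OF assms(1)] triD[OF assms(2)]
  have "\<exists>a. ext_morphism X \<delta> \<delta>' a c \<and> seq_morphism X x y x' y' a b c"
    by (rule ET3_op[OF assms(1,2)[THEN tri_etriangle] _ _ assms(5)]) (use assms(3,4) t in simp_all)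
  then show ?thesis
    using t assms(4) by (auto simp: ext_morphism_def seq_morphism_def push_def pull_def hm_iff)
qed

lemma ET4':
  assumes "tri A B D f f' \<delta>" "tri B C F g g' \<delta>'"
  shows "\<exists>E h' d e \<delta>''. tri A C E (g \<cdot> f) h' \<delta>'' \<and> tri D E F d e (Em (Idn X F) f' \<delta>') \<and>
    d \<cdot> f' = h' \<cdot> g \<and> e \<cdot> h' = g' \<and> Em d (Idn X A) \<delta>'' = \<delta> \<and> Em (Idn X E) f \<delta>'' = Em e (Idn X B) \<delta>'"
proof -
  note t = triD[OF assms(1)] triD[OF assms(2)]
  obtain E h h' \<delta>'' d e where *: "etriangle X h h' \<delta>''" "h = g \<cdot> f" "h' \<in> Hom X C E"
     "d \<in> Hom X D E" "e \<in> Hom X E F" "d \<cdot> f' = h' \<cdot> g" "e \<cdot> h' = g'"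
     "etriangle X d e (push X F f' \<delta>')" "pull X A d \<delta>'' = \<delta>" "push X E f \<delta>'' = pull X B e \<delta>'"
    using ET4[OF assms[THEN tri_etriangle] _ refl refl refl refl refl, unfolded t(4-9) t(14-19), OF
        refl]
    by (elim exE conjE) rule
  have "tri A C E (g \<cdot> f) h' \<delta>''" "tri D E F d e (Em (Idn X F) f' \<delta>')"
    using *(1,2,3,4,5,8) t by (simp_all add: tri_def hm_iff push_def)
  then show ?thesis using *(6,7,9,10) unfolding push_def pull_def by metis
qed

lemma ET4_op':
  assumes "tri D A B f' f \<delta>" "tri F B C g' g \<delta>'"
  shows "\<exists>E h' d e \<delta>''. tri E A C h' (g \<cdot> f) \<delta>'' \<and> tri D E F d e (Em g' (Idn X D) \<delta>) \<and>
    h' \<cdot> d = f' \<and> f \<cdot> h' = g' \<cdot> e \<and> \<delta>' = Em (Idn X C) e \<delta>'' \<and> Em (Idn X B) d \<delta> = Em g (Idn X E) \<delta>''"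
proof -
  note t = triD[OF assms(1)] triD[OF assms(2)]
  obtain E h h' \<delta>'' d e where *: "etriangle X h' h \<delta>''" "h = g \<cdot> f" "h' \<in> Hom X E A"
     "d \<in> Hom X D E" "e \<in> Hom X E F" "h' \<cdot> d = f'" "f \<cdot> h' = g' \<cdot> e"
     "etriangle X d e (pull X D g' \<delta>)" "\<delta>' = push X C e \<delta>''" "push X B d \<delta> = pull X E g \<delta>''"
    using ET4_op[OF assms[THEN tri_etriangle] _ refl refl refl refl refl, unfolded t(4-9) t(14-19),
        OF refl]
    by (elim exE conjE) rule
  have "tri E A C h' (g \<cdot> f) \<delta>''" "tri D E F d e (Em g' (Idn X D) \<delta>)"
    using *(1,2,3,4,5,8) t by (simp_all add: tri_def hm_iff pull_def)
  then show ?thesis using *(6,7,9,10) unfolding push_def pull_def by metis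
qed

lemma tri_biproduct:
  assumes "biproduct X A C P i j p q"
  shows "tri A P C i q (Eo C A)"
proof -
  have "\<forall>A C P i j p q. biproduct X A C P i j p q \<longrightarrow> Real X C A (Eo C A) = seq_class X i q"
    using ET2 unfolding additive_realization_def by (elim conjE)
  then have "Real X C A (Eo C A) = seq_class X i q" using assms by meson
  then show ?thesis
    using biproductD(1-15)[OF assms] by (simp add: tri_def etriangle_def is_sequence_def hm_iff)
qed

lemma tri_zero_left: "\<lbrakk>Z \<in> Obj X; zero_object X Z; Y \<in> Obj X\<rbrakk> \<Longrightarrow> tri Z Y Y (hz Z Y) (Idn X Y) (Eo Y
    Z)"
  by (rule tri_biproduct[OF biproduct_zero_left])

lemma tri_zero_right: "\<lbrakk>Z \<in> Obj X; zero_object X Z; Y \<in> Obj X\<rbrakk> \<Longrightarrow> tri Y Y Z (Idn X Y) (hz Y Z) (Eo Z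
    Y)"
  by (rule tri_biproduct[OF biproduct_zero_right])

lemma zero_objE: obtains Z where "Z \<in> Obj X" "zero_object X Z"
  using ex_zero_object by (auto simp: zero_object_def)

subsection \<open>Exact sequences\<close>

lemma ext_zero_obj:
  assumes "zero_object X Z" "C \<in> Obj X" "\<delta> \<in> EE C Z" shows "\<delta> = Eo C Z"
proof -
  have "Z \<in> Obj X" using assms by (simp add: zero_object_def)
  then show ?thesis using em_id[of C Z \<delta>] zero_obj_idn[OF assms(1)] assms(2,3) em_zero'[of \<delta> "Idn X
      C" Z Z] by simp
qed

text \<open>The composite \<open>b \<cdot> x\<close> vanishes, hence factors through a zero object
  \<open>Z\<close>, and (ET3) against the split triangle
  \<open>Z \<rightarrow> Y \<rightarrow> Y\<close> supplies the factorization as third component. No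
  uniqueness is claimed: \<open>y\<close> is only a weak cokernel.\<close>

lemma tri_factor_right:
  assumes "tri A B C x y \<delta>" "b \<in> hm B Y" "b \<cdot> x = hz A Y"
  shows "\<exists>c\<in>hm C Y. b = c \<cdot> y"
proof -
  note t = triD[OF assms(1)]
  have Y: "Y \<in> Obj X" using hm_obj assms(2) by blast
  obtain Z where Z: "Z \<in> Obj X" "zero_object X Z" by (rule zero_objE)
  have "b \<cdot> x = hz Z Y \<cdot> hz A Z" using assms(3) t Y Z by simp
  then obtain c where "c \<in> hm C Y" "Idn X Y \<cdot> b = c \<cdot> y"
    using ET3'[OF assms(1) tri_zero_left[OF Z Y] hz_hm[OF t(1) Z(1)] assms(2)] by blast
  moreover have "Idn X Y \<cdot> b = b" using assms(2) by (simp add: hm_iff)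
  ultimately show ?thesis by metis
qed

lemma tri_factor_left:
  assumes "tri A B C x y \<delta>" "b \<in> hm Y B" "y \<cdot> b = hz Y C"
  shows "\<exists>a\<in>hm Y A. b = x \<cdot> a"
proof -
  note t = triD[OF assms(1)]
  have Y: "Y \<in> Obj X" using hm_obj assms(2) by blast
  obtain Z where Z: "Z \<in> Obj X" "zero_object X Z" by (rule zero_objE)
  have "y \<cdot> b = hz Z C \<cdot> hz Y Z" using assms(3) t Y Z by simp
  then obtain a where "a \<in> hm Y A" "b \<cdot> Idn X Y = x \<cdot> a"
    using ET3_op'[OF tri_zero_right[OF Z Y] assms(1,2) hz_hm[OF Z(1) t(3)]] by blast
  moreover have "b \<cdot> Idn X Y = b" using assms(2) by (simp add: hm_iff)
  ultimately show ?thesis by metis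
qed

text \<open>Exactness at the arrows \<open>A \<rightarrow> Y\<close>, by comparison with the split
  triangle \<open>Y \<rightarrow> Y \<rightarrow> Z\<close>: an extension of \<open>a\<close> to
  \<open>B\<close> is a middle component of a morphism to that triangle, whose extension is
  trivial.\<close>

lemma tri_extend_iff:
  assumes "tri A B C x y \<delta>" "a \<in> hm A Y"
  shows "Em (Idn X C) a \<delta> = Eo C Y \<longleftrightarrow> (\<exists>b\<in>hm B Y. b \<cdot> x = a)"
proof
  note t = triD[OF assms(1)]
  have Y: "Y \<in> Obj X" using hm_obj assms(2) by blast
  obtain Z where Z: "Z \<in> Obj X" "zero_object X Z" by (rule zero_objE)
  note r = tri_zero_right[OF Z Y]
  have a: "Idn X Y \<cdot> a = a" using assms(2) by (simp add: hm_iff)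
  have e: "Em (hz C Z) (Idn X Y) (Eo Z Y) = Eo C Y" using Y Z t by simp
  show "\<exists>b\<in>hm B Y. b \<cdot> x = a" if "Em (Idn X C) a \<delta> = Eo C Y"
    using tri_realize[OF assms(1) r assms(2) hz_hm[OF t(3) Z(1)]] that a e by auto
  show "Em (Idn X C) a \<delta> = Eo C Y" if "\<exists>b\<in>hm B Y. b \<cdot> x = a"
  proof -
    from that obtain b where b: "b \<in> hm B Y" "b \<cdot> x = a" by blast
    then obtain c where "c \<in> hm C Z" "Em (Idn X C) a \<delta> = Em c (Idn X Y) (Eo Z Y)"
      using ET3'[OF assms(1) r assms(2) b(1)] a by auto
    then show ?thesis using Y Z by (simp add: hm_iff)
  qed
qed

lemma tri_lift_iff:
  assumes "tri A B C x y \<delta>" "c \<in> hm Y C"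
  shows "Em c (Idn X A) \<delta> = Eo Y A \<longleftrightarrow> (\<exists>b\<in>hm Y B. y \<cdot> b = c)"
proof
  note t = triD[OF assms(1)]
  have Y: "Y \<in> Obj X" using hm_obj assms(2) by blast
  obtain Z where Z: "Z \<in> Obj X" "zero_object X Z" by (rule zero_objE)
  note r = tri_zero_left[OF Z Y]
  have c: "c \<cdot> Idn X Y = c" using assms(2) by (simp add: hm_iff)
  have e: "Em (Idn X Y) (hz Z A) (Eo Y Z) = Eo Y A" using Y Z t by simp
  show "\<exists>b\<in>hm Y B. y \<cdot> b = c" if "Em c (Idn X A) \<delta> = Eo Y A"
    using tri_realize[OF r assms(1) hz_hm[OF Z(1) t(1)] assms(2)] that c e by auto
  show "Em c (Idn X A) \<delta> = Eo Y A" if "\<exists>b\<in>hm Y B. y \<cdot> b = c"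
  proof -
    from that obtain b where b: "b \<in> hm Y B" "y \<cdot> b = c" by blast
    then obtain a where "a \<in> hm Z A" "Em (Idn X Y) a (Eo Y Z) = Em c (Idn X A) \<delta>"
      using ET3_op'[OF r assms(1) b(1) assms(2)] c by auto
    then show ?thesis using Y Z by (simp add: hm_iff)
  qed
qed

lemma tri_ext_zero:
  assumes "tri A B C x y \<delta>"
  shows "Em (Idn X C) x \<delta> = Eo C B" "Em y (Idn X A) \<delta> = Eo B A"
proof -
  note t = triD[OF assms]
  have i: "Idn X B \<in> hm B B" "Idn X B \<cdot> x = x" "y \<cdot> Idn X B = y" using t by (simp_all add: hm_iff)
  show "Em (Idn X C) x \<delta> = Eo C B"
    using tri_extend_iff[OF assms tri_hm(1)[OF assms]] i by blast
  show "Em y (Idn X A) \<delta> = Eo B A"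
    using tri_lift_iff[OF assms tri_hm(2)[OF assms]] i by blast
qed

text \<open>Biadditivity turns the equality into vanishing for the difference of the arrows. Thus an
  arrow defined by the extension that it pulls back is unique up to arrows through the middle
  term.\<close>

lemma pull_eq_factor:
  assumes "tri A B C x y \<delta>" "c \<in> hm Y C" "c' \<in> hm Y C" "Em c (Idn X A) \<delta> = Em c' (Idn X A) \<delta>"
  shows "\<exists>b\<in>hm Y B. c \<plusminus> hn c' = y \<cdot> b"
proof -
  note t = triD[OF assms(1)]
  have Y: "Y \<in> Obj X" using hm_obj assms(2) by blast
  have "Em (hn c' \<plusminus> c) (Idn X A) \<delta> = Eo Y A"
    using assms(2-4) t Y em_add_left[of "hn c'" c "Idn X A" \<delta>] em_neg_cancel(1)[of c' "Idn X A" \<delta>]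
        by (simp add: hm_iff)
  then obtain b where "b \<in> hm Y B" "y \<cdot> b = hn c' \<plusminus> c"
    using tri_lift_iff[OF assms(1) add_hm[OF neg_hm[OF assms(3)] assms(2)]] by blast
  moreover have "c \<plusminus> hn c' = hn c' \<plusminus> c" using assms(2,3) acomm[of "hn c'" c] by (simp add: hm_iff)
  ultimately show ?thesis by metis
qed

lemma push_eq_factor:
  assumes "tri A B C x y \<delta>" "a \<in> hm A Y" "a' \<in> hm A Y" "Em (Idn X C) a \<delta> = Em (Idn X C) a' \<delta>"
  shows "\<exists>b\<in>hm B Y. a \<plusminus> hn a' = b \<cdot> x"
proof -
  note t = triD[OF assms(1)]
  have Y: "Y \<in> Obj X" using hm_obj assms(2) by blast
  have "Em (Idn X C) (hn a' \<plusminus> a) \<delta> = Eo C Y"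
    using assms(2-4) t Y em_add_right[of "Idn X C" a "hn a'" \<delta>] em_neg_cancel(2)[of "Idn X C" a' \<delta>]
        by (simp add: hm_iff)
  then obtain b where "b \<in> hm B Y" "b \<cdot> x = hn a' \<plusminus> a"
    using tri_extend_iff[OF assms(1) add_hm[OF neg_hm[OF assms(3)] assms(2)]] by blast
  moreover have "a \<plusminus> hn a' = hn a' \<plusminus> a" using assms(2,3) acomm[of "hn a'" a] by (simp add: hm_iff)
  ultimately show ?thesis by metis
qed

text \<open>Exactness at \<open>EE B Y\<close>. Realize \<open>\<epsilon>\<close> by
  \<open>Y \<rightarrow> W \<rightarrow> B\<close> and compose with \<open>y\<close>: (ET4)op gives
  a triangle \<open>Y \<rightarrow> E \<rightarrow> A\<close> realizing \<open>\<epsilon>\<close>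
  pulled back to \<open>A\<close>, which splits. A retraction \<open>r\<close> of
  \<open>Y \<rightarrow> E\<close> pushes the extension of the composite deflation to the required
  one.\<close>

lemma ext_from_pull:
  assumes "tri A B C x y \<delta>" "\<epsilon> \<in> EE B Y" "Y \<in> Obj X" "Em x (Idn X Y) \<epsilon> = Eo A Y"
  shows "\<exists>\<eta>\<in>EE C Y. Em y (Idn X Y) \<eta> = \<epsilon>"
proof -
  note t = triD[OF assms(1)]
  obtain W p q where w: "tri Y W B p q \<epsilon>" using tri_ex assms t by metis
  note tw = triD[OF w]
  obtain E h' d e \<delta>'' where E: "tri E W C h' (y \<cdot> q) \<delta>''" "tri Y E A d e (Em x (Idn X Y) \<epsilon>)"
     "Em (Idn X B) d \<epsilon> = Em y (Idn X E) \<delta>''"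
    using ET4_op'[OF w assms(1)] by blast
  note te = triD[OF E(1)] triD[OF E(2)]
  obtain r where r: "r \<in> hm E Y" "r \<cdot> d = Idn X Y"
    using tri_extend_iff[OF E(2) idn_hom[OF assms(3)]] assms(3,4) t by auto
  have "Em y r \<delta>'' = Em (Idn X B) r (Em y (Idn X E) \<delta>'')" using r te t by (simp add: hm_iff)
  also have "\<dots> = Em (Idn X B) r (Em (Idn X B) d \<epsilon>)" using E(3) by simp
  also have "\<dots> = \<epsilon>" using r te t tw by (simp add: hm_iff)
  finally have "Em y (Idn X Y) (Em (Idn X C) r \<delta>'') = \<epsilon>" using r te t by (simp add: hm_iff)
  moreover have "Em (Idn X C) r \<delta>'' \<in> EE C Y" using r te t by (simp add: hm_iff)
  ultimately show ?thesis by blast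
qed

lemma ext_from_push:
  assumes "tri A B C x y \<delta>" "\<epsilon> \<in> EE Y B" "Y \<in> Obj X" "Em (Idn X Y) y \<epsilon> = Eo Y C"
  shows "\<exists>\<eta>\<in>EE Y A. Em (Idn X Y) x \<eta> = \<epsilon>"
proof -
  note t = triD[OF assms(1)]
  obtain W p q where w: "tri B W Y p q \<epsilon>" using tri_ex assms t by metis
  note tw = triD[OF w]
  obtain E h' d e \<delta>'' where E: "tri A W E (p \<cdot> x) h' \<delta>''" "tri C E Y d e (Em (Idn X Y) y \<epsilon>)"
     "Em (Idn X E) x \<delta>'' = Em e (Idn X B) \<epsilon>"
    using ET4'[OF assms(1) w] by blast
  note te = triD[OF E(1)] triD[OF E(2)]
  obtain r where r: "r \<in> hm Y E" "e \<cdot> r = Idn X Y"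
    using tri_lift_iff[OF E(2) idn_hom[OF assms(3)]] assms(3,4) t by auto
  have "Em r x \<delta>'' = Em r (Idn X B) (Em (Idn X E) x \<delta>'')" using r te t by (simp add: hm_iff)
  also have "\<dots> = Em r (Idn X B) (Em e (Idn X B) \<epsilon>)" using E(3) by simp
  also have "\<dots> = \<epsilon>" using r te t tw by (simp add: hm_iff)
  finally have "Em (Idn X Y) x (Em r (Idn X A) \<delta>'') = \<epsilon>" using r te t by (simp add: hm_iff)
  moreover have "Em r (Idn X A) \<delta>'' \<in> EE Y A" using r te t by (simp add: hm_iff)
  ultimately show ?thesis by blast
qed

text \<open>The vanishing lifts \<open>y\<close> to the middle term of a realization of
  \<open>\<epsilon>\<close>; (ET3)op then yields the arrow between the left ends.\<close>

lemma ext_push_of_tri: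
  assumes "tri A B C x y \<delta>" "\<epsilon> \<in> EE C Y" "Y \<in> Obj X" "Em y (Idn X Y) \<epsilon> = Eo B Y"
  shows "\<exists>a\<in>hm A Y. \<epsilon> = Em (Idn X C) a \<delta>"
proof -
  note t = triD[OF assms(1)]
  obtain W p q where w: "tri Y W C p q \<epsilon>" using tri_ex assms t by metis
  obtain b where b: "b \<in> hm B W" "q \<cdot> b = y"
    using tri_lift_iff[OF w tri_hm(2)[OF assms(1)]] assms(4) by blast
  have "q \<cdot> b = Idn X C \<cdot> y" using b t by simp
  then obtain a where "a \<in> hm A Y" "Em (Idn X C) a \<delta> = Em (Idn X C) (Idn X Y) \<epsilon>"
    using ET3_op'[OF assms(1) w b(1) idn_hom[OF t(3)]] by blast
  then show ?thesis using t assms by auto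
qed

lemma ext_pull_of_tri:
  assumes "tri A B C x y \<delta>" "\<epsilon> \<in> EE Y A" "Y \<in> Obj X" "Em (Idn X Y) x \<epsilon> = Eo Y B"
  shows "\<exists>c\<in>hm Y C. \<epsilon> = Em c (Idn X A) \<delta>"
proof -
  note t = triD[OF assms(1)]
  obtain W p q where w: "tri A W Y p q \<epsilon>" using tri_ex assms t by metis
  obtain b where b: "b \<in> hm W B" "b \<cdot> p = x"
    using tri_extend_iff[OF w tri_hm(1)[OF assms(1)]] assms(4) by blast
  have "b \<cdot> p = x \<cdot> Idn X A" using b t by simp
  then obtain c where "c \<in> hm Y C" "Em (Idn X Y) (Idn X A) \<epsilon> = Em c (Idn X A) \<delta>"
    using ET3'[OF w assms(1) idn_hom[OF t(1)] b(1)] by blast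
  then show ?thesis using t assms by auto
qed

subsection \<open>Transport along isomorphisms\<close>

text \<open>Write \<open>b = 1 + n\<close>. Then \<open>n\<close> kills \<open>x\<close>, so it
  factors through \<open>y\<close>, while \<open>y \<cdot> n = 0\<close>; hence
  \<open>n \<cdot> n = 0\<close> and \<open>1 - n\<close> is the inverse.\<close>

lemma endo_iso:
  assumes "tri A B C x y \<delta>" "b \<in> hm B B" "b \<cdot> x = x" "y \<cdot> b = y"
  shows "iso_hm B B b"
proof -
  note t = triD[OF assms(1)]
  define n where "n = b \<plusminus> hn (Idn X B)"
  have n: "n \<in> hm B B" using assms t by (simp add: n_def hm_iff)
  have b: "b = Idn X B \<plusminus> n" using assms t by (simp add: n_def hm_iff alcomm[of "Idn X B" b])
  have nx: "n \<cdot> x = hz A B" using assms t by (simp add: n_def hm_iff distrib)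
  have yn: "y \<cdot> n = hz B C" using assms t by (simp add: n_def hm_iff distrib)
  obtain k where k: "k \<in> hm C B" "n = k \<cdot> y" using tri_factor_right[OF assms(1) n nx] by blast
  have nn: "n \<cdot> n = hz B B"
  proof -
    have "n \<cdot> n = k \<cdot> (y \<cdot> n)" using k n t by (simp add: hm_iff)
    then show ?thesis using k yn t by (simp add: hm_iff)
  qed
  show ?thesis
    by (rule iso_hmI[of _ _ _ "Idn X B \<plusminus> hn n"])
      (use n nn t in \<open>auto simp: b hm_iff distrib neg_add[of _ B B] aassoc\<close>)
qed

lemma iso_of_both:
  assumes "b \<in> hm B B'" "b' \<in> hm B' B" "iso_hm B B (b' \<cdot> b)" "iso_hm B' B' (b \<cdot> b')"
  shows "iso_hm B B' b"
proof -
  obtain k where k: "k \<in> hm B B" "k \<cdot> (b' \<cdot> b) = Idn X B" using assms(3) by (meson iso_hmE)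
  obtain l where l: "l \<in> hm B' B'" "(b \<cdot> b') \<cdot> l = Idn X B'" using assms(4) by (meson iso_hmE)
  have "(k \<cdot> b') \<cdot> b = Idn X B" "b \<cdot> (b' \<cdot> l) = Idn X B'" using k l assms(1,2) by (auto simp:
      hm_iff)
  moreover have "k \<cdot> b' = (k \<cdot> b') \<cdot> (b \<cdot> (b' \<cdot> l))" using calculation(2) k l assms(1,2) by (simp
      add: hm_iff)
  moreover have "(k \<cdot> b') \<cdot> (b \<cdot> (b' \<cdot> l)) = ((k \<cdot> b') \<cdot> b) \<cdot> (b' \<cdot> l)" using k(1) l(1) assms(1,2)
      by (simp add: hm_iff)
  moreover have "((k \<cdot> b') \<cdot> b) \<cdot> (b' \<cdot> l) = b' \<cdot> l" unfolding calculation(1) using l(1) assms(1,2)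
      by (simp add: hm_iff)
  ultimately show ?thesis using k(1) l(1) assms(1,2) by (intro iso_hmI[of _ _ _ "k \<cdot> b'"]) (simp_all
      add: hm_iff)
qed

text \<open>A realization of the transported extension maps to the given triangle and back. Both
  round trips fix the outer arrows, so \<open>endo_iso\<close> makes the two middle terms
  isomorphic.\<close>

lemma tri_transport:
  assumes T: "tri A B C x y \<delta>" and a: "a \<in> hm A A'" "a' \<in> hm A' A" "a' \<cdot> a = Idn X A" "a \<cdot> a' = Idn
      X A'"
    and c: "c \<in> hm C C'" "c' \<in> hm C' C" "c' \<cdot> c = Idn X C" "c \<cdot> c' = Idn X C'"
  shows "tri A' B C' (x \<cdot> a') (c \<cdot> y) (Em c' a \<delta>)"
proof -
  note t = triD[OF T]
  have o: "A' \<in> Obj X" "C' \<in> Obj X" using a c hm_obj by blast+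
  define \<epsilon> where "\<epsilon> = Em c' a \<delta>"
  have e: "\<epsilon> \<in> EE C' A'" using t a c by (simp add: \<epsilon>_def hm_iff)
  obtain B' x' y' where T': "tri A' B' C' x' y' \<epsilon>" using tri_ex o e by blast
  note t' = triD[OF T']
  have "Em (Idn X C) a \<delta> = Em c (Idn X A') \<epsilon>" using t a c o by (simp add: \<epsilon>_def hm_iff)
  then obtain b where b: "b \<in> hm B B'" "b \<cdot> x = x' \<cdot> a" "y' \<cdot> b = c \<cdot> y"
    using tri_realize[OF T T' a(1) c(1)] by blast
  have "Em (Idn X C') a' \<epsilon> = Em c' (Idn X A) \<delta>" using t a c o by (simp add: \<epsilon>_def hm_iff)
  then obtain b' where b': "b' \<in> hm B' B" "b' \<cdot> x' = x \<cdot> a'" "y \<cdot> b' = c' \<cdot> y'"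
    using tri_realize[OF T' T a(2) c(2)] by blast
  have 1: "iso_hm B B (b' \<cdot> b)"
    by (rule endo_iso[OF T]) (use a c b b' t t' in \<open>simp_all add: hm_iff reassoc[OF b'(2)]
        reassoc[OF b'(3)] reassoc[OF c(3)]\<close>)
  have 2: "iso_hm B' B' (b \<cdot> b')"
    by (rule endo_iso[OF T']) (use a c b b' t t' in \<open>simp_all add: hm_iff reassoc[OF b(2)]
        reassoc[OF b(3)] reassoc[OF c(4)]\<close>)
  obtain k where k: "k \<in> hm B' B" "k \<cdot> b = Idn X B" "b \<cdot> k = Idn X B'" "iso_hm B' B k"
    using iso_of_both[OF b(1) b'(1) 1 2] by (meson iso_hmE)
  have "k \<cdot> x' = x \<cdot> a'"
  proof -
    have "k \<cdot> x' = k \<cdot> ((x' \<cdot> a) \<cdot> a')" using k a t' by (simp add: hm_iff)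
    also have "\<dots> = k \<cdot> ((b \<cdot> x) \<cdot> a')" using b by simp
    also have "\<dots> = x \<cdot> a'" using k a b(1) t by (simp add: hm_iff reassoc[OF k(2)])
    finally show ?thesis .
  qed
  moreover have "(c \<cdot> y) \<cdot> k = y'"
    using k b c t t' b(3)[symmetric] by (simp add: hm_iff)
  ultimately show ?thesis unfolding \<epsilon>_def[symmetric]
    using tri_mid_iso[OF T' k(4)] a c t by (auto simp: hm_iff)
qed

end

context xcat
begin

subsection \<open>Sums, pushouts and pullbacks of triangles\<close>

text \<open>The sum formula for the extension can be pushed and pulled termwise; the four components
  that additivity of the realization asks for are read off from it. A typical use takes a split
  triangle with a zero object as one summand.\<close>

lemma tri_sum:
  assumes T: "tri A B C x y \<delta>" "tri A' B' C' x' y' \<delta>'"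
    and b: "biproduct X A A' PA iA jA pA qA" "biproduct X B B' PB iB jB pB qB" "biproduct X C C' PC
        iC jC pC qC"
  shows "tri PA PB PC (iB \<cdot> x \<cdot> pA \<plusminus> jB \<cdot> x' \<cdot> qA) (iC \<cdot> y \<cdot> pB \<plusminus> jC \<cdot> y' \<cdot> qB)
    (Em pC iA \<delta> \<otimes>\<^bsub>Ext X PC PA\<^esub> Em qC jA \<delta>')"
proof -
  define \<epsilon> where "\<epsilon> = Em pC iA \<delta> \<otimes>\<^bsub>Ext X PC PA\<^esub> Em qC jA \<delta>'"
  note t = triD[OF T(1)] triD[OF T(2)]
  note bs = biproductD[OF b(1)] biproductD[OF b(2)] biproductD[OF b(3)]
  interpret E: comm_group "Ext X PC PA" using ext_group bs by simp
  have e: "\<epsilon> \<in> EE PC PA" unfolding \<epsilon>_def using t bs by simp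
  have c: "Em c a \<epsilon> = Em (pC \<cdot> c) (a \<cdot> iA) \<delta> \<otimes>\<^bsub>Ext X D Q\<^esub> Em (qC \<cdot> c) (a \<cdot> jA) \<delta>'"
    if "c \<in> hm D PC" "a \<in> hm PA Q" for c a D Q
    unfolding \<epsilon>_def using t bs that by (simp add: em_mult hm_iff)
  have "Em iC pA \<epsilon> = \<delta>"
    using c[of iC C pA A] t bs by (simp add: hm_iff)
  moreover have "Em iC qA \<epsilon> = Eo C A'"
    using c[of iC C qA A'] t bs by (simp add: hm_iff)
  moreover have "Em jC pA \<epsilon> = Eo C' A"
    using c[of jC C' pA A] t bs by (simp add: hm_iff)
  moreover have "Em jC qA \<epsilon> = \<delta>'"
    using c[of jC C' qA A'] t bs by (simp add: hm_iff)
  moreover have "\<forall>x y \<delta> x' y' \<delta>' PA iA jA pA qA PB iB jB pB qB PC iC jC pC qC \<epsilon>.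
        etriangle X x y \<delta> \<and> etriangle X x' y' \<delta>' \<and>
        biproduct X (Dom X x) (Dom X x') PA iA jA pA qA \<and>
        biproduct X (Cod X x) (Cod X x') PB iB jB pB qB \<and>
        biproduct X (Cod X y) (Cod X y') PC iC jC pC qC \<and>
        \<epsilon> \<in> carrier (Ext X PC PA) \<and>
        ExtMap X iC pA \<epsilon> = \<delta> \<and>
        ExtMap X iC qA \<epsilon> = \<one>\<^bsub>Ext X (Cod X y) (Dom X x')\<^esub> \<and>
        ExtMap X jC pA \<epsilon> = \<one>\<^bsub>Ext X (Cod X y') (Dom X x)\<^esub> \<and>
        ExtMap X jC qA \<epsilon> = \<delta>' \<longrightarrow>
        Real X PC PA \<epsilon> =
          seq_class X ((iB \<cdot>\<^bsub>X\<^esub> x \<cdot>\<^bsub>X\<^esub> pA) \<plusminus>\<^bsub>X\<^esub> (jB \<cdot>\<^bsub>X\<^esub> x' \<cdot>\<^bsub>X\<^esub> qA))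
                      ((iC \<cdot>\<^bsub>X\<^esub> y \<cdot>\<^bsub>X\<^esub> pB) \<plusminus>\<^bsub>X\<^esub> (jC \<cdot>\<^bsub>X\<^esub> y' \<cdot>\<^bsub>X\<^esub> qB))"
    using ET2 unfolding additive_realization_def by (elim conjE)
  note this[rule_format, of x y \<delta> x' y' \<delta>' PA iA jA pA qA PB iB jB pB qB PC iC jC pC qC \<epsilon>]
  ultimately have "Real X PC PA \<epsilon> = seq_class X (iB \<cdot> x \<cdot> pA \<plusminus> jB \<cdot> x' \<cdot> qA) (iC \<cdot> y \<cdot> pB \<plusminus> jC \<cdot> y'
      \<cdot> qB)"
    using e b T[THEN tri_etriangle] t by simp
  then show ?thesis unfolding \<epsilon>_def[symmetric]
    using e t bs by (simp add: tri_def hm_iff etriangle_def is_sequence_def)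
qed

text \<open>The inclusion of \<open>A\<close> becomes the graph of \<open>f\<close>, and the second
  projection is corrected so as to vanish on it.\<close>

lemma biproduct_shear:
  assumes "biproduct X A B Q i j p q" "f \<in> hm A B"
  shows "biproduct X A B Q (i \<plusminus> j \<cdot> f) j p (q \<plusminus> hn (f \<cdot> p))"
proof -
  note b = biproductD[OF assms(1)]
  have 1: "j \<cdot> f \<cdot> p \<in> hm Q Q" "i \<cdot> p \<in> hm Q Q" "j \<cdot> q \<in> hm Q Q" using b(1-15) assms(2) by (simp_all
      add: hm_iff)
  have "((i \<plusminus> j \<cdot> f) \<cdot> p) \<plusminus> (j \<cdot> (q \<plusminus> hn (f \<cdot> p))) = i \<cdot> p \<plusminus> j \<cdot> q"
    using b(1-15) assms(2)
    by (simp add: distrib hm_iff aassoc alcomm[of "j \<cdot> f \<cdot> p" "j \<cdot> q"])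
  moreover have "(q \<plusminus> hn (f \<cdot> p)) \<cdot> (i \<plusminus> j \<cdot> f) = hz A B"
    using b(1-19) assms(2) by (simp add: distrib hm_iff aassoc biproduct_re[OF assms(1)])
  moreover have "p \<cdot> (i \<plusminus> j \<cdot> f) = Idn X A" "(q \<plusminus> hn (f \<cdot> p)) \<cdot> j = Idn X B"
    using b(1-19) assms(2) by (simp_all add: distrib hm_iff biproduct_re[OF assms(1)])
  ultimately show ?thesis
    using b assms(2) unfolding biproduct_def by (simp add: hm_iff)
qed

text \<open>A mapping cone for an arbitrary \<open>f\<close>. The arrow into \<open>P\<close> is the
  graph \<open>A \<rightarrow> A \<oplus> B\<close> followed by the sum of \<open>v\<close> and the
  identity, two inflations to which (ET4) applies. The cokernel of the graph is the second
  projection minus \<open>f\<close> after the first, whence the sign in \<open>hn f\<close>.\<close>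

lemma tri_cobase_change:
  assumes T: "tri A V U v u \<rho>" and f: "f \<in> hm A B" and P: "biproduct X V B P i j p q"
  shows "\<exists>M h e. tri A P M (i \<cdot> v \<plusminus> j \<cdot> f) h (Em e (Idn X A) \<rho>) \<and>
    tri B M U (h \<cdot> j) e (Em (Idn X U) (hn f) \<rho>) \<and> e \<cdot> h = u \<cdot> p"
proof -
  note t = triD[OF T]
  have fs: "f \<in> Arr X" "Dom X f = A" "Cod X f = B" "B \<in> Obj X" using f hm_obj(2) by (auto simp:
      hm_iff)
  note bp = biproductD[OF P]
  obtain Z where Z: "Z \<in> Obj X" "zero_object X Z" by (rule zero_objE)
  obtain Q i' j' p' q' where Q: "biproduct X A B Q i' j' p' q'" using ex_biproduct t(1) fs(4) by
      blast
  note bq = biproductD[OF Q]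
  have T1: "tri A Q B (i' \<plusminus> j' \<cdot> f) (q' \<plusminus> hn (f \<cdot> p')) (Eo B A)"
    by (rule tri_biproduct[OF biproduct_shear[OF Q f]])
  have T2: "tri Q P U (i \<cdot> v \<cdot> p' \<plusminus> j \<cdot> q') (u \<cdot> p) (Em (Idn X U) i' \<rho>)"
    using tri_sum[OF T tri_zero_right[OF Z fs(4)] Q P biproduct_zero_right[OF t(3) Z(2)]] t bp bq Z
        by simp
  obtain M h d e \<delta> where M: "tri A P M ((i \<cdot> v \<cdot> p' \<plusminus> j \<cdot> q') \<cdot> (i' \<plusminus> j' \<cdot> f)) h \<delta>"
     "tri B M U d e (Em (Idn X U) (q' \<plusminus> hn (f \<cdot> p')) (Em (Idn X U) i' \<rho>))"
     "d \<cdot> (q' \<plusminus> hn (f \<cdot> p')) = h \<cdot> (i \<cdot> v \<cdot> p' \<plusminus> j \<cdot> q')" "e \<cdot> h = u \<cdot> p"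
     "Em (Idn X M) (i' \<plusminus> j' \<cdot> f) \<delta> = Em e (Idn X Q) (Em (Idn X U) i' \<rho>)"
    using ET4'[OF T1 T2] by blast
  note m = triD(2,3)[OF M(1)] triD(7-10)[OF M(1)] triD(4-9)[OF M(2)]
  have "(i \<cdot> v \<cdot> p' \<plusminus> j \<cdot> q') \<cdot> (i' \<plusminus> j' \<cdot> f) = i \<cdot> v \<plusminus> j \<cdot> f"
    using t bp bq fs by (simp add: distrib biproduct_re[OF Q])
  moreover have "d = h \<cdot> j"
  proof -
    have "d = (d \<cdot> (q' \<plusminus> hn (f \<cdot> p'))) \<cdot> j'" using m bq fs by (simp add: distrib biproduct_re[OF Q])
    also have "\<dots> = h \<cdot> j" unfolding M(3) using m bq bp fs t by (simp add: distrib biproduct_re[OF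
        Q])
    finally show ?thesis .
  qed
  moreover have "Em (Idn X U) (q' \<plusminus> hn (f \<cdot> p')) (Em (Idn X U) i' \<rho>) = Em (Idn X U) (hn f) \<rho>"
    using t bq fs by (simp add: distrib)
  moreover have "\<delta> = Em e (Idn X A) \<rho>"
  proof -
    have "\<delta> = Em (Idn X M) p' (Em (Idn X M) (i' \<plusminus> j' \<cdot> f) \<delta>)"
      using m bq fs by (simp add: distrib biproduct_re[OF Q])
    also have "\<dots> = Em e (Idn X A) \<rho>" unfolding M(5) using m bq t by simp
    finally show ?thesis .
  qed
  ultimately show ?thesis using M(1,2,4) by (intro exI[of _ M] exI[of _ h] exI[of _ e]) simp
qed

text \<open>Dual mapping cone: the sum of \<open>w\<close> and the identity followed by a sheared
  projection. Shearing with \<open>hn f\<close> leaves \<open>f\<close> unsigned in the deflation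
  and puts the sign into the pulled back extension.\<close>

lemma tri_base_change:
  assumes T: "tri K N C k w \<kappa>" and f: "f \<in> hm B C" and P: "biproduct X N B P i j p q"
  shows "\<exists>M h e. tri M P C h (w \<cdot> p \<plusminus> f \<cdot> q) (Em (Idn X C) e \<kappa>) \<and>
    tri K M B e (q \<cdot> h) (Em (hn f) (Idn X K) \<kappa>) \<and> h \<cdot> e = i \<cdot> k"
proof -
  note t = triD[OF T]
  have fs: "f \<in> Arr X" "Dom X f = B" "Cod X f = C" "B \<in> Obj X" using f hm_obj(1) by (auto simp:
      hm_iff)
  note bp = biproductD[OF P]
  obtain Z where Z: "Z \<in> Obj X" "zero_object X Z" by (rule zero_objE)
  obtain Q i' j' p' q' where Q: "biproduct X C B Q i' j' p' q'" using ex_biproduct t(3) fs(4) by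
      blast
  note bq = biproductD[OF Q]
  have T1: "tri B Q C (j' \<plusminus> i' \<cdot> hn f) (p' \<plusminus> hn (hn f \<cdot> q')) (Eo C B)"
    by (rule tri_biproduct[OF biproduct_shear[OF biproduct_swap[OF Q] neg_hm[OF f]]])
  have T2: "tri K P Q (i \<cdot> k) (i' \<cdot> w \<cdot> p \<plusminus> j' \<cdot> q) (Em p' (Idn X K) \<kappa>)"
    using tri_sum[OF T tri_zero_left[OF Z fs(4)] biproduct_zero_right[OF t(1) Z(2)] P Q] t bp bq Z
        by simp
  obtain M h d e \<delta> where M: "tri M P C h ((p' \<plusminus> hn (hn f \<cdot> q')) \<cdot> (i' \<cdot> w \<cdot> p \<plusminus> j' \<cdot> q)) \<delta>"
     "tri K M B d e (Em (j' \<plusminus> i' \<cdot> hn f) (Idn X K) (Em p' (Idn X K) \<kappa>))"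
     "h \<cdot> d = i \<cdot> k" "(i' \<cdot> w \<cdot> p \<plusminus> j' \<cdot> q) \<cdot> h = (j' \<plusminus> i' \<cdot> hn f) \<cdot> e"
     "Em (Idn X Q) d (Em p' (Idn X K) \<kappa>) = Em (p' \<plusminus> hn (hn f \<cdot> q')) (Idn X M) \<delta>"
    using ET4_op'[OF T2 T1] by blast
  note m = triD(1,2)[OF M(1)] triD(4-6,10)[OF M(1)] triD(4-9)[OF M(2)]
  have "(p' \<plusminus> hn (hn f \<cdot> q')) \<cdot> (i' \<cdot> w \<cdot> p \<plusminus> j' \<cdot> q) = w \<cdot> p \<plusminus> f \<cdot> q"
    using t bp bq fs by (simp add: distrib biproduct_re[OF Q])
  moreover have "e = q \<cdot> h"
  proof -
    have "e = q' \<cdot> ((j' \<plusminus> i' \<cdot> hn f) \<cdot> e)" using m bq fs by (simp add: distrib biproduct_re[OF Q])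
    also have "\<dots> = q \<cdot> h" unfolding M(4)[symmetric] using m bq bp fs t by (simp add: distrib
        biproduct_re[OF Q])
    finally show ?thesis .
  qed
  moreover have "Em (j' \<plusminus> i' \<cdot> hn f) (Idn X K) (Em p' (Idn X K) \<kappa>) = Em (hn f) (Idn X K) \<kappa>"
    using t bq fs by (simp add: distrib biproduct_re[OF Q])
  moreover have "\<delta> = Em (Idn X C) d \<kappa>"
  proof -
    have "\<delta> = Em i' (Idn X M) (Em (p' \<plusminus> hn (hn f \<cdot> q')) (Idn X M) \<delta>)"
      using m bq fs by (simp add: distrib biproduct_re[OF Q])
    also have "\<dots> = Em (Idn X C) d \<kappa>" unfolding M(5)[symmetric] using m bq t by simp
    finally show ?thesis .
  qed
  ultimately show ?thesis using M(1,2,3) by (intro exI[of _ M] exI[of _ h] exI[of _ d]) simp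
qed

text \<open>The restriction of \<open>\<epsilon>\<close> to the summand \<open>C2\<close> is
  realized by \<open>B2\<close>. (ET4)op for \<open>M \<rightarrow> P\<close> followed by the
  projection to \<open>C1\<close> exhibits this middle term as the fibre of
  \<open>M \<rightarrow> C1\<close>.\<close>

lemma tri_pushout_leg:
  assumes T: "tri A B1 C1 x1 y1 \<delta>1" "tri A B2 C2 x2 y2 \<delta>2" and P: "biproduct X C1 C2 P i1 i2 p1 p2"
    and M: "tri A M P m e \<epsilon>" and e: "Em i1 (Idn X A) \<epsilon> = \<delta>1" "Em i2 (Idn X A) \<epsilon> = \<delta>2"
  shows "\<exists>m2. m2 \<cdot> x2 = m \<and> e \<cdot> m2 = i2 \<cdot> y2 \<and> tri B2 M C1 m2 (p1 \<cdot> e) (Em (Idn X C1) x2 \<delta>1)"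
proof -
  note t = triD[OF T(1)] triD[OF T(2)] triD[OF M] biproductD[OF P]
  obtain E h' d e0 \<delta>'' where E: "tri E M C1 h' (p1 \<cdot> e) \<delta>''" "tri A E C2 d e0 (Em i2 (Idn X A) \<epsilon>)"
     "h' \<cdot> d = m" "e \<cdot> h' = i2 \<cdot> e0" "Em (Idn X P) d \<epsilon> = Em p1 (Idn X E) \<delta>''"
    using ET4_op'[OF M tri_biproduct[OF biproduct_swap[OF P]]] by blast
  note te = triD[OF E(1)] triD[OF E(2)]
  obtain b where b: "iso_hm B2 E b" "b \<cdot> x2 = d" "e0 \<cdot> b = y2"
    using tri_mid_unique[OF T(2) E(2)[unfolded e]] by blast
  obtain b' where b': "b \<in> hm B2 E" "b' \<in> hm E B2" "b' \<cdot> b = Idn X B2" "b \<cdot> b' = Idn X E"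
    using b(1) by (meson iso_hmE)
  have "tri B2 M C1 (h' \<cdot> b) (Idn X C1 \<cdot> p1 \<cdot> e) (Em (Idn X C1) b' \<delta>'')"
    by (rule tri_transport[OF E(1) b'(2,1,4,3)]) (use t in \<open>simp_all add: hm_iff\<close>)
  moreover have "Em (Idn X C1) b' \<delta>'' = Em (Idn X C1) x2 \<delta>1"
  proof -
    have "Em (Idn X C1) b' \<delta>'' = Em i1 b' (Em p1 (Idn X E) \<delta>'')" using b' t te by (simp add: hm_iff)
    also have "\<dots> = Em i1 b' (Em (Idn X P) (b \<cdot> x2) \<epsilon>)" using E(5) b(2) by simp
    also have "\<dots> = Em (Idn X C1) x2 (Em i1 (Idn X A) \<epsilon>)"
      using b' t by (simp add: hm_iff reassoc[OF b'(3)])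
    finally show ?thesis using e by simp
  qed
  moreover have "(h' \<cdot> b) \<cdot> x2 = m" using b b' t te E(3) by (simp add: hm_iff)
  moreover have "e \<cdot> h' \<cdot> b = i2 \<cdot> y2" using b b' t te reassoc[OF E(4), of b] by (simp add: hm_iff)
  ultimately show ?thesis using t te by (intro exI[of _ "h' \<cdot> b"]) simp
qed

text \<open>\<open>M\<close> realizes the sum of the two extensions, pulled back to
  \<open>C1 \<oplus> C2\<close>. A realized extension becomes trivial on its own middle term;
  written out on \<open>M\<close>, this is the last equation, the source of the sign in the rotation
  of triangles.\<close>

lemma tri_pushout:
  assumes T: "tri A B1 C1 x1 y1 \<delta>1" "tri A B2 C2 x2 y2 \<delta>2"
  shows "\<exists>M m1 m2 e1 e2. tri B1 M C2 m1 e2 (Em (Idn X C2) x1 \<delta>2) \<and> tri B2 M C1 m2 e1 (Em (Idn X C1)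
      x2 \<delta>1) \<and>
    m1 \<cdot> x1 = m2 \<cdot> x2 \<and> e1 \<cdot> m1 = y1 \<and> e2 \<cdot> m2 = y2 \<and> Em e1 (Idn X A) \<delta>1 = Em (hn e2) (Idn X A) \<delta>2"
proof -
  note t = triD[OF T(1)] triD[OF T(2)]
  obtain P i1 i2 p1 p2 where P: "biproduct X C1 C2 P i1 i2 p1 p2" using ex_biproduct t by blast
  note b = biproductD[OF P]
  define \<epsilon> where "\<epsilon> = Em p1 (Idn X A) \<delta>1 \<otimes>\<^bsub>Ext X P A\<^esub> Em p2 (Idn X A) \<delta>2"
  interpret E: comm_group "Ext X P A" using ext_group b t by simp
  have e: "\<epsilon> \<in> EE P A" unfolding \<epsilon>_def using t b by simp
  have c: "Em c (Idn X A) \<epsilon> = Em (p1 \<cdot> c) (Idn X A) \<delta>1 \<otimes>\<^bsub>Ext X D A\<^esub> Em (p2 \<cdot> c) (Idn X A) \<delta>2"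
    if "c \<in> hm D P" for c D
    unfolding \<epsilon>_def using t b that by (simp add: em_mult hm_iff)
  have e1: "Em i1 (Idn X A) \<epsilon> = \<delta>1" using c[of i1 C1] t b by (simp add: hm_iff)
  have e2: "Em i2 (Idn X A) \<epsilon> = \<delta>2" using c[of i2 C2] t b by (simp add: hm_iff)
  obtain M m k where M: "tri A M P m k \<epsilon>" using tri_ex e b t by metis
  note tm = triD[OF M]
  obtain m2 where m2: "m2 \<cdot> x2 = m" "k \<cdot> m2 = i2 \<cdot> y2" "tri B2 M C1 m2 (p1 \<cdot> k) (Em (Idn X C1) x2
      \<delta>1)"
    using tri_pushout_leg[OF T P M e1 e2] by blast
  obtain m1 where m1: "m1 \<cdot> x1 = m" "k \<cdot> m1 = i1 \<cdot> y1" "tri B1 M C2 m1 (p2 \<cdot> k) (Em (Idn X C2) x1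
      \<delta>2)"
    using tri_pushout_leg[OF T(2,1) biproduct_swap[OF P] M e2 e1] by blast
  have "(p1 \<cdot> k) \<cdot> m1 = y1" "(p2 \<cdot> k) \<cdot> m2 = y2"
    using m1(2) m2(2) t b tm triD[OF m1(3)] triD[OF m2(3)] by (simp_all add: biproduct_re[OF P])
  moreover have "Em (p1 \<cdot> k) (Idn X A) \<delta>1 = Em (hn (p2 \<cdot> k)) (Idn X A) \<delta>2"
  proof -
    have "Em k (Idn X A) \<epsilon> = Eo M A" by (rule tri_ext_zero(2)[OF M])
    then have 1: "Em (p1 \<cdot> k) (Idn X A) \<delta>1 \<otimes>\<^bsub>Ext X M A\<^esub> Em (p2 \<cdot> k) (Idn X A) \<delta>2 = Eo M A"
      using c[of k M] tm by (simp add: hm_iff)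
    have 2: "Em (hn (p2 \<cdot> k)) (Idn X A) \<delta>2 \<otimes>\<^bsub>Ext X M A\<^esub> Em (p2 \<cdot> k) (Idn X A) \<delta>2 = Eo M A"
      using em_neg_cancel(1)[of "p2 \<cdot> k" "Idn X A" \<delta>2] tm b t by simp
    show ?thesis
      by (rule ext_cancel[of M A _ _ "Em (p2 \<cdot> k) (Idn X A) \<delta>2"]) (use 1 2 tm b t in simp_all)
  qed
  ultimately show ?thesis
    using m1 m2 by (intro exI[of _ M] exI[of _ m1] exI[of _ m2] exI[of _ "p1 \<cdot> k"] exI[of _ "p2 \<cdot>
        k"]) simp
qed

lemma tri_pullback_leg:
  assumes T: "tri A1 B1 C x1 y1 \<delta>1" "tri A2 B2 C x2 y2 \<delta>2" and P: "biproduct X A1 A2 P i1 i2 p1 p2"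
    and M: "tri P M C k m \<epsilon>" and e: "Em (Idn X C) p1 \<epsilon> = \<delta>1" "Em (Idn X C) p2 \<epsilon> = \<delta>2"
  shows "\<exists>e2. y2 \<cdot> e2 = m \<and> e2 \<cdot> k = x2 \<cdot> p2 \<and> tri A1 M B2 (k \<cdot> i1) e2 (Em y2 (Idn X A1) \<delta>1)"
proof -
  note t = triD[OF T(1)] triD[OF T(2)] triD[OF M] biproductD[OF P]
  obtain E h' d e0 \<delta>'' where E: "tri A1 M E (k \<cdot> i1) h' \<delta>''" "tri A2 E C d e0 (Em (Idn X C) p2 \<epsilon>)"
     "d \<cdot> p2 = h' \<cdot> k" "e0 \<cdot> h' = m" "Em (Idn X E) i1 \<delta>'' = Em e0 (Idn X P) \<epsilon>"
    using ET4'[OF tri_biproduct[OF P] M] by blast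
  note te = triD[OF E(1)] triD[OF E(2)]
  obtain b where b: "iso_hm E B2 b" "b \<cdot> d = x2" "y2 \<cdot> b = e0"
    using tri_mid_unique[OF E(2)[unfolded e] T(2)] by blast
  obtain b' where b': "b \<in> hm E B2" "b' \<in> hm B2 E" "b' \<cdot> b = Idn X E" "b \<cdot> b' = Idn X B2"
    using b(1) by (meson iso_hmE)
  have "tri A1 M B2 ((k \<cdot> i1) \<cdot> Idn X A1) (b \<cdot> h') (Em b' (Idn X A1) \<delta>'')"
    by (rule tri_transport[OF E(1) _ _ _ _ b']) (use t in \<open>simp_all add: hm_iff\<close>)
  moreover have "Em b' (Idn X A1) \<delta>'' = Em y2 (Idn X A1) \<delta>1"
  proof -
    have "Em b' (Idn X A1) \<delta>'' = Em b' p1 (Em (Idn X E) i1 \<delta>'')" using b' t te by (simp add: hm_iff)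
    also have "\<dots> = Em b' p1 (Em (y2 \<cdot> b) (Idn X P) \<epsilon>)" using E(5) b(3) by simp
    also have "\<dots> = Em y2 (Idn X A1) (Em (Idn X C) p1 \<epsilon>)"
      using b' t by (simp add: hm_iff)
    finally show ?thesis using e by simp
  qed
  moreover have "y2 \<cdot> b \<cdot> h' = m" using b' t te E(4) reassoc[OF b(3), of h'] by (simp add: hm_iff)
  moreover have "(b \<cdot> h') \<cdot> k = x2 \<cdot> p2"
    using b' t te E(3)[symmetric] reassoc[OF b(2), of p2] by (simp add: hm_iff)
  ultimately show ?thesis using t te by (intro exI[of _ "b \<cdot> h'"]) simp
qed

text \<open>Dual to the pushout: both extensions are pushed into the sum of the left ends, added and
  realized.\<close>

lemma tri_pullback:
  assumes T: "tri A1 B1 C x1 y1 \<delta>1" "tri A2 B2 C x2 y2 \<delta>2"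
  shows "\<exists>M e1 e2 m1 m2. tri A2 M B1 m2 e1 (Em y1 (Idn X A2) \<delta>2) \<and> tri A1 M B2 m1 e2 (Em y2 (Idn X
      A1) \<delta>1) \<and>
    y1 \<cdot> e1 = y2 \<cdot> e2 \<and> e1 \<cdot> m1 = x1 \<and> e2 \<cdot> m2 = x2"
proof -
  note t = triD[OF T(1)] triD[OF T(2)]
  obtain P i1 i2 p1 p2 where P: "biproduct X A1 A2 P i1 i2 p1 p2" using ex_biproduct t by blast
  note b = biproductD[OF P]
  define \<epsilon> where "\<epsilon> = Em (Idn X C) i1 \<delta>1 \<otimes>\<^bsub>Ext X C P\<^esub> Em (Idn X C) i2 \<delta>2"
  interpret E: comm_group "Ext X C P" using ext_group b t by simp
  have e: "\<epsilon> \<in> EE C P" unfolding \<epsilon>_def using t b by simp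
  have c: "Em (Idn X C) a \<epsilon> = Em (Idn X C) (a \<cdot> i1) \<delta>1 \<otimes>\<^bsub>Ext X C D\<^esub> Em (Idn X C) (a \<cdot> i2) \<delta>2"
    if "a \<in> hm P D" for a D
    unfolding \<epsilon>_def using t b that by (simp add: em_mult hm_iff)
  have e1: "Em (Idn X C) p1 \<epsilon> = \<delta>1" using c[of p1 A1] t b by (simp add: hm_iff)
  have e2: "Em (Idn X C) p2 \<epsilon> = \<delta>2" using c[of p2 A2] t b by (simp add: hm_iff)
  obtain M k m where M: "tri P M C k m \<epsilon>" using tri_ex e b t by metis
  note tm = triD[OF M]
  obtain g2 where g2: "y2 \<cdot> g2 = m" "g2 \<cdot> k = x2 \<cdot> p2" "tri A1 M B2 (k \<cdot> i1) g2 (Em y2 (Idn X A1)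
      \<delta>1)"
    using tri_pullback_leg[OF T P M e1 e2] by blast
  obtain g1 where g1: "y1 \<cdot> g1 = m" "g1 \<cdot> k = x1 \<cdot> p1" "tri A2 M B1 (k \<cdot> i2) g1 (Em y1 (Idn X A2)
      \<delta>2)"
    using tri_pullback_leg[OF T(2,1) biproduct_swap[OF P] M e2 e1] by blast
  have "g1 \<cdot> (k \<cdot> i1) = x1"
    using reassoc[OF g1(2), of i1] t b tm triD[OF g1(3)] by simp
  moreover have "g2 \<cdot> (k \<cdot> i2) = x2"
    using reassoc[OF g2(2), of i2] t b tm triD[OF g2(3)] by simp
  ultimately show ?thesis
    using g1 g2 by (intro exI[of _ M] exI[of _ g1] exI[of _ g2] exI[of _ "k \<cdot> i1"] exI[of _ "k \<cdot>
        i2"]) simp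
qed

end

section \<open>Cotorsion pairs\<close>

context xcat
begin

lemma split_tri_mem:
  assumes "tri A B C x y (Eo C A)" "B \<in> U" "closed_under_isos X U" "closed_under_summands X U"
  shows "A \<in> U \<and> C \<in> U"
proof -
  note t = triD[OF assms(1)]
  obtain P i j p q where P: "biproduct X A C P i j p q" using ex_biproduct t by blast
  obtain b where "iso_hm B P b" using tri_mid_unique[OF assms(1) tri_biproduct[OF P]] by blast
  then have "iso_arr X b" "Dom X b = B" "Cod X b = P"
    using iso_hm_hm iso_arr_iff by (auto simp: hm_iff)
  then have "P \<in> U" using assms(2,3) unfolding closed_under_isos_def by metis
  then show ?thesis using P assms(4) unfolding closed_under_summands_def by meson
qed

end

locale cotorsion = xcat X for X :: "('o, 'm, 'e, 'z) ext_cat_scheme" (structure) +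
  fixes U V :: "'o set"
  assumes cotorsion: "cotorsion_pair X U V"
begin

lemma cot_ext: "\<lbrakk>A \<in> U; B \<in> V; \<delta> \<in> EE A B\<rbrakk> \<Longrightarrow> \<delta> = Eo A B"
  using cotorsion unfolding cotorsion_pair_def ext_vanishes_def by blast

lemma cot_obj: "A \<in> U \<Longrightarrow> A \<in> Obj X" "B \<in> V \<Longrightarrow> B \<in> Obj X"
  using cotorsion unfolding cotorsion_pair_def additive_subcategory_def by blast+

lemma cot_closed: "closed_under_isos X U" "closed_under_summands X U"
    "closed_under_isos X V" "closed_under_summands X V"
  using cotorsion unfolding cotorsion_pair_def by blast+

lemma cot_left:
  assumes "C \<in> Obj X" obtains V0 U0 x y \<delta> where "tri V0 U0 C x y \<delta>" "V0 \<in> V" "U0 \<in> U"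
proof -
  obtain x y where "conflation X x y" "Dom X x \<in> V" "Cod X x \<in> U" "Cod X y = C"
    using cotorsion assms unfolding cotorsion_pair_def by meson
  then show ?thesis using conflation_tri[of x y] that by blast
qed

lemma cot_right:
  assumes "C \<in> Obj X" obtains V0 U0 x y \<delta> where "tri C V0 U0 x y \<delta>" "V0 \<in> V" "U0 \<in> U"
proof -
  obtain x y where "conflation X x y" "Dom X x = C" "Cod X x \<in> V" "Cod X y \<in> U"
    using cotorsion assms unfolding cotorsion_pair_def by meson
  then show ?thesis using conflation_tri[of x y] that by blast
qed

text \<open>The approximation \<open>V0 \<rightarrow> U0 \<rightarrow> A\<close> splits under the
  hypothesis, so \<open>A\<close> is a summand of \<open>U0\<close>. Hence \<open>U\<close> consists
  of all objects orthogonal to \<open>V\<close>.\<close>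

lemma cot_mem_left:
  assumes "A \<in> Obj X" "\<And>B \<delta>. \<lbrakk>B \<in> V; \<delta> \<in> EE A B\<rbrakk> \<Longrightarrow> \<delta> = Eo A B"
  shows "A \<in> U"
proof -
  obtain V0 U0 x y \<delta> where d: "tri V0 U0 A x y \<delta>" "V0 \<in> V" "U0 \<in> U" using cot_left[OF assms(1)] .
  then have "\<delta> = Eo A V0" using assms(2) triD(10) by blast
  then show ?thesis using split_tri_mem[OF _ d(3) cot_closed(1,2)] d(1) by blast
qed

lemma cot_mem_right:
  assumes "B \<in> Obj X" "\<And>A \<delta>. \<lbrakk>A \<in> U; \<delta> \<in> EE A B\<rbrakk> \<Longrightarrow> \<delta> = Eo A B"
  shows "B \<in> V"
proof -
  obtain V0 U0 x y \<delta> where d: "tri B V0 U0 x y \<delta>" "V0 \<in> V" "U0 \<in> U" using cot_right[OF assms(1)] .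
  then have "\<delta> = Eo U0 B" using assms(2) triD(10) by blast
  then show ?thesis using split_tri_mem[OF _ d(2) cot_closed(3,4)] d(1) by blast
qed

text \<open>An extension on \<open>B\<close> vanishes on \<open>A\<close>, hence comes from
  \<open>C\<close> by half-exactness, where it vanishes too.\<close>

lemma cot_left_extension:
  assumes "tri A B C x y \<delta>" "A \<in> U" "C \<in> U" shows "B \<in> U"
proof (rule cot_mem_left)
  note t = triD[OF assms(1)]
  show "B \<in> Obj X" by (rule t)
  fix Y \<epsilon> assume Y: "Y \<in> V" "\<epsilon> \<in> EE B Y"
  note o = cot_obj(2)[OF Y(1)]
  have "Em x (Idn X Y) \<epsilon> = Eo A Y" using cot_ext[OF assms(2) Y(1)] Y o t by simp
  then obtain \<eta> where e: "\<eta> \<in> EE C Y" "Em y (Idn X Y) \<eta> = \<epsilon>" using ext_from_pull[OF assms(1) Y(2) o]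
      by blast
  then have "\<eta> = Eo C Y" using cot_ext[OF assms(3) Y(1)] by blast
  then show "\<epsilon> = Eo B Y" using e(2) o t by simp
qed

lemma cot_right_extension:
  assumes "tri A B C x y \<delta>" "A \<in> V" "C \<in> V" shows "B \<in> V"
proof (rule cot_mem_right)
  note t = triD[OF assms(1)]
  show "B \<in> Obj X" by (rule t)
  fix Y \<epsilon> assume Y: "Y \<in> U" "\<epsilon> \<in> EE Y B"
  note o = cot_obj(1)[OF Y(1)]
  have "Em (Idn X Y) y \<epsilon> = Eo Y C" using cot_ext[OF Y(1) assms(3)] Y o t by simp
  then obtain \<eta> where e: "\<eta> \<in> EE Y A" "Em (Idn X Y) x \<eta> = \<epsilon>" using ext_from_push[OF assms(1) Y(2) o]
      by blast
  then have "\<eta> = Eo Y A" using cot_ext[OF Y(1) assms(2)] by blast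
  then show "\<epsilon> = Eo Y B" using e(2) o t by simp
qed

lemma cot_zero:
  assumes "zero_object X Z" shows "Z \<in> U" "Z \<in> V"
proof -
  have Z: "Z \<in> Obj X" using assms by (simp add: zero_object_def)
  have "\<delta> = Eo Z B" if "B \<in> V" "\<delta> \<in> EE Z B" for B \<delta>
    using em_id[of Z B \<delta>] that cot_obj Z zero_obj_idn[OF assms] em_zero[of \<delta> Z "Idn X B" Z] by simp
  then show "Z \<in> U" using cot_mem_left Z by blast
  have "\<delta> = Eo A Z" if "A \<in> U" "\<delta> \<in> EE A Z" for A \<delta>
    using ext_zero_obj assms that cot_obj by blast
  then show "Z \<in> V" using cot_mem_right Z by blast
qed

end

section \<open>Hovey twin cotorsion pairs\<close>

locale hovey = xcat X for X :: "('o, 'm, 'e, 'z) ext_cat_scheme" (structure) +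
  fixes S T U V :: "'o set"
  assumes hovey: "hovey_twin_cotorsion_pair X S T U V"

sublocale hovey \<subseteq> ST: cotorsion X S T
  using hovey by unfold_locales (simp add: hovey_twin_cotorsion_pair_def twin_cotorsion_pair_def)

sublocale hovey \<subseteq> UV: cotorsion X U V
  using hovey by unfold_locales (simp add: hovey_twin_cotorsion_pair_def twin_cotorsion_pair_def)

context hovey
begin

lemma ext_SV: "\<lbrakk>A \<in> S; B \<in> V; \<delta> \<in> EE A B\<rbrakk> \<Longrightarrow> \<delta> = Eo A B"
  using hovey unfolding hovey_twin_cotorsion_pair_def twin_cotorsion_pair_def ext_vanishes_def by
      blast

lemma S_U: "A \<in> S \<Longrightarrow> A \<in> U"
  using UV.cot_mem_left ext_SV ST.cot_obj(1) by blast

lemma V_T: "B \<in> V \<Longrightarrow> B \<in> T"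
  using ST.cot_mem_right ext_SV UV.cot_obj(2) by blast

section \<open>Closure properties of \<open>N\<close>\<close>

definition N :: "'o set" where "N = Ni X S V"

lemma N_Nf: "N = Nf X S V"
  using hovey by (simp add: N_def hovey_twin_cotorsion_pair_def)

lemma NiE:
  assumes "A \<in> N" obtains V0 S0 x y \<delta> where "tri V0 S0 A x y \<delta>" "V0 \<in> V" "S0 \<in> S"
proof -
  from assms obtain x y where "conflation X x y" "Dom X x \<in> V" "Cod X x \<in> S" "Cod X y = A"
    unfolding N_def Ni_def by blast
  then show ?thesis using conflation_tri[of x y] that by blast
qed

lemma NfE:
  assumes "A \<in> N" obtains V0 S0 x y \<delta> where "tri A V0 S0 x y \<delta>" "V0 \<in> V" "S0 \<in> S"
proof -
  from assms obtain x y where "conflation X x y" "Dom X x = A" "Cod X x \<in> V" "Cod X y \<in> S"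
    unfolding N_Nf Nf_def by blast
  then show ?thesis using conflation_tri[of x y] that by blast
qed

lemma NiI: "\<lbrakk>tri V0 S0 A x y \<delta>; V0 \<in> V; S0 \<in> S\<rbrakk> \<Longrightarrow> A \<in> N"
  unfolding N_def Ni_def using tri_conflation[of V0 S0 A x y \<delta>] triD[of V0 S0 A x y \<delta>] by blast

lemma NfI: "\<lbrakk>tri A V0 S0 x y \<delta>; V0 \<in> V; S0 \<in> S\<rbrakk> \<Longrightarrow> A \<in> N"
  unfolding N_Nf Nf_def using tri_conflation[of A V0 S0 x y \<delta>] triD[of A V0 S0 x y \<delta>] by blast

lemma V_N: assumes "A \<in> V" shows "A \<in> N"
proof -
  obtain Z where Z: "Z \<in> Obj X" "zero_object X Z" by (rule zero_objE)
  show ?thesis using NfI[OF tri_zero_right[OF Z UV.cot_obj(2)[OF assms]] assms ST.cot_zero(1)[OF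
      Z(2)]] .
qed

lemma S_N: assumes "A \<in> S" shows "A \<in> N"
proof -
  obtain Z where Z: "Z \<in> Obj X" "zero_object X Z" by (rule zero_objE)
  show ?thesis using NiI[OF tri_zero_left[OF Z ST.cot_obj(1)[OF assms]] UV.cot_zero(2)[OF Z(2)]
      assms] .
qed

text \<open>Uses the presentation \<open>V1 \<rightarrow> S1 \<rightarrow> N0\<close>: the fibre of
  the composite \<open>S1 \<rightarrow> Y\<close> is an extension of \<open>V0\<close> by
  \<open>V1\<close>, hence in \<open>V\<close>.\<close>

lemma N_cone_V:
  assumes "tri V0 N0 Y k p \<delta>" "V0 \<in> V" "N0 \<in> N" shows "Y \<in> N"
proof -
  obtain V1 S1 x y \<epsilon> where 1: "tri V1 S1 N0 x y \<epsilon>" "V1 \<in> V" "S1 \<in> S" by (rule NiE[OF assms(3)])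
  obtain E h' d e \<delta>'' where "tri E S1 Y h' (p \<cdot> y) \<delta>''" "tri V1 E V0 d e (Em k (Idn X V1) \<epsilon>)"
    using ET4_op'[OF 1(1) assms(1)] by blast
  then show ?thesis using NiI UV.cot_right_extension 1 assms by blast
qed

text \<open>Uses the other presentation \<open>N0 \<rightarrow> V1 \<rightarrow> S1\<close>, so that
  together with \<open>N_cone_V\<close> both descriptions of \<open>N\<close> are in play.\<close>

lemma N_cocone_S:
  assumes "tri Y N0 S0 k p \<delta>" "S0 \<in> S" "N0 \<in> N" shows "Y \<in> N"
proof -
  obtain V1 S1 x y \<epsilon> where 1: "tri N0 V1 S1 x y \<epsilon>" "V1 \<in> V" "S1 \<in> S" by (rule NfE[OF assms(3)])
  obtain E h' d e \<delta>'' where "tri Y V1 E (x \<cdot> k) h' \<delta>''" "tri S0 E S1 d e (Em (Idn X S1) p \<epsilon>)"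
    using ET4'[OF assms(1) 1(1)] by blast
  then show ?thesis using NfI ST.cot_left_extension 1 assms by blast
qed

lemma N_iso:
  assumes "A \<in> N" "iso_hm A B f" shows "B \<in> N"
proof -
  obtain V1 S1 x y \<epsilon> where 1: "tri V1 S1 A x y \<epsilon>" "V1 \<in> V" "S1 \<in> S" by (rule NiE[OF assms(1)])
  note t = triD[OF 1(1)]
  obtain g where g: "f \<in> hm A B" "g \<in> hm B A" "g \<cdot> f = Idn X A" "f \<cdot> g = Idn X B" using assms(2) by
      (meson iso_hmE)
  have "tri V1 S1 B (x \<cdot> Idn X V1) (f \<cdot> y) (Em g (Idn X V1) \<epsilon>)"
    by (rule tri_transport[OF 1(1) _ _ _ _ g]) (use t in \<open>simp_all add: hm_iff\<close>)
  then show ?thesis using NiI 1 by blast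
qed

text \<open>Resolve both ends. Pulling back along \<open>S1 \<rightarrow> C\<close> replaces
  \<open>C\<close> by an object of \<open>S\<close>, and pushing out along
  \<open>A \<rightarrow> V2\<close> replaces \<open>A\<close> by an object of \<open>V\<close>; the
  remaining extension of \<open>S1\<close> by \<open>V2\<close> splits. The two replacements are
  undone with \<open>N_cocone_S\<close> and \<open>N_cone_V\<close>.\<close>

lemma N_extension:
  assumes "tri A B C x y \<delta>" "A \<in> N" "C \<in> N" shows "B \<in> N"
proof -
  obtain V1 S1 k p \<epsilon> where 1: "tri V1 S1 C k p \<epsilon>" "V1 \<in> V" "S1 \<in> S" by (rule NiE[OF assms(3)])
  obtain M e1 e2 m1 m2 where M: "tri V1 M B m2 e1 (Em y (Idn X V1) \<epsilon>)" "tri A M S1 m1 e2 (Em p (Idn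
      X A) \<delta>)"
    using tri_pullback[OF assms(1) 1(1)] by blast
  obtain V2 S2 l q \<kappa> where 2: "tri A V2 S2 l q \<kappa>" "V2 \<in> V" "S2 \<in> S" by (rule NfE[OF assms(2)])
  obtain M' m1' m2' e1' e2' where M': "tri M M' S2 m1' e2' (Em (Idn X S2) m1 \<kappa>)"
      "tri V2 M' S1 m2' e1' (Em (Idn X S1) l (Em p (Idn X A) \<delta>))"
    using tri_pushout[OF M(2) 2(1)] by blast
  have z: "Em (Idn X S1) l (Em p (Idn X A) \<delta>) = Eo S1 V2"
    using ext_SV[OF 1(3) 2(2)] triD(10)[OF M'(2)] by blast
  obtain P i j p' q' where P: "biproduct X V2 S1 P i j p' q'" using ex_biproduct triD(1,3)[OF M'(2)]
      by blast
  \<comment> \<open>A sum of an object of \<open>V\<close> and one of \<open>S\<close> is in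
    \<open>N\<close> because \<open>S1\<close> embeds in some \<open>V3\<close> with cone in
    \<open>S\<close>; adding \<open>V2\<close> on both sides leaves the cone unchanged.\<close>
  have "P \<in> N"
  proof -
    obtain V3 S3 a b \<eta> where 3: "tri S1 V3 S3 a b \<eta>" "V3 \<in> V" "S3 \<in> S" by (rule NfE[OF S_N[OF
        1(3)]])
    obtain Z where Z: "Z \<in> Obj X" "zero_object X Z" by (rule zero_objE)
    obtain P2 i2 j2 p2 q2 where P2: "biproduct X V2 V3 P2 i2 j2 p2 q2"
      using ex_biproduct triD(1)[OF M'(2)] triD(2)[OF 3(1)] by blast
    obtain x3 y3 \<delta>3 where "tri P P2 S3 x3 y3 \<delta>3"
      using tri_sum[OF tri_zero_right[OF Z triD(1)[OF M'(2)]] 3(1) P P2 biproduct_zero_left[OF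
          triD(3)[OF 3(1)] Z(2)]] by blast
    moreover have "P2 \<in> V" using UV.cot_right_extension[OF tri_biproduct[OF P2] 2(2) 3(2)] .
    ultimately show ?thesis using NfI 3(3) by blast
  qed
  moreover obtain b where "iso_hm P M' b"
    using tri_mid_unique[OF tri_biproduct[OF P] M'(2)[unfolded z]] by blast
  ultimately have "M' \<in> N" using N_iso by blast
  then have "M \<in> N" using N_cocone_S M'(1) 2(3) by blast
  then show ?thesis using N_cone_V M(1) 1(2) by blast
qed

lemma N_biproduct:
  assumes "biproduct X A B P i j p q" "A \<in> N" "B \<in> N" shows "P \<in> N"
  using N_extension[OF tri_biproduct] assms by blast

text \<open>Orthogonality of \<open>U\<close> and \<open>V\<close> splits the presentation
  \<open>V1 \<rightarrow> S1 \<rightarrow> A\<close>.\<close>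

lemma N_U_S: assumes "A \<in> N" "A \<in> U" shows "A \<in> S"
proof -
  obtain V1 S1 x y \<epsilon> where 1: "tri V1 S1 A x y \<epsilon>" "V1 \<in> V" "S1 \<in> S" by (rule NiE[OF assms(1)])
  then have "\<epsilon> = Eo A V1" using UV.cot_ext[OF assms(2)] triD(10) by blast
  then show ?thesis using split_tri_mem[OF _ 1(3) ST.cot_closed(1,2)] 1(1) by blast
qed

subsection \<open>Trivial fibrations and trivial cofibrations\<close>

abbreviation wF :: "'m set" where "wF \<equiv> wFib X V"
abbreviation wC :: "'m set" where "wC \<equiv> wCof X S"
abbreviation W :: "'m set" where "W \<equiv> weq X S V"

lemma wF_I: "\<lbrakk>tri V0 A B x f \<delta>; V0 \<in> V\<rbrakk> \<Longrightarrow> f \<in> wF"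
  unfolding wFib_def deflation_def using tri_conflation[of V0 A B x f \<delta>] triD[of V0 A B x f \<delta>] by
      blast

lemma wC_I: "\<lbrakk>tri A B S0 f y \<delta>; S0 \<in> S\<rbrakk> \<Longrightarrow> f \<in> wC"
  unfolding wCof_def inflation_def using tri_conflation[of A B S0 f y \<delta>] triD[of A B S0 f y \<delta>] by
      blast

lemma wF_E:
  assumes "f \<in> wF" "f \<in> hm A B" obtains V0 x \<delta> where "tri V0 A B x f \<delta>" "V0 \<in> V"
proof -
  from assms(1) obtain x where x: "conflation X x f" "Dom X x \<in> V" unfolding wFib_def by blast
  then obtain \<delta> where "tri (Dom X x) (Cod X x) (Cod X f) x f \<delta>" using conflation_tri by blast
  moreover have "Cod X x = A" "Cod X f = B" using triD(6,8)[OF calculation] assms(2) by (auto simp: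
      hm_iff)
  ultimately show ?thesis using that x(2) by simp
qed

lemma wC_E:
  assumes "f \<in> wC" "f \<in> hm A B" obtains S0 y \<delta> where "tri A B S0 f y \<delta>" "S0 \<in> S"
proof -
  from assms(1) obtain y where y: "conflation X f y" "Cod X y \<in> S" unfolding wCof_def by blast
  then obtain \<delta> where "tri (Dom X f) (Cod X f) (Cod X y) f y \<delta>" using conflation_tri by blast
  then show ?thesis using that y(2) assms(2) by (auto simp: hm_iff)
qed

lemma wF_arr: "f \<in> wF \<Longrightarrow> f \<in> Arr X"
  unfolding wFib_def deflation_def conflation_def using etriangle_tri triD(7) by blast

lemma wC_arr: "f \<in> wC \<Longrightarrow> f \<in> Arr X"
  unfolding wCof_def inflation_def conflation_def using etriangle_tri triD(4) by blast

lemma wF_cmp: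
  assumes "f \<in> wF" "g \<in> wF" "f \<in> hm A B" "g \<in> hm B C" shows "g \<cdot> f \<in> wF"
proof -
  obtain V0 x \<delta> where 0: "tri V0 A B x f \<delta>" "V0 \<in> V" by (rule wF_E[OF assms(1,3)])
  obtain V1 y \<epsilon> where 1: "tri V1 B C y g \<epsilon>" "V1 \<in> V" by (rule wF_E[OF assms(2,4)])
  obtain E h' d e \<delta>'' where "tri E A C h' (g \<cdot> f) \<delta>''" "tri V0 E V1 d e (Em y (Idn X V0) \<delta>)"
    using ET4_op'[OF 0(1) 1(1)] by blast
  then show ?thesis using wF_I UV.cot_right_extension 0 1 by blast
qed

lemma wC_cmp:
  assumes "f \<in> wC" "g \<in> wC" "f \<in> hm A B" "g \<in> hm B C" shows "g \<cdot> f \<in> wC"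
proof -
  obtain S0 x \<delta> where 0: "tri A B S0 f x \<delta>" "S0 \<in> S" by (rule wC_E[OF assms(1,3)])
  obtain S1 y \<epsilon> where 1: "tri B C S1 g y \<epsilon>" "S1 \<in> S" by (rule wC_E[OF assms(2,4)])
  obtain E h' d e \<delta>'' where "tri A C E (g \<cdot> f) h' \<delta>''" "tri S0 E S1 d e (Em (Idn X S1) x \<epsilon>)"
    using ET4'[OF 0(1) 1(1)] by blast
  then show ?thesis using wC_I ST.cot_left_extension 0 1 by blast
qed

lemma idn_wF: "A \<in> Obj X \<Longrightarrow> Idn X A \<in> wF"
  using zero_objE wF_I[OF tri_zero_left] UV.cot_zero(2) by metis

lemma idn_wC: "A \<in> Obj X \<Longrightarrow> Idn X A \<in> wC"
  using zero_objE wC_I[OF tri_zero_right] ST.cot_zero(1) by metis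

lemma weqI: "\<lbrakk>i \<in> wC; p \<in> wF; i \<in> hm A E; p \<in> hm E B\<rbrakk> \<Longrightarrow> p \<cdot> i \<in> W"
  unfolding weq_def mem_Collect_eq by (intro exI[of _ p] exI[of _ i]) (simp add: hm_iff)

lemma weqE:
  assumes "w \<in> W" "w \<in> hm A B"
  obtains i p E where "i \<in> wC" "p \<in> wF" "i \<in> hm A E" "p \<in> hm E B" "w = p \<cdot> i"
proof -
  from assms(1) obtain p i where pi: "w = p \<cdot> i" "i \<in> wC" "p \<in> wF" "Cod X i = Dom X p" unfolding
      weq_def by blast
  then show ?thesis using that[of i p "Dom X p"] assms(2) wF_arr[OF pi(3)] wC_arr[OF pi(2)] by (simp
      add: hm_iff)
qed

lemma wF_W: "f \<in> wF \<Longrightarrow> f \<in> W"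
  using weqI[of "Idn X (Dom X f)" f "Dom X f" "Dom X f" "Cod X f"] wF_arr[of f] idn_wC by (simp add:
      hm_iff)

lemma wC_W: "f \<in> wC \<Longrightarrow> f \<in> W"
  using weqI[of f "Idn X (Cod X f)" "Dom X f" "Cod X f" "Cod X f"] wC_arr[of f] idn_wF by (simp add:
      hm_iff)

text \<open>Embed the fibre in \<open>V2\<close> with cone in \<open>S\<close> and push out:
  \<open>A \<rightarrow> M\<close> has cone \<open>S2\<close>, and \<open>M \<rightarrow> B\<close>
  has fibre \<open>V2\<close>.\<close>

lemma deflation_N_W:
  assumes "tri N0 A B k p \<delta>" "N0 \<in> N" shows "p \<in> W"
proof -
  obtain V2 S2 l q \<kappa> where 2: "tri N0 V2 S2 l q \<kappa>" "V2 \<in> V" "S2 \<in> S" by (rule NfE[OF assms(2)])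
  obtain M m1 m2 e1 e2 where M: "tri A M S2 m1 e2 (Em (Idn X S2) k \<kappa>)" "tri V2 M B m2 e1 (Em (Idn X
      B) l \<delta>)" "e1 \<cdot> m1 = p"
    using tri_pushout[OF assms(1) 2(1)] by blast
  then show ?thesis using weqI[OF wC_I[OF M(1) 2(3)] wF_I[OF M(2) 2(2)]] tri_hm M by metis
qed

text \<open>Dual: cover the cone by \<open>S1\<close> with fibre in \<open>V\<close> and pull
  back.\<close>

lemma inflation_N_W:
  assumes "tri A B N0 i y \<delta>" "N0 \<in> N" shows "i \<in> W"
proof -
  obtain V1 S1 k p \<epsilon> where 1: "tri V1 S1 N0 k p \<epsilon>" "V1 \<in> V" "S1 \<in> S" by (rule NiE[OF assms(2)])
  obtain M e1 e2 m1 m2 where M: "tri V1 M B m2 e1 (Em y (Idn X V1) \<epsilon>)" "tri A M S1 m1 e2 (Em p (Idn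
      X A) \<delta>)" "e1 \<cdot> m1 = i"
    using tri_pullback[OF assms(1) 1(1)] by blast
  then show ?thesis using weqI[OF wC_I[OF M(2) 1(3)] wF_I[OF M(1) 1(2)]] tri_hm M by metis
qed

lemma proj_wF:
  assumes "biproduct X V0 A P i j p q" "V0 \<in> V" shows "q \<in> wF"
  using wF_I[OF tri_biproduct[OF assms(1)] assms(2)] .

text \<open>The Hovey condition makes the class of weak equivalences stable under composition: the cone
  of \<open>A \<rightarrow> C \<oplus> V\<^sub>A\<close> lies in \<open>N\<close> and can therefore be replaced by an object of \<open>S = U \<inter> N\<close>.\<close>

lemma wC_after_wF:
  assumes x: "x \<in> wF" "x \<in> hm A B" and y: "y \<in> wC" "y \<in> hm B C"
  obtains E i p where "i \<in> wC" "p \<in> wF" "i \<in> hm A E" "p \<in> hm E C" "y \<cdot> x = p \<cdot> i"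
proof -
  obtain V0 k \<delta> where V0: "tri V0 A B k x \<delta>" "V0 \<in> V" by (rule wF_E[OF x])
  obtain S0 s \<epsilon> where S0: "tri B C S0 y s \<epsilon>" "S0 \<in> S" by (rule wC_E[OF y])
  have A: "A \<in> Obj X" using triD[OF V0(1)] by simp
  obtain V1 U1 v u \<rho> where V1: "tri A V1 U1 v u \<rho>" "V1 \<in> V" "U1 \<in> U" by (rule UV.cot_right[OF A])
  note t = triD[OF V1(1)] triD[OF V0(1)] triD[OF S0(1)]
  obtain P0 i j p q where P0: "biproduct X V1 B P0 i j p q" using ex_biproduct t by blast
  note b0 = biproductD[OF P0]
  \<comment> \<open>The component \<open>hn x\<close> cancels the sign of
    \<open>tri_cobase_change\<close>: \<open>M0\<close> realizes the extension pushed along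
    \<open>x\<close> itself.\<close>
  obtain M0 h e where M0: "tri A P0 M0 (i \<cdot> v \<plusminus> j \<cdot> hn x) h (Em e (Idn X A) \<rho>)"
    "tri B M0 U1 (h \<cdot> j) e (Em (Idn X U1) (hn (hn x)) \<rho>)" "e \<cdot> h = u \<cdot> p"
    using tri_cobase_change[OF V1(1) neg_hm[OF x(2)] P0] by blast
  \<comment> \<open>\<open>E0\<close> is the cone of an arrow between objects of \<open>V\<close>,
    hence in \<open>N\<close>; it realizes the same extension as \<open>M0\<close>.\<close>
  obtain E0 h0 d0 e0 \<delta>0 where E0: "tri V0 V1 E0 (v \<cdot> k) h0 \<delta>0" "tri B E0 U1 d0 e0 (Em (Idn X U1) x
      \<rho>)"
    using ET4'[OF V0(1) V1(1)] by blast
  have M0': "tri B M0 U1 (h \<cdot> j) e (Em (Idn X U1) x \<rho>)" using M0(2) t by simp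
  have "E0 \<in> N" using N_cone_V[OF E0(1) V0(2) V_N[OF V1(2)]] .
  moreover obtain b where "iso_hm E0 M0 b"
    using tri_mid_unique[OF E0(2) M0'] by blast
  ultimately have M0N: "M0 \<in> N" using N_iso by blast
  obtain P1 i1 j1 p1 q1 where P1: "biproduct X V1 C P1 i1 j1 p1 q1" using ex_biproduct t by blast
  note b1 = biproductD[OF P1]
  obtain Z where Z: "Z \<in> Obj X" "zero_object X Z" by (rule zero_objE)
  \<comment> \<open>Replacing the summand \<open>B\<close> by \<open>C\<close> through
    \<open>y\<close> adds only \<open>S0\<close> to the cone, so the new cone \<open>M\<close> is an
    extension of \<open>S0\<close> by \<open>M0\<close> and stays in \<open>N\<close>.\<close>
  obtain s' \<delta>1 where P01: "tri P0 P1 S0 (i1 \<cdot> p \<plusminus> j1 \<cdot> y \<cdot> q) s' \<delta>1"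
    using tri_sum[OF tri_zero_right[OF Z t(2)] S0(1) P0 P1 biproduct_zero_left[OF triD(3)[OF S0(1)]
        Z(2)]] t b0 b1 by auto
  obtain M a a' d e' \<delta>2 where M: "tri A P1 M a a' \<delta>2" "a = (i1 \<cdot> p \<plusminus> j1 \<cdot> y \<cdot> q) \<cdot> (i \<cdot> v \<plusminus> j \<cdot> hn
      x)"
     "tri M0 M S0 d e' (Em (Idn X S0) h \<delta>1)"
    using ET4'[OF M0(1) P01] by blast
  have MN: "M \<in> N" using N_extension[OF M(3) M0N S_N[OF S0(2)]] .
  have "M \<in> Obj X" using triD[OF M(1)] by simp
  \<comment> \<open>\<open>U2\<close> is an extension of \<open>M\<close> by \<open>V2\<close>, so
    it lies in \<open>U \<inter> N = S\<close>. Pulling back along \<open>U2 \<rightarrow> M\<close>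
    therefore splits the inflation \<open>a\<close> into a trivial cofibration followed by a trivial
    fibration.\<close>
  then obtain V2 U2 l r \<kappa> where V2: "tri V2 U2 M l r \<kappa>" "V2 \<in> V" "U2 \<in> U" by (rule UV.cot_left)
  have "U2 \<in> S" using N_U_S[OF N_extension[OF V2(1) V_N[OF V2(2)] MN] V2(3)] .
  obtain E e1 e2 m1 m2 where E: "tri V2 E P1 m2 e1 (Em a' (Idn X V2) \<kappa>)" "tri A E U2 m1 e2 (Em r
      (Idn X A) \<delta>2)" "e1 \<cdot> m1 = a"
    using tri_pullback[OF M(1) V2(1)] by blast
  note te = triD[OF E(1)] triD[OF E(2)]
  have e1: "e1 \<in> wF" "e1 \<in> hm E P1" using wF_I[OF E(1) V2(2)] tri_hm[OF E(1)] by auto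
  \<comment> \<open>The projection is negated because \<open>q1 \<cdot> a\<close> is the negative of
    \<open>y \<cdot> x\<close>.\<close>
  have q1: "hn q1 \<in> wF" "hn q1 \<in> hm P1 C"
  proof -
    have "tri V1 P1 C (i1 \<cdot> Idn X V1) (hn (Idn X C) \<cdot> q1) (Em (hn (Idn X C)) (Idn X V1) (Eo C V1))"
      by (rule tri_transport[OF tri_biproduct[OF P1]]) (use b1 in \<open>simp_all add: hm_iff\<close>)
    then show "hn q1 \<in> wF" "hn q1 \<in> hm P1 C" using wF_I[OF _ V1(2)] b1 by (auto simp: hm_iff)
  qed
  have "q1 \<cdot> a = hn (y \<cdot> x)"
    unfolding M(2) using b0 b1 t by (simp add: distrib biproduct_re[OF P0] biproduct_re[OF P1])
  then have "y \<cdot> x = (hn q1 \<cdot> e1) \<cdot> m1"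
    using b1 te t by (simp add: E(3))
  then show thesis
    using that[of m1 "hn q1 \<cdot> e1" E] wC_I[OF E(2) \<open>U2 \<in> S\<close>] wF_cmp[OF e1(1) q1(1) e1(2) q1(2)] te b1
    by (simp add: hm_iff)
qed

subsection \<open>Lifting and extension of arrows\<close>

lemma lift_wF:
  assumes "A \<in> U" "p \<in> wF" "p \<in> hm E B" "f \<in> hm A B" shows "\<exists>g\<in>hm A E. p \<cdot> g = f"
proof -
  obtain V0 x \<delta> where 0: "tri V0 E B x p \<delta>" "V0 \<in> V" by (rule wF_E[OF assms(2,3)])
  have "Em f (Idn X V0) \<delta> = Eo A V0"
    using UV.cot_ext[OF assms(1) 0(2)] triD[OF 0(1)] assms(4) by (simp add: hm_iff)
  then show ?thesis using tri_lift_iff[OF 0(1) assms(4)] by blast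
qed

lemma extend_wC:
  assumes "B \<in> T" "i \<in> wC" "i \<in> hm A E" "f \<in> hm A B" shows "\<exists>g\<in>hm E B. g \<cdot> i = f"
proof -
  obtain S0 x \<delta> where 0: "tri A E S0 i x \<delta>" "S0 \<in> S" by (rule wC_E[OF assms(2,3)])
  have "Em (Idn X S0) f \<delta> = Eo S0 B"
    using ST.cot_ext[OF 0(2) assms(1)] triD[OF 0(1)] assms(4) by (simp add: hm_iff)
  then show ?thesis using tri_extend_iff[OF 0(1) assms(4)] by blast
qed

text \<open>The class of objects is a parameter: two lifts along a trivial fibration differ by an
  arrow through \<open>V\<close>, two extensions along a trivial cofibration by one through
  \<open>S\<close>, and both cases are absorbed into \<open>N\<close>.\<close>

definition through :: "'o set \<Rightarrow> 'o \<Rightarrow> 'o \<Rightarrow> 'm \<Rightarrow> bool" where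
  "through K A B f \<longleftrightarrow> (\<exists>N0\<in>K. \<exists>k\<in>hm A N0. \<exists>l\<in>hm N0 B. f = l \<cdot> k)"

lemma through_left:
  assumes "through K A B f" "g \<in> hm B D" shows "through K A D (g \<cdot> f)"
proof -
  obtain N0 k l where *: "N0 \<in> K" "k \<in> hm A N0" "l \<in> hm N0 B" "f = l \<cdot> k" using assms(1) unfolding
      through_def by blast
  then have "g \<cdot> f = (g \<cdot> l) \<cdot> k" "g \<cdot> l \<in> hm N0 D" using assms(2) by (auto simp: hm_iff)
  then show ?thesis unfolding through_def using * by blast
qed

lemma through_right:
  assumes "through K A B f" "g \<in> hm D A" shows "through K D B (f \<cdot> g)"
proof -
  obtain N0 k l where *: "N0 \<in> K" "k \<in> hm A N0" "l \<in> hm N0 B" "f = l \<cdot> k" using assms(1) unfolding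
      through_def by blast
  then have "f \<cdot> g = l \<cdot> (k \<cdot> g)" "k \<cdot> g \<in> hm D N0" using assms(2) by (auto simp: hm_iff)
  then show ?thesis unfolding through_def using * by blast
qed

lemma through_neg:
  assumes "through K A B f" shows "through K A B (hn f)"
proof -
  obtain N0 k l where *: "N0 \<in> K" "k \<in> hm A N0" "l \<in> hm N0 B" "f = l \<cdot> k" using assms(1) unfolding
      through_def by blast
  then have "hn f = hn l \<cdot> k" "hn l \<in> hm N0 B" by (auto simp: hm_iff)
  then show ?thesis unfolding through_def using * by blast
qed

lemma through_add:
  assumes "\<And>A B P i j p q. \<lbrakk>biproduct X A B P i j p q; A \<in> K; B \<in> K\<rbrakk> \<Longrightarrow> P \<in> K"
   and "through K A B f" "through K A B g" shows "through K A B (f \<plusminus> g)"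
proof -
  obtain N0 k l where *: "N0 \<in> K" "k \<in> hm A N0" "l \<in> hm N0 B" "f = l \<cdot> k" using assms(2) unfolding
      through_def by blast
  obtain N1 k1 l1 where 1: "N1 \<in> K" "k1 \<in> hm A N1" "l1 \<in> hm N1 B" "g = l1 \<cdot> k1" using assms(3)
      unfolding through_def by blast
  obtain P i j p q where P: "biproduct X N0 N1 P i j p q" using ex_biproduct *(2) 1(2) hm_obj(2) by
      blast
  note b = biproductD[OF P]
  have "f \<plusminus> g = (l \<cdot> p \<plusminus> l1 \<cdot> q) \<cdot> (i \<cdot> k \<plusminus> j \<cdot> k1)"
    unfolding *(4) 1(4) using *(2,3) 1(2,3) b hm_obj(1)[OF *(2)] hm_obj(2)[OF *(3)] by (simp add:
        hm_iff distrib biproduct_re[OF P])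
  moreover have "l \<cdot> p \<plusminus> l1 \<cdot> q \<in> hm P B" "i \<cdot> k \<plusminus> j \<cdot> k1 \<in> hm A P" using *(2,3) 1(2,3) b by
      (simp_all add: hm_iff)
  ultimately show ?thesis unfolding through_def using assms(1)[OF P] * 1 by blast
qed

lemma through_N_add: "\<lbrakk>through N A B f; through N A B g\<rbrakk> \<Longrightarrow> through N A B (f \<plusminus> g)"
  by (rule through_add[OF N_biproduct])

lemma through_mono: "\<lbrakk>through K A B f; K \<subseteq> L\<rbrakk> \<Longrightarrow> through L A B f"
  unfolding through_def by blast

lemma through_hz: "\<lbrakk>A \<in> Obj X; B \<in> Obj X\<rbrakk> \<Longrightarrow> through N A B (hz A B)"
proof -
  assume "A \<in> Obj X" "B \<in> Obj X"
  moreover obtain Z where "Z \<in> Obj X" "zero_object X Z" by (rule zero_objE)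
  moreover have "hz A B = hz Z B \<cdot> hz A Z" using calculation by simp
  ultimately show ?thesis unfolding through_def using V_N UV.cot_zero(2) hz_hm by metis
qed

text \<open>Embed the intermediate object in an object of \<open>V\<close> with cone in
  \<open>S\<close>; the second factor extends because its target is in \<open>T\<close>. This
  sharper factorization is what allows squares to be corrected strictly later on.\<close>

lemma through_N_V:
  assumes "through N A B f" "B \<in> T" shows "through V A B f"
proof -
  obtain N0 k l where *: "N0 \<in> N" "k \<in> hm A N0" "l \<in> hm N0 B" "f = l \<cdot> k" using assms(1) unfolding
      through_def by blast
  obtain V2 S2 a q \<kappa> where 2: "tri N0 V2 S2 a q \<kappa>" "V2 \<in> V" "S2 \<in> S" by (rule NfE[OF *(1)])
  obtain g where g: "g \<in> hm V2 B" "g \<cdot> a = l"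
    using extend_wC[OF assms(2) wC_I[OF 2(1,3)] tri_hm(1)[OF 2(1)] *(3)] by blast
  have "f = g \<cdot> (a \<cdot> k)" "a \<cdot> k \<in> hm A V2" using g * triD[OF 2(1)] by (auto simp: hm_iff)
  then show ?thesis unfolding through_def using g(1) 2(2) by blast
qed

lemma wF_diff:
  assumes "p \<in> wF" "p \<in> hm E B" "g \<in> hm A E" "g' \<in> hm A E" "p \<cdot> g = p \<cdot> g'"
  shows "through V A E (g \<plusminus> hn g')"
proof -
  obtain V0 x \<delta> where 0: "tri V0 E B x p \<delta>" "V0 \<in> V" by (rule wF_E[OF assms(1,2)])
  have "p \<cdot> (g \<plusminus> hn g') = hz A B" using assms(2-5) by (simp add: hm_iff distrib)
  then obtain a where "a \<in> hm A V0" "g \<plusminus> hn g' = x \<cdot> a"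
    using tri_factor_left[OF 0(1) add_hm[OF assms(3) neg_hm[OF assms(4)]]] by blast
  then show ?thesis unfolding through_def using 0(2) tri_hm(1)[OF 0(1)] by blast
qed

lemma wC_diff:
  assumes "i \<in> wC" "i \<in> hm A E" "g \<in> hm E B" "g' \<in> hm E B" "g \<cdot> i = g' \<cdot> i"
  shows "through S E B (g \<plusminus> hn g')"
proof -
  obtain S0 y \<delta> where 0: "tri A E S0 i y \<delta>" "S0 \<in> S" by (rule wC_E[OF assms(1,2)])
  have "(g \<plusminus> hn g') \<cdot> i = hz A B" using assms(2-5) by (simp add: hm_iff distrib)
  then obtain a where "a \<in> hm S0 B" "g \<plusminus> hn g' = a \<cdot> y"
    using tri_factor_right[OF 0(1) add_hm[OF assms(3) neg_hm[OF assms(4)]]] by blast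
  then show ?thesis unfolding through_def using 0(2) tri_hm(2)[OF 0(1)] by blast
qed

text \<open>The factor into \<open>V\<close> extends along \<open>i\<close> because \<open>V\<close>
  is contained in \<open>T\<close>. Subtracting the extended composite leaves an arrow that vanishes
  on \<open>A\<close>, hence factors through \<open>S\<close>.\<close>

lemma extension_through:
  assumes "i \<in> wC" "i \<in> hm A A'" "through V A B (g \<cdot> i)" "g \<in> hm A' B"
  shows "through N A' B g"
proof -
  obtain V0 k l where k: "V0 \<in> V" "k \<in> hm A V0" "l \<in> hm V0 B" "g \<cdot> i = l \<cdot> k"
    using assms(3) unfolding through_def by blast
  obtain k' where k': "k' \<in> hm A' V0" "k' \<cdot> i = k" using extend_wC[OF V_T[OF k(1)] assms(1,2) k(2)]
      by blast
  have "g \<cdot> i = (l \<cdot> k') \<cdot> i" using k k' assms(2) by (simp add: hm_iff)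
  moreover have lk: "l \<cdot> k' \<in> hm A' B" using k k' by (simp add: hm_iff)
  ultimately have "through S A' B (g \<plusminus> hn (l \<cdot> k'))" using wC_diff[OF assms(1,2,4)] by blast
  then have 1: "through N A' B (g \<plusminus> hn (l \<cdot> k'))" using through_mono S_N by blast
  have 2: "through N A' B (l \<cdot> k')" unfolding through_def using V_N k k' by blast
  have "g = (g \<plusminus> hn (l \<cdot> k')) \<plusminus> (l \<cdot> k')"
    using assms(4) lk by (simp add: hm_iff aassoc)
  then show ?thesis using through_N_add[OF 1 2] by simp
qed

end

section \<open>Arrows of the localization\<close>

context hovey
begin

subsection \<open>Replacements\<close>

text \<open>The replacement \<open>Zo A\<close> is linked to \<open>A\<close> by a span
  \<open>A \<leftarrow> Qo A \<rightarrow> Zo A\<close>; in general there is no direct arrow between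
  them.\<close>

definition qr :: "'o \<Rightarrow> 'm" where "qr A = (SOME q. q \<in> wF \<and> Cod X q = A \<and> Dom X q \<in> U)"
definition Qo :: "'o \<Rightarrow> 'o" where "Qo A = Dom X (qr A)"
definition rr :: "'o \<Rightarrow> 'm" where "rr A = (SOME r. r \<in> wC \<and> Dom X r = A \<and> Cod X r \<in> T)"
definition Ro :: "'o \<Rightarrow> 'o" where "Ro A = Cod X (rr A)"
abbreviation Zo :: "'o \<Rightarrow> 'o" where "Zo A \<equiv> Ro (Qo A)"
abbreviation jr :: "'o \<Rightarrow> 'm" where "jr A \<equiv> rr (Qo A)"

lemma qr:
  assumes "A \<in> Obj X"
  shows "qr A \<in> wF" "qr A \<in> hm (Qo A) A" "Qo A \<in> U" "Qo A \<in> Obj X"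
proof -
  obtain V0 U0 x y \<delta> where d: "tri V0 U0 A x y \<delta>" "V0 \<in> V" "U0 \<in> U" using UV.cot_left[OF assms] .
  have "y \<in> wF \<and> Cod X y = A \<and> Dom X y \<in> U" using wF_I[OF d(1,2)] triD[OF d(1)] d(3) by simp
  then have *: "qr A \<in> wF \<and> Cod X (qr A) = A \<and> Dom X (qr A) \<in> U"
    unfolding qr_def by (rule someI)
  then show "qr A \<in> wF" "qr A \<in> hm (Qo A) A" "Qo A \<in> U" using wF_arr by (auto simp: Qo_def hm_iff)
  then show "Qo A \<in> Obj X" using UV.cot_obj by blast
qed

lemma rr:
  assumes "A \<in> Obj X"
  shows "rr A \<in> wC" "rr A \<in> hm A (Ro A)" "Ro A \<in> T" "Ro A \<in> Obj X"
proof -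
  obtain V0 U0 x y \<delta> where d: "tri A V0 U0 x y \<delta>" "V0 \<in> T" "U0 \<in> S" using ST.cot_right[OF assms] .
  have "x \<in> wC \<and> Dom X x = A \<and> Cod X x \<in> T" using wC_I[OF d(1,3)] triD[OF d(1)] d(2) by simp
  then have *: "rr A \<in> wC \<and> Dom X (rr A) = A \<and> Cod X (rr A) \<in> T"
    unfolding rr_def by (rule someI)
  then show "rr A \<in> wC" "rr A \<in> hm A (Ro A)" "Ro A \<in> T" using wC_arr by (auto simp: Ro_def hm_iff)
  then show "Ro A \<in> Obj X" using ST.cot_obj by blast
qed

text \<open>The cone is in \<open>S\<close>, hence in \<open>U\<close>, which is closed under
  extensions. So fibrant replacement keeps \<open>Qo A\<close> cofibrant.\<close>

lemma wC_U:
  assumes "i \<in> wC" "i \<in> hm A E" "A \<in> U" shows "E \<in> U"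
proof -
  obtain S0 y \<delta> where "tri A E S0 i y \<delta>" "S0 \<in> S" by (rule wC_E[OF assms(1,2)])
  then show ?thesis using UV.cot_left_extension assms(3) S_U by blast
qed

lemma Zo: assumes "A \<in> Obj X" shows "Zo A \<in> U" "Zo A \<in> T" "Zo A \<in> Obj X"
  using qr[OF assms] rr[of "Qo A"] wC_U by blast+

section \<open>The congruence modulo arrows through \<open>N\<close>\<close>

definition eqv :: "'o \<Rightarrow> 'o \<Rightarrow> 'm \<Rightarrow> 'm \<Rightarrow> bool" where
  "eqv A B f g \<longleftrightarrow> f \<in> hm A B \<and> g \<in> hm A B \<and> through N A B (f \<plusminus> hn g)"

lemma eqv_refl: "f \<in> hm A B \<Longrightarrow> eqv A B f f"
  unfolding eqv_def using through_hz[of A B] hm_obj[of f A B] by (simp add: hm_iff)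

lemma eqv_sym: assumes "eqv A B f g" shows "eqv A B g f"
proof -
  have "hn (f \<plusminus> hn g) = g \<plusminus> hn f"
    using assms neg_add[of f A B "hn g"] acomm[of "hn f" g] unfolding eqv_def by (simp add: hm_iff)
  then show ?thesis using assms through_neg[of N A B "f \<plusminus> hn g"] unfolding eqv_def by simp
qed

lemma eqv_trans: assumes "eqv A B f g" "eqv A B g h" shows "eqv A B f h"
proof -
  have "f \<plusminus> hn h = (f \<plusminus> hn g) \<plusminus> (g \<plusminus> hn h)"
    using assms unfolding eqv_def by (simp add: hm_iff aassoc)
  then show ?thesis using assms through_N_add unfolding eqv_def by simp
qed

lemma eqv_cmp: assumes "eqv A B f f'" "eqv B D g g'" shows "eqv A D (g \<cdot> f) (g' \<cdot> f')"
proof -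
  have h: "f \<in> hm A B" "f' \<in> hm A B" "g \<in> hm B D" "g' \<in> hm B D" using assms unfolding eqv_def by
      auto
  have "(g \<cdot> f) \<plusminus> hn (g' \<cdot> f') = g \<cdot> (f \<plusminus> hn f') \<plusminus> (g \<plusminus> hn g') \<cdot> f'"
    using h by (simp add: hm_iff aassoc distrib)
  moreover have "through N A D (g \<cdot> (f \<plusminus> hn f'))" "through N A D ((g \<plusminus> hn g') \<cdot> f')"
    using assms through_left[of N A B _ g D] through_right[of N B D _ f' A] h unfolding eqv_def by
        blast+
  ultimately show ?thesis unfolding eqv_def using h through_N_add by (simp add: hm_iff)
qed

lemma eqv_add: assumes "eqv A B f f'" "eqv A B g g'" shows "eqv A B (f \<plusminus> g) (f' \<plusminus> g')"
proof -
  have h: "f \<in> hm A B" "f' \<in> hm A B" "g \<in> hm A B" "g' \<in> hm A B" using assms unfolding eqv_def by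
      auto
  have "(f \<plusminus> g) \<plusminus> hn (f' \<plusminus> g') = (f \<plusminus> hn f') \<plusminus> (g \<plusminus> hn g')"
    using h by (simp add: hm_iff aassoc neg_add[of _ A B] alcomm[of "hn f'"])
  then show ?thesis using assms through_N_add h unfolding eqv_def by (simp add: hm_iff)
qed

lemma eqv_hm: "eqv A B f g \<Longrightarrow> f \<in> hm A B" "eqv A B f g \<Longrightarrow> g \<in> hm A B"
  by (auto simp: eqv_def)

text \<open>The common uniqueness argument for lifting and then extending: \<open>f\<close> and
  \<open>f'\<close> differ through \<open>V\<close>, hence so do \<open>g \<cdot> i\<close> and
  \<open>g' \<cdot> i\<close>, and \<open>extension_through\<close> passes this on to
  \<open>g\<close> and \<open>g'\<close>.\<close>

lemma eqv_lift_ext: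
  assumes "i \<in> wC" "i \<in> hm A A'" "g \<in> hm A' B'" "g' \<in> hm A' B'" "j \<in> hm B B'" "f \<in> hm A B" "f' \<in> hm
      A B"
    "g \<cdot> i = j \<cdot> f" "g' \<cdot> i = j \<cdot> f'" "p \<in> wF" "p \<in> hm B D" "p \<cdot> f = p \<cdot> f'"
  shows "eqv A' B' g g'"
proof -
  have "through V A B' (j \<cdot> (f \<plusminus> hn f'))"
    by (rule through_left[OF wF_diff[OF assms(10,11,6,7,12)] assms(5)])
  moreover have "j \<cdot> (f \<plusminus> hn f') = (g \<plusminus> hn g') \<cdot> i"
    using assms(2-9) by (simp add: hm_iff distrib)
  ultimately show ?thesis
    using extension_through[OF assms(1,2), of B' "g \<plusminus> hn g'"] assms(3,4) unfolding eqv_def by (simp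
        add: hm_iff)
qed

lemma eqv_ext:
  assumes "i \<in> wC" "i \<in> hm A A'" "g \<in> hm A' B'" "g' \<in> hm A' B'" "g \<cdot> i = g' \<cdot> i"
  shows "eqv A' B' g g'"
  using wC_diff[OF assms] through_mono S_N assms(3,4) unfolding eqv_def by blast

text \<open>A relation instead of a function: the lift \<open>f'\<close> and the extension
  \<open>g\<close> are both free choices. Composition and sums are then compatible on the nose, and
  only uniqueness is up to \<open>eqv\<close>.\<close>

definition rep :: "'o \<Rightarrow> 'o \<Rightarrow> 'm \<Rightarrow> 'm \<Rightarrow> bool" where
  "rep A B f g \<longleftrightarrow> f \<in> hm A B \<and> g \<in> hm (Zo A) (Zo B) \<and>
     (\<exists>f'\<in>hm (Qo A) (Qo B). qr B \<cdot> f' = f \<cdot> qr A \<and> g \<cdot> jr A = jr B \<cdot> f')"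

lemma rep_ex: assumes "f \<in> hm A B" shows "\<exists>g. rep A B f g"
proof -
  have o: "A \<in> Obj X" "B \<in> Obj X" using assms hm_obj by blast+
  obtain f' where f': "f' \<in> hm (Qo A) (Qo B)" "qr B \<cdot> f' = f \<cdot> qr A"
    using lift_wF[OF qr(3)[OF o(1)] qr(1,2)[OF o(2)] cmp_hom[OF qr(2)[OF o(1)] assms]] by blast
  obtain g where "g \<in> hm (Zo A) (Zo B)" "g \<cdot> jr A = jr B \<cdot> f'"
    using extend_wC[OF rr(3) rr(1,2) cmp_hom[OF f'(1) rr(2)]] qr(4) o by blast
  then show ?thesis using f' assms unfolding rep_def by blast
qed

lemma rep_unique: assumes "rep A B f g" "rep A B f g'" shows "eqv (Zo A) (Zo B) g g'"
proof -
  have o: "A \<in> Obj X" "B \<in> Obj X" using assms hm_obj unfolding rep_def by blast+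
  note oq = qr(4)[OF o(1)] qr(4)[OF o(2)]
  obtain f1 where f1: "f1 \<in> hm (Qo A) (Qo B)" "qr B \<cdot> f1 = f \<cdot> qr A" "g \<cdot> jr A = jr B \<cdot> f1" "g \<in> hm
      (Zo A) (Zo B)"
    using assms(1) unfolding rep_def by blast
  obtain f2 where f2: "f2 \<in> hm (Qo A) (Qo B)" "qr B \<cdot> f2 = f \<cdot> qr A" "g' \<cdot> jr A = jr B \<cdot> f2" "g' \<in>
      hm (Zo A) (Zo B)"
    using assms(2) unfolding rep_def by blast
  show ?thesis
    by (rule eqv_lift_ext[OF rr(1,2)[OF oq(1)] f1(4) f2(4) rr(2)[OF oq(2)] f1(1) f2(1) f1(3) f2(3)
        qr(1,2)[OF o(2)]])
      (simp add: f1(2) f2(2))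
qed

lemma rep_cmp: assumes "rep A B f g" "rep B D f' g'" shows "rep A D (f' \<cdot> f) (g' \<cdot> g)"
proof -
  have h: "f \<in> hm A B" "f' \<in> hm B D" "g \<in> hm (Zo A) (Zo B)" "g' \<in> hm (Zo B) (Zo D)" using assms
      unfolding rep_def by auto
  have o: "A \<in> Obj X" "B \<in> Obj X" "D \<in> Obj X" using hm_obj h by blast+
  note oh = rr(2)[OF qr(4)[OF o(1)]] rr(2)[OF qr(4)[OF o(2)]] rr(2)[OF qr(4)[OF o(3)]] qr(2)[OF
      o(1)] qr(2)[OF o(2)] qr(2)[OF o(3)]
  obtain f1 where f1: "f1 \<in> hm (Qo A) (Qo B)" "qr B \<cdot> f1 = f \<cdot> qr A" "g \<cdot> jr A = jr B \<cdot> f1"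
    using assms(1) unfolding rep_def by blast
  obtain f2 where f2: "f2 \<in> hm (Qo B) (Qo D)" "qr D \<cdot> f2 = f' \<cdot> qr B" "g' \<cdot> jr B = jr D \<cdot> f2"
    using assms(2) unfolding rep_def by blast
  have "qr D \<cdot> (f2 \<cdot> f1) = (f' \<cdot> f) \<cdot> qr A" "(g' \<cdot> g) \<cdot> jr A = jr D \<cdot> (f2 \<cdot> f1)"
    using h oh f1(1) f2(1) f1(2,3) reassoc[OF f2(2), of f1] reassoc[OF f2(3), of f1] by (simp_all
        add: hm_iff)
  then show ?thesis unfolding rep_def using cmp_hom h f1(1) f2(1) by blast
qed

lemma rep_idn: assumes "A \<in> Obj X" shows "rep A A (Idn X A) (Idn X (Zo A))"
  unfolding rep_def using qr[OF assms] rr[OF qr(4)[OF assms]] assms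
  by (auto simp: hm_iff intro!: bexI[of _ "Idn X (Qo A)"])

lemma rep_add: assumes "rep A B f g" "rep A B f' g'" shows "rep A B (f \<plusminus> f') (g \<plusminus> g')"
proof -
  have h: "f \<in> hm A B" "f' \<in> hm A B" "g \<in> hm (Zo A) (Zo B)" "g' \<in> hm (Zo A) (Zo B)" using assms
      unfolding rep_def by auto
  have o: "A \<in> Obj X" "B \<in> Obj X" using hm_obj h by blast+
  note oh = rr(2)[OF qr(4)[OF o(1)]] rr(2)[OF qr(4)[OF o(2)]] qr(2)[OF o(1)] qr(2)[OF o(2)]
  obtain f1 where f1: "f1 \<in> hm (Qo A) (Qo B)" "qr B \<cdot> f1 = f \<cdot> qr A" "g \<cdot> jr A = jr B \<cdot> f1"
    using assms(1) unfolding rep_def by blast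
  obtain f2 where f2: "f2 \<in> hm (Qo A) (Qo B)" "qr B \<cdot> f2 = f' \<cdot> qr A" "g' \<cdot> jr A = jr B \<cdot> f2"
    using assms(2) unfolding rep_def by blast
  have "qr B \<cdot> (f1 \<plusminus> f2) = (f \<plusminus> f') \<cdot> qr A" "(g \<plusminus> g') \<cdot> jr A = jr B \<cdot> (f1 \<plusminus> f2)"
    using h oh f1 f2 by (simp_all add: hm_iff distrib)
  then show ?thesis unfolding rep_def using add_hm h f1(1) f2(1) by blast
qed

subsection \<open>Weak equivalences become invertible\<close>

definition rep_invertible :: "'o \<Rightarrow> 'o \<Rightarrow> 'm \<Rightarrow> bool" where
  "rep_invertible A B w \<longleftrightarrow> (\<exists>g h. rep A B w g \<and> h \<in> hm (Zo B) (Zo A) \<and>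
     eqv (Zo A) (Zo A) (h \<cdot> g) (Idn X (Zo A)) \<and> eqv (Zo B) (Zo B) (g \<cdot> h) (Idn X (Zo B)))"

text \<open>The composite \<open>w \<cdot> qr A\<close> is another cofibrant replacement of
  \<open>B\<close>. Lifting the two against each other gives arrows whose round trips solve the same
  lifting problems as identities.\<close>

lemma rep_invertible_wF:
  assumes w: "w \<in> wF" "w \<in> hm A B" shows "rep_invertible A B w"
proof -
  have o: "A \<in> Obj X" "B \<in> Obj X" using hm_obj w by blast+
  note oq = qr(4)[OF o(1)] qr(4)[OF o(2)]
  note jA = rr[OF oq(1)] and jB = rr[OF oq(2)] and qA = qr[OF o(1)] and qB = qr[OF o(2)]
  have wq: "w \<cdot> qr A \<in> wF" "w \<cdot> qr A \<in> hm (Qo A) B" using wF_cmp[OF qA(1) w(1) qA(2) w(2)]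
      cmp_hom[OF qA(2) w(2)] by auto
  obtain h where h: "h \<in> hm (Qo B) (Qo A)" "(w \<cdot> qr A) \<cdot> h = qr B" using lift_wF[OF qB(3) wq qB(2)]
      by blast
  obtain f where f: "f \<in> hm (Qo A) (Qo B)" "qr B \<cdot> f = w \<cdot> qr A" using lift_wF[OF qA(3) qB(1,2)
      wq(2)] by blast
  obtain g where g: "g \<in> hm (Zo A) (Zo B)" "g \<cdot> jr A = jr B \<cdot> f" using extend_wC[OF jB(3) jA(1,2)
      cmp_hom[OF f(1) jB(2)]] by blast
  obtain k where k: "k \<in> hm (Zo B) (Zo A)" "k \<cdot> jr B = jr A \<cdot> h" using extend_wC[OF jA(3) jB(1,2)
      cmp_hom[OF h(1) jA(2)]] by blast
  note hs = jA(2,4) jB(2,4) qA(2) qB(2) w(2) oq h(1) f(1) g(1) k(1)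
  have "rep A B w g" using w f g unfolding rep_def by blast
  moreover have "eqv (Zo A) (Zo A) (k \<cdot> g) (Idn X (Zo A))"
    by (rule eqv_lift_ext[OF jA(1,2) _ _ jA(2), of _ _ "h \<cdot> f" "Idn X (Qo A)", OF _ _ _ _ _ _ wq])
      (use hs g(2) f(2) reassoc[OF k(2), of f] reassoc[OF h(2), of f] in \<open>simp_all add: hm_iff\<close>)
  moreover have "eqv (Zo B) (Zo B) (g \<cdot> k) (Idn X (Zo B))"
    by (rule eqv_lift_ext[OF jB(1,2) _ _ jB(2), of _ _ "f \<cdot> h" "Idn X (Qo B)", OF _ _ _ _ _ _
        qB(1,2)])
      (use hs k(2) h(2) reassoc[OF g(2), of h] reassoc[OF f(2), of h] in \<open>simp_all add: hm_iff\<close>)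
  ultimately show ?thesis using k(1) unfolding rep_invertible_def by blast
qed

lemma rep_invertible_wC:
  assumes w: "w \<in> wC" "w \<in> hm A B" shows "rep_invertible A B w"
proof -
  have o: "A \<in> Obj X" "B \<in> Obj X" using hm_obj w by blast+
  note oq = qr(4)[OF o(1)] qr(4)[OF o(2)]
  note jA = rr[OF oq(1)] and jB = rr[OF oq(2)] and qA = qr[OF o(1)] and qB = qr[OF o(2)]
  obtain E i p where E: "i \<in> wC" "p \<in> wF" "i \<in> hm (Qo A) E" "p \<in> hm E B" "w \<cdot> qr A = p \<cdot> i"
    by (rule wC_after_wF[OF qA(1,2) w])
  have EU: "E \<in> U" "E \<in> Obj X" using wC_U[OF E(1,3) qA(3)] hm_obj E(3) by blast+
  note rE = rr[OF EU(2)]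
  obtain e where e: "e \<in> hm E (Qo B)" "qr B \<cdot> e = p" using lift_wF[OF EU(1) qB(1,2) E(4)] by blast
  obtain h where h: "h \<in> hm (Qo B) E" "p \<cdot> h = qr B" using lift_wF[OF qB(3) E(2,4) qB(2)] by blast
  have c: "rr E \<cdot> i \<in> wC" "rr E \<cdot> i \<in> hm (Qo A) (Ro E)" using wC_cmp[OF E(1) rE(1) E(3) rE(2)]
      cmp_hom[OF E(3) rE(2)] by auto
  obtain g0 where g0: "g0 \<in> hm (Zo A) (Ro E)" "g0 \<cdot> jr A = rr E \<cdot> i" using extend_wC[OF rE(3)
      jA(1,2) c(2)] by blast
  obtain g2 where g2: "g2 \<in> hm (Ro E) (Zo A)" "g2 \<cdot> (rr E \<cdot> i) = jr A" using extend_wC[OF jA(3) c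
      jA(2)] by blast
  obtain e1 where e1: "e1 \<in> hm (Ro E) (Zo B)" "e1 \<cdot> rr E = jr B \<cdot> e" using extend_wC[OF jB(3)
      rE(1,2) cmp_hom[OF e(1) jB(2)]] by blast
  obtain h1 where h1: "h1 \<in> hm (Zo B) (Ro E)" "h1 \<cdot> jr B = rr E \<cdot> h" using extend_wC[OF rE(3)
      jB(1,2) cmp_hom[OF h(1) rE(2)]] by blast
  note hs = jA(2,4) jB(2,4) rE(2,4) qA(2) qB(2) w(2) oq EU(2) h(1) e(1) g0(1) g2(1) e1(1) h1(1)
      E(3,4)
  have "qr B \<cdot> (e \<cdot> i) = w \<cdot> qr A" "(e1 \<cdot> g0) \<cdot> jr A = jr B \<cdot> (e \<cdot> i)"
    using hs g0(2) E(5) reassoc[OF e(2), of i] reassoc[OF e1(2), of i] by (simp_all add: hm_iff)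
  then have "rep A B w (e1 \<cdot> g0)" using w cmp_hom hs unfolding rep_def by blast
  moreover have he: "eqv (Ro E) (Ro E) (h1 \<cdot> e1) (Idn X (Ro E))"
    by (rule eqv_lift_ext[OF rE(1,2) _ _ rE(2), of _ _ "h \<cdot> e" "Idn X E", OF _ _ _ _ _ _ E(2,4)])
      (use hs e(2) e1(2) reassoc[OF h1(2), of e] reassoc[OF h(2), of e] in \<open>simp_all add: hm_iff\<close>)
  have eh: "eqv (Zo B) (Zo B) (e1 \<cdot> h1) (Idn X (Zo B))"
    by (rule eqv_lift_ext[OF jB(1,2) _ _ jB(2), of _ _ "e \<cdot> h" "Idn X (Qo B)", OF _ _ _ _ _ _
        qB(1,2)])
      (use hs h(2) h1(2) reassoc[OF e1(2), of h] reassoc[OF e(2), of h] in \<open>simp_all add: hm_iff\<close>)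
  have gg: "eqv (Zo A) (Zo A) (g2 \<cdot> g0) (Idn X (Zo A))"
    by (rule eqv_ext[OF jA(1,2)]) (use hs g0(2) g2(2) in \<open>simp_all add: hm_iff\<close>)
  have gg': "eqv (Ro E) (Ro E) (g0 \<cdot> g2) (Idn X (Ro E))"
    by (rule eqv_ext[OF c]) (use hs g0(2) g2(2) in \<open>simp_all add: hm_iff\<close>)
  have "eqv (Zo A) (Zo A) (g2 \<cdot> (h1 \<cdot> e1) \<cdot> g0) (g2 \<cdot> Idn X (Ro E) \<cdot> g0)"
    using eqv_cmp[OF eqv_cmp[OF eqv_refl[OF g0(1)] he] eqv_refl[OF g2(1)]] .
  then have 1: "eqv (Zo A) (Zo A) ((g2 \<cdot> h1) \<cdot> (e1 \<cdot> g0)) (Idn X (Zo A))"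
    using eqv_trans[OF _ gg] hs by (simp add: hm_iff)
  have "eqv (Zo B) (Zo B) (e1 \<cdot> (g0 \<cdot> g2) \<cdot> h1) (e1 \<cdot> Idn X (Ro E) \<cdot> h1)"
    using eqv_cmp[OF eqv_cmp[OF eqv_refl[OF h1(1)] gg'] eqv_refl[OF e1(1)]] .
  then have 2: "eqv (Zo B) (Zo B) ((e1 \<cdot> g0) \<cdot> (g2 \<cdot> h1)) (Idn X (Zo B))"
    using eqv_trans[OF _ eh] hs by (simp add: hm_iff)
  have "g2 \<cdot> h1 \<in> hm (Zo B) (Zo A)" using cmp_hom hs by blast
  with calculation 1 2 show ?thesis unfolding rep_invertible_def by blast
qed

lemma rep_invertible_W:
  assumes w: "w \<in> W" "w \<in> hm A B" shows "rep_invertible A B w"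
proof -
  obtain i p E where E: "i \<in> wC" "p \<in> wF" "i \<in> hm A E" "p \<in> hm E B" "w = p \<cdot> i" by (rule weqE[OF w])
  obtain g h where g: "rep A E i g" "h \<in> hm (Zo E) (Zo A)"
     "eqv (Zo A) (Zo A) (h \<cdot> g) (Idn X (Zo A))" "eqv (Zo E) (Zo E) (g \<cdot> h) (Idn X (Zo E))"
    using rep_invertible_wC[OF E(1,3)] unfolding rep_invertible_def by blast
  obtain g' h' where g': "rep E B p g'" "h' \<in> hm (Zo B) (Zo E)"
     "eqv (Zo E) (Zo E) (h' \<cdot> g') (Idn X (Zo E))" "eqv (Zo B) (Zo B) (g' \<cdot> h') (Idn X (Zo B))"
    using rep_invertible_wF[OF E(2,4)] unfolding rep_invertible_def by blast
  have hs: "g \<in> hm (Zo A) (Zo E)" "g' \<in> hm (Zo E) (Zo B)" using g(1) g'(1) unfolding rep_def by auto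
  have "eqv (Zo A) (Zo A) (h \<cdot> (h' \<cdot> g') \<cdot> g) (h \<cdot> Idn X (Zo E) \<cdot> g)"
    using eqv_cmp[OF eqv_cmp[OF eqv_refl[OF hs(1)] g'(3)] eqv_refl[OF g(2)]] .
  then have 1: "eqv (Zo A) (Zo A) ((h \<cdot> h') \<cdot> (g' \<cdot> g)) (Idn X (Zo A))"
    using eqv_trans[OF _ g(3)] hs g(2) g'(2) by (simp add: hm_iff)
  have "eqv (Zo B) (Zo B) (g' \<cdot> (g \<cdot> h) \<cdot> h') (g' \<cdot> Idn X (Zo E) \<cdot> h')"
    using eqv_cmp[OF eqv_cmp[OF eqv_refl[OF g'(2)] g(4)] eqv_refl[OF hs(2)]] .
  then have 2: "eqv (Zo B) (Zo B) ((g' \<cdot> g) \<cdot> (h \<cdot> h')) (Idn X (Zo B))"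
    using eqv_trans[OF _ g'(4)] hs g(2) g'(2) by (simp add: hm_iff)
  have "h \<cdot> h' \<in> hm (Zo B) (Zo A)" using cmp_hom g(2) g'(2) by blast
  with rep_cmp[OF g(1) g'(1)] 1 2 show ?thesis unfolding rep_invertible_def E(5) by blast
qed

subsection \<open>The homotopy category of replacements\<close>

definition kcls :: "'o \<Rightarrow> 'o \<Rightarrow> 'm \<Rightarrow> 'o \<times> 'm set \<times> 'o" where
  "kcls A B g = (A, {g'. eqv (Zo A) (Zo B) g g'}, B)"

text \<open>Its role is to separate arrows of the localization. Source and target are stored with
  the class because different objects may have the same replacement; composing over all
  representatives avoids a choice.\<close>

definition K :: "('o, 'o \<times> 'm set \<times> 'o) cat" where
  "K = \<lparr>Obj = Obj X,
     Arr = {kcls A B g | A B g. A \<in> Obj X \<and> B \<in> Obj X \<and> g \<in> hm (Zo A) (Zo B)},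
     Dom = fst, Cod = (\<lambda>t. snd (snd t)), Idn = (\<lambda>A. kcls A A (Idn X (Zo A))),
     Cmp = (\<lambda>(B', s, D) (A, r, B). (A, {t. \<exists>f\<in>r. \<exists>g\<in>s. eqv (Zo A) (Zo D) (g \<cdot> f) t}, D))\<rparr>"

lemma kcls_eq_iff: "g \<in> hm (Zo A) (Zo B) \<Longrightarrow> kcls A B g = kcls A B g' \<longleftrightarrow> eqv (Zo A) (Zo B) g g'"
  unfolding kcls_def using eqv_refl eqv_sym eqv_trans by blast

lemma K_simps [simp]: "Obj K = Obj X" "Dom K (kcls A B g) = A" "Cod K (kcls A B g) = B"
  "Idn K A = kcls A A (Idn X (Zo A))"
  by (simp_all add: K_def kcls_def)

lemma K_hom_iff: "\<alpha> \<in> Hom K A B \<longleftrightarrow> A \<in> Obj X \<and> B \<in> Obj X \<and> (\<exists>g\<in>hm (Zo A) (Zo B). \<alpha> = kcls A B g)"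
proof
  assume "\<alpha> \<in> Hom K A B"
  then have "\<alpha> \<in> Arr K" "Dom K \<alpha> = A" "Cod K \<alpha> = B" by (simp_all add: Hom_def)
  moreover then obtain A' B' g where "\<alpha> = kcls A' B' g" "A' \<in> Obj X" "B' \<in> Obj X" "g \<in> hm (Zo A')
      (Zo B')"
    unfolding K_def by force
  ultimately show "A \<in> Obj X \<and> B \<in> Obj X \<and> (\<exists>g\<in>hm (Zo A) (Zo B). \<alpha> = kcls A B g)" by auto
next
  assume "A \<in> Obj X \<and> B \<in> Obj X \<and> (\<exists>g\<in>hm (Zo A) (Zo B). \<alpha> = kcls A B g)"
  then obtain g where *: "A \<in> Obj X" "B \<in> Obj X" "g \<in> hm (Zo A) (Zo B)" "\<alpha> = kcls A B g" by blast
  then have "\<alpha> \<in> Arr K" unfolding K_def by auto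
  then show "\<alpha> \<in> Hom K A B" unfolding Hom_def using * by simp
qed

lemma K_cmp:
  assumes "g \<in> hm (Zo A) (Zo B)" "h \<in> hm (Zo B) (Zo D)"
  shows "kcls B D h \<cdot>\<^bsub>K\<^esub> kcls A B g = kcls A D (h \<cdot> g)"
proof -
  have "(\<exists>f\<in>{g'. eqv (Zo A) (Zo B) g g'}. \<exists>k\<in>{h'. eqv (Zo B) (Zo D) h h'}. eqv (Zo A) (Zo D) (k \<cdot> f)
      t)
     \<longleftrightarrow> eqv (Zo A) (Zo D) (h \<cdot> g) t" for t
    using eqv_refl[OF assms(1)] eqv_refl[OF assms(2)] eqv_cmp eqv_trans by blast
  then show ?thesis unfolding K_def kcls_def by simp
qed

lemma category_K: "category K"
proof
  fix f assume "f \<in> Arr K"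
  then have "f \<in> Hom K (Dom K f) (Cod K f)" by (simp add: Hom_def)
  then show "Dom K f \<in> Obj K" "Cod K f \<in> Obj K" unfolding K_hom_iff by auto
next
  fix A assume "A \<in> Obj K"
  then show "Idn K A \<in> Hom K A A" unfolding K_hom_iff using Zo(3) idn_hom by auto
next
  fix f g A B D assume "f \<in> Hom K A B" "g \<in> Hom K B D"
  then show "g \<cdot>\<^bsub>K\<^esub> f \<in> Hom K A D" unfolding K_hom_iff using K_cmp cmp_hom by metis
next
  fix f A B assume "f \<in> Hom K A B"
  then obtain g where g: "A \<in> Obj X" "B \<in> Obj X" "g \<in> hm (Zo A) (Zo B)" "f = kcls A B g" unfolding
      K_hom_iff by blast
  then show "Idn K B \<cdot>\<^bsub>K\<^esub> f = f" "f \<cdot>\<^bsub>K\<^esub> Idn K A = f"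
    using K_cmp[OF g(3) idn_hom[OF Zo(3)[OF g(2)]]] K_cmp[OF idn_hom[OF Zo(3)[OF g(1)]] g(3)]
        idn_left[OF g(3)] idn_right[OF g(3)]
    by auto
next
  fix f g h A B D E assume "f \<in> Hom K A B" "g \<in> Hom K B D" "h \<in> Hom K D E"
  then obtain f' g' h' where *: "f' \<in> hm (Zo A) (Zo B)" "f = kcls A B f'" "g' \<in> hm (Zo B) (Zo D)" "g
      = kcls B D g'"
     "h' \<in> hm (Zo D) (Zo E)" "h = kcls D E h'" unfolding K_hom_iff by blast
  note c = K_cmp[OF *(1,3)] K_cmp[OF *(3,5)] K_cmp[OF cmp_hom[OF *(1,3)] *(5)] K_cmp[OF *(1)
      cmp_hom[OF *(3,5)]]
  show "h \<cdot>\<^bsub>K\<^esub> (g \<cdot>\<^bsub>K\<^esub> f) = (h \<cdot>\<^bsub>K\<^esub> g) \<cdot>\<^bsub>K\<^esub> f"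
    unfolding * c using cmp_assoc[OF *(1,3,5)] by simp
qed

definition KF :: "('o, 'm, 'o, 'o \<times> 'm set \<times> 'o) func" where
  "KF = \<lparr>OMap = (\<lambda>A. A), AMap = (\<lambda>f. kcls (Dom X f) (Cod X f) (SOME g. rep (Dom X f) (Cod X f) f
      g))\<rparr>"

lemma KF_eq:
  assumes "rep A B f g" shows "AMap KF f = kcls A B g"
proof -
  have f: "Dom X f = A" "Cod X f = B" "g \<in> hm (Zo A) (Zo B)" using assms by (auto simp: rep_def
      hm_iff)
  have "eqv (Zo A) (Zo B) g (SOME g. rep A B f g)" using rep_unique[OF assms someI[of "rep A B f",
      OF assms]] .
  then have "kcls A B g = kcls A B (SOME g. rep A B f g)" by (simp only: kcls_eq_iff[OF f(3)])
  then show ?thesis by (simp add: KF_def f)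
qed

lemma KF_functor: "is_functor X K KF"
  unfolding is_functor_def
proof (intro conjI ballI impI)
  fix A assume "A \<in> Obj X" then show "OMap KF A \<in> Obj K" by (simp add: KF_def)
next
  fix f assume f: "f \<in> Arr X"
  then obtain g where g: "rep (Dom X f) (Cod X f) f g" using rep_ex[of f "Dom X f" "Cod X f"] by
      (auto simp: hm_iff)
  then have "g \<in> hm (Zo (Dom X f)) (Zo (Cod X f))" unfolding rep_def by blast
  then show "AMap KF f \<in> Hom K (OMap KF (Dom X f)) (OMap KF (Cod X f))"
    unfolding KF_eq[OF g] K_hom_iff using f by (auto simp: KF_def)
next
  fix A assume "A \<in> Obj X"
  then show "AMap KF (Idn X A) = Idn K (OMap KF A)" using KF_eq[OF rep_idn] by (simp add: KF_def)
next
  fix f g assume fg: "f \<in> Arr X" "g \<in> Arr X" "Cod X f = Dom X g"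
  then obtain f' g' where r: "rep (Dom X f) (Dom X g) f f'" "rep (Dom X g) (Cod X g) g g'"
    using rep_ex[of f "Dom X f" "Dom X g"] rep_ex[of g "Dom X g" "Cod X g"] by (auto simp: hm_iff)
  then have "f' \<in> hm (Zo (Dom X f)) (Zo (Dom X g))" "g' \<in> hm (Zo (Dom X g)) (Zo (Cod X g))"
      unfolding rep_def by auto
  then show "AMap KF (g \<cdot> f) = AMap KF g \<cdot>\<^bsub>K\<^esub> AMap KF f"
    unfolding KF_eq[OF r(1)] KF_eq[OF r(2)] KF_eq[OF rep_cmp[OF r]] using K_cmp by simp
qed

lemma KF_inverts: assumes "w \<in> W" "w \<in> Arr X" shows "iso_arr K (AMap KF w)"
proof -
  interpret K: ccat K using category_K by (simp add: ccat_def)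
  let ?A = "Dom X w" and ?B = "Cod X w"
  have w: "w \<in> hm ?A ?B" using assms by (simp add: hm_iff)
  obtain g h where g: "rep ?A ?B w g" "h \<in> hm (Zo ?B) (Zo ?A)"
     "eqv (Zo ?A) (Zo ?A) (h \<cdot> g) (Idn X (Zo ?A))" "eqv (Zo ?B) (Zo ?B) (g \<cdot> h) (Idn X (Zo ?B))"
    using rep_invertible_W[OF assms(1) w] unfolding rep_invertible_def by blast
  have gh: "g \<in> hm (Zo ?A) (Zo ?B)" using g(1) unfolding rep_def by blast
  have "K.iso_hm ?A ?B (kcls ?A ?B g)"
    by (rule K.iso_hmI[of _ _ _ "kcls ?B ?A h"])
      (use g gh assms in \<open>auto simp: K_hom_iff K_cmp kcls_eq_iff cmp_hom intro: eqv_refl\<close>)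
  then show ?thesis unfolding KF_eq[OF g(1)] K.iso_arr_iff by blast
qed

end

subsection \<open>Arrows between cofibrant and fibrant objects\<close>

declare localization_simps(4) [simp del]

sublocale hovey \<subseteq> L: ccat "localization X (weq X S V)"
  using category_localization[OF category_axioms] by (simp add: ccat_def)

context hovey
begin

abbreviation "LL \<equiv> localization X W"
abbreviation lcmp :: "('o, 'm) loc_arr \<Rightarrow> ('o, 'm) loc_arr \<Rightarrow> ('o, 'm) loc_arr"  (infixr \<open>\<odot>\<close> 75) where
  "\<beta> \<odot> \<alpha> \<equiv> \<beta> \<cdot>\<^bsub>localization X W\<^esub> \<alpha>"
abbreviation linv :: "('o, 'm) loc_arr \<Rightarrow> ('o, 'm) loc_arr" where "linv \<alpha> \<equiv> inv_arr LL \<alpha>"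
abbreviation lc :: "'m \<Rightarrow> ('o, 'm) loc_arr" where "lc f \<equiv> loc X W f"

lemma lc_hm: "f \<in> hm A B \<Longrightarrow> lc f \<in> L.hm A B"
  using loc_functor_is_functor[OF category_axioms, of W]
  unfolding is_functor_def by (auto simp: hm_iff loc_functor_def)

lemma lc_arr [simp]:
  assumes "f \<in> Arr X" shows "lc f \<in> Arr LL" "Dom LL (lc f) = Dom X f" "Cod LL (lc f) = Cod X f"
  using lc_hm[of f "Dom X f" "Cod X f"] assms by (auto simp: hm_iff L.hm_iff)

lemma lc_idn: "A \<in> Obj X \<Longrightarrow> lc (Idn X A) = Idn LL A"
  using loc_functor_is_functor[OF category_axioms, of W]
  unfolding is_functor_def by (simp add: loc_functor_def)

lemma lc_cmp: "\<lbrakk>f \<in> hm A B; g \<in> hm B D\<rbrakk> \<Longrightarrow> lc (g \<cdot> f) = lc g \<odot> lc f"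
  using loc_functor_is_functor[OF category_axioms, of W]
  unfolding is_functor_def by (auto simp: hm_iff)

lemma lc_iso: assumes "w \<in> W" "w \<in> hm A B" shows "L.iso_hm A B (lc w)"
proof -
  have "w \<in> Arr X" "Dom X w = A" "Cod X w = B" using assms by (auto simp: hm_iff)
  then show ?thesis
    using loc_inverse[OF category_axioms assms(1)] lc_hm[OF assms(2)] L.iso_arr_hm unfolding
        iso_arr_def by metis
qed

text \<open>The sum \<open>N0 \<oplus> B\<close> acts as a cylinder. Its arrows \<open>c\<close> and
  \<open>q\<close> to \<open>B\<close> have the common section \<open>j\<close>, and
  \<open>q\<close> is a weak equivalence, so they become equal; \<open>f\<close> and
  \<open>g\<close> are \<open>c \<cdot> m\<close> and \<open>q \<cdot> m\<close>.\<close>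

lemma lc_eqv: assumes "eqv A B f g" shows "lc f = lc g"
proof -
  obtain N0 k l where N0: "N0 \<in> N" "k \<in> hm A N0" "l \<in> hm N0 B" "f \<plusminus> hn g = l \<cdot> k"
    using assms unfolding eqv_def through_def by blast
  have fg: "f \<in> hm A B" "g \<in> hm A B" using assms unfolding eqv_def by auto
  have o: "A \<in> Obj X" "B \<in> Obj X" "N0 \<in> Obj X" using hm_obj fg N0(2) by blast+
  obtain P i j p q where P: "biproduct X N0 B P i j p q" using ex_biproduct o by blast
  note b = biproductD[OF P]
  have bh: "j \<in> hm B P" "q \<in> hm P B" using b by (auto simp: hm_iff)
  have qW: "q \<in> W" using deflation_N_W[OF tri_biproduct[OF P] N0(1)] .
  define c where "c = l \<cdot> p \<plusminus> q"
  define m where "m = i \<cdot> k \<plusminus> j \<cdot> g"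
  have cm: "c \<in> hm P B" "m \<in> hm A P" unfolding c_def m_def using b N0(2,3) fg by (simp_all add:
      hm_iff)
  have f: "f = l \<cdot> k \<plusminus> g" unfolding N0(4)[symmetric] using fg by (simp add: hm_iff aassoc)
  have 1: "c \<cdot> m = f" "q \<cdot> m = g" "c \<cdot> j = Idn X B"
    unfolding f c_def m_def using b N0(2,3) fg o by (simp_all add: hm_iff distrib biproduct_re[OF
        P])
  have qj: "lc q \<odot> lc j = Idn LL B" "lc c \<odot> lc j = Idn LL B"
    using lc_cmp[OF bh] lc_cmp[OF bh(1) cm(1)] b 1(3) lc_idn by simp_all
  have "L.iso_hm B P (lc j)"
    by (rule L.iso_of_cmp_right[OF lc_iso[OF qW bh(2)] lc_hm[OF bh(1)]]) (use qj o in simp)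
  then have "lc c = lc q" using L.iso_cancel_right lc_hm cm(1) bh(2) qj by metis
  then show ?thesis using lc_cmp[OF cm(2) cm(1)] lc_cmp[OF cm(2) bh(2)] 1 by simp
qed

text \<open>The inverted span \<open>A \<leftarrow> Qo A \<rightarrow> Zo A\<close>. Conjugation by
  these isomorphisms identifies arrows \<open>A \<rightarrow> B\<close> with arrows
  \<open>Zo A \<rightarrow> Zo B\<close>.\<close>

definition th :: "'o \<Rightarrow> ('o, 'm) loc_arr" where
  "th A = lc (jr A) \<odot> linv (lc (qr A))"

lemma qr_iso: assumes "A \<in> Obj X" shows "L.iso_hm (Qo A) A (lc (qr A))"
  using lc_iso[OF wF_W] qr[OF assms] by blast

lemma rr_iso: assumes "A \<in> Obj X" shows "L.iso_hm A (Ro A) (lc (rr A))"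
  using lc_iso[OF wC_W] rr[OF assms] by blast

lemma th_iso: assumes "A \<in> Obj X" shows "L.iso_hm A (Zo A) (th A)"
  unfolding th_def by (rule L.iso_cmp[OF L.inv_arr_props(4)[OF qr_iso[OF assms]] rr_iso[OF qr(4)[OF
      assms]]])

lemma th_hm: "A \<in> Obj X \<Longrightarrow> th A \<in> L.hm A (Zo A)"
  by (rule L.iso_hm_hm[OF th_iso])

lemma th_qr: assumes "A \<in> Obj X" shows "th A \<odot> lc (qr A) = lc (jr A)"
  unfolding th_def
  using L.inv_arr_props[OF qr_iso[OF assms]] L.iso_hm_hm[OF rr_iso[OF qr(4)[OF assms]]]
      L.iso_hm_hm[OF qr_iso[OF assms]]
  by (simp add: L.hm_iff)

lemma th_natural: assumes "rep A B f g" shows "lc g \<odot> th A = th B \<odot> lc f"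
proof -
  have h: "f \<in> hm A B" "g \<in> hm (Zo A) (Zo B)" using assms unfolding rep_def by auto
  have o: "A \<in> Obj X" "B \<in> Obj X" using hm_obj h by blast+
  note q = qr(2)[OF o(1)] qr(2)[OF o(2)] rr(2)[OF qr(4)[OF o(1)]] rr(2)[OF qr(4)[OF o(2)]]
  obtain f1 where f1: "f1 \<in> hm (Qo A) (Qo B)" "qr B \<cdot> f1 = f \<cdot> qr A" "g \<cdot> jr A = jr B \<cdot> f1"
    using assms unfolding rep_def by blast
  note t = th_hm[OF o(1)] th_hm[OF o(2)]
  note l = lc_hm[OF h(1)] lc_hm[OF h(2)] lc_hm[OF f1(1)] q[THEN lc_hm]
  show ?thesis
  proof (rule L.iso_cancel_right[OF qr_iso[OF o(1)]])
    have "(lc g \<odot> th A) \<odot> lc (qr A) = lc (g \<cdot> jr A)"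
      using t l th_qr[OF o(1)] lc_cmp[OF q(3) h(2)] by (simp add: L.hm_iff)
    also have "\<dots> = lc (jr B) \<odot> lc f1" unfolding f1(3) by (rule lc_cmp[OF f1(1) q(4)])
    also have "\<dots> = th B \<odot> lc (qr B \<cdot> f1)"
      using t l th_qr[OF o(2), symmetric] lc_cmp[OF f1(1) q(2)] by (simp add: L.hm_iff)
    also have "\<dots> = (th B \<odot> lc f) \<odot> lc (qr A)"
      unfolding f1(2) using t l lc_cmp[OF q(1) h(1)] by (simp add: L.hm_iff)
    finally show "(lc g \<odot> th A) \<odot> lc (qr A) = (th B \<odot> lc f) \<odot> lc (qr A)" .
  qed (use t l in \<open>simp_all add: L.hm_iff\<close>)
qed

text \<open>Induction on words without mentioning them: the first letter is split off as
  \<open>lc f\<close>, or as a two-sided inverse \<open>v\<close> of some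
  \<open>lc w\<close>.\<close>

lemma loc_zigzag_induct [consumes 1, case_names Idn Fwd Bwd]:
  assumes "\<alpha> \<in> L.hm A B"
    and "\<And>A. A \<in> Obj X \<Longrightarrow> P A A (Idn LL A)"
    and "\<And>A D B f \<alpha>. \<lbrakk>f \<in> hm A D; \<alpha> \<in> L.hm D B; P D B \<alpha>\<rbrakk> \<Longrightarrow> P A B (\<alpha> \<odot> lc f)"
    and "\<And>A D B w v \<alpha>. \<lbrakk>w \<in> W; w \<in> hm D A; v \<in> L.hm A D; v \<odot> lc w = Idn LL D; lc w \<odot> v = Idn LL A;
      \<alpha> \<in> L.hm D B; P D B \<alpha>\<rbrakk> \<Longrightarrow> P A B (\<alpha> \<odot> v)"
  shows "P A B \<alpha>"
proof -
  obtain r where r: "zigzag X W A r B" "\<alpha> = zz_class X W A r B" using assms(1) by (rule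
      localization_homE)
  from r(1) have "P A B (zz_class X W A r B)"
  proof induction
    case (zigzag_Nil A) then show ?case using assms(2)[of A] by (simp add: localization_simps(4))
  next
    case (zigzag_Fwd f r B)
    then show ?case
      using assms(3)[of f "Dom X f" "Cod X f" "zz_class X W (Cod X f) r B" B] zz_class_hom[OF
          zigzag_Fwd(2)]
        localization_cmp[OF zigzag_letter(1)[OF category_axioms zigzag_Fwd(1)] zigzag_Fwd(2)]
      by (simp add: loc_eq hm_iff)
  next
    case (zigzag_Bwd w r B)
    let ?v = "zz_class X W (Cod X w) [Bwd w] (Dom X w)"
    have v: "?v \<in> L.hm (Cod X w) (Dom X w)" by (rule zz_class_hom[OF zigzag_letter(2)[OF
        category_axioms zigzag_Bwd(1,2)]])
    have iv: "?v \<odot> lc w = Idn LL (Dom X w)" "lc w \<odot> ?v = Idn LL (Cod X w)"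
      using loc_inverse[OF category_axioms zigzag_Bwd(1,2)] zigzag_Bwd(2) by (simp_all add:
          inverse_arrows_def del: localization_simps(2,3))
    show ?case
      using assms(4)[OF zigzag_Bwd(1) _ v iv zz_class_hom[OF zigzag_Bwd(3)] zigzag_Bwd(4)]
          zigzag_Bwd(2)
        localization_cmp[OF zigzag_letter(2)[OF category_axioms zigzag_Bwd(1,2)] zigzag_Bwd(3)]
      by (simp add: hm_iff)
  qed
  then show ?thesis by (simp add: r(2))
qed

text \<open>Each letter is represented between replacements: an ordinary arrow by
  \<open>rep\<close>, a formal inverse by the inverse modulo \<open>eqv\<close> of a
  representative.\<close>

lemma loc_rep:
  assumes "\<alpha> \<in> L.hm A B"
  shows "\<exists>g\<in>hm (Zo A) (Zo B). lc g \<odot> th A = th B \<odot> \<alpha>"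
  using assms
proof (induction rule: loc_zigzag_induct)
  case (Idn A)
  note t = th_hm[OF Idn]
  then have "lc (Idn X (Zo A)) \<odot> th A = th A \<odot> Idn LL A"
    using lc_idn[OF Zo(3)[OF Idn]] by (simp add: L.hm_iff)
  then show ?case using idn_hom[OF Zo(3)[OF Idn]] by blast
next
  case (Fwd A D B f \<alpha>)
  obtain g where g: "g \<in> hm (Zo D) (Zo B)" "lc g \<odot> th D = th B \<odot> \<alpha>" using Fwd by blast
  obtain g0 where g0: "rep A D f g0" using rep_ex Fwd by blast
  have h: "g0 \<in> hm (Zo A) (Zo D)" using g0 unfolding rep_def by blast
  have o: "A \<in> Obj X" "B \<in> Obj X" "D \<in> Obj X" using hm_obj Fwd L.hm_obj(2)[OF Fwd(2)] by auto
  note t = th_hm[OF o(1)] th_hm[OF o(2)] th_hm[OF o(3)]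
  have "lc (g \<cdot> g0) \<odot> th A = th B \<odot> (\<alpha> \<odot> lc f)"
    using lc_cmp[OF h g(1)] th_natural[OF g0] L.reassoc[OF g(2), of "lc f"] t lc_hm[OF h] lc_hm[OF
        g(1)] Fwd(2) lc_hm[OF Fwd(1)]
    by (simp add: L.hm_iff)
  then show ?case using cmp_hom[OF h g(1)] by blast
next
  case (Bwd A D B w v \<alpha>)
  obtain g where g: "g \<in> hm (Zo D) (Zo B)" "lc g \<odot> th D = th B \<odot> \<alpha>" using Bwd by blast
  obtain g0 k where k: "rep D A w g0" "k \<in> hm (Zo A) (Zo D)" "eqv (Zo D) (Zo D) (k \<cdot> g0) (Idn X (Zo
      D))"
    using rep_invertible_W[OF Bwd(1,2)] unfolding rep_invertible_def by blast
  have h: "g0 \<in> hm (Zo D) (Zo A)" using k(1) unfolding rep_def by blast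
  have o: "A \<in> Obj X" "B \<in> Obj X" "D \<in> Obj X" using hm_obj Bwd L.hm_obj(2)[OF Bwd(6)] by auto
  note t = th_hm[OF o(1)] th_hm[OF o(2)] th_hm[OF o(3)]
  have kg: "lc k \<odot> lc g0 = Idn LL (Zo D)" using lc_eqv[OF k(3)] lc_cmp[OF h k(2)] lc_idn Zo(3)[OF
      o(3)] by simp
  \<comment> \<open>Naturality for the formal inverse \<open>v\<close>, obtained from naturality for
    \<open>w\<close> by inserting \<open>k\<close> on the left.\<close>
  have "th D \<odot> v = lc k \<odot> th A"
  proof -
    have "th D \<odot> v = (lc k \<odot> (lc g0 \<odot> th D)) \<odot> v"
      using t lc_hm[OF h] lc_hm[OF k(2)] Bwd(3) L.reassoc[OF kg, of "th D"] by (simp add: L.hm_iff)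
    also have "\<dots> = (lc k \<odot> th A) \<odot> (lc w \<odot> v)"
      unfolding th_natural[OF k(1)] using t lc_hm[OF k(2)] Bwd(3) lc_hm[OF Bwd(2)] by (simp add:
          L.hm_iff)
    also have "\<dots> = lc k \<odot> th A" unfolding Bwd(5) using t lc_hm[OF k(2)] by (simp add: L.hm_iff)
    finally show ?thesis .
  qed
  then have "lc (g \<cdot> k) \<odot> th A = th B \<odot> (\<alpha> \<odot> v)"
    using lc_cmp[OF k(2) g(1)] L.reassoc[OF g(2), of v] t lc_hm[OF k(2)] lc_hm[OF g(1)] Bwd(3,6)
    by (simp add: L.hm_iff)
  then show ?case using cmp_hom[OF k(2) g(1)] by blast
qed

text \<open>For cofibrant \<open>A\<close> the trivial fibration \<open>qr A\<close> has a section,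
  which represents its inverse; so \<open>th A\<close> comes from an actual arrow.\<close>

lemma U_section:
  assumes "A \<in> U" obtains s where "s \<in> hm A (Qo A)" "qr A \<cdot> s = Idn X A" "th A = lc (jr A \<cdot> s)"
proof -
  have o: "A \<in> Obj X" using UV.cot_obj assms by blast
  obtain s where s: "s \<in> hm A (Qo A)" "qr A \<cdot> s = Idn X A"
    using lift_wF[OF assms qr(1,2)[OF o] idn_hom[OF o]] by blast
  have "th A \<odot> (lc (qr A) \<odot> lc s) = lc (jr A) \<odot> lc s"
    using L.reassoc[OF th_qr[OF o], of "lc s"] th_hm[OF o] lc_hm[OF s(1)] lc_hm[OF qr(2)[OF o]] by
        (simp add: L.hm_iff)
  moreover have "lc (qr A) \<odot> lc s = Idn LL A" using lc_cmp[OF s(1) qr(2)[OF o]] s(2) lc_idn o by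
      simp
  ultimately have "th A = lc (jr A \<cdot> s)"
    using lc_cmp[OF s(1) rr(2)[OF qr(4)[OF o]]] th_hm[OF o] by (simp add: L.hm_iff)
  then show thesis using that s by blast
qed

text \<open>For fibrant \<open>B\<close> the arrow \<open>qr B\<close> extends along
  \<open>jr B\<close>, and the extension represents the inverse of \<open>th B\<close>.\<close>

lemma T_retraction:
  assumes "B \<in> T" obtains t where "t \<in> hm (Zo B) B" "t \<cdot> jr B = qr B" "lc t \<odot> th B = Idn LL B"
proof -
  have o: "B \<in> Obj X" using ST.cot_obj assms by blast
  note q = qr[OF o] and r = rr[OF qr(4)[OF o]]
  obtain t where t: "t \<in> hm (Zo B) B" "t \<cdot> jr B = qr B"
    using extend_wC[OF assms r(1,2) q(2)] by blast
  have "lc t \<odot> th B = Idn LL B"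
  proof (rule L.iso_cancel_right[OF qr_iso[OF o]])
    show "(lc t \<odot> th B) \<odot> lc (qr B) = Idn LL B \<odot> lc (qr B)"
      using th_qr[OF o] lc_cmp[OF r(2) t(1)] t(2) th_hm[OF o] lc_hm[OF t(1)] lc_hm[OF q(2)]
      by (simp add: L.hm_iff)
  qed (use o th_hm[OF o] lc_hm[OF t(1)] in \<open>simp_all add: L.hm_iff\<close>)
  then show thesis using that t by blast
qed

text \<open>A representative between replacements is pulled back along the section for
  \<open>A\<close> and pushed along the retraction for \<open>B\<close>, all of which are actual
  arrows.\<close>

theorem loc_full:
  assumes "A \<in> U" "B \<in> T" "\<alpha> \<in> L.hm A B" shows "\<exists>f\<in>hm A B. \<alpha> = lc f"
proof -
  have o: "A \<in> Obj X" "B \<in> Obj X" using UV.cot_obj ST.cot_obj assms by blast+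
  obtain s where s: "s \<in> hm A (Qo A)" "qr A \<cdot> s = Idn X A" "th A = lc (jr A \<cdot> s)" by (rule
      U_section[OF assms(1)])
  obtain t where t: "t \<in> hm (Zo B) B" "t \<cdot> jr B = qr B" "lc t \<odot> th B = Idn LL B" by (rule
      T_retraction[OF assms(2)])
  obtain g where g: "g \<in> hm (Zo A) (Zo B)" "lc g \<odot> th A = th B \<odot> \<alpha>" using loc_rep[OF assms(3)] by
      blast
  note js = cmp_hom[OF s(1) rr(2)[OF qr(4)[OF o(1)]]]
  have "\<alpha> = lc t \<odot> (th B \<odot> \<alpha>)"
    using L.reassoc[OF t(3), of \<alpha>] th_hm[OF o(2)] lc_hm[OF t(1)] assms(3) by (simp add: L.hm_iff)
  also have "\<dots> = lc (t \<cdot> (g \<cdot> (jr A \<cdot> s)))"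
    unfolding g(2)[symmetric] s(3) lc_cmp[OF js g(1)] lc_cmp[OF cmp_hom[OF js g(1)] t(1)] ..
  finally show ?thesis using cmp_hom[OF cmp_hom[OF js g(1)] t(1)] by blast
qed

theorem loc_faithful:
  assumes "A \<in> U" "B \<in> T" "f \<in> hm A B" "g \<in> hm A B" "lc f = lc g" shows "eqv A B f g"
proof -
  have o: "A \<in> Obj X" "B \<in> Obj X" using UV.cot_obj ST.cot_obj assms by blast+
  obtain s where s: "s \<in> hm A (Qo A)" "qr A \<cdot> s = Idn X A" by (rule U_section[OF assms(1)])
  obtain t where t: "t \<in> hm (Zo B) B" "t \<cdot> jr B = qr B" by (rule T_retraction[OF assms(2)])
  \<comment> \<open>The functor into \<open>K\<close> is what converts equality of word classes into
    the relation \<open>eqv\<close>.\<close>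
  obtain G where G: "is_functor LL K G" "\<forall>f\<in>Arr X. AMap G (lc f) = AMap KF f"
    using localization_universal_property(1)[OF category_axioms category_K KF_functor, of W]
        KF_inverts by blast
  obtain f1 where f1: "rep A B f f1" using rep_ex[OF assms(3)] by blast
  obtain g1 where g1: "rep A B g g1" using rep_ex[OF assms(4)] by blast
  have "AMap KF f = AMap KF g" using G(2) assms(3-5) unfolding hm_iff by metis
  then have e: "eqv (Zo A) (Zo B) f1 g1"
    using kcls_eq_iff[of f1 A B g1] f1 KF_eq[OF f1] KF_eq[OF g1] unfolding rep_def by simp
  note q = qr(2)[OF o(1)] qr(2)[OF o(2)] rr(2)[OF qr(4)[OF o(1)]] rr(2)[OF qr(4)[OF o(2)]]
  \<comment> \<open>Going back from replacements recovers the arrow strictly, so the relation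
    between the representatives passes to \<open>f\<close> and \<open>g\<close>.\<close>
  have *: "t \<cdot> (k \<cdot> (jr A \<cdot> s)) = h" if k: "rep A B h k" for h k
  proof -
    obtain h' where h': "h \<in> hm A B" "k \<in> hm (Zo A) (Zo B)" "h' \<in> hm (Qo A) (Qo B)" "qr B \<cdot> h' = h \<cdot>
        qr A" "k \<cdot> jr A = jr B \<cdot> h'"
      using k unfolding rep_def by blast
    have "t \<cdot> (k \<cdot> (jr A \<cdot> s)) = t \<cdot> (jr B \<cdot> (h' \<cdot> s))"
      using reassoc[OF h'(5), of s] h'(1-3) q s t by (simp add: hm_iff)
    also have "\<dots> = (qr B \<cdot> h') \<cdot> s" using reassoc[OF t(2), of "h' \<cdot> s"] h'(1-3) q s t by (simp add:
        hm_iff)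
    also have "\<dots> = h" unfolding h'(4) using h'(1-3) q s by (simp add: hm_iff)
    finally show ?thesis .
  qed
  show ?thesis
    using eqv_cmp[OF eqv_cmp[OF eqv_refl[OF cmp_hom[OF s(1) q(3)]] e] eqv_refl[OF t(1)]] *[OF f1]
        *[OF g1] by simp
qed

end

section \<open>The additive structure of the localization\<close>

context hovey
begin

text \<open>Sums of arrows of the localization are computed on representatives between the replacements.\<close>

definition lrep :: "'o \<Rightarrow> 'o \<Rightarrow> ('o, 'm) loc_arr \<Rightarrow> 'm \<Rightarrow> bool" where
  "lrep A B \<alpha> g \<longleftrightarrow> \<alpha> \<in> L.hm A B \<and> g \<in> hm (Zo A) (Zo B) \<and> lc g \<odot> th A = th B \<odot> \<alpha>"

definition ladd :: "('o, 'm) loc_arr \<Rightarrow> ('o, 'm) loc_arr \<Rightarrow> ('o, 'm) loc_arr" where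
  "ladd \<alpha> \<beta> = (let A = Dom LL \<alpha>; B = Cod LL \<alpha> in
     linv (th B) \<odot> (lc ((SOME g. lrep A B \<alpha> g) \<plusminus> (SOME g. lrep A B \<beta> g)) \<odot> th A))"

definition lzero :: "'o \<Rightarrow> 'o \<Rightarrow> ('o, 'm) loc_arr" where "lzero A B = lc (hz A B)"

text \<open>Built in exactly the shape in which \<open>triangulation\<close> asks for an addition
  and zero arrows.\<close>

definition LA :: "('o, ('o, 'm) loc_arr) add_cat" where
  "LA = cat.extend LL (add_cat.fields ladd lzero)"

lemma LA_simps [simp]: "Obj LA = Obj X" "Arr LA = Arr LL" "Dom LA = Dom LL" "Cod LA = Cod LL"
  "Idn LA = Idn LL" "Cmp LA = Cmp LL" "hadd LA = ladd" "hzero LA = lzero"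
  by (simp_all add: LA_def cat.extend_def add_cat.fields_def)

lemma LA_Hom [simp]: "Hom LA = Hom LL"
  by (intro ext) (simp add: Hom_def)

lemma loc_obj: "\<alpha> \<in> L.hm A B \<Longrightarrow> A \<in> Obj X" "\<alpha> \<in> L.hm A B \<Longrightarrow> B \<in> Obj X"
  using L.hm_obj[of \<alpha> A B] by simp_all

lemma lrep_obj: "lrep A B \<alpha> g \<Longrightarrow> A \<in> Obj X" "lrep A B \<alpha> g \<Longrightarrow> B \<in> Obj X"
  unfolding lrep_def using loc_obj by blast+

lemma lrep_ex: "\<alpha> \<in> L.hm A B \<Longrightarrow> \<exists>g. lrep A B \<alpha> g"
  unfolding lrep_def using loc_rep by blast

lemma lrep_unique: assumes "lrep A B \<alpha> g" "lrep A B \<alpha> g'" shows "eqv (Zo A) (Zo B) g g'"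
proof -
  have o: "A \<in> Obj X" "B \<in> Obj X" using lrep_obj[OF assms(1)] by auto
  have g: "g \<in> hm (Zo A) (Zo B)" "g' \<in> hm (Zo A) (Zo B)" "lc g \<odot> th A = lc g' \<odot> th A"
    using assms unfolding lrep_def by auto
  have "lc g = lc g'" using L.iso_cancel_right[OF th_iso[OF o(1)] lc_hm[OF g(1)] lc_hm[OF g(2)]
      g(3)] .
  then show ?thesis using loc_faithful[OF Zo(1)[OF o(1)] Zo(2)[OF o(2)] g(1,2)] by blast
qed

lemma lrep_det: assumes "lrep A B \<alpha> g" "lrep A B \<beta> g'" "eqv (Zo A) (Zo B) g g'" shows "\<alpha> = \<beta>"
proof -
  have o: "A \<in> Obj X" "B \<in> Obj X" using lrep_obj[OF assms(1)] by auto
  have "th B \<odot> \<alpha> = th B \<odot> \<beta>" using assms(1,2) lc_eqv[OF assms(3)] unfolding lrep_def by metis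
  then show ?thesis using L.iso_cancel_left[OF th_iso[OF o(2)]] assms(1,2) unfolding lrep_def by
      blast
qed

lemma lrep_det': assumes "lrep A B \<alpha> g" "lrep A B \<beta> g" shows "\<alpha> = \<beta>"
  using lrep_det[OF assms eqv_refl] assms(1) unfolding lrep_def by blast

lemma lrep_of: assumes "A \<in> Obj X" "B \<in> Obj X" "g \<in> hm (Zo A) (Zo B)"
  shows "lrep A B (linv (th B) \<odot> (lc g \<odot> th A)) g"
  using L.inv_arr_props[OF th_iso[OF assms(2)]] th_hm[OF assms(2)] th_hm[OF assms(1)]
    lc_hm[OF assms(3)] L.reassoc[of "th B" "linv (th B)" "Idn LL (Zo B)" "lc g \<odot> th A"] assms(3)
  unfolding lrep_def by (simp add: L.hm_iff)

lemma lrep_cmp: assumes "lrep A B \<alpha> g" "lrep B D \<beta> h" shows "lrep A D (\<beta> \<odot> \<alpha>) (h \<cdot> g)"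
proof -
  have o: "A \<in> Obj X" "B \<in> Obj X" "D \<in> Obj X" using lrep_obj assms by auto
  have g: "g \<in> hm (Zo A) (Zo B)" "h \<in> hm (Zo B) (Zo D)" "\<alpha> \<in> L.hm A B" "\<beta> \<in> L.hm B D"
    "lc g \<odot> th A = th B \<odot> \<alpha>" "lc h \<odot> th B = th D \<odot> \<beta>"
    using assms unfolding lrep_def by auto
  have "lc (h \<cdot> g) \<odot> th A = th D \<odot> (\<beta> \<odot> \<alpha>)"
    unfolding lc_cmp[OF g(1,2)]
    using g(3-5) L.reassoc[OF g(6), of \<alpha>] lc_hm[OF g(1)] lc_hm[OF g(2)]
      th_hm[OF o(1)] th_hm[OF o(2)] th_hm[OF o(3)] by (simp add: L.hm_iff)
  then show ?thesis unfolding lrep_def using cmp_hom[OF g(1,2)] L.cmp_hom[OF g(3,4)] by blast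
qed

lemma lrep_lc: assumes "rep A B f g" shows "lrep A B (lc f) g"
  using th_natural[OF assms] assms lc_hm unfolding lrep_def rep_def by blast

lemma lrep_zero: assumes "A \<in> Obj X" "B \<in> Obj X" shows "lrep A B (lzero A B) (hz (Zo A) (Zo B))"
proof -
  note q = qr(2,4)[OF assms(1)] qr(2,4)[OF assms(2)]
  note r = rr(2,4)[OF q(2)] rr(2,4)[OF q(4)]
  have "rep A B (hz A B) (hz (Zo A) (Zo B))" unfolding rep_def using q r assms
    by (auto simp: hm_iff intro!: bexI[of _ "hz (Qo A) (Qo B)"])
  then show ?thesis unfolding lzero_def by (rule lrep_lc)
qed

text \<open>The representatives chosen in \<open>ladd\<close> do not matter:
  \<open>loc_faithful\<close> applies between \<open>Zo A\<close> in \<open>U\<close> and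
  \<open>Zo B\<close> in \<open>T\<close>, so representatives are unique up to \<open>eqv\<close>,
  which respects sums.\<close>

lemma lrep_add: assumes "lrep A B \<alpha> g" "lrep A B \<beta> h" shows "lrep A B (ladd \<alpha> \<beta>) (g \<plusminus> h)"
proof -
  have o: "A \<in> Obj X" "B \<in> Obj X" using lrep_obj assms by auto
  define g' where "g' = (SOME g. lrep A B \<alpha> g)"
  define h' where "h' = (SOME g. lrep A B \<beta> g)"
  have g': "lrep A B \<alpha> g'" unfolding g'_def using assms(1) by (rule someI)
  have h': "lrep A B \<beta> h'" unfolding h'_def using assms(2) by (rule someI)
  have gh: "g' \<plusminus> h' \<in> hm (Zo A) (Zo B)" using g' h' add_hm unfolding lrep_def by blast
  have D: "Dom LL \<alpha> = A" "Cod LL \<alpha> = B" using assms(1) unfolding lrep_def by (auto simp: L.hm_iff)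
  have 1: "lrep A B (ladd \<alpha> \<beta>) (g' \<plusminus> h')"
    using lrep_of[OF o gh] unfolding ladd_def D Let_def g'_def h'_def .
  have "eqv (Zo A) (Zo B) (g' \<plusminus> h') (g \<plusminus> h)"
    using eqv_add lrep_unique[OF g' assms(1)] lrep_unique[OF h' assms(2)] by blast
  then have "lc (g' \<plusminus> h') = lc (g \<plusminus> h)" "g \<plusminus> h \<in> hm (Zo A) (Zo B)" using lc_eqv eqv_hm by blast+
  then show ?thesis using 1 unfolding lrep_def by simp
qed

lemma lc_add: assumes "f \<in> hm A B" "g \<in> hm A B" shows "lc (f \<plusminus> g) = ladd (lc f) (lc g)"
proof -
  obtain f' g' where r: "rep A B f f'" "rep A B g g'" using rep_ex assms by blast
  show ?thesis using lrep_det'[OF lrep_lc[OF rep_add[OF r]] lrep_add[OF lrep_lc[OF r(1)] lrep_lc[OF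
      r(2)]]] .
qed

lemma ladd_hm: assumes "\<alpha> \<in> L.hm A B" "\<beta> \<in> L.hm A B" shows "ladd \<alpha> \<beta> \<in> L.hm A B"
proof -
  obtain f' g' where r: "lrep A B \<alpha> f'" "lrep A B \<beta> g'" using lrep_ex assms by blast
  show ?thesis using lrep_add[OF r] unfolding lrep_def by blast
qed

lemma lzero_cmp:
  assumes "\<alpha> \<in> L.hm A B" "D \<in> Obj X" shows "\<alpha> \<odot> lzero D A = lzero D B" "lzero B D \<odot> \<alpha> = lzero A D"
proof -
  have o: "A \<in> Obj X" "B \<in> Obj X" using loc_obj assms by blast+
  note z = Zo(3)[OF o(1)] Zo(3)[OF o(2)] Zo(3)[OF assms(2)]
  obtain g where g: "lrep A B \<alpha> g" using lrep_ex assms by blast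
  then have gh: "g \<in> hm (Zo A) (Zo B)" unfolding lrep_def by blast
  have "g \<cdot> hz (Zo D) (Zo A) = hz (Zo D) (Zo B)" "hz (Zo B) (Zo D) \<cdot> g = hz (Zo A) (Zo D)"
    using gh z by (simp_all add: hm_iff)
  then have 1: "lrep D B (\<alpha> \<odot> lzero D A) (hz (Zo D) (Zo B))" "lrep A D (lzero B D \<odot> \<alpha>) (hz (Zo A)
      (Zo D))"
    using lrep_cmp[OF lrep_zero[OF assms(2) o(1)] g] lrep_cmp[OF g lrep_zero[OF o(2) assms(2)]] by
        simp_all
  show "\<alpha> \<odot> lzero D A = lzero D B" by (rule lrep_det'[OF 1(1) lrep_zero[OF assms(2) o(2)]])
  show "lzero B D \<odot> \<alpha> = lzero A D" by (rule lrep_det'[OF 1(2) lrep_zero[OF o(1) assms(2)]])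
qed

lemma LA_group: assumes o: "A \<in> Obj X" "B \<in> Obj X" shows "comm_group (hom_group LA A B)"
proof (rule comm_groupI)
  note zr = lrep_zero[OF o]
  show "\<one>\<^bsub>hom_group LA A B\<^esub> \<in> carrier (hom_group LA A B)"
    using zr unfolding lrep_def by (simp add: hom_group_def)
  fix \<alpha> assume "\<alpha> \<in> carrier (hom_group LA A B)"
  then have a: "\<alpha> \<in> L.hm A B" by (simp add: hom_group_def)
  then obtain f where f: "lrep A B \<alpha> f" using lrep_ex by blast
  then have fh: "f \<in> hm (Zo A) (Zo B)" unfolding lrep_def by blast
  show "\<one>\<^bsub>hom_group LA A B\<^esub> \<otimes>\<^bsub>hom_group LA A B\<^esub> \<alpha> = \<alpha>"
  proof -
    have "lrep A B (ladd (lzero A B) \<alpha>) f" using lrep_add[OF zr f] fh by (simp add: hm_iff)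
    from lrep_det'[OF this f] show ?thesis by (simp add: hom_group_def)
  qed
  have "lrep A B (ladd (linv (th B) \<odot> (lc (hn f) \<odot> th A)) \<alpha>) (hz (Zo A) (Zo B))"
    using lrep_add[OF lrep_of[OF o neg_hm[OF fh]] f] fh by (simp add: hm_iff)
  note l = lrep_det'[OF this zr]
  have "linv (th B) \<odot> (lc (hn f) \<odot> th A) \<in> carrier (hom_group LA A B)"
    using lrep_of[OF o neg_hm[OF fh]] unfolding lrep_def by (simp add: hom_group_def)
  then show "\<exists>y\<in>carrier (hom_group LA A B). y \<otimes>\<^bsub>hom_group LA A B\<^esub> \<alpha> = \<one>\<^bsub>hom_group LA A B\<^esub>"
    by (rule bexI[rotated]) (simp add: l hom_group_def)
  fix \<beta> assume "\<beta> \<in> carrier (hom_group LA A B)"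
  then have b: "\<beta> \<in> L.hm A B" by (simp add: hom_group_def)
  then obtain g where g: "lrep A B \<beta> g" using lrep_ex by blast
  then have gh: "g \<in> hm (Zo A) (Zo B)" unfolding lrep_def by blast
  show "\<alpha> \<otimes>\<^bsub>hom_group LA A B\<^esub> \<beta> \<in> carrier (hom_group LA A B)" using ladd_hm[OF a b] by (simp add:
      hom_group_def)
  show "\<alpha> \<otimes>\<^bsub>hom_group LA A B\<^esub> \<beta> = \<beta> \<otimes>\<^bsub>hom_group LA A B\<^esub> \<alpha>"
  proof -
    have "f \<plusminus> g = g \<plusminus> f" using acomm[of f g] fh gh by (simp add: hm_iff)
    then have "lrep A B (ladd \<beta> \<alpha>) (f \<plusminus> g)" using lrep_add[OF g f] by simp
    from lrep_det'[OF lrep_add[OF f g] this] show ?thesis by (simp add: hom_group_def)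
  qed
  fix \<gamma> assume "\<gamma> \<in> carrier (hom_group LA A B)"
  then have c: "\<gamma> \<in> L.hm A B" by (simp add: hom_group_def)
  then obtain h where h: "lrep A B \<gamma> h" using lrep_ex by blast
  then have hh: "h \<in> hm (Zo A) (Zo B)" unfolding lrep_def by blast
  show "(\<alpha> \<otimes>\<^bsub>hom_group LA A B\<^esub> \<beta>) \<otimes>\<^bsub>hom_group LA A B\<^esub> \<gamma> = \<alpha> \<otimes>\<^bsub>hom_group LA A B\<^esub> (\<beta> \<otimes>\<^bsub>hom_group LA A
      B\<^esub> \<gamma>)"
  proof -
    have "(f \<plusminus> g) \<plusminus> h = f \<plusminus> (g \<plusminus> h)" using fh gh hh by (simp add: hm_iff aassoc)
    then have "lrep A B (ladd \<alpha> (ladd \<beta> \<gamma>)) ((f \<plusminus> g) \<plusminus> h)" using lrep_add[OF f lrep_add[OF g h]] by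
        simp
    from lrep_det'[OF lrep_add[OF lrep_add[OF f g] h] this] show ?thesis by (simp add:
        hom_group_def)
  qed
qed

lemma LA_zero_object: assumes "zero_object X Z" shows "zero_object LA Z"
proof -
  have Z: "Z \<in> Obj X" using assms by (simp add: zero_object_def)
  have i: "Idn LL Z = lzero Z Z" using lc_idn[OF Z] zero_obj_idn[OF assms] by (simp add: lzero_def)
  have "\<alpha> = lzero Z A" if "\<alpha> \<in> L.hm Z A" for \<alpha> A
    using lzero_cmp(1)[OF that Z] that by (simp add: i[symmetric] L.hm_iff)
  moreover have "\<alpha> = lzero A Z" if "\<alpha> \<in> L.hm A Z" for \<alpha> A
    using lzero_cmp(2)[OF that Z] that by (simp add: i[symmetric] L.hm_iff)
  moreover have "lzero Z A \<in> L.hm Z A" "lzero A Z \<in> L.hm A Z" if "A \<in> Obj X" for A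
    using lc_hm hz_hm that Z unfolding lzero_def by blast+
  ultimately show ?thesis unfolding zero_object_def LA_simps LA_Hom using Z by blast
qed

lemma lc_biproduct: assumes "biproduct X A B P i j p q"
  shows "biproduct LA A B P (lc i) (lc j) (lc p) (lc q)"
proof -
  have b: "i \<in> hm A P" "j \<in> hm B P" "p \<in> hm P A" "q \<in> hm P B" using assms unfolding biproduct_def by
      auto
  show ?thesis
    using assms b[THEN lc_hm] lc_cmp[OF b(1,3)] lc_cmp[OF b(1,4)] lc_cmp[OF b(2,3)] lc_cmp[OF
        b(2,4)]
     lc_cmp[OF b(3,1)] lc_cmp[OF b(4,2)] lc_add[OF cmp_hom[OF b(3,1)] cmp_hom[OF b(4,2)]]
    unfolding biproduct_def by (simp add: lc_idn lzero_def)
qed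

lemma additive_LA: "additive_category LA"
proof (intro additive_category.intro additive_category_axioms.intro category.intro)
  fix f assume "f \<in> Arr LA" then show "Dom LA f \<in> Obj LA" "Cod LA f \<in> Obj LA"
    using L.dom_obj[of f] L.cod_obj[of f] by auto
next
  fix A assume "A \<in> Obj LA" then show "Idn LA A \<in> Hom LA A A" using L.idn_hom[of A] by simp
next
  fix f g A B D assume "f \<in> Hom LA A B" "g \<in> Hom LA B D"
  then show "g \<cdot>\<^bsub>LA\<^esub> f \<in> Hom LA A D" using L.cmp_hom by simp
next
  fix f A B assume "f \<in> Hom LA A B"
  then show "Idn LA B \<cdot>\<^bsub>LA\<^esub> f = f" "f \<cdot>\<^bsub>LA\<^esub> Idn LA A = f" using L.idn_left L.idn_right by auto
next
  fix f g h A B D E assume "f \<in> Hom LA A B" "g \<in> Hom LA B D" "h \<in> Hom LA D E"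
  then show "h \<cdot>\<^bsub>LA\<^esub> (g \<cdot>\<^bsub>LA\<^esub> f) = (h \<cdot>\<^bsub>LA\<^esub> g) \<cdot>\<^bsub>LA\<^esub> f" using L.cmp_assoc by simp
next
  fix A B assume "A \<in> Obj LA" "B \<in> Obj LA" then show "comm_group (hom_group LA A B)" using LA_group
      by simp
next
  fix f g h A B D assume "f \<in> Hom LA A B" "g \<in> Hom LA B D" "h \<in> Hom LA B D"
  then have h: "f \<in> L.hm A B" "g \<in> L.hm B D" "h \<in> L.hm B D" by auto
  obtain f' g' h' where r: "lrep A B f f'" "lrep B D g g'" "lrep B D h h'" using lrep_ex h by meson
  have "(g' \<plusminus> h') \<cdot> f' = g' \<cdot> f' \<plusminus> h' \<cdot> f'" using r cmp_add unfolding lrep_def by blast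
  then have "lrep A D (ladd (g \<odot> f) (h \<odot> f)) ((g' \<plusminus> h') \<cdot> f')"
    using lrep_add[OF lrep_cmp[OF r(1,2)] lrep_cmp[OF r(1,3)]] by simp
  from lrep_det'[OF lrep_cmp[OF r(1) lrep_add[OF r(2,3)]] this]
  show "(g \<plusminus>\<^bsub>LA\<^esub> h) \<cdot>\<^bsub>LA\<^esub> f = g \<cdot>\<^bsub>LA\<^esub> f \<plusminus>\<^bsub>LA\<^esub> h \<cdot>\<^bsub>LA\<^esub> f" by simp
next
  fix f g h A B D assume "f \<in> Hom LA A B" "g \<in> Hom LA A B" "h \<in> Hom LA B D"
  then have h: "f \<in> L.hm A B" "g \<in> L.hm A B" "h \<in> L.hm B D" by auto
  obtain f' g' h' where r: "lrep A B f f'" "lrep A B g g'" "lrep B D h h'" using lrep_ex h by meson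
  have "h' \<cdot> (f' \<plusminus> g') = h' \<cdot> f' \<plusminus> h' \<cdot> g'" using r add_cmp unfolding lrep_def by blast
  then have "lrep A D (ladd (h \<odot> f) (h \<odot> g)) (h' \<cdot> (f' \<plusminus> g'))"
    using lrep_add[OF lrep_cmp[OF r(1,3)] lrep_cmp[OF r(2,3)]] by simp
  from lrep_det'[OF lrep_cmp[OF lrep_add[OF r(1,2)] r(3)] this]
  show "h \<cdot>\<^bsub>LA\<^esub> (f \<plusminus>\<^bsub>LA\<^esub> g) = h \<cdot>\<^bsub>LA\<^esub> f \<plusminus>\<^bsub>LA\<^esub> h \<cdot>\<^bsub>LA\<^esub> g" by simp
next
  show "\<exists>Z. zero_object LA Z" using LA_zero_object ex_zero_object by blast
next
  fix A B assume "A \<in> Obj LA" "B \<in> Obj LA"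
  then show "\<exists>P i j p q. biproduct LA A B P i j p q" using lc_biproduct ex_biproduct LA_simps(1) by
      metis
qed

end

sublocale hovey \<subseteq> LA: acat LA
  using additive_LA by (simp add: acat_def)

context hovey
begin

lemma lc_neg: assumes "f \<in> hm A B" shows "lc (hn f) = hneg LA (lc f)"
proof -
  have "ladd (lc (hn f)) (lc f) = lzero A B" using lc_add[OF neg_hm[OF assms] assms] assms by (simp
      add: lzero_def hm_iff)
  then show ?thesis using LA.neg_unique[of "lc (hn f)" A B "lc f"] lc_hm[OF assms] lc_hm[OF
      neg_hm[OF assms]] by simp
qed

lemma LA_iso_hm [simp]: "LA.iso_hm A B f \<longleftrightarrow> L.iso_hm A B f"
  unfolding LA.iso_hm_def L.iso_hm_def by simp

lemma lc_iso_neg: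
  assumes "L.iso_hm A B (lc f)" "f \<in> hm A B" shows "L.iso_hm A B (lc (hn f))"
  using LA.iso_neg[of A B "lc f"] assms lc_neg by simp

subsection \<open>Triangles with middle term in \<open>N\<close>\<close>

text \<open>The deflation \<open>N2 \<oplus> C1 \<rightarrow> C2\<close> built from
  \<open>y2\<close> and \<open>hn c\<close> has a fibre realizing \<open>\<delta>1\<close>, so the
  fibre is isomorphic to \<open>N1\<close> and the deflation is a weak equivalence. The projection
  to \<open>C1\<close> is one too, and \<open>c\<close> is, up to sign, the deflation restricted
  along the section \<open>j\<close>.\<close>

lemma tri_N_iso_right:
  assumes T: "tri A N1 C1 x1 y1 \<delta>1" "tri A N2 C2 x2 y2 \<delta>2" and N: "N1 \<in> N" "N2 \<in> N"
    and c: "c \<in> hm C1 C2" "\<delta>1 = Em c (Idn X A) \<delta>2"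
  shows "L.iso_hm C1 C2 (lc c)"
proof -
  note t = triD[OF T(1)] triD[OF T(2)]
  obtain P i j p q where P: "biproduct X N2 C1 P i j p q" using ex_biproduct t by blast
  note b = biproductD[OF P]
  \<comment> \<open>Using \<open>hn c\<close> cancels the sign of
    \<open>tri_base_change\<close>.\<close>
  obtain M h e where M: "tri M P C2 h (y2 \<cdot> p \<plusminus> hn c \<cdot> q) (Em (Idn X C2) e \<delta>2)"
     "tri A M C1 e (q \<cdot> h) (Em (hn (hn c)) (Idn X A) \<delta>2)"
    using tri_base_change[OF T(2) neg_hm[OF c(1)] P] by blast
  have "tri A M C1 e (q \<cdot> h) \<delta>1" using M(2) c by (simp add: hm_iff)
  then obtain f where "iso_hm N1 M f" using tri_mid_unique[OF T(1)] by blast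
  then have "M \<in> N" using N_iso N(1) by blast
  define w where "w = y2 \<cdot> p \<plusminus> hn c \<cdot> q"
  have wh: "w \<in> hm P C2" unfolding w_def using b t c(1) by (simp add: hm_iff)
  have w: "L.iso_hm P C2 (lc w)" using lc_iso[OF deflation_N_W[OF M(1) \<open>M \<in> N\<close>]] wh unfolding w_def
      by blast
  have qj: "j \<in> hm C1 P" "q \<in> hm P C1" using b by (simp_all add: hm_iff)
  have q: "L.iso_hm P C1 (lc q)" using lc_iso[OF deflation_N_W[OF tri_biproduct[OF P] N(2)] qj(2)] .
  have "L.iso_hm C1 P (lc j)"
    by (rule L.iso_of_cmp_right[OF q lc_hm[OF qj(1)]])
      (use t in \<open>simp add: lc_cmp[OF qj, symmetric] b(17) lc_idn[of C1]\<close>)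
  then have "L.iso_hm C1 C2 (lc (w \<cdot> j))" using L.iso_cmp[OF _ w] lc_cmp[OF qj(1) wh] by simp
  moreover have "w \<cdot> j = hn c" unfolding w_def using b t c(1) by (simp add: hm_iff distrib)
  ultimately have "L.iso_hm C1 C2 (lc (hn c))" by simp
  then show ?thesis using lc_iso_neg[OF _ neg_hm[OF c(1)]] c(1) by (simp add: hm_iff)
qed

text \<open>Dual: the inflation \<open>A1 \<rightarrow> N1 \<oplus> A2\<close> has a cone realizing
  \<open>\<delta>2\<close>, hence in \<open>N\<close>.\<close>

lemma tri_N_iso_left:
  assumes T: "tri A1 N1 C x1 y1 \<delta>1" "tri A2 N2 C x2 y2 \<delta>2" and N: "N1 \<in> N" "N2 \<in> N"
    and a: "a \<in> hm A1 A2" "Em (Idn X C) a \<delta>1 = \<delta>2"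
  shows "L.iso_hm A1 A2 (lc a)"
proof -
  note t = triD[OF T(1)] triD[OF T(2)]
  obtain P i j p q where P: "biproduct X N1 A2 P i j p q" using ex_biproduct t by blast
  note b = biproductD[OF P]
  obtain M h e where M: "tri A1 P M (i \<cdot> x1 \<plusminus> j \<cdot> hn a) h (Em e (Idn X A1) \<delta>1)"
     "tri A2 M C (h \<cdot> j) e (Em (Idn X C) (hn (hn a)) \<delta>1)"
    using tri_cobase_change[OF T(1) neg_hm[OF a(1)] P] by blast
  have "tri A2 M C (h \<cdot> j) e \<delta>2" using M(2) a by (simp add: hm_iff)
  then obtain f where "iso_hm N2 M f" using tri_mid_unique[OF T(2)] by blast
  then have "M \<in> N" using N_iso N(2) by blast
  define w where "w = i \<cdot> x1 \<plusminus> j \<cdot> hn a"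
  have wh: "w \<in> hm A1 P" unfolding w_def using b t a(1) by (simp add: hm_iff)
  have w: "L.iso_hm A1 P (lc w)" using lc_iso[OF inflation_N_W[OF M(1) \<open>M \<in> N\<close>]] wh unfolding w_def
      by blast
  have qh: "q \<in> hm P A2" using b by (simp_all add: hm_iff)
  have q: "L.iso_hm P A2 (lc q)" using lc_iso[OF deflation_N_W[OF tri_biproduct[OF P] N(1)] qh] .
  have "L.iso_hm A1 A2 (lc (q \<cdot> w))" using L.iso_cmp[OF w q] lc_cmp[OF wh qh] by simp
  moreover have "q \<cdot> w = hn a" unfolding w_def using b t a(1) by (simp add: hm_iff distrib
      biproduct_re[OF P])
  ultimately have "L.iso_hm A1 A2 (lc (hn a))" by simp
  then show ?thesis using lc_iso_neg[OF _ neg_hm[OF a(1)]] a(1) by (simp add: hm_iff)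
qed

text \<open>A weak equivalence is a composite of the two special kinds, so invertibility need only
  be checked on \<open>wF\<close> and \<open>wC\<close>.\<close>

lemma loc_functor_ex:
  assumes F: "is_functor X LL F" and inv: "\<And>w A B. \<lbrakk>w \<in> wF \<or> w \<in> wC; w \<in> hm A B\<rbrakk> \<Longrightarrow> L.iso_hm (OMap F
      A) (OMap F B) (AMap F w)"
  shows "\<exists>G. is_functor LL LL G \<and> (\<forall>A\<in>Obj X. OMap G A = OMap F A) \<and> (\<forall>f\<in>Arr X. AMap G (lc f) = AMap
      F f)"
proof (rule localization_universal_property(1)[OF category_axioms L.category_axioms F])
  fix w assume w: "w \<in> W" "w \<in> Arr X"
  then have "w \<in> hm (Dom X w) (Cod X w)" by (simp add: hm_iff)
  then obtain i p E where E: "i \<in> wC" "p \<in> wF" "i \<in> hm (Dom X w) E" "p \<in> hm E (Cod X w)" "w = p \<cdot> i"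
      using weqE[OF w(1)] by blast
  have "AMap F (p \<cdot> i) = AMap F p \<odot> AMap F i" using F E(3,4) unfolding is_functor_def hm_iff by
      metis
  then have "L.iso_hm (OMap F (Dom X w)) (OMap F (Cod X w)) (AMap F w)"
    using L.iso_cmp[OF inv inv] E by metis
  then show "iso_arr LL (AMap F w)" unfolding L.iso_arr_iff by blast
qed

text \<open>Naturality on arrows of the original category suffices: for the inverse of
  \<open>lc w\<close> it follows from that for \<open>lc w\<close>, since both functors preserve the
  inverse relations.\<close>

lemma loc_natural:
  assumes F: "is_functor LL LL F" "is_functor LL LL G"
    and \<eta>: "\<And>A. A \<in> Obj X \<Longrightarrow> \<eta> A \<in> L.hm (OMap F A) (OMap G A)"
    and nat: "\<And>f A B. f \<in> hm A B \<Longrightarrow> \<eta> B \<odot> AMap F (lc f) = AMap G (lc f) \<odot> \<eta> A"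
    and \<alpha>: "\<alpha> \<in> L.hm A B"
  shows "\<eta> B \<odot> AMap F \<alpha> = AMap G \<alpha> \<odot> \<eta> A"
proof -
  have Fh: "AMap H \<beta> \<in> L.hm (OMap H A) (OMap H B)" if "is_functor LL LL H" "\<beta> \<in> L.hm A B" for H \<beta> A
      B
    using that unfolding is_functor_def by (auto simp: L.hm_iff)
  have Fc: "AMap H (\<gamma> \<odot> \<beta>) = AMap H \<gamma> \<odot> AMap H \<beta>" if "is_functor LL LL H" "\<beta> \<in> L.hm A B" "\<gamma> \<in> L.hm B
      D" for H \<beta> A B \<gamma> D
    using that unfolding is_functor_def by (auto simp: L.hm_iff)
  have Fi: "AMap H (Idn LL A) = Idn LL (OMap H A)" if "is_functor LL LL H" "A \<in> Obj X" for H A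
    using that unfolding is_functor_def by auto
  from \<alpha> show ?thesis
  proof (induction rule: loc_zigzag_induct)
    case (Idn A)
    then show ?case using Fi[OF F(1) Idn] Fi[OF F(2) Idn] \<eta>[OF Idn] by (simp add: L.hm_iff)
  next
    case (Fwd A D B f \<alpha>)
    have o: "A \<in> Obj X" "D \<in> Obj X" "B \<in> Obj X" using hm_obj[OF Fwd(1)] loc_obj(2)[OF Fwd(2)] by
        auto
    note h = Fh[OF F(1) Fwd(2)] Fh[OF F(2) Fwd(2)] Fh[OF F(1) lc_hm[OF Fwd(1)]] Fh[OF F(2) lc_hm[OF
        Fwd(1)]] \<eta>[OF o(1)] \<eta>[OF o(2)] \<eta>[OF o(3)]
    show ?case
      unfolding Fc[OF F(1) lc_hm[OF Fwd(1)] Fwd(2)] Fc[OF F(2) lc_hm[OF Fwd(1)] Fwd(2)]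
      using h L.reassoc[OF Fwd(3), of "AMap F (lc f)"] nat[OF Fwd(1)] by (simp add: L.hm_iff)
  next
    case (Bwd A D B w v \<alpha>)
    have o: "A \<in> Obj X" "D \<in> Obj X" "B \<in> Obj X" using hm_obj[OF Bwd(2)] loc_obj(2)[OF Bwd(6)] by
        auto
    note h = Fh[OF F(1) Bwd(6)] Fh[OF F(2) Bwd(6)] Fh[OF F(1) Bwd(3)] Fh[OF F(2) Bwd(3)] \<eta>[OF o(1)]
        \<eta>[OF o(2)] \<eta>[OF o(3)]
      Fh[OF F(1) lc_hm[OF Bwd(2)]] Fh[OF F(2) lc_hm[OF Bwd(2)]]
    have 1: "AMap F (lc w) \<odot> AMap F v = Idn LL (OMap F A)"
      using Fc[OF F(1) Bwd(3) lc_hm[OF Bwd(2)]] Fi[OF F(1) o(1)] Bwd(5) by simp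
    have 2: "AMap G v \<odot> AMap G (lc w) = Idn LL (OMap G D)"
      using Fc[OF F(2) lc_hm[OF Bwd(2)] Bwd(3)] Fi[OF F(2) o(2)] Bwd(4) by simp
    have "\<eta> D \<odot> AMap F v = AMap G v \<odot> \<eta> A"
    proof -
      have "\<eta> D \<odot> AMap F v = (AMap G v \<odot> (AMap G (lc w) \<odot> \<eta> D)) \<odot> AMap F v"
        using h L.reassoc[OF 2, of "\<eta> D"] by (simp add: L.hm_iff)
      also have "\<dots> = AMap G v \<odot> (\<eta> A \<odot> (AMap F (lc w) \<odot> AMap F v))"
        unfolding nat[OF Bwd(2), symmetric] using h by (simp add: L.hm_iff)
      also have "\<dots> = AMap G v \<odot> \<eta> A" unfolding 1 using h by (simp add: L.hm_iff)
      finally show ?thesis .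
    qed
    then show ?case
      unfolding Fc[OF F(1) Bwd(3,6)] Fc[OF F(2) Bwd(3,6)]
      using h L.reassoc[OF Bwd(7), of "AMap F v"] by (simp add: L.hm_iff)
  qed
qed

end

section \<open>The shift functor\<close>

locale hovey_shift = hovey X S T U V
  for X :: "('o, 'm, 'e, 'z) ext_cat_scheme" (structure) and S T U V :: "'o set" +
  fixes v u :: "'o \<Rightarrow> 'm" and \<rho> :: "'o \<Rightarrow> 'e" and uf :: "'m \<Rightarrow> 'm"
  assumes shift_choice: "shift_choice X U V v u \<rho> uf"
begin

abbreviation Vo :: "'o \<Rightarrow> 'o" where "Vo A \<equiv> Cod X (v A)"
abbreviation Uo :: "'o \<Rightarrow> 'o" where "Uo A \<equiv> Cod X (u A)"

lemma sh:
  assumes "A \<in> Obj X"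
  shows "tri A (Vo A) (Uo A) (v A) (u A) (\<rho> A)" "Vo A \<in> V" "Uo A \<in> U" "Uo A \<in> Obj X"
proof -
  have "etriangle X (v A) (u A) (\<rho> A)" "Dom X (v A) = A" "Vo A \<in> V" "Uo A \<in> U"
    using shift_choice assms unfolding shift_choice_def by blast+
  then show "tri A (Vo A) (Uo A) (v A) (u A) (\<rho> A)" "Vo A \<in> V" "Uo A \<in> U" "Uo A \<in> Obj X"
    using etriangle_tri[of "v A" "u A" "\<rho> A"] UV.cot_obj(1) by auto
qed

lemma uf:
  assumes "f \<in> hm A B"
  shows "uf f \<in> hm (Uo A) (Uo B)" "Em (Idn X (Uo A)) f (\<rho> A) = Em (uf f) (Idn X B) (\<rho> B)"
proof -
  have f: "f \<in> Arr X" "Dom X f = A" "Cod X f = B" using assms by (auto simp: hm_iff)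
  then have 1: "uf f \<in> hm (Uo A) (Uo B)" "ext_morphism X (\<rho> A) (\<rho> B) f (uf f)"
    using shift_choice unfolding shift_choice_def by blast+
  then show "uf f \<in> hm (Uo A) (Uo B)" "Em (Idn X (Uo A)) f (\<rho> A) = Em (uf f) (Idn X B) (\<rho> B)"
    using f by (simp_all add: ext_morphism_def push_def pull_def hm_iff)
qed

text \<open>The difference factors through \<open>Vo A\<close>, which lies in \<open>N\<close>. This
  makes the class of \<open>uf f\<close> independent of the choice and yields functoriality and
  additivity.\<close>

lemma pull_lc_eq:
  assumes "A \<in> Obj X" "a \<in> hm D (Uo A)" "b \<in> hm D (Uo A)" "Em a (Idn X A) (\<rho> A) = Em b (Idn X A) (\<rho>
      A)"
  shows "lc a = lc b"
proof -
  obtain k where "k \<in> hm D (Vo A)" "a \<plusminus> hn b = u A \<cdot> k"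
    using pull_eq_factor[OF sh(1)[OF assms(1)] assms(2-4)] by blast
  then have "eqv D (Uo A) a b"
    unfolding eqv_def through_def using assms(2,3) V_N[OF sh(2)[OF assms(1)]] tri_hm(2)[OF sh(1)[OF
        assms(1)]] by blast
  then show ?thesis by (rule lc_eqv)
qed

lemma uf_eq:
  assumes "f \<in> hm A B" "a \<in> hm (Uo A) (Uo B)" "Em (Idn X (Uo A)) f (\<rho> A) = Em a (Idn X B) (\<rho> B)"
  shows "lc (uf f) = lc a"
  using pull_lc_eq[OF hm_obj(2)[OF assms(1)] uf(1)[OF assms(1)] assms(2)] uf(2)[OF assms(1)]
      assms(3) by simp

lemma uf_idn: assumes "A \<in> Obj X" shows "lc (uf (Idn X A)) = Idn LL (Uo A)"
  using uf_eq[OF idn_hom[OF assms] idn_hom[OF sh(4)[OF assms]]] lc_idn[OF sh(4)[OF assms]] by simp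

lemma uf_cmp: assumes "f \<in> hm A B" "g \<in> hm B D" shows "lc (uf (g \<cdot> f)) = lc (uf g) \<odot> lc (uf f)"
proof -
  have o: "A \<in> Obj X" "B \<in> Obj X" "D \<in> Obj X" using assms hm_obj by blast+
  note s = triD[OF sh(1)[OF o(1)]] triD[OF sh(1)[OF o(2)]] triD[OF sh(1)[OF o(3)]]
  note fg = uf[OF assms(1)] uf[OF assms(2)]
  have "Em (Idn X (Uo A)) (g \<cdot> f) (\<rho> A) = Em (Idn X (Uo A)) g (Em (Idn X (Uo A)) f (\<rho> A))"
    using s assms by (simp add: hm_iff)
  also have "\<dots> = Em (uf f) (Idn X D) (Em (Idn X (Uo B)) g (\<rho> B))"
    unfolding fg(2) using s assms fg(1) by (simp add: hm_iff)
  also have "\<dots> = Em (uf g \<cdot> uf f) (Idn X D) (\<rho> D)"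
    unfolding fg(4) using s assms fg(1,3) by (simp add: hm_iff)
  finally show ?thesis
    using uf_eq[OF cmp_hom[OF assms] cmp_hom[OF fg(1,3)]] lc_cmp[OF fg(1,3)] by simp
qed

lemma uf_add: assumes "f \<in> hm A B" "g \<in> hm A B" shows "lc (uf (f \<plusminus> g)) = ladd (lc (uf f)) (lc (uf
    g))"
proof -
  have o: "A \<in> Obj X" "B \<in> Obj X" using assms hm_obj by blast+
  note s = triD[OF sh(1)[OF o(1)]] triD[OF sh(1)[OF o(2)]]
  note fg = uf[OF assms(1)] uf[OF assms(2)]
  have "Em (Idn X (Uo A)) (f \<plusminus> g) (\<rho> A) = Em (uf f \<plusminus> uf g) (Idn X B) (\<rho> B)"
    using s assms fg by (simp add: hm_iff em_add_left em_add_right)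
  then show ?thesis
    using uf_eq[OF add_hm[OF assms] add_hm[OF fg(1,3)]] lc_add[OF fg(1,3)] by simp
qed

lemma pre_shift_functor: "is_functor X LL (pre_shift X W u uf)"
  unfolding is_functor_def pre_shift_def
proof (intro conjI ballI impI, simp_all)
  show "Uo A \<in> Obj X" if "A \<in> Obj X" for A using sh that by blast
  show "lc (uf f) \<in> L.hm (Uo (Dom X f)) (Uo (Cod X f))" if "f \<in> Arr X" for f
    by (rule lc_hm[OF uf(1)]) (simp add: hm_iff that)
  show "lc (uf (Idn X A)) = Idn LL (Uo A)" if "A \<in> Obj X" for A by (rule uf_idn[OF that])
  show "lc (uf (g \<cdot> f)) = lc (uf g) \<odot> lc (uf f)" if "f \<in> Arr X" "g \<in> Arr X" "Cod X f = Dom X g" for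
      f g
    using uf_cmp[of f "Dom X f" "Cod X f" g "Cod X g"] that by (simp add: hm_iff)
qed

text \<open>By the defining property of \<open>uf w\<close>, the extension \<open>\<rho> A\<close>
  pushed along \<open>w\<close> equals \<open>\<rho> B\<close> pulled back along
  \<open>uf w\<close>. Once a middle term of it is in \<open>N\<close>,
  \<open>tri_N_iso_right\<close> applies.\<close>

lemma pre_shift_inverts:
  assumes "w \<in> wF \<or> w \<in> wC" "w \<in> hm A B"
  shows "L.iso_hm (Uo A) (Uo B) (lc (uf w))"
proof -
  have o: "A \<in> Obj X" "B \<in> Obj X" using assms hm_obj by blast+
  \<comment> \<open>For a trivial fibration the middle term is the cone of an arrow
    \<open>V0 \<rightarrow> Vo A\<close>; for a trivial cofibration it is an extension of
    \<open>S0\<close> by \<open>Vo A\<close>.\<close>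
  have "\<exists>M x y. M \<in> N \<and> tri B M (Uo A) x y (Em (Idn X (Uo A)) w (\<rho> A))"
  proof (cases "w \<in> wF")
    case True
    obtain V0 k \<delta> where V0: "tri V0 A B k w \<delta>" "V0 \<in> V" by (rule wF_E[OF True assms(2)])
    obtain E h' d e \<delta>'' where E: "tri V0 (Vo A) E (v A \<cdot> k) h' \<delta>''" "tri B E (Uo A) d e (Em (Idn X
        (Uo A)) w (\<rho> A))"
      using ET4'[OF V0(1) sh(1)[OF o(1)]] by blast
    then show ?thesis using N_cone_V[OF E(1) V0(2) V_N[OF sh(2)[OF o(1)]]] by blast
  next
    case False
    then have w: "w \<in> wC" using assms(1) by blast
    obtain S0 y \<delta> where S0: "tri A B S0 w y \<delta>" "S0 \<in> S" by (rule wC_E[OF w assms(2)])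
    obtain M m1 m2 e1 e2 where M: "tri B M (Uo A) m1 e2 (Em (Idn X (Uo A)) w (\<rho> A))"
      "tri (Vo A) M S0 m2 e1 (Em (Idn X S0) (v A) \<delta>)"
      using tri_pushout[OF S0(1) sh(1)[OF o(1)]] by blast
    then show ?thesis using N_extension[OF M(2) V_N[OF sh(2)[OF o(1)]] S_N[OF S0(2)]] by blast
  qed
  then obtain M x y where M: "M \<in> N" "tri B M (Uo A) x y (Em (Idn X (Uo A)) w (\<rho> A))" by blast
  show ?thesis
    by (rule tri_N_iso_right[OF M(2) sh(1)[OF o(2)] M(1) V_N[OF sh(2)[OF o(2)]] uf[OF assms(2)]])
qed

abbreviation Sh :: "('o, ('o, 'm) loc_arr, 'o, ('o, 'm) loc_arr) func" where "Sh \<equiv> shift X W u uf"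

text \<open>Existence discharges the choice in \<open>induced_functor\<close>; later facts about
  \<open>Sh\<close> are derived from these three properties.\<close>

lemma shift_props: "is_functor LL LL Sh" "A \<in> Obj X \<Longrightarrow> OMap Sh A = Uo A" "f \<in> Arr X \<Longrightarrow> AMap Sh (lc f)
    = lc (uf f)"
proof -
  have "\<exists>G. is_functor LL LL G \<and> (\<forall>A\<in>Obj X. OMap G A = OMap (pre_shift X W u uf) A) \<and>
      (\<forall>f\<in>Arr X. AMap G (lc f) = AMap (pre_shift X W u uf) f)"
    by (rule loc_functor_ex[OF pre_shift_functor]) (simp add: pre_shift_def pre_shift_inverts)
  note * = someI_ex[OF this, folded induced_functor_def, folded shift_def]
  then show "is_functor LL LL Sh" "A \<in> Obj X \<Longrightarrow> OMap Sh A = Uo A" "f \<in> Arr X \<Longrightarrow> AMap Sh (lc f) = lc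
      (uf f)"
    by (simp_all add: pre_shift_def)
qed

lemma Sh_hm: assumes "\<alpha> \<in> L.hm A B" shows "AMap Sh \<alpha> \<in> L.hm (Uo A) (Uo B)"
  using shift_props(1) shift_props(2) loc_obj[OF assms] assms unfolding is_functor_def by (auto
      simp: L.hm_iff)

lemma Sh_cmp: "\<lbrakk>\<alpha> \<in> L.hm A B; \<beta> \<in> L.hm B D\<rbrakk> \<Longrightarrow> AMap Sh (\<beta> \<odot> \<alpha>) = AMap Sh \<beta> \<odot> AMap Sh \<alpha>"
  using shift_props(1) unfolding is_functor_def by (auto simp: L.hm_iff)

lemma Sh_lc: "f \<in> hm A B \<Longrightarrow> AMap Sh (lc f) = lc (uf f)"
  by (simp add: shift_props(3) hm_iff)

text \<open>Additivity holds for the classes of the \<open>uf f\<close>. A general arrow is such a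
  class conjugated by \<open>th\<close>, and the images of the conjugating arrows factor out by
  bilinearity.\<close>

lemma Sh_add: assumes "\<alpha> \<in> L.hm A B" "\<beta> \<in> L.hm A B" shows "AMap Sh (ladd \<alpha> \<beta>) = ladd (AMap Sh \<alpha>)
    (AMap Sh \<beta>)"
proof -
  have o: "A \<in> Obj X" "B \<in> Obj X" using loc_obj assms by blast+
  obtain f g where r: "lrep A B \<alpha> f" "lrep A B \<beta> g" using lrep_ex assms by blast
  have fg: "f \<in> hm (Zo A) (Zo B)" "g \<in> hm (Zo A) (Zo B)" using r unfolding lrep_def by auto
  let ?i = "linv (th B)"
  have i: "?i \<in> L.hm (Zo B) B" "th A \<in> L.hm A (Zo A)"
    using L.inv_arr_props[OF th_iso[OF o(2)]] th_hm[OF o(1)] by auto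
  have *: "\<gamma> = ?i \<odot> (lc h \<odot> th A)" if "lrep A B \<gamma> h" for \<gamma> h
    using lrep_det'[OF that lrep_of[OF o]] that unfolding lrep_def by blast
  have S: "AMap Sh \<gamma> = AMap Sh ?i \<odot> (lc (uf h) \<odot> AMap Sh (th A))" if "lrep A B \<gamma> h" for \<gamma> h
  proof -
    have h: "h \<in> hm (Zo A) (Zo B)" using that unfolding lrep_def by blast
    show ?thesis
      unfolding *[OF that] using Sh_cmp[OF L.cmp_hom[OF i(2) lc_hm[OF h]] i(1)] Sh_cmp[OF i(2)
          lc_hm[OF h]] Sh_lc[OF h] by simp
  qed
  note Sh' = Sh_hm[OF i(1)] Sh_hm[OF i(2)] lc_hm[OF uf(1)[OF fg(1)]] lc_hm[OF uf(1)[OF fg(2)]]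
  have "AMap Sh (ladd \<alpha> \<beta>) = AMap Sh ?i \<odot> (ladd (lc (uf f)) (lc (uf g)) \<odot> AMap Sh (th A))"
    using S[OF lrep_add[OF r]] uf_add[OF fg] by simp
  also have "\<dots> = ladd (AMap Sh \<alpha>) (AMap Sh \<beta>)"
    unfolding S[OF r(1)] S[OF r(2)]
    using LA.cmp_add[of "AMap Sh (th A)" "Uo A" "Uo (Zo A)" "lc (uf f)" "Uo (Zo B)" "lc (uf g)"]
      LA.add_cmp[of "lc (uf f) \<odot> AMap Sh (th A)" "Uo A" "Uo (Zo B)" "lc (uf g) \<odot> AMap Sh (th A)"
          "AMap Sh ?i" "Uo B"]
      Sh' L.cmp_hom[OF Sh'(2,3)] L.cmp_hom[OF Sh'(2,4)] by simp
  finally show ?thesis .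
qed

section \<open>The connecting arrow of an extension\<close>

abbreviation lt :: "'o \<Rightarrow> 'o \<Rightarrow> 'e \<Rightarrow> ('o, 'm) loc_arr" where "lt C A \<delta> \<equiv> ltilde X S V u \<rho> C A \<delta>"

text \<open>Since \<open>Qo C\<close> is in \<open>U\<close>, the pulled back extension dies in
  \<open>Vo A\<close> and is therefore a pullback of \<open>\<rho> A\<close>.\<close>

lemma lt_span:
  assumes "A \<in> Obj X" "C \<in> Obj X" "\<delta> \<in> EE C A"
  shows "\<exists>d\<in>hm (Qo C) (Uo A). Em (qr C) (Idn X A) \<delta> = Em d (Idn X A) (\<rho> A)"
proof -
  note q = qr[OF assms(2)] and s = sh[OF assms(1)]
  note t = triD[OF s(1)]
  have "Em (Idn X (Qo C)) (v A) (Em (qr C) (Idn X A) \<delta>) = Eo (Qo C) (Vo A)"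
    using UV.cot_ext[OF q(3) s(2)] q(2,4) t assms by (simp add: hm_iff)
  moreover have "Em (qr C) (Idn X A) \<delta> \<in> EE (Qo C) A" using q(2) assms by (simp add: hm_iff)
  ultimately show ?thesis using ext_pull_of_tri[OF s(1)] q(4) by blast
qed

text \<open>Reduces the definite description to the span through \<open>qr C\<close>; this is the
  independence of the choice of span.\<close>

lemma lt_eq:
  assumes o: "A \<in> Obj X" "C \<in> Obj X" and \<delta>: "\<delta> \<in> EE C A"
   and d: "d \<in> hm (Qo C) (Uo A)" "Em (qr C) (Idn X A) \<delta> = Em d (Idn X A) (\<rho> A)"
  shows "lt C A \<delta> = lc d \<odot> linv (lc (qr C))"
  unfolding ltilde_def Let_def
proof (rule the_equality)
  note q = qr[OF o(2)]
  show "\<exists>w d'. w \<in> wF \<and> Cod X w = C \<and> d' \<in> hm (Dom X w) (Uo A) \<and> pull X A w \<delta> = pull X A d' (\<rho> A) \<and>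
      lc d \<odot> linv (lc (qr C)) = lc d' \<odot> linv (lc w)"
    using q d by (intro exI[of _ "qr C"] exI[of _ d]) (simp add: pull_def hm_iff)
  fix h assume "\<exists>w d. w \<in> wF \<and> Cod X w = C \<and> d \<in> hm (Dom X w) (Uo A) \<and> pull X A w \<delta> = pull X A d (\<rho>
      A) \<and>
      h = lc d \<odot> linv (lc w)"
  then obtain w d' where w: "w \<in> wF" "Cod X w = C" "d' \<in> hm (Dom X w) (Uo A)" "Em w (Idn X A) \<delta> = Em
      d' (Idn X A) (\<rho> A)"
    "h = lc d' \<odot> linv (lc w)" unfolding pull_def by blast
  have wh: "w \<in> hm (Dom X w) C" using w wF_arr by (simp add: hm_iff)
  have iw: "L.iso_hm (Dom X w) C (lc w)" by (rule lc_iso[OF wF_W[OF w(1)] wh])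
  \<comment> \<open>Any admissible \<open>w\<close> is dominated by \<open>qr C\<close>, because
    \<open>Qo C\<close> is in \<open>U\<close>.\<close>
  obtain s where s: "s \<in> hm (Qo C) (Dom X w)" "w \<cdot> s = qr C" using lift_wF[OF q(3) w(1) wh q(2)] by
      blast
  note ts = triD[OF sh(1)[OF o(1)]]
  have "Em (d' \<cdot> s) (Idn X A) (\<rho> A) = Em s (Idn X A) (Em d' (Idn X A) (\<rho> A))" using w(3) s(1) ts by
      (simp add: hm_iff)
  also have "\<dots> = Em (w \<cdot> s) (Idn X A) \<delta>" unfolding w(4)[symmetric] using wh s(1) \<delta> o by (simp add:
      hm_iff)
  finally have "lc (d' \<cdot> s) = lc d"
    using pull_lc_eq[OF o(1) cmp_hom[OF s(1) w(3)] d(1)] d(2) s(2) by simp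
  then have l: "lc d' \<odot> lc s = lc d" "lc w \<odot> lc s = lc (qr C)" using lc_cmp[OF s(1) w(3)] lc_cmp[OF
      s(1) wh] s(2) by simp_all
  note i = L.inv_arr_props[OF iw] L.inv_arr_props[OF qr_iso[OF o(2)]]
  note hs = lc_hm[OF w(3)] lc_hm[OF s(1)] lc_hm[OF wh] lc_hm[OF d(1)] lc_hm[OF q(2)]
  show "h = lc d \<odot> linv (lc (qr C))"
  proof (rule L.iso_cancel_right[OF qr_iso[OF o(2)]])
    have "h \<odot> lc (qr C) = lc d' \<odot> ((linv (lc w) \<odot> lc w) \<odot> lc s)"
      unfolding w(5) l(2)[symmetric] using hs(1-3) i(1) by (simp add: L.hm_iff)
    also have "\<dots> = lc d" unfolding i(2) using hs l(1) by (simp add: L.hm_iff)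
    also have "\<dots> = (lc d \<odot> linv (lc (qr C))) \<odot> lc (qr C)" using hs(4,5) i(5,6) by (simp add:
        L.hm_iff)
    finally show "h \<odot> lc (qr C) = (lc d \<odot> linv (lc (qr C))) \<odot> lc (qr C)" .
    show "h \<in> L.hm C (Uo A)" unfolding w(5) using L.cmp_hom[OF i(1) hs(1)] .
    show "lc d \<odot> linv (lc (qr C)) \<in> L.hm C (Uo A)" using L.cmp_hom[OF i(5) hs(4)] .
  qed
qed

lemma lt_hm:
  assumes "A \<in> Obj X" "C \<in> Obj X" "\<delta> \<in> EE C A" shows "lt C A \<delta> \<in> L.hm C (Uo A)"
proof -
  obtain d where d: "d \<in> hm (Qo C) (Uo A)" "Em (qr C) (Idn X A) \<delta> = Em d (Idn X A) (\<rho> A)" using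
      lt_span[OF assms] by blast
  show ?thesis unfolding lt_eq[OF assms d] by (rule L.cmp_hom[OF L.inv_arr_props(1)[OF qr_iso[OF
      assms(2)]] lc_hm[OF d(1)]])
qed

lemma lt_qr:
  assumes "A \<in> Obj X" "C \<in> Obj X" "\<delta> \<in> EE C A" "d \<in> hm (Qo C) (Uo A)" "Em (qr C) (Idn X A) \<delta> = Em d
      (Idn X A) (\<rho> A)"
  shows "lt C A \<delta> \<odot> lc (qr C) = lc d"
  unfolding lt_eq[OF assms] using L.inv_arr_props[OF qr_iso[OF assms(2)]] lc_hm[OF assms(4)]
      lc_hm[OF qr(2)[OF assms(2)]]
  by (simp add: L.hm_iff)

text \<open>Extends the defining equation from trivial fibrations to arbitrary \<open>k\<close>:
  both sides are compared after composing with \<open>qr D\<close>, where \<open>k\<close> lifts to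
  cofibrant replacements.\<close>

lemma lt_pull:
  assumes o: "A \<in> Obj X" and \<delta>: "\<delta> \<in> EE C A" and k: "k \<in> hm D C" "d \<in> hm D (Uo A)" "Em k (Idn X A) \<delta>
      = Em d (Idn X A) (\<rho> A)"
  shows "lt C A \<delta> \<odot> lc k = lc d"
proof -
  have oo: "C \<in> Obj X" "D \<in> Obj X" using hm_obj k by blast+
  note qC = qr[OF oo(1)] and qD = qr[OF oo(2)] and ts = triD[OF sh(1)[OF o]]
  obtain d0 where d0: "d0 \<in> hm (Qo C) (Uo A)" "Em (qr C) (Idn X A) \<delta> = Em d0 (Idn X A) (\<rho> A)" using
      lt_span[OF o oo(1) \<delta>] by blast
  obtain s where s: "s \<in> hm (Qo D) (Qo C)" "qr C \<cdot> s = k \<cdot> qr D" using lift_wF[OF qD(3) qC(1,2)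
      cmp_hom[OF qD(2) k(1)]] by blast
  have "Em (d \<cdot> qr D) (Idn X A) (\<rho> A) = Em (qr D) (Idn X A) (Em d (Idn X A) (\<rho> A))" using k qD(2) ts
      by (simp add: hm_iff)
  also have "\<dots> = Em (k \<cdot> qr D) (Idn X A) \<delta>" unfolding k(3)[symmetric] using k(1) qD(2) \<delta> o by (simp
      add: hm_iff)
  also have "\<dots> = Em s (Idn X A) (Em (qr C) (Idn X A) \<delta>)" unfolding s(2)[symmetric] using s(1) qC(2)
      \<delta> o by (simp add: hm_iff)
  also have "\<dots> = Em (d0 \<cdot> s) (Idn X A) (\<rho> A)" unfolding d0(2) using d0(1) s(1) ts by (simp add:
      hm_iff)
  finally have e: "lc (d \<cdot> qr D) = lc (d0 \<cdot> s)" using pull_lc_eq[OF o cmp_hom[OF qD(2) k(2)]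
      cmp_hom[OF s(1) d0(1)]] by blast
  note hs = lt_hm[OF o oo(1) \<delta>] lc_hm[OF k(1)] lc_hm[OF k(2)] lc_hm[OF qD(2)] lc_hm[OF qC(2)]
      lc_hm[OF s(1)]
  show ?thesis
  proof (rule L.iso_cancel_right[OF qr_iso[OF oo(2)]])
    have "(lt C A \<delta> \<odot> lc k) \<odot> lc (qr D) = lt C A \<delta> \<odot> lc (qr C \<cdot> s)"
      unfolding s(2) lc_cmp[OF qD(2) k(1)] using hs by (simp add: L.hm_iff)
    also have "\<dots> = lc (d0 \<cdot> s)"
      unfolding lc_cmp[OF s(1) qC(2)] lc_cmp[OF s(1) d0(1)] using L.reassoc[OF lt_qr[OF o oo(1) \<delta>
          d0], of "lc s"] hs by (simp add: L.hm_iff)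
    also have "\<dots> = lc d \<odot> lc (qr D)" unfolding e[symmetric] by (rule lc_cmp[OF qD(2) k(2)])
    finally show "(lt C A \<delta> \<odot> lc k) \<odot> lc (qr D) = lc d \<odot> lc (qr D)" .
  qed (use hs L.cmp_hom[OF hs(2,1)] in simp_all)
qed

text \<open>After restriction along \<open>qr C\<close> both connecting arrows are represented by
  actual arrows, and the claim becomes an identity between pulled back extensions.\<close>

lemma lt_natural:
  assumes o: "A \<in> Obj X" "A' \<in> Obj X" and \<delta>: "\<delta> \<in> EE C A" "\<delta>' \<in> EE C' A'"
    and ac: "a \<in> hm A A'" "c \<in> hm C C'" "Em (Idn X C) a \<delta> = Em c (Idn X A') \<delta>'"
  shows "lt C' A' \<delta>' \<odot> lc c = lc (uf a) \<odot> lt C A \<delta>"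
proof -
  have oo: "C \<in> Obj X" "C' \<in> Obj X" using hm_obj ac by blast+
  note q = qr[OF oo(1)] and ts = triD[OF sh(1)[OF o(1)]] triD[OF sh(1)[OF o(2)]] and ua = uf[OF
      ac(1)]
  obtain d where d: "d \<in> hm (Qo C) (Uo A)" "Em (qr C) (Idn X A) \<delta> = Em d (Idn X A) (\<rho> A)" using
      lt_span[OF o(1) oo(1) \<delta>(1)] by blast
  have "Em (c \<cdot> qr C) (Idn X A') \<delta>' = Em (qr C) (Idn X A') (Em c (Idn X A') \<delta>')" using ac(2) q(2) \<delta>
      o by (simp add: hm_iff)
  also have "\<dots> = Em (Idn X (Qo C)) a (Em (qr C) (Idn X A) \<delta>)" unfolding ac(3)[symmetric] using ac(1)
      q(2,4) \<delta>(1) o oo by (simp add: hm_iff)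
  also have "\<dots> = Em d (Idn X A') (Em (Idn X (Uo A)) a (\<rho> A))" unfolding d(2) using d(1) ac(1) ts
      q(4) o by (simp add: hm_iff)
  also have "\<dots> = Em (uf a \<cdot> d) (Idn X A') (\<rho> A')" unfolding ua(2) using d(1) ua(1) ts o by (simp
      add: hm_iff)
  finally have l: "lt C' A' \<delta>' \<odot> lc (c \<cdot> qr C) = lc (uf a \<cdot> d)"
    using lt_pull[OF o(2) \<delta>(2) cmp_hom[OF q(2) ac(2)] cmp_hom[OF d(1) ua(1)]] by blast
  note hs = lt_hm[OF o(1) oo(1) \<delta>(1)] lt_hm[OF o(2) oo(2) \<delta>(2)] lc_hm[OF ac(2)] lc_hm[OF ua(1)]
      lc_hm[OF q(2)] lc_hm[OF d(1)]
  show ?thesis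
    by (rule L.iso_cancel_right[OF qr_iso[OF oo(1)] L.cmp_hom[OF hs(3,2)] L.cmp_hom[OF hs(1,4)]])
      (use l lc_cmp[OF q(2) ac(2)] lc_cmp[OF d(1) ua(1)] lt_qr[OF o(1) oo(1) \<delta>(1) d] hs in \<open>simp
          add: L.hm_iff\<close>)
qed

lemma lt_of_pull:
  assumes "A \<in> Obj X" "d \<in> hm C (Uo A)" shows "lt C A (Em d (Idn X A) (\<rho> A)) = lc d"
proof -
  have C: "C \<in> Obj X" using hm_obj assms by blast
  have e: "Em d (Idn X A) (\<rho> A) \<in> EE C A" using triD[OF sh(1)[OF assms(1)]] assms(2) by (simp add:
      hm_iff)
  have "lt C A (Em d (Idn X A) (\<rho> A)) \<odot> lc (Idn X C) = lc d"
    by (rule lt_pull[OF assms(1) e idn_hom[OF C] assms(2)]) (use e C assms in simp)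
  then show ?thesis using lt_hm[OF assms(1) C e] lc_idn[OF C] by (simp add: L.hm_iff)
qed

text \<open>Pulling the triangle back along \<open>qr C\<close> gives a middle term that is an
  extension of \<open>N1\<close> by an object of \<open>V\<close>. The representing arrow
  \<open>d\<close> is thus an isomorphism by \<open>tri_N_iso_right\<close>, and \<open>qr C\<close>
  cancels.\<close>

lemma lt_iso:
  assumes "tri A N1 C x y \<delta>" "N1 \<in> N" shows "L.iso_hm C (Uo A) (lt C A \<delta>)"
proof -
  note t = triD[OF assms(1)]
  note q = qr[OF t(3)] and s = sh[OF t(1)]
  obtain d where d: "d \<in> hm (Qo C) (Uo A)" "Em (qr C) (Idn X A) \<delta> = Em d (Idn X A) (\<rho> A)" using
      lt_span[OF t(1,3,10)] by blast
  obtain V0 k \<epsilon> where V0: "tri V0 (Qo C) C k (qr C) \<epsilon>" "V0 \<in> V" by (rule wF_E[OF q(1,2)])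
  obtain M e1 e2 m1 m2 where M: "tri A M (Qo C) m2 e1 (Em (qr C) (Idn X A) \<delta>)" "tri V0 M N1 m1 e2
      (Em y (Idn X V0) \<epsilon>)"
    using tri_pullback[OF V0(1) assms(1)] by blast
  have MN: "M \<in> N" by (rule N_extension[OF M(2) V_N[OF V0(2)] assms(2)])
  have "L.iso_hm (Qo C) (Uo A) (lc d)" by (rule tri_N_iso_right[OF M(1) s(1) MN V_N[OF s(2)] d])
  then show ?thesis
    using L.iso_of_cmp_left[OF qr_iso[OF t(3)] lt_hm[OF t(1,3,10)]] lt_qr[OF t(1,3,10) d] by simp
qed

section \<open>The shift is an equivalence\<close>

text \<open>Data for the inverse shift, selected in one choice: the triple consists of both arrows
  of the triangle and its extension.\<close>

definition om :: "'o \<Rightarrow> 'm \<times> 'm \<times> 'e" where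
  "om C = (SOME t. tri (Dom X (fst t)) (Cod X (fst t)) C (fst t) (fst (snd t)) (snd (snd t)) \<and>
     Dom X (fst t) \<in> T \<and> Cod X (fst t) \<in> S)"

abbreviation To :: "'o \<Rightarrow> 'o" where "To C \<equiv> Dom X (fst (om C))"
abbreviation So :: "'o \<Rightarrow> 'o" where "So C \<equiv> Cod X (fst (om C))"
abbreviation lam :: "'o \<Rightarrow> 'e" where "lam C \<equiv> snd (snd (om C))"

lemma om:
  assumes "C \<in> Obj X"
  shows "tri (To C) (So C) C (fst (om C)) (fst (snd (om C))) (lam C)" "To C \<in> T" "So C \<in> S" "To C \<in>
      Obj X"
proof -
  obtain T0 S0 x y \<delta> where d: "tri T0 S0 C x y \<delta>" "T0 \<in> T" "S0 \<in> S" by (rule ST.cot_left[OF assms])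
  let ?P = "\<lambda>t. tri (Dom X (fst t)) (Cod X (fst t)) C (fst t) (fst (snd t)) (snd (snd t)) \<and>
     Dom X (fst t) \<in> T \<and> Cod X (fst t) \<in> S"
  have "?P (x, y, \<delta>)" using d triD[OF d(1)] by simp
  then have *: "?P (om C)" unfolding om_def by (rule someI[of ?P])
  then show "tri (To C) (So C) C (fst (om C)) (fst (snd (om C))) (lam C)" "To C \<in> T" "So C \<in> S" by
      auto
  then show "To C \<in> Obj X" using ST.cot_obj by blast
qed

definition tfc :: "'m \<Rightarrow> 'm" where
  "tfc c = (SOME t. t \<in> hm (To (Dom X c)) (To (Cod X c)) \<and>
     Em (Idn X (Dom X c)) t (lam (Dom X c)) = Em c (Idn X (To (Cod X c))) (lam (Cod X c)))"

text \<open>Weak universality of the chosen triangle: the extension vanishes on \<open>So C\<close>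
  because \<open>S\<close> is orthogonal to \<open>T\<close>. It is restricted to targets in
  \<open>T\<close>.\<close>

lemma om_push:
  assumes "C \<in> Obj X" "Y \<in> T" "\<epsilon> \<in> EE C Y"
  shows "\<exists>a\<in>hm (To C) Y. \<epsilon> = Em (Idn X C) a (lam C)"
proof -
  note o = om[OF assms(1)]
  note t = triD[OF o(1)]
  have Y: "Y \<in> Obj X" using ST.cot_obj assms by blast
  have "Em (fst (snd (om C))) (Idn X Y) \<epsilon> = Eo (So C) Y" using ST.cot_ext[OF o(3) assms(2)] t Y
      assms by simp
  then show ?thesis using ext_push_of_tri[OF o(1) assms(3) Y] by blast
qed

lemma tfc:
  assumes "c \<in> hm C D"
  shows "tfc c \<in> hm (To C) (To D)" "Em (Idn X C) (tfc c) (lam C) = Em c (Idn X (To D)) (lam D)"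
proof -
  have o: "C \<in> Obj X" "D \<in> Obj X" using hm_obj assms by blast+
  have c: "Dom X c = C" "Cod X c = D" using assms by (auto simp: hm_iff)
  have "Em c (Idn X (To D)) (lam D) \<in> EE C (To D)" using triD[OF om(1)[OF o(2)]] assms by (simp add:
      hm_iff)
  then obtain t where "t \<in> hm (To C) (To D) \<and> Em (Idn X C) t (lam C) = Em c (Idn X (To D)) (lam D)"
    using om_push[OF o(1) om(2)[OF o(2)]] by metis
  then have "tfc c \<in> hm (To C) (To D) \<and> Em (Idn X C) (tfc c) (lam C) = Em c (Idn X (To D)) (lam D)"
    unfolding tfc_def c by (rule someI)
  then show "tfc c \<in> hm (To C) (To D)" "Em (Idn X C) (tfc c) (lam C) = Em c (Idn X (To D)) (lam D)"
      by auto
qed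

lemma push_lc_eq:
  assumes "C \<in> Obj X" "a \<in> hm (To C) Y" "b \<in> hm (To C) Y" "Em (Idn X C) a (lam C) = Em (Idn X C) b
      (lam C)"
  shows "lc a = lc b"
proof -
  obtain k where "k \<in> hm (So C) Y" "a \<plusminus> hn b = k \<cdot> fst (om C)"
    using push_eq_factor[OF om(1)[OF assms(1)] assms(2-4)] by blast
  then have "eqv (To C) Y a b"
    unfolding eqv_def through_def using assms(2,3) S_N[OF om(3)[OF assms(1)]] tri_hm(1)[OF om(1)[OF
        assms(1)]] by blast
  then show ?thesis by (rule lc_eqv)
qed

definition pre_loop :: "('o, 'm, 'o, ('o, 'm) loc_arr) func" where
  "pre_loop = \<lparr>OMap = To, AMap = \<lambda>f. lc (tfc f)\<rparr>"

lemma tfc_cmp: assumes "f \<in> hm A B" "g \<in> hm B D" shows "lc (tfc (g \<cdot> f)) = lc (tfc g) \<odot> lc (tfc f)"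
proof -
  have o: "A \<in> Obj X" "B \<in> Obj X" "D \<in> Obj X" using assms hm_obj by blast+
  note s = triD[OF om(1)[OF o(1)]] triD[OF om(1)[OF o(2)]] triD[OF om(1)[OF o(3)]]
  note fg = tfc[OF assms(1)] tfc[OF assms(2)] and gf = tfc[OF cmp_hom[OF assms]]
  have "Em (Idn X A) (tfc g \<cdot> tfc f) (lam A) = Em (Idn X A) (tfc g) (Em (Idn X A) (tfc f) (lam A))"
    using s fg(1,3) by (simp add: hm_iff)
  also have "\<dots> = Em f (Idn X (To D)) (Em (Idn X B) (tfc g) (lam B))" unfolding fg(2) using s fg(1,3)
      assms by (simp add: hm_iff)
  also have "\<dots> = Em (Idn X A) (tfc (g \<cdot> f)) (lam A)" unfolding fg(4) gf(2) using s assms by (simp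
      add: hm_iff)
  finally show ?thesis
    using push_lc_eq[OF o(1) gf(1) cmp_hom[OF fg(1,3)]] lc_cmp[OF fg(1,3)] by simp
qed

lemma pre_loop_functor: "is_functor X LL pre_loop"
  unfolding is_functor_def pre_loop_def
proof (intro conjI ballI impI, simp_all)
  show "To A \<in> Obj X" if "A \<in> Obj X" for A using om that by blast
  show "lc (tfc f) \<in> L.hm (To (Dom X f)) (To (Cod X f))" if "f \<in> Arr X" for f
    by (rule lc_hm[OF tfc(1)]) (simp add: hm_iff that)
  show "lc (tfc (Idn X A)) = Idn LL (To A)" if "A \<in> Obj X" for A
  proof -
    have "lc (tfc (Idn X A)) = lc (Idn X (To A))"
      by (rule push_lc_eq[OF that tfc(1)[OF idn_hom[OF that]] idn_hom[OF om(4)[OF that]] tfc(2)[OF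
          idn_hom[OF that]]])
    then show ?thesis using lc_idn[OF om(4)[OF that]] by simp
  qed
  show "lc (tfc (g \<cdot> f)) = lc (tfc g) \<odot> lc (tfc f)" if "f \<in> Arr X" "g \<in> Arr X" "Cod X f = Dom X g"
      for f g
    using tfc_cmp[of f "Dom X f" "Cod X f" g "Cod X g"] that by (simp add: hm_iff)
qed

text \<open>Mirror image of the argument for the shift, with \<open>tri_N_iso_left\<close>: the
  middle term over \<open>C\<close> is an extension of \<open>So D\<close> by an object of
  \<open>V\<close>, or the fibre of an arrow \<open>So D \<rightarrow> S0\<close>.\<close>

lemma pre_loop_inverts:
  assumes "w \<in> wF \<or> w \<in> wC" "w \<in> hm C D"
  shows "L.iso_hm (To C) (To D) (lc (tfc w))"
proof -
  have o: "C \<in> Obj X" "D \<in> Obj X" using assms hm_obj by blast+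
  note oC = om[OF o(1)] and oD = om[OF o(2)]
  have "\<exists>M x y. M \<in> N \<and> tri (To D) M C x y (Em w (Idn X (To D)) (lam D))"
  proof (cases "w \<in> wF")
    case True
    obtain V0 k \<delta> where V0: "tri V0 C D k w \<delta>" "V0 \<in> V" by (rule wF_E[OF True assms(2)])
    obtain M e1 e2 m1 m2 where M: "tri (To D) M C m2 e1 (Em w (Idn X (To D)) (lam D))"
       "tri V0 M (So D) m1 e2 (Em (fst (snd (om D))) (Idn X V0) \<delta>)"
      using tri_pullback[OF V0(1) oD(1)] by blast
    then show ?thesis using N_extension[OF M(2) V_N[OF V0(2)] S_N[OF oD(3)]] by blast
  next
    case False
    then have w: "w \<in> wC" using assms(1) by blast
    obtain S0 y \<delta> where S0: "tri C D S0 w y \<delta>" "S0 \<in> S" by (rule wC_E[OF w assms(2)])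
    obtain E h' d e \<delta>'' where E: "tri E (So D) S0 h' (y \<cdot> fst (snd (om D))) \<delta>''" "tri (To D) E C d e
        (Em w (Idn X (To D)) (lam D))"
      using ET4_op'[OF oD(1) S0(1)] by blast
    then show ?thesis using N_cocone_S[OF E(1) S0(2) S_N[OF oD(3)]] by blast
  qed
  then obtain M x y where M: "M \<in> N" "tri (To D) M C x y (Em w (Idn X (To D)) (lam D))" by blast
  show ?thesis
    by (rule tri_N_iso_left[OF oC(1) M(2) S_N[OF oC(3)] M(1) tfc[OF assms(2)]])
qed

lemma nat_iso_locI:
  assumes F: "is_functor LL LL F" "is_functor LL LL G"
    and \<eta>: "\<And>A. A \<in> Obj X \<Longrightarrow> L.iso_hm (OMap F A) (OMap G A) (\<eta> A)"
    and nat: "\<And>f A B. f \<in> hm A B \<Longrightarrow> \<eta> B \<odot> AMap F (lc f) = AMap G (lc f) \<odot> \<eta> A"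
  shows "naturally_isomorphic LL LL F G"
  unfolding naturally_isomorphic_def
proof (intro exI[of _ \<eta>] conjI ballI)
  show "\<eta> A \<in> L.hm (OMap F A) (OMap G A)" "iso_arr LL (\<eta> A)" if "A \<in> Obj LL" for A
    using \<eta>[of A] that L.iso_hm_hm L.iso_arr_iff by auto
  show "\<eta> (Cod LL f) \<odot> AMap F f = AMap G f \<odot> \<eta> (Dom LL f)" if "f \<in> Arr LL" for f
    using loc_natural[OF F L.iso_hm_hm[OF \<eta>] nat, of f "Dom LL f" "Cod LL f"] that by (simp add:
        L.hm_iff)
qed

lemma comp_func_functor: "\<lbrakk>is_functor LL LL F; is_functor LL LL G\<rbrakk> \<Longrightarrow> is_functor LL LL (comp_func G
    F)"
  unfolding is_functor_def comp_func_def by (auto simp: L.hm_iff)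

lemma id_func_functor: "is_functor LL LL id_func"
  unfolding is_functor_def id_func_def by (auto simp: L.hm_iff)

lemma inv_arr_natural:
  assumes "L.iso_hm A A' h" "L.iso_hm B B' k" "f \<in> L.hm A B" "g \<in> L.hm A' B'" "k \<odot> f = g \<odot> h"
  shows "linv k \<odot> g = f \<odot> linv h"
proof -
  note i = L.inv_arr_props[OF assms(1)] L.inv_arr_props[OF assms(2)] L.iso_hm_hm[OF assms(1)]
      L.iso_hm_hm[OF assms(2)]
  have "linv k \<odot> g = linv k \<odot> ((g \<odot> h) \<odot> linv h)"
    using i assms(4) by (simp add: L.hm_iff)
  also have "\<dots> = (linv k \<odot> k) \<odot> (f \<odot> linv h)"
    unfolding assms(5)[symmetric] using i(1,5,9,10) assms(3) by (simp add: L.hm_iff)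
  also have "\<dots> = f \<odot> linv h" unfolding i(6) using i(1) assms(3) by (simp add: L.hm_iff)
  finally show ?thesis .
qed

text \<open>In one direction the comparison is the inverse of the connecting arrow of the triangle
  chosen for \<open>C\<close>. In the other, both \<open>\<rho> A\<close> and the chosen triangle of
  \<open>Uo A\<close> end in \<open>Uo A\<close>, and their left ends are compared.\<close>

lemma shift_equivalence: "auto_equivalence LL Sh"
proof -
  obtain G where G: "is_functor LL LL G" "\<And>A. A \<in> Obj X \<Longrightarrow> OMap G A = To A" "\<And>f. f \<in> Arr X \<Longrightarrow> AMap G
      (lc f) = lc (tfc f)"
    using loc_functor_ex[OF pre_loop_functor] pre_loop_inverts by (auto simp: pre_loop_def)
  have "naturally_isomorphic LL LL (comp_func Sh G) id_func"
  proof (rule nat_iso_locI[where \<eta> = "\<lambda>C. linv (lt C (To C) (lam C))", OF comp_func_functor[OF G(1)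
      shift_props(1)] id_func_functor])
    have i: "L.iso_hm C (Uo (To C)) (lt C (To C) (lam C))" if "C \<in> Obj X" for C
      by (rule lt_iso[OF om(1)[OF that] S_N[OF om(3)[OF that]]])
    show "L.iso_hm (OMap (comp_func Sh G) C) (OMap id_func C) (linv (lt C (To C) (lam C)))" if "C \<in>
        Obj X" for C
      using L.inv_arr_props(4)[OF i[OF that]] that om(4)[OF that] G(2) shift_props(2) by (simp add:
          comp_func_def id_func_def)
    fix c C D assume c: "c \<in> hm C D"
    have o: "C \<in> Obj X" "D \<in> Obj X" using hm_obj c by blast+
    note t = tfc[OF c]
    have "linv (lt D (To D) (lam D)) \<odot> lc (uf (tfc c)) = lc c \<odot> linv (lt C (To C) (lam C))"
      by (rule inv_arr_natural[OF i[OF o(1)] i[OF o(2)] lc_hm[OF c] lc_hm[OF uf(1)[OF t(1)]]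
          lt_natural[OF om(4)[OF o(1)] om(4)[OF o(2)] triD(10)[OF om(1)[OF o(1)]] triD(10)[OF
              om(1)[OF o(2)]] t(1) c t(2)]])
    then show "linv (lt D (To D) (lam D)) \<odot> AMap (comp_func Sh G) (lc c) =
        AMap id_func (lc c) \<odot> linv (lt C (To C) (lam C))"
      using c t(1) G(3) shift_props(3) by (simp add: comp_func_def id_func_def hm_iff)
  qed
  moreover have "naturally_isomorphic LL LL (comp_func G Sh) id_func"
  proof -
    \<comment> \<open>\<open>A\<close> need not be in \<open>T\<close>, so \<open>\<rho> A\<close>
      is first pushed to \<open>Ro A\<close>; the replacement arrow is inverted afterwards.\<close>
    have "\<exists>a. a \<in> hm (To (Uo A)) (Ro A) \<and> Em (Idn X (Uo A)) a (lam (Uo A)) = Em (Idn X (Uo A)) (rr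
        A) (\<rho> A)" if "A \<in> Obj X" for A
    proof -
      have "Em (Idn X (Uo A)) (rr A) (\<rho> A) \<in> EE (Uo A) (Ro A)" using triD[OF sh(1)[OF that]] rr[OF
          that] by (simp add: hm_iff)
      then show ?thesis using om_push[OF sh(4)[OF that] rr(3)[OF that]] by metis
    qed
    then obtain a where a: "\<And>A. A \<in> Obj X \<Longrightarrow> a A \<in> hm (To (Uo A)) (Ro A)"
       "\<And>A. A \<in> Obj X \<Longrightarrow> Em (Idn X (Uo A)) (a A) (lam (Uo A)) = Em (Idn X (Uo A)) (rr A) (\<rho> A)" by
           metis
    have ai: "L.iso_hm (To (Uo A)) (Ro A) (lc (a A))" if "A \<in> Obj X" for A
    proof -
      note s = sh[OF that] and r = rr[OF that]
      note o = om[OF s(4)]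
      obtain S0 y \<delta> where S0: "tri A (Ro A) S0 (rr A) y \<delta>" "S0 \<in> S" by (rule wC_E[OF r(1,2)])
      \<comment> \<open>The pushed extension still has middle term in \<open>N\<close>: it is an
        extension of \<open>S0\<close> by \<open>Vo A\<close>.\<close>
      obtain M m1 m2 e1 e2 where M: "tri (Ro A) M (Uo A) m1 e2 (Em (Idn X (Uo A)) (rr A) (\<rho> A))"
        "tri (Vo A) M S0 m2 e1 (Em (Idn X S0) (v A) \<delta>)"
        using tri_pushout[OF S0(1) s(1)] by blast
      have "M \<in> N" by (rule N_extension[OF M(2) V_N[OF s(2)] S_N[OF S0(2)]])
      then show ?thesis using tri_N_iso_left[OF o(1) M(1) S_N[OF o(3)] _ a(1)[OF that] a(2)[OF
          that]] by blast
    qed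
    define \<psi> where "\<psi> = (\<lambda>A. linv (lc (rr A)) \<odot> lc (a A))"
    show ?thesis
    proof (rule nat_iso_locI[where \<eta> = \<psi>, OF comp_func_functor[OF shift_props(1) G(1)]
        id_func_functor])
      show "L.iso_hm (OMap (comp_func G Sh) A) (OMap id_func A) (\<psi> A)" if "A \<in> Obj X" for A
        using L.iso_cmp[OF ai[OF that] L.inv_arr_props(4)[OF rr_iso[OF that]]] that sh(4)[OF that]
            G(2) shift_props(2)
        by (simp add: comp_func_def id_func_def \<psi>_def)
      fix f A B assume f: "f \<in> hm A B"
      have o: "A \<in> Obj X" "B \<in> Obj X" using hm_obj f by blast+
      note uf' = uf[OF f] and t = tfc[OF uf(1)[OF f]] and rA = rr[OF o(1)] and rB = rr[OF o(2)]
      note ts = triD[OF sh(1)[OF o(1)]] triD[OF sh(1)[OF o(2)]] triD[OF om(1)[OF sh(4)[OF o(1)]]]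
          triD[OF om(1)[OF sh(4)[OF o(2)]]]
      note aA = a(1)[OF o(1)] and aB = a(1)[OF o(2)]
      obtain g where g: "g \<in> hm (Ro A) (Ro B)" "g \<cdot> rr A = rr B \<cdot> f" using extend_wC[OF rB(3)
          rA(1,2) cmp_hom[OF f rB(2)]] by blast
      have "Em (Idn X (Uo A)) (g \<cdot> a A) (lam (Uo A)) = Em (Idn X (Uo A)) g (Em (Idn X (Uo A)) (a A)
          (lam (Uo A)))"
        using ts aA g(1) by (simp add: hm_iff)
      also have "\<dots> = Em (Idn X (Uo A)) (g \<cdot> rr A) (\<rho> A)" unfolding a(2)[OF o(1)] using ts rA(2) g(1)
          by (simp add: hm_iff)
      also have "\<dots> = Em (Idn X (Uo A)) (rr B) (Em (Idn X (Uo A)) f (\<rho> A))" unfolding g(2) using ts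
          rB(2) f by (simp add: hm_iff)
      also have "\<dots> = Em (uf f) (Idn X (Ro B)) (Em (Idn X (Uo B)) (rr B) (\<rho> B))" unfolding uf'(2)
          using ts rB(2,4) uf'(1) by (simp add: hm_iff)
      also have "\<dots> = Em (Idn X (Uo A)) (a B) (Em (uf f) (Idn X (To (Uo B))) (lam (Uo B)))"
        unfolding a(2)[OF o(2), symmetric] using ts aB rB(4) uf'(1) by (simp add: hm_iff)
      also have "\<dots> = Em (Idn X (Uo A)) (a B \<cdot> tfc (uf f)) (lam (Uo A))" unfolding t(2)[symmetric]
          using ts aB t(1) by (simp add: hm_iff)
      finally have "lc (g \<cdot> a A) = lc (a B \<cdot> tfc (uf f))"
        using push_lc_eq[OF sh(4)[OF o(1)] cmp_hom[OF aA g(1)] cmp_hom[OF t(1) aB]] by blast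
      then have e: "lc g \<odot> lc (a A) = lc (a B) \<odot> lc (tfc (uf f))"
        using lc_cmp[OF aA g(1)] lc_cmp[OF t(1) aB] by simp
      have n: "linv (lc (rr B)) \<odot> lc g = lc f \<odot> linv (lc (rr A))"
        by (rule inv_arr_natural[OF rr_iso[OF o(1)] rr_iso[OF o(2)] lc_hm[OF f] lc_hm[OF g(1)]])
          (use lc_cmp[OF rA(2) g(1)] lc_cmp[OF f rB(2)] g(2) in simp)
      have "\<psi> B \<odot> lc (tfc (uf f)) = lc f \<odot> \<psi> A"
        unfolding \<psi>_def using e[symmetric] L.reassoc[OF n, of "lc (a A)"] L.inv_arr_props(1)[OF
            rr_iso[OF o(1)]] L.inv_arr_props(1)[OF rr_iso[OF o(2)]]
          lc_hm[OF aA] lc_hm[OF aB] lc_hm[OF t(1)] lc_hm[OF g(1)] lc_hm[OF f] by (simp add: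
              L.hm_iff)
      then show "\<psi> B \<odot> AMap (comp_func G Sh) (lc f) = AMap id_func (lc f) \<odot> \<psi> A"
        using f uf'(1) G(3) shift_props(3) by (simp add: comp_func_def id_func_def hm_iff)
    qed
  qed
  ultimately show ?thesis unfolding auto_equivalence_def using G(1) shift_props(1) by blast
qed

end

section \<open>A criterion for triangulated categories\<close>

text \<open>It suffices to know forward rotation and one octahedron for every composable pair: the
  five lemma makes the cone of an arrow unique up to isomorphism, which gives backward rotation and
  transports the octahedron to arbitrary cones.\<close>

locale pretriangulated = acat T for T :: "('o, 'm, 'z) add_cat_scheme" (structure) +
  fixes F :: "('o, 'm, 'o, 'm) func" and \<Delta> :: "('m \<times> 'm \<times> 'm) set"
  assumes F_additive: "additive_functor T T F"
    and F_equiv: "auto_equivalence T F"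
    and dist_triangle: "t \<in> \<Delta> \<Longrightarrow> triangle T F t"
    and dist_iso: "\<lbrakk>t \<in> \<Delta>; triangle_iso T F t t'\<rbrakk> \<Longrightarrow> t' \<in> \<Delta>"
    and dist_idn: "\<lbrakk>A \<in> Obj T; zero_object T Z\<rbrakk> \<Longrightarrow> (Idn T A, hzero T A Z, hzero T Z (OMap F A)) \<in> \<Delta>"
    and dist_ex: "f \<in> Arr T \<Longrightarrow> \<exists>g h. (f, g, h) \<in> \<Delta>"
    and dist_rotate: "(f, g, h) \<in> \<Delta> \<Longrightarrow> (g, h, hneg T (AMap F f)) \<in> \<Delta>"
    and dist_morphism: "\<lbrakk>(f, g, h) \<in> \<Delta>; (f', g', h') \<in> \<Delta>;
        a \<in> Hom T (Dom T f) (Dom T f'); b \<in> Hom T (Cod T f) (Cod T f'); b \<cdot> f = f' \<cdot> a\<rbrakk>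
      \<Longrightarrow> \<exists>c. triangle_morphism T F (f, g, h) (f', g', h') (a, b, c)"
    and octahedron: "\<lbrakk>f \<in> Hom T A B; g \<in> Hom T B D\<rbrakk> \<Longrightarrow>
      \<exists>f' f'' g' g'' h' h'' d e. (f, f', f'') \<in> \<Delta> \<and> (g, g', g'') \<in> \<Delta> \<and> (g \<cdot> f, h', h'') \<in> \<Delta> \<and>
        d \<in> Hom T (Cod T f') (Cod T h') \<and> e \<in> Hom T (Cod T h') (Cod T g') \<and>
        (d, e, AMap F f' \<cdot> g'') \<in> \<Delta> \<and>
        d \<cdot> f' = h' \<cdot> g \<and> h'' \<cdot> d = f'' \<and> e \<cdot> h' = g' \<and> g'' \<cdot> e = AMap F f \<cdot> h''"
begin

abbreviation Fo :: "'o \<Rightarrow> 'o" where "Fo \<equiv> OMap F"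
abbreviation Fm :: "'m \<Rightarrow> 'm" where "Fm \<equiv> AMap F"

lemma F_functor: "is_functor T T F"
  using F_additive by (simp add: additive_functor_def)

lemma Fm_hm: "f \<in> hm A B \<Longrightarrow> Fm f \<in> hm (Fo A) (Fo B)"
  using F_functor unfolding is_functor_def by (auto simp: hm_iff)

lemma Fm_arr [simp]: "f \<in> Arr T \<Longrightarrow> Fm f \<in> Arr T" "f \<in> Arr T \<Longrightarrow> Dom T (Fm f) = Fo (Dom T f)"
   "f \<in> Arr T \<Longrightarrow> Cod T (Fm f) = Fo (Cod T f)"
  using Fm_hm[of f "Dom T f" "Cod T f"] by (auto simp: hm_iff)

lemma Fo_obj [simp]: "A \<in> Obj T \<Longrightarrow> Fo A \<in> Obj T"
  using F_functor unfolding is_functor_def by blast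

lemma Fm_cmp: "\<lbrakk>f \<in> Arr T; g \<in> Arr T; Cod T f = Dom T g\<rbrakk> \<Longrightarrow> Fm (g \<cdot> f) = Fm g \<cdot> Fm f"
  using F_functor unfolding is_functor_def by blast

lemma Fm_idn: "A \<in> Obj T \<Longrightarrow> Fm (Idn T A) = Idn T (Fo A)"
  using F_functor unfolding is_functor_def by blast

section \<open>The shift is fully faithful and reflects isomorphisms\<close>

lemma equiv_faithful:
  assumes F: "is_functor T T F1" and n: "naturally_isomorphic T T (comp_func G F1) id_func"
    and f: "f \<in> hm A B" "g \<in> hm A B" "AMap F1 f = AMap F1 g"
  shows "f = g"
proof -
  obtain \<eta> where \<eta>: "\<And>A. A \<in> Obj T \<Longrightarrow> \<eta> A \<in> hm (OMap (comp_func G F1) A) A \<and> iso_arr T (\<eta> A)"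
     "\<And>f. f \<in> Arr T \<Longrightarrow> \<eta> (Cod T f) \<cdot> AMap (comp_func G F1) f = f \<cdot> \<eta> (Dom T f)"
    using n unfolding naturally_isomorphic_def id_func_def by auto
  have "A \<in> Obj T" using hm_obj f by blast
  then have "iso_hm (OMap (comp_func G F1) A) A (\<eta> A)" using \<eta>(1) iso_arr_hm by blast
  moreover have "f \<cdot> \<eta> A = g \<cdot> \<eta> A" using \<eta>(2)[of f] \<eta>(2)[of g] f by (simp add: hm_iff
      comp_func_def)
  ultimately show ?thesis using iso_cancel_right f by blast
qed

lemma Fm_faithful: "\<lbrakk>f \<in> hm A B; g \<in> hm A B; Fm f = Fm g\<rbrakk> \<Longrightarrow> f = g"
  using F_equiv equiv_faithful[OF F_functor] unfolding auto_equivalence_def by blast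

lemma Fm_full:
  assumes "k \<in> hm (Fo A) (Fo B)" "A \<in> Obj T" "B \<in> Obj T" shows "\<exists>f\<in>hm A B. Fm f = k"
proof -
  obtain G where G: "is_functor T T G" "naturally_isomorphic T T (comp_func G F) id_func"
     "naturally_isomorphic T T (comp_func F G) id_func"
    using F_equiv unfolding auto_equivalence_def by blast
  have Gh: "AMap G k \<in> hm (OMap G (Fo A)) (OMap G (Fo B))" using G(1) assms(1) unfolding
      is_functor_def by (auto simp: hm_iff)
  obtain \<eta> where \<eta>: "\<And>A. A \<in> Obj T \<Longrightarrow> \<eta> A \<in> hm (OMap G (Fo A)) A \<and> iso_arr T (\<eta> A)"
     "\<And>f. f \<in> Arr T \<Longrightarrow> \<eta> (Cod T f) \<cdot> AMap G (Fm f) = f \<cdot> \<eta> (Dom T f)"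
    using G(2) unfolding naturally_isomorphic_def id_func_def comp_func_def by auto
  have i: "iso_hm (OMap G (Fo A)) A (\<eta> A)" "iso_hm (OMap G (Fo B)) B (\<eta> B)" using \<eta>(1) assms
      iso_arr_hm by blast+
  note ia = inv_arr_props[OF i(1)]
  define f where "f = \<eta> B \<cdot> AMap G k \<cdot> inv_arr T (\<eta> A)"
  have f: "f \<in> hm A B" unfolding f_def using cmp_hom[OF cmp_hom[OF ia(1) Gh] iso_hm_hm[OF i(2)]] by
      simp
  have GF: "AMap G (Fm f) \<in> hm (OMap G (Fo A)) (OMap G (Fo B))"
    using G(1) Fm_hm[OF f] unfolding is_functor_def by (auto simp: hm_iff)
  have "\<eta> B \<cdot> AMap G (Fm f) = f \<cdot> \<eta> A" using \<eta>(2)[of f] f by (simp add: hm_iff)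
  also have "\<dots> = \<eta> B \<cdot> AMap G k"
    unfolding f_def using ia Gh iso_hm_hm[OF i(1)] iso_hm_hm[OF i(2)] by (simp add: hm_iff)
  finally have "AMap G (Fm f) = AMap G k" using iso_cancel_left[OF i(2) GF Gh] by blast
  \<comment> \<open>The quasi-inverse \<open>G\<close> is faithful as well, by the other natural
    isomorphism.\<close>
  then have "Fm f = k" using equiv_faithful[OF G(1,3) Fm_hm[OF f] assms(1)] by blast
  then show ?thesis using f by blast
qed

lemma Fm_reflects_iso:
  assumes "iso_hm (Fo A) (Fo B) (Fm f)" "f \<in> hm A B" shows "iso_hm A B f"
proof -
  have o: "A \<in> Obj T" "B \<in> Obj T" using hm_obj assms(2) by blast+
  obtain k where k: "k \<in> hm (Fo B) (Fo A)" "k \<cdot> Fm f = Idn T (Fo A)" "Fm f \<cdot> k = Idn T (Fo B)"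
    using assms(1) by (meson iso_hmE)
  obtain g where g: "g \<in> hm B A" "Fm g = k" using Fm_full[OF k(1) o(2,1)] by blast
  have "Fm (g \<cdot> f) = Fm (Idn T A)" "Fm (f \<cdot> g) = Fm (Idn T B)"
    using Fm_cmp[of f g] Fm_cmp[of g f] Fm_idn o g k assms(2) by (simp_all add: hm_iff)
  then have "g \<cdot> f = Idn T A" "f \<cdot> g = Idn T B"
    using Fm_faithful[OF cmp_hom[OF assms(2) g(1)] idn_hom[OF o(1)]] Fm_faithful[OF cmp_hom[OF g(1)
        assms(2)] idn_hom[OF o(2)]] by blast+
  then show ?thesis using iso_hmI[OF assms(2) g(1)] by blast
qed

lemma distE:
  assumes "(f, g, h) \<in> \<Delta>"
  obtains A B C where "f \<in> hm A B" "g \<in> hm B C" "h \<in> hm C (Fo A)"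
  using dist_triangle[OF assms] unfolding triangle_def by (auto simp: hm_iff)

lemma dist_morphism':
  assumes "(f, g, h) \<in> \<Delta>" "f \<in> hm A B" "g \<in> hm B C" "h \<in> hm C (Fo A)"
    "(f', g', h') \<in> \<Delta>" "f' \<in> hm A' B'" "g' \<in> hm B' C'" "h' \<in> hm C' (Fo A')"
    "a \<in> hm A A'" "b \<in> hm B B'" "b \<cdot> f = f' \<cdot> a"
  shows "\<exists>c\<in>hm C C'. c \<cdot> g = g' \<cdot> b \<and> h' \<cdot> c = Fm a \<cdot> h"
proof -
  have "\<exists>c. triangle_morphism T F (f, g, h) (f', g', h') (a, b, c)"
    by (rule dist_morphism[OF assms(1,5)]) (use assms in \<open>simp_all add: hm_iff\<close>)
  then show ?thesis using assms unfolding triangle_morphism_def by (auto simp: hm_iff)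
qed

text \<open>The pair consisting of the identity and \<open>f\<close> completes to a morphism from
  the identity triangle, so \<open>g \<cdot> f\<close> factors through a zero object.\<close>

lemma dist_cmp_zero:
  assumes "(f, g, h) \<in> \<Delta>" "f \<in> hm A B" "g \<in> hm B C" "h \<in> hm C (Fo A)"
  shows "g \<cdot> f = hz A C"
proof -
  obtain Z where Z: "zero_object T Z" using ex_zero_object by blast
  have o: "A \<in> Obj T" "Z \<in> Obj T" using Z hm_obj(1)[OF assms(2)] by (auto simp: zero_object_def)
  have "f \<cdot> Idn T A = f \<cdot> Idn T A" ..
  then obtain c where "c \<in> hm Z C" "c \<cdot> hz A Z = g \<cdot> f"
    using dist_morphism'[OF dist_idn[OF o(1) Z] idn_hom[OF o(1)] hz_hm[OF o] hz_hm[OF o(2) Fo_obj[OF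
        o(1)]] assms idn_hom[OF o(1)] assms(2)] by blast
  then show ?thesis using o by (auto simp: hm_iff)
qed

text \<open>Rotate the identity triangle of \<open>Y\<close> and the given triangle;
  \<open>y\<close> and a zero arrow form the starting square, and the completion is an arrow
  \<open>Fo Y \<rightarrow> Fo A\<close>. Fullness and faithfulness of the shift bring it back to
  \<open>Y \<rightarrow> A\<close>.\<close>

lemma dist_exact:
  assumes "(f, g, h) \<in> \<Delta>" "f \<in> hm A B" "g \<in> hm B C" "h \<in> hm C (Fo A)" "y \<in> hm Y B" "g \<cdot> y = hz Y C"
  shows "\<exists>x\<in>hm Y A. y = f \<cdot> x"
proof -
  obtain Z where Z: "zero_object T Z" using ex_zero_object by blast
  have o: "A \<in> Obj T" "B \<in> Obj T" "C \<in> Obj T" "Z \<in> Obj T" "Y \<in> Obj T"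
    using Z hm_obj[OF assms(2)] hm_obj[OF assms(3)] hm_obj(1)[OF assms(5)] by (auto simp:
        zero_object_def)
  note h = hz_hm[OF o(5,4)] hz_hm[OF o(4) Fo_obj[OF o(5)]] neg_hm[OF Fm_hm[OF idn_hom[OF o(5)]]]
      neg_hm[OF Fm_hm[OF assms(2)]]
  have "hz Z C \<cdot> hz Y Z = g \<cdot> y" using assms(6) o by simp
  then obtain c where c: "c \<in> hm (Fo Y) (Fo A)" "hn (Fm f) \<cdot> c = Fm y \<cdot> hn (Fm (Idn T Y))"
    using dist_morphism'[OF dist_rotate[OF dist_idn[OF o(5) Z]] h(1,2,3) dist_rotate[OF assms(1)]
        assms(3,4) h(4) assms(5) hz_hm[OF o(4,3)]] by blast
  obtain x where x: "x \<in> hm Y A" "Fm x = c" using Fm_full[OF c(1) o(5,1)] by blast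
  have "hn (Fm f \<cdot> c) = hn (Fm y)" using c o assms(2,5) Fm_idn by (simp add: hm_iff)
  then have "hn (hn (Fm f \<cdot> c)) = hn (hn (Fm y))" by simp
  then have "Fm y = Fm (f \<cdot> x)" using Fm_cmp[of x f] x c(1) assms(2,5) by (simp add: hm_iff)
  then show ?thesis using Fm_faithful[OF assms(5) cmp_hom[OF x(1) assms(2)]] x(1) by blast
qed

text \<open>A diagram chase with arrows from a test object \<open>Y\<close>, with exactness taken
  from the triangles and their rotations.\<close>

lemma five:
  assumes D: "(f, g, h) \<in> \<Delta>" "f \<in> hm A B" "g \<in> hm B C" "h \<in> hm C (Fo A)"
    and D': "(f', g', h') \<in> \<Delta>" "f' \<in> hm A' B'" "g' \<in> hm B' C'" "h' \<in> hm C' (Fo A')"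
    and a: "iso_hm A A' a" and b: "iso_hm B B' b" and c: "c \<in> hm C C'"
    and e: "b \<cdot> f = f' \<cdot> a" "c \<cdot> g = g' \<cdot> b" "h' \<cdot> c = Fm a \<cdot> h"
  shows "iso_hm C C' c"
proof -
  note ah = iso_hm_hm[OF a] and bh = iso_hm_hm[OF b]
  note R = dist_rotate[OF D(1)] and R' = dist_rotate[OF D'(1)]
  note nf = neg_hm[OF Fm_hm[OF D(2)]] neg_hm[OF Fm_hm[OF D'(2)]]
  note ng = neg_hm[OF Fm_hm[OF D(3)]] neg_hm[OF Fm_hm[OF D'(3)]]
  note RR = dist_rotate[OF R] and RR' = dist_rotate[OF R']
  obtain a' where a': "a' \<in> hm A' A" "a' \<cdot> a = Idn T A" "a \<cdot> a' = Idn T A'" using a by (meson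
      iso_hmE)
  obtain b' where b': "b' \<in> hm B' B" "b' \<cdot> b = Idn T B" "b \<cdot> b' = Idn T B'" using b by (meson
      iso_hmE)
  have o: "A \<in> Obj T" "A' \<in> Obj T" "C \<in> Obj T" "C' \<in> Obj T" using hm_obj[OF ah] hm_obj[OF c] by auto
  have Fa: "Fm a \<cdot> Fm a' = Idn T (Fo A')" "Fm a' \<cdot> Fm a = Idn T (Fo A)"
    using Fm_cmp[of a' a] Fm_cmp[of a a'] a' ah Fm_idn o by (auto simp: hm_iff)
  have bf: "f \<cdot> a' = b' \<cdot> f'"
  proof -
    have "f \<cdot> a' = b' \<cdot> ((b \<cdot> f) \<cdot> a')" using reassoc[OF b'(2), of "f \<cdot> a'"] b'(1) bh D(2) a'(1) by
        (simp add: hm_iff)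
    also have "\<dots> = b' \<cdot> f'" unfolding e(1) using D'(2) ah a' b'(1) by (simp add: hm_iff)
    finally show ?thesis .
  qed
  \<comment> \<open>Surjectivity: \<open>h' \<cdot> z\<close> comes from some \<open>y1\<close> in
    \<open>C\<close>, and the remaining error \<open>z - c \<cdot> y1\<close> comes from
    \<open>B'\<close>, where \<open>b\<close> can be inverted.\<close>
  have surj: "\<exists>y\<in>hm Y C. c \<cdot> y = z" if z: "z \<in> hm Y C'" for Y z
  proof -
    have Y: "Y \<in> Obj T" using hm_obj z by blast
    define w where "w = Fm a' \<cdot> (h' \<cdot> z)"
    have w: "w \<in> hm Y (Fo A)" unfolding w_def using cmp_hom[OF cmp_hom[OF z D'(4)] Fm_hm[OF a'(1)]]
        .
    have ff: "Fm f' \<cdot> h' = hz C' (Fo B')"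
    proof -
      have "hn (Fm f' \<cdot> h') = hz C' (Fo B')" using dist_cmp_zero[OF R' D'(3,4) nf(2)]
          dist_cmp_zero[OF RR' D'(4) nf(2) ng(2)] D'(2,4) by (simp add: hm_iff)
      then have "hn (hn (Fm f' \<cdot> h')) = hn (hz C' (Fo B'))" by simp
      then show ?thesis using D'(2,4) o(4) hm_obj(2)[OF D'(2)] by (simp add: hm_iff)
    qed
    have Ffa: "Fm f \<cdot> Fm a' = Fm b' \<cdot> Fm f'"
      using bf Fm_cmp[of a' f] Fm_cmp[of f' b'] a'(1) b'(1) D(2) D'(2) by (auto simp: hm_iff)
    have "Fm f \<cdot> w = hz Y (Fo B)"
    proof -
      have "Fm f \<cdot> w = (Fm f \<cdot> Fm a') \<cdot> (h' \<cdot> z)" unfolding w_def using D(2) D'(4) a'(1) z by (simp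
          add: hm_iff)
      also have "\<dots> = Fm b' \<cdot> ((Fm f' \<cdot> h') \<cdot> z)" unfolding Ffa using D'(2,4) b'(1) z by (simp add:
          hm_iff)
      also have "\<dots> = hz Y (Fo B)" unfolding ff using b'(1) z Y hm_obj(2)[OF D'(2)] by (simp add:
          hm_iff)
      finally show ?thesis .
    qed
    then have "hn (Fm f) \<cdot> w = hz Y (Fo B)" using D(2) w Y hm_obj(2)[OF D(2)] by (simp add: hm_iff)
    then obtain y1 where y1: "y1 \<in> hm Y C" "w = h \<cdot> y1" using dist_exact[OF RR D(4) nf(1) ng(1) w]
        by blast
    have "h' \<cdot> (c \<cdot> y1) = Fm a \<cdot> w" using reassoc[OF e(3), of y1] y1 c D(4) D'(4) ah by (simp add:
        hm_iff)
    also have "\<dots> = h' \<cdot> z" unfolding w_def using reassoc[OF Fa(1), of "h' \<cdot> z"] ah a'(1) D'(4) z by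
        (simp add: hm_iff)
    finally have hh: "h' \<cdot> (c \<cdot> y1) = h' \<cdot> z" .
    have cy: "c \<cdot> y1 \<in> hm Y C'" using cmp_hom[OF y1(1) c] .
    have "h' \<cdot> (z \<plusminus> hn (c \<cdot> y1)) = hz Y (Fo A')" using hh D'(4) z cy by (simp add: hm_iff distrib)
    then obtain y2 where y2: "y2 \<in> hm Y B'" "z \<plusminus> hn (c \<cdot> y1) = g' \<cdot> y2"
      using dist_exact[OF R' D'(3,4) nf(2) add_hm[OF z neg_hm[OF cy]]] by blast
    have "c \<cdot> (g \<cdot> (b' \<cdot> y2)) = g' \<cdot> y2"
      using reassoc[OF e(2), of "b' \<cdot> y2"] reassoc[OF b'(3), of y2] c D(3) D'(3) b'(1) bh y2(1) by
          (simp add: hm_iff)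
    then have "c \<cdot> (y1 \<plusminus> g \<cdot> (b' \<cdot> y2)) = c \<cdot> y1 \<plusminus> (z \<plusminus> hn (c \<cdot> y1))"
      unfolding y2(2) using c y1(1) D(3) b'(1) y2(1) by (simp add: hm_iff distrib)
    also have "\<dots> = z" using cy z by (simp add: hm_iff alcomm[of "c \<cdot> y1" z])
    finally show ?thesis using add_hm[OF y1(1) cmp_hom[OF cmp_hom[OF y2(1) b'(1)] D(3)]] by blast
  qed
  \<comment> \<open>Injectivity: \<open>z\<close> comes from \<open>B\<close>, its image under
    \<open>b\<close> comes from \<open>A'\<close>, so \<open>z\<close> contains the zero composite
    \<open>g \<cdot> f\<close>.\<close>
  have inj: "z = hz Y C" if z: "z \<in> hm Y C" "c \<cdot> z = hz Y C'" for Y z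
  proof -
    have Y: "Y \<in> Obj T" using hm_obj z(1) by blast
    have "h \<cdot> z = (Fm a' \<cdot> Fm a) \<cdot> (h \<cdot> z)" unfolding Fa(2) using D(4) z(1) by (simp add: hm_iff)
    also have "\<dots> = Fm a' \<cdot> ((h' \<cdot> c) \<cdot> z)" unfolding e(3) using D(4) z(1) ah a'(1) by (simp add:
        hm_iff)
    also have "\<dots> = hz Y (Fo A)" using D'(4) c z a'(1) Y o(4) by (simp add: hm_iff)
    finally obtain y where y: "y \<in> hm Y B" "z = g \<cdot> y" using dist_exact[OF R D(3,4) nf(1) z(1)] by
        blast
    have "g' \<cdot> (b \<cdot> y) = hz Y C'" using z(2) reassoc[OF e(2), of y] y c D(3) D'(3) bh by (simp add:
        hm_iff)
    then obtain x' where x': "x' \<in> hm Y A'" "b \<cdot> y = f' \<cdot> x'" using dist_exact[OF D' cmp_hom[OF y(1)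
        bh]] by blast
    have "y = b' \<cdot> (b \<cdot> y)" using reassoc[OF b'(2), of y] y(1) b'(1) bh by (simp add: hm_iff)
    also have "\<dots> = f \<cdot> (a' \<cdot> x')" unfolding x'(2) using reassoc[OF bf, of x'] x'(1) b'(1) D'(2) D(2)
        a'(1) by (simp add: hm_iff)
    finally have yf: "y = f \<cdot> (a' \<cdot> x')" .
    have "z = (g \<cdot> f) \<cdot> (a' \<cdot> x')" unfolding y(2) yf using D(2,3) a'(1) x'(1) by (simp add: hm_iff)
    then show ?thesis unfolding dist_cmp_zero[OF D] using a'(1) x'(1) o Y by (simp add: hm_iff)
  qed
  obtain d where d: "d \<in> hm C' C" "c \<cdot> d = Idn T C'" using surj[OF idn_hom[OF o(4)]] by blast
  have dc: "d \<cdot> c \<in> hm C C" using cmp_hom[OF c d(1)] .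
  \<comment> \<open>The right inverse is also a left inverse, since \<open>d \<cdot> c - 1\<close>
    is killed by \<open>c\<close>.\<close>
  have "c \<cdot> (d \<cdot> c \<plusminus> hn (Idn T C)) = hz C C'"
    using c d reassoc[OF d(2), of c] o by (simp add: hm_iff distrib)
  then have "d \<cdot> c \<plusminus> hn (Idn T C) = hz C C" using inj add_hm[OF dc neg_hm[OF idn_hom[OF o(3)]]] by
      blast
  then have "d \<cdot> c = Idn T C" using diff_zero_eq[OF dc idn_hom[OF o(3)]] by blast
  then show ?thesis using iso_hmI[OF c d(1)] d(2) by blast
qed

lemma cone_unique:
  assumes D: "(f, g, h) \<in> \<Delta>" "f \<in> hm A B" "g \<in> hm B C" "h \<in> hm C (Fo A)"
    and D': "(f, g', h') \<in> \<Delta>" "g' \<in> hm B C'" "h' \<in> hm C' (Fo A)"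
  shows "\<exists>c. iso_hm C C' c \<and> c \<cdot> g = g' \<and> h' \<cdot> c = h"
proof -
  have o: "A \<in> Obj T" "B \<in> Obj T" using hm_obj[OF D(2)] by auto
  have ff: "Idn T B \<cdot> f = f \<cdot> Idn T A" using D(2) by (simp add: hm_iff)
  obtain c where c: "c \<in> hm C C'" "c \<cdot> g = g' \<cdot> Idn T B" "h' \<cdot> c = Fm (Idn T A) \<cdot> h"
    using dist_morphism'[OF D D'(1) D(2) D'(2,3) idn_hom[OF o(1)] idn_hom[OF o(2)] ff] by blast
  have "iso_hm C C' c" by (rule five[OF D D'(1) D(2) D'(2,3) iso_idn[OF o(1)] iso_idn[OF o(2)] c(1)
      ff c(2,3)])
  then show ?thesis using c D'(2) D(4) o Fm_idn by (auto simp: hm_iff)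
qed

text \<open>Complete \<open>f\<close> to some distinguished triangle. Three rotations of it and two
  rotations of the given one both start with the negative of \<open>Fm f\<close>, so their cones
  agree; the comparison descends along the fully faithful shift.\<close>

lemma dist_rotate_back:
  assumes t: "f \<in> hm A B" "g \<in> hm B C" "h \<in> hm C (Fo A)" and D: "(g, h, hn (Fm f)) \<in> \<Delta>"
  shows "(f, g, h) \<in> \<Delta>"
proof -
  have o: "A \<in> Obj T" "B \<in> Obj T" "C \<in> Obj T" using hm_obj[OF t(1)] hm_obj[OF t(2)] by auto
  obtain g' h' where D': "(f, g', h') \<in> \<Delta>" using dist_ex[of f] t(1) unfolding hm_iff by blast
  obtain C' where g'h': "g' \<in> hm B C'" "h' \<in> hm C' (Fo A)"
    using distE[OF D'] t(1) by (metis hm_iff)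
  have oC': "C' \<in> Obj T" using hm_obj g'h' by blast
  note R' = dist_rotate[OF dist_rotate[OF dist_rotate[OF D']]] and R = dist_rotate[OF dist_rotate[OF
      D]]
  note nh = neg_hm[OF Fm_hm[OF t(1)]] neg_hm[OF Fm_hm[OF t(2)]] neg_hm[OF Fm_hm[OF t(3)]]
  note nh' = neg_hm[OF Fm_hm[OF g'h'(1)]] neg_hm[OF Fm_hm[OF g'h'(2)]]
  obtain c where c: "iso_hm (Fo C') (Fo C) c" "c \<cdot> hn (Fm g') = hn (Fm g)" "hn (Fm h) \<cdot> c = hn (Fm
      h')"
    using cone_unique[OF R' nh(1) nh' R nh(2,3)] by blast
  obtain k where k: "k \<in> hm C' C" "Fm k = c" using Fm_full[OF iso_hm_hm[OF c(1)] oC' o(3)] by blast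
  have ik: "iso_hm C' C k" using Fm_reflects_iso k c(1) by blast
  have "hn (Fm (k \<cdot> g')) = hn (Fm g)" "hn (Fm (h \<cdot> k)) = hn (Fm h')"
    using c iso_hm_hm[OF c(1)] k g'h' t Fm_cmp[of g' k] Fm_cmp[of k h] by (simp_all add: hm_iff)
  then have "hn (hn (Fm (k \<cdot> g'))) = hn (hn (Fm g))" "hn (hn (Fm (h \<cdot> k))) = hn (hn (Fm h'))" by
      simp_all
  then have "Fm (k \<cdot> g') = Fm g" "Fm (h \<cdot> k) = Fm h'" using k g'h' t by (simp_all add: hm_iff)
  then have e: "k \<cdot> g' = g" "h \<cdot> k = h'"
    using Fm_faithful[OF cmp_hom[OF g'h'(1) k(1)] t(2)] Fm_faithful[OF cmp_hom[OF k(1) t(3)]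
        g'h'(2)] by blast+
  have i: "iso_arr T (Idn T A)" "iso_arr T (Idn T B)" "iso_arr T k" using ik o iso_idn iso_arr_iff
      by blast+
  have "triangle_morphism T F (f, g', h') (f, g, h) (Idn T A, Idn T B, k)"
    unfolding triangle_morphism_def using t g'h' k(1) o e Fm_idn[OF o(1)] by (simp add: hm_iff)
  moreover have "triangle T F (f, g', h')" "triangle T F (f, g, h)"
    unfolding triangle_def using t g'h' by (simp_all add: hm_iff)
  ultimately have "triangle_iso T F (f, g', h') (f, g, h)" unfolding triangle_iso_def using i by
      blast
  then show ?thesis using dist_iso D' by blast
qed

lemma triangulated: "triangulated_category T F \<Delta>"
proof (intro triangulated_category.intro triangulated_category_axioms.intro)
  show "additive_category T" by (rule additive_category_axioms)
  show "additive_functor T T F" by (rule F_additive)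
  show "auto_equivalence T F" by (rule F_equiv)
  show "triangle T F t" if "t \<in> \<Delta>" for t by (rule dist_triangle[OF that])
  show "t' \<in> \<Delta>" if "t \<in> \<Delta>" "triangle_iso T F t t'" for t t' by (rule dist_iso[OF that])
  show "(Idn T A, hz A Z, hz Z (Fo A)) \<in> \<Delta>" if "A \<in> Obj T" "zero_object T Z" for A Z by (rule
      dist_idn[OF that])
  show "\<exists>g h. (f, g, h) \<in> \<Delta>" if "f \<in> Arr T" for f by (rule dist_ex[OF that])
  show "(f, g, h) \<in> \<Delta> \<longleftrightarrow> (g, h, hn (Fm f)) \<in> \<Delta>" if "triangle T F (f, g, h)" for f g h
    using dist_rotate dist_rotate_back[of f "Dom T f" "Cod T f" g "Cod T g" h] that unfolding
        triangle_def by (auto simp: hm_iff)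
  show "\<exists>c. triangle_morphism T F (f, g, h) (f', g', h') (a, b, c)"
    if "(f, g, h) \<in> \<Delta>" "(f', g', h') \<in> \<Delta>" "a \<in> hm (Dom T f) (Dom T f')" "b \<in> hm (Cod T f) (Cod T
        f')" "b \<cdot> f = f' \<cdot> a"
    for f g h f' g' h' a b by (rule dist_morphism[OF that])
next
  fix f g f' f'' g' g'' h' h''
  assume "Cod T f = Dom T g" and D: "(f, f', f'') \<in> \<Delta>" "(g, g', g'') \<in> \<Delta>" "(g \<cdot> f, h', h'') \<in> \<Delta>"
  obtain A B D1 where tf: "f \<in> hm A B" "f' \<in> hm B D1" "f'' \<in> hm D1 (Fo A)" by (rule distE[OF D(1)])
  obtain C E1 where tg: "g \<in> hm B C" "g' \<in> hm C E1" "g'' \<in> hm E1 (Fo B)"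
    by (rule distE[OF D(2)]) (use \<open>Cod T f = Dom T g\<close> tf(1) in \<open>simp add: hm_iff\<close>)
  have gf: "g \<cdot> f \<in> hm A C" by (rule cmp_hom[OF tf(1) tg(1)])
  obtain H1 where th: "h' \<in> hm C H1" "h'' \<in> hm H1 (Fo A)"
    by (rule distE[OF D(3)]) (use gf in \<open>simp add: hm_iff\<close>)
  \<comment> \<open>The octahedron on these cones is conjugated to the prescribed ones by the
    isomorphisms \<open>c1\<close>, \<open>c2\<close>, \<open>c3\<close>.\<close>
  obtain f0 f1 g0 g1 h0 h1 d0 e0 where O: "(f, f0, f1) \<in> \<Delta>" "(g, g0, g1) \<in> \<Delta>" "(g \<cdot> f, h0, h1) \<in> \<Delta>"
    "d0 \<in> hm (Cod T f0) (Cod T h0)" "e0 \<in> hm (Cod T h0) (Cod T g0)" "(d0, e0, Fm f0 \<cdot> g1) \<in> \<Delta>"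
    "d0 \<cdot> f0 = h0 \<cdot> g" "h1 \<cdot> d0 = f1" "e0 \<cdot> h0 = g0" "g1 \<cdot> e0 = Fm f \<cdot> h1"
    using octahedron[OF tf(1) tg(1)] by blast
  obtain D0 where tf0: "f0 \<in> hm B D0" "f1 \<in> hm D0 (Fo A)" by (rule distE[OF O(1)]) (use tf(1) in
      \<open>simp add: hm_iff\<close>)
  obtain E0 where tg0: "g0 \<in> hm C E0" "g1 \<in> hm E0 (Fo B)" by (rule distE[OF O(2)]) (use tg(1) in
      \<open>simp add: hm_iff\<close>)
  obtain H0 where th0: "h0 \<in> hm C H0" "h1 \<in> hm H0 (Fo A)" by (rule distE[OF O(3)]) (use gf in \<open>simp
      add: hm_iff\<close>)
  have de: "d0 \<in> hm D0 H0" "e0 \<in> hm H0 E0" using O(4,5) tf0 tg0 th0 by (simp_all add: hm_iff)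
  obtain c1 where c1: "iso_hm D0 D1 c1" "c1 \<cdot> f0 = f'" "f'' \<cdot> c1 = f1" using cone_unique[OF O(1)
      tf(1) tf0 D(1) tf(2,3)] by blast
  obtain c2 where c2: "iso_hm E0 E1 c2" "c2 \<cdot> g0 = g'" "g'' \<cdot> c2 = g1" using cone_unique[OF O(2)
      tg(1) tg0 D(2) tg(2,3)] by blast
  obtain c3 where c3: "iso_hm H0 H1 c3" "c3 \<cdot> h0 = h'" "h'' \<cdot> c3 = h1" using cone_unique[OF O(3) gf
      th0 D(3) th] by blast
  obtain k1 where k1: "k1 \<in> hm D1 D0" "k1 \<cdot> c1 = Idn T D0" "c1 \<cdot> k1 = Idn T D1" using c1(1) by
      (meson iso_hmE)
  obtain k3 where k3: "k3 \<in> hm H1 H0" "k3 \<cdot> c3 = Idn T H0" "c3 \<cdot> k3 = Idn T H1" using c3(1) by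
      (meson iso_hmE)
  have ch: "c1 \<in> hm D0 D1" "c2 \<in> hm E0 E1" "c3 \<in> hm H0 H1" using c1(1) c2(1) c3(1) iso_hm_hm by auto
  define d where "d = c3 \<cdot> (d0 \<cdot> k1)"
  define e where "e = c2 \<cdot> (e0 \<cdot> k3)"
  have dh: "d \<in> hm D1 H1" "e \<in> hm H1 E1" unfolding d_def e_def using cmp_hom[OF cmp_hom[OF k1(1)
      de(1)] ch(3)] cmp_hom[OF cmp_hom[OF k3(1) de(2)] ch(2)] .
  have kf: "k1 \<cdot> f' = f0" using reassoc[OF k1(2), of f0] c1(2) k1(1) ch tf0 by (simp add: hm_iff)
  have kh: "k3 \<cdot> h' = h0" using reassoc[OF k3(2), of h0] c3(2) k3(1) ch th0 by (simp add: hm_iff)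
  have fk: "f1 \<cdot> k1 = f''" using reassoc[OF c1(3), of k1] k1 ch tf by (simp add: hm_iff)
  have hk: "h1 \<cdot> k3 = h''" using reassoc[OF c3(3), of k3] k3 ch th by (simp add: hm_iff)
  have 1: "d \<cdot> f' = h' \<cdot> g"
    unfolding d_def using kf O(7) reassoc[OF c3(2), of g] k1(1) ch de tf th tg th0 tf0 by (simp add:
        hm_iff)
  have 2: "h'' \<cdot> d = f''"
    unfolding d_def using fk reassoc[OF O(8), of k1] reassoc[OF c3(3), of "d0 \<cdot> k1"] k1(1) ch de th
        th0 by (simp add: hm_iff)
  have 3: "e \<cdot> h' = g'"
    unfolding e_def using kh O(9) c2(2) k3(1) ch de th tg tg0 by (simp add: hm_iff)
  have 4: "g'' \<cdot> e = Fm f \<cdot> h''"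
    unfolding e_def using hk reassoc[OF O(10), of k3] reassoc[OF c2(3), of "e0 \<cdot> k3"] k3(1) ch de tg
        tg0 th0 tf by (simp add: hm_iff)
  have 5: "d \<cdot> c1 = c3 \<cdot> d0" "e \<cdot> c3 = c2 \<cdot> e0"
    unfolding d_def e_def using k1 k3 ch de by (simp_all add: hm_iff)
  have 6: "Fm c1 \<cdot> (Fm f0 \<cdot> g1) = (Fm f' \<cdot> g'') \<cdot> c2"
    using Fm_cmp[of f0 c1] c1(2) reassoc[of "Fm c1" "Fm f0" "Fm f'" g1] c2(3) ch tf0 tg0 tg tf by
        (simp add: hm_iff)
  have i: "iso_arr T c1" "iso_arr T c2" "iso_arr T c3" using c1(1) c2(1) c3(1) iso_arr_iff by blast+
  have "triangle_morphism T F (d0, e0, Fm f0 \<cdot> g1) (d, e, Fm f' \<cdot> g'') (c1, c3, c2)"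
    unfolding triangle_morphism_def using ch de dh tf0 tg0 tf tg 5 6 by (simp add: hm_iff)
  moreover have "triangle T F (d0, e0, Fm f0 \<cdot> g1)" "triangle T F (d, e, Fm f' \<cdot> g'')"
    unfolding triangle_def using de dh tf0 tg0 tf tg by (simp_all add: hm_iff)
  ultimately have "triangle_iso T F (d0, e0, Fm f0 \<cdot> g1) (d, e, Fm f' \<cdot> g'')"
    unfolding triangle_iso_def using i by blast
  then have "(d, e, Fm f' \<cdot> g'') \<in> \<Delta>" using dist_iso O(6) by blast
  then show "\<exists>d e. d \<in> hm (Cod T f') (Cod T h') \<and> e \<in> hm (Cod T h') (Cod T g') \<and> (d, e, Fm f' \<cdot> g'')
      \<in> \<Delta> \<and>
      d \<cdot> f' = h' \<cdot> g \<and> h'' \<cdot> d = f'' \<and> e \<cdot> h' = g' \<and> g'' \<cdot> e = Fm f \<cdot> h''"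
    using 1 2 3 4 dh tf tg th by (intro exI[of _ d] exI[of _ e]) (simp add: hm_iff)
qed

end

section \<open>Distinguished triangles\<close>

context hovey_shift
begin

lemma Sh_idn: "A \<in> Obj X \<Longrightarrow> AMap Sh (Idn LL A) = Idn LL (Uo A)"
  using shift_props(1,2) unfolding is_functor_def by auto

lemma Sh_iso: assumes "L.iso_hm A B \<alpha>" shows "L.iso_hm (Uo A) (Uo B) (AMap Sh \<alpha>)"
proof -
  obtain \<beta> where b: "\<alpha> \<in> L.hm A B" "\<beta> \<in> L.hm B A" "\<beta> \<odot> \<alpha> = Idn LL A" "\<alpha> \<odot> \<beta> = Idn LL B"
    using assms by (meson L.iso_hmE)
  show ?thesis
    by (rule L.iso_hmI[OF Sh_hm[OF b(1)] Sh_hm[OF b(2)]])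
      (use Sh_cmp[OF b(1,2)] Sh_cmp[OF b(2,1)] b(3,4) Sh_idn loc_obj[OF b(1)] in simp_all)
qed

section \<open>Triangles with named objects and their isomorphisms\<close>

definition ltyped :: "'o \<times> 'o \<times> 'o \<times> ('o, 'm) loc_arr \<times> ('o, 'm) loc_arr \<times> ('o, 'm) loc_arr \<Rightarrow> bool"
    where
  "ltyped = (\<lambda>(A, B, C, f, g, h). f \<in> L.hm A B \<and> g \<in> L.hm B C \<and> h \<in> L.hm C (Uo A))"

definition liso :: "'o \<times> 'o \<times> 'o \<times> ('o, 'm) loc_arr \<times> ('o, 'm) loc_arr \<times> ('o, 'm) loc_arr
    \<Rightarrow> 'o \<times> 'o \<times> 'o \<times> ('o, 'm) loc_arr \<times> ('o, 'm) loc_arr \<times> ('o, 'm) loc_arr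
    \<Rightarrow> ('o, 'm) loc_arr \<times> ('o, 'm) loc_arr \<times> ('o, 'm) loc_arr \<Rightarrow> bool" where
  "liso = (\<lambda>(A, B, C, f, g, h) (A', B', C', f', g', h') (a, b, c).
     ltyped (A, B, C, f, g, h) \<and> ltyped (A', B', C', f', g', h') \<and>
     L.iso_hm A A' a \<and> L.iso_hm B B' b \<and> L.iso_hm C C' c \<and>
     b \<odot> f = f' \<odot> a \<and> c \<odot> g = g' \<odot> b \<and> AMap Sh a \<odot> h = h' \<odot> c)"

lemma lisoD:
  assumes "liso (A, B, C, f, g, h) (A', B', C', f', g', h') (a, b, c)"
  shows "f \<in> L.hm A B" "g \<in> L.hm B C" "h \<in> L.hm C (Uo A)" "f' \<in> L.hm A' B'" "g' \<in> L.hm B' C'" "h' \<in>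
      L.hm C' (Uo A')"
    "L.iso_hm A A' a" "L.iso_hm B B' b" "L.iso_hm C C' c"
    "b \<odot> f = f' \<odot> a" "c \<odot> g = g' \<odot> b" "AMap Sh a \<odot> h = h' \<odot> c"
  using assms unfolding liso_def ltyped_def by auto

lemma lisoI:
  assumes "f \<in> L.hm A B" "g \<in> L.hm B C" "h \<in> L.hm C (Uo A)" "f' \<in> L.hm A' B'" "g' \<in> L.hm B' C'" "h'
      \<in> L.hm C' (Uo A')"
    "L.iso_hm A A' a" "L.iso_hm B B' b" "L.iso_hm C C' c"
    "b \<odot> f = f' \<odot> a" "c \<odot> g = g' \<odot> b" "AMap Sh a \<odot> h = h' \<odot> c"
  shows "liso (A, B, C, f, g, h) (A', B', C', f', g', h') (a, b, c)"
  using assms unfolding liso_def ltyped_def by simp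

lemma liso_trans:
  assumes "liso (A, B, C, f, g, h) (A', B', C', f', g', h') (a, b, c)"
    "liso (A', B', C', f', g', h') (A'', B'', C'', f'', g'', h'') (a', b', c')"
  shows "liso (A, B, C, f, g, h) (A'', B'', C'', f'', g'', h'') (a' \<odot> a, b' \<odot> b, c' \<odot> c)"
proof -
  note d = lisoD[OF assms(1)] and d' = lisoD[OF assms(2)]
  note i = d(7-9)[THEN L.iso_hm_hm] d'(7-9)[THEN L.iso_hm_hm]
  note s = Sh_hm[OF i(1)] Sh_hm[OF i(4)]
  show ?thesis
    by (rule lisoI[OF d(1-3) d'(4-6) L.iso_cmp[OF d(7) d'(7)] L.iso_cmp[OF d(8) d'(8)] L.iso_cmp[OF
        d(9) d'(9)]])
      (use d(1-6,10-12) d'(4-6) i s L.reassoc[OF d'(10), of a] L.reassoc[OF d'(11), of b]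
          L.reassoc[OF d'(12), of c] Sh_cmp[OF i(1,4)]
        in \<open>simp_all add: L.hm_iff\<close>)
qed

lemma Sh_inv: assumes "L.iso_hm A B \<alpha>" shows "AMap Sh (linv \<alpha>) = linv (AMap Sh \<alpha>)"
proof -
  note i = L.inv_arr_props[OF assms] L.iso_hm_hm[OF assms]
  show ?thesis
    using L.inv_arr_eq[OF Sh_hm[OF i(5)] Sh_hm[OF i(1)]] Sh_cmp[OF i(5,1)] Sh_cmp[OF i(1,5)] i(2,3)
        Sh_idn loc_obj[OF i(5)] by simp
qed

lemma liso_sym:
  assumes "liso (A, B, C, f, g, h) (A', B', C', f', g', h') (a, b, c)"
  shows "liso (A', B', C', f', g', h') (A, B, C, f, g, h) (linv a, linv b, linv c)"
proof -
  note d = lisoD[OF assms]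
  show ?thesis
    by (rule lisoI[OF d(4-6,1-3) L.inv_arr_props(4)[OF d(7)] L.inv_arr_props(4)[OF d(8)]
        L.inv_arr_props(4)[OF d(9)]
          inv_arr_natural[OF d(7,8,1,4,10)] inv_arr_natural[OF d(8,9,2,5,11)]])
      (use inv_arr_natural[OF d(9) Sh_iso[OF d(7)] d(3,6,12)] Sh_inv[OF d(7)] in simp)
qed

lemma triangle_isoE:
  assumes "triangle_iso LL Sh (f, g, h) (f', g', h')"
  obtains A B C A' B' C' a b c where "liso (A, B, C, f, g, h) (A', B', C', f', g', h') (a, b, c)"
proof -
  obtain a b c where m: "triangle LL Sh (f, g, h)" "triangle LL Sh (f', g', h')"
    "triangle_morphism LL Sh (f, g, h) (f', g', h') (a, b, c)" "iso_arr LL a" "iso_arr LL b"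
        "iso_arr LL c"
    using assms unfolding triangle_iso_def by blast
  have t: "f \<in> L.hm (Dom LL f) (Dom LL g)" "g \<in> L.hm (Dom LL g) (Dom LL h)" "h \<in> L.hm (Dom LL h) (Uo
      (Dom LL f))"
      "f' \<in> L.hm (Dom LL f') (Dom LL g')" "g' \<in> L.hm (Dom LL g') (Dom LL h')" "h' \<in> L.hm (Dom LL h')
          (Uo (Dom LL f'))"
    using m(1,2) shift_props(2)[of "Dom LL f"] shift_props(2)[of "Dom LL f'"] L.arr_obj(1)[of f]
        L.arr_obj(1)[of f']
    unfolding triangle_def by (simp_all add: L.hm_iff)
  have n: "a \<in> L.hm (Dom LL f) (Dom LL f')" "b \<in> L.hm (Dom LL g) (Dom LL g')" "c \<in> L.hm (Dom LL h)
      (Dom LL h')"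
    "b \<odot> f = f' \<odot> a" "c \<odot> g = g' \<odot> b" "AMap Sh a \<odot> h = h' \<odot> c"
    using m(3) unfolding triangle_morphism_def by simp_all
  have "L.iso_hm (Dom LL f) (Dom LL f') a" "L.iso_hm (Dom LL g) (Dom LL g') b" "L.iso_hm (Dom LL h)
      (Dom LL h') c"
    using m(4-6) L.iso_arr_hm n(1-3) by blast+
  then show thesis by (rule that[OF lisoI[OF t _ _ _ n(4-6)]])
qed

lemma triangle_isoI:
  assumes "liso (A, B, C, f, g, h) (A', B', C', f', g', h') (a, b, c)"
  shows "triangle_iso LL Sh (f, g, h) (f', g', h')"
proof -
  note d = lisoD[OF assms]
  have o: "A \<in> Obj X" "A' \<in> Obj X" using loc_obj d(1,4) by blast+
  have "triangle LL Sh (f, g, h)" "triangle LL Sh (f', g', h')"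
    unfolding triangle_def using d(1-6) shift_props(2) o by (simp_all add: L.hm_iff)
  moreover have "triangle_morphism LL Sh (f, g, h) (f', g', h') (a, b, c)"
    unfolding triangle_morphism_def using d(1-6,10-12) d(7-9)[THEN L.iso_hm_hm] by (simp add:
        L.hm_iff)
  moreover have "iso_arr LL a" "iso_arr LL b" "iso_arr LL c" using d(7-9) L.iso_arr_iff by blast+
  ultimately show ?thesis unfolding triangle_iso_def by blast
qed

abbreviation Dt :: "(('o, 'm) loc_arr \<times> ('o, 'm) loc_arr \<times> ('o, 'm) loc_arr) set" where
  "Dt \<equiv> distinguished_triangles X S V u \<rho> uf"

lemma std_typed:
  assumes "tri A B C x y \<delta>" shows "lc x \<in> L.hm A B" "lc y \<in> L.hm B C" "lt C A \<delta> \<in> L.hm C (Uo A)"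
  using lc_hm tri_hm[OF assms] lt_hm triD[OF assms] by blast+

lemma DtI:
  assumes "tri A' B' C' x y \<delta>" "liso (A, B, C, f, g, h) (A', B', C', lc x, lc y, lt C' A' \<delta>) (a, b,
      c)"
  shows "(f, g, h) \<in> Dt"
proof -
  have "Dom X x = A'" "Cod X y = C'" using triD[OF assms(1)] by auto
  then have "(lc x, lc y, lt C' A' \<delta>) \<in> standard_triangles X S V u \<rho>"
    unfolding standard_triangles_def using tri_etriangle[OF assms(1)] by blast
  then show ?thesis unfolding distinguished_triangles_def using triangle_isoI[OF assms(2)] by blast
qed

lemma DtE:
  assumes "(f, g, h) \<in> Dt"
  obtains A B C A' B' C' x y \<delta> a b c where "tri A' B' C' x y \<delta>"
    "liso (A, B, C, f, g, h) (A', B', C', lc x, lc y, lt C' A' \<delta>) (a, b, c)"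
proof -
  obtain x y \<delta> where x: "etriangle X x y \<delta>" "triangle_iso LL Sh (f, g, h) (lc x, lc y, lt (Cod X y)
      (Dom X x) \<delta>)"
    using assms unfolding distinguished_triangles_def standard_triangles_def by blast
  obtain A B C A' B' C' a b c where l: "liso (A, B, C, f, g, h) (A', B', C', lc x, lc y, lt (Cod X
      y) (Dom X x) \<delta>) (a, b, c)"
    by (rule triangle_isoE[OF x(2)])
  have t: "tri (Dom X x) (Cod X x) (Cod X y) x y \<delta>" by (rule etriangle_tri[OF x(1)])
  have "A' = Dom X x" "B' = Cod X x" "C' = Cod X y"
    using lisoD(4,5)[OF l] std_typed(1,2)[OF t] by (auto simp: L.hm_iff)
  then show thesis using that t l by simp
qed

lemma std_Dt:
  assumes "tri A B C x y \<delta>" shows "(lc x, lc y, lt C A \<delta>) \<in> Dt"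
proof (rule DtI[OF assms lisoI[OF std_typed[OF assms] std_typed[OF assms]]])
  note t = triD[OF assms] and s = std_typed[OF assms]
  show "L.iso_hm A A (Idn LL A)" "L.iso_hm B B (Idn LL B)" "L.iso_hm C C (Idn LL C)" using t by
      simp_all
  show "Idn LL B \<odot> lc x = lc x \<odot> Idn LL A" "Idn LL C \<odot> lc y = lc y \<odot> Idn LL B"
    "AMap Sh (Idn LL A) \<odot> lt C A \<delta> = lt C A \<delta> \<odot> Idn LL C"
    using s Sh_idn t by (simp_all add: L.hm_iff)
qed

text \<open>The last two arrows are transported from the standard triangle, so the third comparison
  is an identity and only the first square has to be supplied.\<close>

lemma Dt_of_iso:
  assumes T: "tri A' B' C x y \<delta>" and a: "L.iso_hm A A' a" "L.iso_hm B B' b" and f: "f \<in> L.hm A B" "b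
      \<odot> f = lc x \<odot> a"
  shows "(f, lc y \<odot> b, linv (AMap Sh a) \<odot> lt C A' \<delta>) \<in> Dt"
proof (rule DtI[OF T, of A B C _ _ _ a b "Idn LL C"], rule lisoI[OF f(1) _ _ std_typed[OF T] a])
  note s = std_typed[OF T] and i = L.inv_arr_props[OF Sh_iso[OF a(1)]] and ah = L.iso_hm_hm[OF a(1)]
      L.iso_hm_hm[OF a(2)]
  have C: "C \<in> Obj X" using triD[OF T] by simp
  show "lc y \<odot> b \<in> L.hm B C" using L.cmp_hom[OF ah(2) s(2)] .
  show "linv (AMap Sh a) \<odot> lt C A' \<delta> \<in> L.hm C (Uo A)" using L.cmp_hom[OF s(3) i(1)] .
  show "L.iso_hm C C (Idn LL C)" using C by simp
  show "b \<odot> f = lc x \<odot> a" by (rule f(2))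
  show "Idn LL C \<odot> (lc y \<odot> b) = lc y \<odot> b" using s ah by (simp add: L.hm_iff)
  show "AMap Sh a \<odot> (linv (AMap Sh a) \<odot> lt C A' \<delta>) = lt C A' \<delta> \<odot> Idn LL C"
    using L.reassoc[OF i(3), of "lt C A' \<delta>"] s i(1) Sh_hm[OF ah(1)] by (simp add: L.hm_iff)
qed

lemma lt_pull_right:
  assumes "A \<in> Obj X" "\<delta> \<in> EE C A" "c \<in> hm D C" shows "lt C A \<delta> \<odot> lc c = lt D A (Em c (Idn X A) \<delta>)"
proof -
  have o: "D \<in> Obj X" using hm_obj assms(3) by blast
  have e: "Em c (Idn X A) \<delta> \<in> EE D A" using assms by (simp add: hm_iff)
  show ?thesis
    using lt_natural[OF assms(1,1) e assms(2) idn_hom[OF assms(1)] assms(3)] uf_idn[OF assms(1)]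
        lt_hm[OF assms(1) o e] e o assms(1)
    by (simp add: L.hm_iff)
qed

lemma lt_push_left:
  assumes "C \<in> Obj X" "\<delta> \<in> EE C A" "a \<in> hm A A'" shows "lt C A' (Em (Idn X C) a \<delta>) = lc (uf a) \<odot> lt
      C A \<delta>"
proof -
  have o: "A \<in> Obj X" "A' \<in> Obj X" using hm_obj assms(3) by blast+
  have e: "Em (Idn X C) a \<delta> \<in> EE C A'" using assms by (simp add: hm_iff)
  show ?thesis
    using lt_natural[OF o assms(2) e assms(3) idn_hom[OF assms(1)]] lc_idn[OF assms(1)] lt_hm[OF
        o(2) assms(1) e] e o assms(1)
    by (simp add: L.hm_iff)
qed

subsection \<open>Existence, rotation and the octahedron\<close>

text \<open>The target is replaced by \<open>Zo B\<close> so that the arrow lifts to the category,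
  and \<open>V1\<close> is added to make it an inflation. The new target stays in \<open>U\<close>,
  so a second arrow can be modelled starting from it.\<close>

lemma inflation_model:
  assumes a: "L.iso_hm A A0 a" "A0 \<in> U" and \<alpha>: "\<alpha> \<in> L.hm A B"
  obtains B0 b x C y \<delta> where "B0 \<in> U" "L.iso_hm B B0 b" "tri A0 B0 C x y \<delta>" "b \<odot> \<alpha> = lc x \<odot> a"
proof -
  have o: "A0 \<in> Obj X" "B \<in> Obj X" using UV.cot_obj(1)[OF a(2)] loc_obj(2)[OF \<alpha>] by auto
  note z = Zo[OF o(2)] and th = th_hm[OF o(2)] and ai = L.inv_arr_props[OF a(1)] and ah =
      L.iso_hm_hm[OF a(1)]
  obtain f where f: "f \<in> hm A0 (Zo B)" "th B \<odot> (\<alpha> \<odot> linv a) = lc f"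
    using loc_full[OF a(2) z(2) L.cmp_hom[OF L.cmp_hom[OF ai(1) \<alpha>] th]] by blast
  have fa: "th B \<odot> \<alpha> = lc f \<odot> a" unfolding f(2)[symmetric] using th \<alpha> ai ah by (simp add: L.hm_iff)
  obtain V1 U1 v1 u1 \<rho>1 where V1: "tri A0 V1 U1 v1 u1 \<rho>1" "V1 \<in> V" "U1 \<in> U" by (rule UV.cot_right[OF
      o(1)])
  obtain P i j p q where P: "biproduct X V1 (Zo B) P i j p q" using ex_biproduct triD(2)[OF V1(1)]
      z(3) by blast
  note b = biproductD[OF P] and t = triD[OF V1(1)]
  obtain M h e where M: "tri A0 P M (i \<cdot> v1 \<plusminus> j \<cdot> f) h (Em e (Idn X A0) \<rho>1)" using
      tri_cobase_change[OF V1(1) f(1) P] by blast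
  \<comment> \<open>\<open>V1\<close> is an extension of \<open>U1\<close> by \<open>A0\<close>,
    hence lies in \<open>U\<close>.\<close>
  have PU: "P \<in> U"
    using UV.cot_left_extension[OF tri_biproduct[OF P] UV.cot_left_extension[OF V1(1) a(2) V1(3)]
        z(1)] .
  let ?x = "i \<cdot> v1 \<plusminus> j \<cdot> f"
  have qh: "q \<in> hm P (Zo B)" using b by (simp add: hm_iff)
  have q: "L.iso_hm P (Zo B) (lc q)" by (rule lc_iso[OF wF_W[OF proj_wF[OF P V1(2)]] qh])
  note iq = L.inv_arr_props[OF q]
  have "q \<cdot> ?x = f" using b t f(1) by (simp add: hm_iff distrib biproduct_re[OF P])
  then have qx: "lc q \<odot> lc ?x = lc f" using lc_cmp[OF tri_hm(1)[OF M] qh] by simp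
  have "(linv (lc q) \<odot> th B) \<odot> \<alpha> = linv (lc q) \<odot> ((lc q \<odot> lc ?x) \<odot> a)"
    unfolding qx fa[symmetric] using th \<alpha> iq by (simp add: L.hm_iff)
  also have "\<dots> = (linv (lc q) \<odot> lc q) \<odot> (lc ?x \<odot> a)"
    using iq(1) lc_hm[OF qh] lc_hm[OF tri_hm(1)[OF M]] ah by (simp add: L.hm_iff)
  also have "\<dots> = lc ?x \<odot> a" unfolding iq(2) using lc_hm[OF tri_hm(1)[OF M]] ah by (simp add:
      L.hm_iff)
  finally show thesis using that[OF PU L.iso_cmp[OF th_iso[OF o(2)] iq(4)] M] by blast
qed

lemma Dt_ex: assumes "f \<in> L.hm A B" shows "\<exists>g h. (f, g, h) \<in> Dt"
proof -
  have o: "A \<in> Obj X" using loc_obj assms by blast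
  note i = L.inv_arr_props(4)[OF qr_iso[OF o]]
  obtain B0 b x C y \<delta> where "B0 \<in> U" "L.iso_hm B B0 b" "tri (Qo A) B0 C x y \<delta>" "b \<odot> f = lc x \<odot> linv
      (lc (qr A))"
    by (rule inflation_model[OF i qr(3)[OF o] assms])
  then show ?thesis using Dt_of_iso[OF _ i _ assms] by blast
qed

text \<open>Both arrows are modelled by composable inflations, the second starting at the model of
  \<open>B\<close>; (ET4) for these provides all the data, with \<open>E\<close> as the cone of the
  composite.\<close>

lemma Dt_octahedron:
  assumes f: "f \<in> L.hm A B" and g: "g \<in> L.hm B D"
  shows "\<exists>f' f'' g' g'' h' h'' d e. (f, f', f'') \<in> Dt \<and> (g, g', g'') \<in> Dt \<and> (g \<odot> f, h', h'') \<in> Dt \<and>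
        d \<in> L.hm (Cod LL f') (Cod LL h') \<and> e \<in> L.hm (Cod LL h') (Cod LL g') \<and>
        (d, e, AMap Sh f' \<odot> g'') \<in> Dt \<and>
        d \<odot> f' = h' \<odot> g \<and> h'' \<odot> d = f'' \<and> e \<odot> h' = g' \<and> g'' \<odot> e = AMap Sh f \<odot> h''"
proof -
  have o: "A \<in> Obj X" using loc_obj f by blast
  define a where "a = linv (lc (qr A))"
  have a: "L.iso_hm A (Qo A) a" unfolding a_def by (rule L.inv_arr_props(4)[OF qr_iso[OF o]])
  obtain B0 b x C1 y \<delta> where b: "B0 \<in> U" "L.iso_hm B B0 b" "tri (Qo A) B0 C1 x y \<delta>" "b \<odot> f = lc x \<odot>
      a"
    by (rule inflation_model[OF a qr(3)[OF o] f])
  obtain D0 k z C2 w \<delta>' where k: "D0 \<in> U" "L.iso_hm D D0 k" "tri B0 D0 C2 z w \<delta>'" "k \<odot> g = lc z \<odot> b"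
    by (rule inflation_model[OF b(2,1) g])
  obtain E h' d e \<delta>'' where E: "tri (Qo A) D0 E (z \<cdot> x) h' \<delta>''" "tri C1 E C2 d e (Em (Idn X C2) y
      \<delta>')"
     "d \<cdot> y = h' \<cdot> z" "e \<cdot> h' = w" "Em d (Idn X (Qo A)) \<delta>'' = \<delta>" "Em (Idn X E) x \<delta>'' = Em e (Idn X
         B0) \<delta>'"
    using ET4'[OF b(3) k(3)] by blast
  note t = triD[OF b(3)] triD[OF k(3)]
  note tE = triD[OF E(1)] triD[OF E(2)]
  note hs = std_typed[OF b(3)] std_typed[OF k(3)] std_typed[OF E(1)] std_typed[OF E(2)]
  note ah = L.iso_hm_hm[OF a] L.iso_hm_hm[OF b(2)] L.iso_hm_hm[OF k(2)]
  note Ia = L.inv_arr_props[OF Sh_iso[OF a]] and Ib = L.inv_arr_props[OF Sh_iso[OF b(2)]]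
  have dy: "lc d \<odot> lc y = lc h' \<odot> lc z" "lc e \<odot> lc h' = lc w" "lc (z \<cdot> x) = lc z \<odot> lc x"
    using lc_cmp[OF tri_hm(2)[OF b(3)] tri_hm(1)[OF E(2)]] lc_cmp[OF tri_hm(1)[OF k(3)] tri_hm(2)[OF
        E(1)]]
      lc_cmp[OF tri_hm(2)[OF E(1)] tri_hm(2)[OF E(2)]] lc_cmp[OF tri_hm(1)[OF b(3)] tri_hm(1)[OF
          k(3)]] E(3,4) by simp_all
  let ?f' = "lc y \<odot> b" and ?f'' = "linv (AMap Sh a) \<odot> lt C1 (Qo A) \<delta>"
    and ?g' = "lc w \<odot> k" and ?g'' = "linv (AMap Sh b) \<odot> lt C2 B0 \<delta>'"
    and ?h' = "lc h' \<odot> k" and ?h'' = "linv (AMap Sh a) \<odot> lt E (Qo A) \<delta>''"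
  have 1: "(f, ?f', ?f'') \<in> Dt" by (rule Dt_of_iso[OF b(3) a b(2) f b(4)])
  have 2: "(g, ?g', ?g'') \<in> Dt" by (rule Dt_of_iso[OF k(3) b(2) k(2) g k(4)])
  have "k \<odot> (g \<odot> f) = lc (z \<cdot> x) \<odot> a"
    unfolding dy(3) using L.reassoc[OF k(4), of f] b(4) ah hs f g by (simp add: L.hm_iff)
  then have 3: "(g \<odot> f, ?h', ?h'') \<in> Dt" by (rule Dt_of_iso[OF E(1) a k(2) L.cmp_hom[OF f g]])
  \<comment> \<open>Pushing an extension along \<open>y\<close> composes its connecting arrow with
    the shift of \<open>y\<close>, so this is the connecting arrow of the third triangle of
    (ET4).\<close>
  have "AMap Sh ?f' \<odot> ?g'' = lt C2 C1 (Em (Idn X C2) y \<delta>')"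
  proof -
    have "AMap Sh ?f' \<odot> ?g'' = lc (uf y) \<odot> ((AMap Sh b \<odot> linv (AMap Sh b)) \<odot> lt C2 B0 \<delta>')"
      unfolding Sh_cmp[OF ah(2) hs(2)] Sh_lc[OF tri_hm(2)[OF b(3)]]
      using Sh_hm[OF ah(2)] Ib(1) hs(6) lc_hm[OF uf(1)[OF tri_hm(2)[OF b(3)]]] by (simp add:
          L.hm_iff)
    also have "\<dots> = lc (uf y) \<odot> lt C2 B0 \<delta>'" unfolding Ib(3) using hs(6) by (simp add: L.hm_iff)
    finally show ?thesis using lt_push_left[OF t(13,20) tri_hm(2)[OF b(3)]] by simp
  qed
  then have 4: "(lc d, lc e, AMap Sh ?f' \<odot> ?g'') \<in> Dt" using std_Dt[OF E(2)] by simp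
  have 5: "lc d \<odot> ?f' = ?h' \<odot> g"
    using L.reassoc[OF dy(1), of b] k(4) ah hs g by (simp add: L.hm_iff)
  have 6: "?h'' \<odot> lc d = ?f''"
    using lt_pull_right[OF tE(1) tE(10) tri_hm(1)[OF E(2)]] E(5) hs Ia(1) by (simp add: L.hm_iff)
  have 7: "lc e \<odot> ?h' = ?g'" using L.reassoc[OF dy(2), of k] ah hs by (simp add: L.hm_iff)
  have n: "linv (AMap Sh b) \<odot> lc (uf x) = AMap Sh f \<odot> linv (AMap Sh a)"
    by (rule inv_arr_natural[OF Sh_iso[OF a] Sh_iso[OF b(2)] Sh_hm[OF f] lc_hm[OF uf(1)[OF
        tri_hm(1)[OF b(3)]]]])
      (use Sh_cmp[OF f ah(2)] Sh_cmp[OF ah(1) hs(1)] b(4) Sh_lc[OF tri_hm(1)[OF b(3)]] in simp)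
  have 8: "?g'' \<odot> lc e = AMap Sh f \<odot> ?h''"
  proof -
    have "lt C2 B0 \<delta>' \<odot> lc e = lc (uf x) \<odot> lt E (Qo A) \<delta>''"
      by (rule lt_natural[OF tE(1) t(11) tE(10) t(20) tri_hm(1)[OF b(3)] tri_hm(2)[OF E(2)] E(6)])
    then show ?thesis
      using L.reassoc[OF n, of "lt E (Qo A) \<delta>''"] hs Ia(1) Ib(1) Sh_hm[OF f] lc_hm[OF uf(1)[OF
          tri_hm(1)[OF b(3)]]] by (simp add: L.hm_iff)
  qed
  have c: "Cod LL ?f' = C1" "Cod LL ?g' = C2" "Cod LL ?h' = E" using ah hs by (simp_all add:
      L.hm_iff)
  show ?thesis
    by (intro exI conjI) (rule 1, rule 2, rule 3, unfold c, rule hs(10), rule hs(11), rule 4, rule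
        5, rule 6, rule 7, rule 8)
qed

text \<open>The pushout \<open>M\<close> of the triangle with the chosen one for \<open>A\<close>
  replaces \<open>C\<close>, since \<open>M \<rightarrow> C\<close> has fibre \<open>Vo A\<close>.
  Then \<open>B \<rightarrow> M \<rightarrow> Uo A\<close> models the rotated triangle.\<close>

lemma Dt_rotate:
  assumes "(f, g, h) \<in> Dt" shows "(g, h, hneg LA (AMap Sh f)) \<in> Dt"
proof -
  obtain A' B' C' A B C x y \<delta> a b c where T: "tri A B C x y \<delta>"
    and l: "liso (A', B', C', f, g, h) (A, B, C, lc x, lc y, lt C A \<delta>) (a, b, c)"
    by (rule DtE[OF assms])
  note t = triD[OF T] and hs = std_typed[OF T] and d = lisoD[OF l]
  note s = sh[OF t(1)]
  note ih = d(7-9)[THEN L.iso_hm_hm]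
  obtain M m1 m2 e1 e2 where M: "tri B M (Uo A) m1 e2 (Em (Idn X (Uo A)) x (\<rho> A))" "tri (Vo A) M C
      m2 e1 (Em (Idn X C) (v A) \<delta>)"
    "e1 \<cdot> m1 = y" "Em e1 (Idn X A) \<delta> = Em (hn e2) (Idn X A) (\<rho> A)"
    using tri_pushout[OF T s(1)] by blast
  note ms = tri_hm[OF M(1)] tri_hm[OF M(2)]
  note lm = ms[THEN lc_hm]
  have e1: "L.iso_hm M C (lc e1)" by (rule lc_iso[OF wF_W[OF wF_I[OF M(2) s(2)]] ms(4)])
  note ie = L.inv_arr_props[OF e1]
  have cl: "lt (Uo A) B (Em (Idn X (Uo A)) x (\<rho> A)) = lc (uf x)"
    unfolding uf(2)[OF tri_hm(1)[OF T]] by (rule lt_of_pull[OF t(2) uf(1)[OF tri_hm(1)[OF T]]])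
  note sx = lc_hm[OF uf(1)[OF tri_hm(1)[OF T]]]
  \<comment> \<open>The relation between the two extensions on \<open>M\<close> makes the connecting
    arrow the negative of \<open>e2\<close>; this is compensated by the comparison
    \<open>hneg LA (AMap Sh a)\<close> on the third object.\<close>
  have lte: "lt C A \<delta> \<odot> lc e1 = hneg LA (lc e2)"
    using lt_pull[OF t(1,10) ms(4) neg_hm[OF ms(2)] M(4)] lc_neg[OF ms(2)] by simp
  have Sf: "AMap Sh b \<odot> AMap Sh f = lc (uf x) \<odot> AMap Sh a"
    using Sh_cmp[OF d(1) ih(2)] Sh_cmp[OF ih(1) hs(1)] d(10) Sh_lc[OF tri_hm(1)[OF T]] by simp
  note Sa = Sh_hm[OF ih(1)] Sh_hm[OF ih(2)] Sh_hm[OF d(1)]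
  have ci: "L.iso_hm C' M (linv (lc e1) \<odot> c)" by (rule L.iso_cmp[OF d(9) ie(4)])
  have ai: "L.iso_hm (Uo A') (Uo A) (hneg LA (AMap Sh a))" using LA.iso_neg[of "Uo A'" "Uo A" "AMap
      Sh a"] Sh_iso[OF d(7)] by simp
  have nf: "hneg LA (AMap Sh f) \<in> L.hm (Uo A') (Uo B')" using LA.neg_hm[of "AMap Sh f" "Uo A'" "Uo
      B'"] Sa(3) by simp
  show ?thesis
  proof (rule DtI[OF M(1) lisoI[OF d(2,3) nf std_typed[OF M(1)] d(8) ci ai]])
    have my: "lc e1 \<odot> lc m1 = lc y" using lc_cmp[OF ms(1,4)] M(3) by simp
    have "(linv (lc e1) \<odot> c) \<odot> g = linv (lc e1) \<odot> (lc y \<odot> b)"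
      using d(2,11) ih ie(1) by (simp add: L.hm_iff)
    also have "\<dots> = (linv (lc e1) \<odot> lc e1) \<odot> (lc m1 \<odot> b)"
      unfolding my[symmetric] using ie(1) lm ih by (simp add: L.hm_iff)
    also have "\<dots> = lc m1 \<odot> b" unfolding ie(2) using lm ih by (simp add: L.hm_iff)
    finally show "(linv (lc e1) \<odot> c) \<odot> g = lc m1 \<odot> b" .
    have ltc: "lt C A \<delta> = hneg LA (lc e2) \<odot> linv (lc e1)"
      unfolding lte[symmetric] using hs(3) lm(4) ie by (simp add: L.hm_iff)
    have "hneg LA (AMap Sh a) \<odot> h = hneg LA (lt C A \<delta> \<odot> c)"
      using LA.cmp_neg(2)[of h "AMap Sh a"] d(3,12) Sa(1) by (simp add: L.hm_iff)
    also have "\<dots> = hneg LA (hneg LA ((lc e2 \<odot> linv (lc e1)) \<odot> c))"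
      unfolding ltc
      using LA.cmp_neg(2)[of "linv (lc e1)" "lc e2"] LA.cmp_neg(2)[of c "lc e2 \<odot> linv (lc e1)"]
          lm(2) ie(1) ih(3)
      by (simp add: L.hm_iff)
    also have "\<dots> = lc e2 \<odot> (linv (lc e1) \<odot> c)"
      using LA.neg_neg[of "lc e2 \<odot> (linv (lc e1) \<odot> c)"] lm(2) ie(1) ih(3) by (simp add: L.hm_iff)
    finally show "hneg LA (AMap Sh a) \<odot> h = lc e2 \<odot> (linv (lc e1) \<odot> c)" .
    show "AMap Sh b \<odot> hneg LA (AMap Sh f) = lt (Uo A) B (Em (Idn X (Uo A)) x (\<rho> A)) \<odot> hneg LA (AMap
        Sh a)"
      unfolding cl using LA.cmp_neg(1)[of "AMap Sh f" "AMap Sh b"] LA.cmp_neg(1)[of "AMap Sh a" "lc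
          (uf x)"] Sf Sa sx
      by (simp add: L.hm_iff)
  qed
qed

lemma Dt_idn:
  assumes "A \<in> Obj X" "zero_object LA Z'"
  shows "(Idn LL A, lzero A Z', lzero Z' (Uo A)) \<in> Dt"
proof -
  obtain Z where Z: "Z \<in> Obj X" "zero_object X Z" by (rule zero_objE)
  note T = tri_zero_right[OF Z assms(1)]
  note hs = std_typed[OF T] and LZ = LA_zero_object[OF Z(2)]
  have Z': "Z' \<in> Obj X" using assms(2) by (simp add: zero_object_def)
  have zh: "lzero B C \<in> L.hm B C" if "B \<in> Obj X" "C \<in> Obj X" for B C using lc_hm[OF hz_hm[OF that]]
      unfolding lzero_def .
  have zz: "k = k'" if "k \<in> L.hm B Z" "k' \<in> L.hm B Z" for k k' B
    using LA.zero_obj_hm[OF LZ, of k B] LA.zero_obj_hm[OF LZ, of k' B] that by simp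
  have zz1: "k = k'" if "k \<in> L.hm B Z'" "k' \<in> L.hm B Z'" for k k' B
    using LA.zero_obj_hm[OF assms(2), of k B] LA.zero_obj_hm[OF assms(2), of k' B] that by simp
  have zz2: "k = k'" if "k \<in> L.hm Z' B" "k' \<in> L.hm Z' B" for k k' B
    using LA.zero_obj_hm'[OF assms(2), of k B] LA.zero_obj_hm'[OF assms(2), of k' B] that by simp
  have U: "Uo A \<in> Obj X" using sh[OF assms(1)] by blast
  have i: "L.iso_hm Z' Z (lzero Z' Z)"
    by (rule L.iso_hmI[OF zh[OF Z' Z(1)] zh[OF Z(1) Z']])
      (rule zz1[OF L.cmp_hom[OF zh[OF Z' Z(1)] zh[OF Z(1) Z']] L.idn_hom], use Z' in simp,
       rule zz[OF L.cmp_hom[OF zh[OF Z(1) Z'] zh[OF Z' Z(1)]] L.idn_hom], use Z in simp)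
  have I: "L.iso_hm A A (Idn LL A)" "Idn LL A \<in> L.hm A A" using assms(1) L.idn_hom[of A] by auto
  show ?thesis
  proof (rule DtI[OF T lisoI[OF I(2) zh[OF assms(1) Z'] zh[OF Z' U] hs I(1) I(1) i]])
    show "Idn LL A \<odot> Idn LL A = lc (Idn X A) \<odot> Idn LL A" using lc_idn[OF assms(1)] by simp
    show "lzero Z' Z \<odot> lzero A Z' = lc (hz A Z) \<odot> Idn LL A"
      by (rule zz[OF L.cmp_hom[OF zh[OF assms(1) Z'] zh[OF Z' Z(1)]] L.cmp_hom[OF I(2) hs(2)]])
    show "AMap Sh (Idn LL A) \<odot> lzero Z' (Uo A) = lt Z A (Eo Z A) \<odot> lzero Z' Z"
      by (rule zz2[OF L.cmp_hom[OF zh[OF Z' U] Sh_hm[OF I(2)]] L.cmp_hom[OF zh[OF Z' Z(1)] hs(3)]])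
  qed
qed

subsection \<open>Morphisms of triangles\<close>

text \<open>Completion of squares, with explicit objects. Stating it between two fixed triangles
  lets source and target be replaced independently along isomorphisms.\<close>

definition fills :: "'o \<times> 'o \<times> 'o \<times> ('o, 'm) loc_arr \<times> ('o, 'm) loc_arr \<times> ('o, 'm) loc_arr
    \<Rightarrow> 'o \<times> 'o \<times> 'o \<times> ('o, 'm) loc_arr \<times> ('o, 'm) loc_arr \<times> ('o, 'm) loc_arr \<Rightarrow> bool" where
  "fills = (\<lambda>(A, B, C, f, g, h) (A', B', C', f', g', h').
     \<forall>\<alpha>\<in>L.hm A A'. \<forall>\<beta>\<in>L.hm B B'. \<beta> \<odot> f = f' \<odot> \<alpha> \<longrightarrow>
       (\<exists>\<gamma>\<in>L.hm C C'. \<gamma> \<odot> g = g' \<odot> \<beta> \<and> AMap Sh \<alpha> \<odot> h = h' \<odot> \<gamma>))"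

lemma fills_source:
  assumes l: "liso (A, B, C, f, g, h) (A', B', C', f', g', h') (a, b, c)" and F: "fills (A', B', C',
      f', g', h') (A'', B'', C'', f'', g'', h'')"
    and t: "f'' \<in> L.hm A'' B''" "g'' \<in> L.hm B'' C''" "h'' \<in> L.hm C'' (Uo A'')"
  shows "fills (A, B, C, f, g, h) (A'', B'', C'', f'', g'', h'')"
  unfolding fills_def split
proof (intro ballI impI)
  note d = lisoD[OF l]
  note e = lisoD(10,11)[OF liso_sym[OF l]]
  note i = d(7-9)[THEN L.iso_hm_hm] L.inv_arr_props(1,2)[OF d(7)] L.inv_arr_props(1,2)[OF d(8)]
  fix \<alpha> \<beta> assume ab: "\<alpha> \<in> L.hm A A''" "\<beta> \<in> L.hm B B''" "\<beta> \<odot> f = f'' \<odot> \<alpha>"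
  have "(\<beta> \<odot> linv b) \<odot> f' = f'' \<odot> (\<alpha> \<odot> linv a)"
    using e(1) L.reassoc[OF ab(3), of "linv a"] ab t d(1,4) i by (simp add: L.hm_iff)
  then obtain \<gamma> where g: "\<gamma> \<in> L.hm C' C''" "\<gamma> \<odot> g' = g'' \<odot> (\<beta> \<odot> linv b)"
     "AMap Sh (\<alpha> \<odot> linv a) \<odot> h' = h'' \<odot> \<gamma>"
    using F L.cmp_hom[OF i(4) ab(1)] L.cmp_hom[OF i(6) ab(2)] unfolding fills_def split by blast
  have "(\<gamma> \<odot> c) \<odot> g = (\<gamma> \<odot> g') \<odot> b"
    using d(2,5,11) g(1) i by (simp add: L.hm_iff)
  also have "\<dots> = g'' \<odot> \<beta>" unfolding g(2) using t ab i by (simp add: L.hm_iff)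
  finally have 1: "(\<gamma> \<odot> c) \<odot> g = g'' \<odot> \<beta>" .
  have "h'' \<odot> (\<gamma> \<odot> c) = (h'' \<odot> \<gamma>) \<odot> c" using t g(1) i by (simp add: L.hm_iff)
  also have "\<dots> = AMap Sh (\<alpha> \<odot> linv a) \<odot> (AMap Sh a \<odot> h)"
    unfolding g(3)[symmetric] d(12) using d(6) i Sh_hm[OF L.cmp_hom[OF i(4) ab(1)]] by (simp add:
        L.hm_iff)
  also have "\<dots> = AMap Sh ((\<alpha> \<odot> linv a) \<odot> a) \<odot> h"
    unfolding Sh_cmp[OF i(1) L.cmp_hom[OF i(4) ab(1)]] using d(3) Sh_hm[OF L.cmp_hom[OF i(4) ab(1)]]
        Sh_hm[OF i(1)] by (simp add: L.hm_iff)
  also have "(\<alpha> \<odot> linv a) \<odot> a = \<alpha>" using ab i by (simp add: L.hm_iff)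
  finally have 2: "AMap Sh \<alpha> \<odot> h = h'' \<odot> (\<gamma> \<odot> c)" by simp
  show "\<exists>\<gamma>\<in>L.hm C C''. \<gamma> \<odot> g = g'' \<odot> \<beta> \<and> AMap Sh \<alpha> \<odot> h = h'' \<odot> \<gamma>"
    using 1 2 L.cmp_hom[OF i(3) g(1)] by blast
qed

lemma fills_target:
  assumes l: "liso (A, B, C, f, g, h) (A', B', C', f', g', h') (a, b, c)" and F: "fills (A'', B'',
      C'', f'', g'', h'') (A', B', C', f', g', h')"
    and t: "f'' \<in> L.hm A'' B''" "g'' \<in> L.hm B'' C''" "h'' \<in> L.hm C'' (Uo A'')"
  shows "fills (A'', B'', C'', f'', g'', h'') (A, B, C, f, g, h)"
  unfolding fills_def split
proof (intro ballI impI)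
  note d = lisoD[OF l]
  note i = d(7-9)[THEN L.iso_hm_hm] L.inv_arr_props(1,2)[OF d(7)] L.inv_arr_props(1,2)[OF d(8)]
      L.inv_arr_props(1,2,3)[OF d(9)]
  fix \<alpha> \<beta> assume ab: "\<alpha> \<in> L.hm A'' A" "\<beta> \<in> L.hm B'' B" "\<beta> \<odot> f'' = f \<odot> \<alpha>"
  have "(b \<odot> \<beta>) \<odot> f'' = f' \<odot> (a \<odot> \<alpha>)"
    using L.reassoc[OF d(10), of \<alpha>] ab t d(1,4) i by (simp add: L.hm_iff)
  then obtain \<gamma> where g: "\<gamma> \<in> L.hm C'' C'" "\<gamma> \<odot> g'' = g' \<odot> (b \<odot> \<beta>)"
     "AMap Sh (a \<odot> \<alpha>) \<odot> h'' = h' \<odot> \<gamma>"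
    using F L.cmp_hom[OF ab(1) i(1)] L.cmp_hom[OF ab(2) i(2)] unfolding fills_def split by blast
  have "(linv c \<odot> \<gamma>) \<odot> g'' = linv c \<odot> (g' \<odot> (b \<odot> \<beta>))"
    using g t i by (simp add: L.hm_iff)
  also have "\<dots> = (linv c \<odot> (c \<odot> g)) \<odot> \<beta>"
    unfolding d(11) using d(5) ab i by (simp add: L.hm_iff)
  also have "\<dots> = g \<odot> \<beta>" using L.reassoc[OF i(9), of g] d(2) ab i by (simp add: L.hm_iff)
  finally have 1: "(linv c \<odot> \<gamma>) \<odot> g'' = g \<odot> \<beta>" .
  have ic: "linv c \<odot> \<gamma> \<in> L.hm C'' C" using L.cmp_hom[OF g(1) i(8)] .
  \<comment> \<open>Checked after composing with the isomorphism \<open>AMap Sh a\<close>, which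
    brings in the last square of \<open>liso\<close>.\<close>
  have 2: "AMap Sh \<alpha> \<odot> h'' = h \<odot> (linv c \<odot> \<gamma>)"
  proof (rule L.iso_cancel_left[OF Sh_iso[OF d(7)]])
    have "AMap Sh a \<odot> (AMap Sh \<alpha> \<odot> h'') = h' \<odot> \<gamma>"
      using g(3) Sh_cmp[OF ab(1) i(1)] Sh_hm[OF ab(1)] Sh_hm[OF i(1)] t by (simp add: L.hm_iff)
    also have "\<dots> = (h' \<odot> c) \<odot> (linv c \<odot> \<gamma>)"
      using L.reassoc[OF i(10), of \<gamma>] d(6) g(1) i by (simp add: L.hm_iff)
    also have "\<dots> = AMap Sh a \<odot> (h \<odot> (linv c \<odot> \<gamma>))"
      unfolding d(12)[symmetric] using d(3) Sh_hm[OF i(1)] g(1) i by (simp add: L.hm_iff)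
    finally show "AMap Sh a \<odot> (AMap Sh \<alpha> \<odot> h'') = AMap Sh a \<odot> (h \<odot> (linv c \<odot> \<gamma>))" .
  qed (use L.cmp_hom[OF t(3) Sh_hm[OF ab(1)]] L.cmp_hom[OF ic d(3)] in simp_all)
  show "\<exists>\<gamma>\<in>L.hm C'' C. \<gamma> \<odot> g'' = g \<odot> \<beta> \<and> AMap Sh \<alpha> \<odot> h'' = h \<odot> \<gamma>"
    using 1 2 ic by blast
qed

lemma std_liso:
  assumes T: "tri A B C x y \<delta>" "tri A' B' C' x' y' \<delta>'" and h: "p \<in> hm A A'" "q \<in> hm B B'" "r \<in> hm C
      C'"
    and e: "q \<cdot> x = x' \<cdot> p" "r \<cdot> y = y' \<cdot> q" "Em (Idn X C) p \<delta> = Em r (Idn X A') \<delta>'"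
    and i: "L.iso_hm A A' (lc p)" "L.iso_hm B B' (lc q)" "L.iso_hm C C' (lc r)"
  shows "liso (A, B, C, lc x, lc y, lt C A \<delta>) (A', B', C', lc x', lc y', lt C' A' \<delta>') (lc p, lc q,
      lc r)"
proof (rule lisoI[OF std_typed[OF T(1)] std_typed[OF T(2)] i])
  note t = tri_hm[OF T(1)] tri_hm[OF T(2)]
  show "lc q \<odot> lc x = lc x' \<odot> lc p" using lc_cmp[OF t(1) h(2)] lc_cmp[OF h(1) t(3)] e(1) by simp
  show "lc r \<odot> lc y = lc y' \<odot> lc q" using lc_cmp[OF t(2) h(3)] lc_cmp[OF h(2) t(4)] e(2) by simp
  show "AMap Sh (lc p) \<odot> lt C A \<delta> = lt C' A' \<delta>' \<odot> lc r"
    using lt_natural[OF triD(1)[OF T(1)] triD(1)[OF T(2)] triD(10)[OF T(1)] triD(10)[OF T(2)] h(1,3)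
        e(3)] Sh_lc[OF h(1)] by simp
qed

abbreviation stdt :: "'o \<Rightarrow> 'o \<Rightarrow> 'o \<Rightarrow> 'm \<Rightarrow> 'm \<Rightarrow> 'e \<Rightarrow> 'o \<times> 'o \<times> 'o \<times> ('o, 'm) loc_arr \<times> ('o, 'm)
    loc_arr \<times> ('o, 'm) loc_arr" where
  "stdt A B C x y \<delta> \<equiv> (A, B, C, lc x, lc y, lt C A \<delta>)"

text \<open>Here the arrows lift to the category and the square commutes up to an arrow
  \<open>l \<cdot> k\<close> through \<open>V\<close>. The hypothesis on extensions along
  \<open>x\<close> allows the middle arrow to be changed within its class until the square commutes;
  then (ET3) applies.\<close>

lemma fills_strict:
  assumes T: "tri A B C x y \<delta>" "tri A' B' C' x' y' \<delta>'" and U: "A \<in> U" "B \<in> U" and T': "A' \<in> T" "B' \<in>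
      T"
    and ext: "\<And>V0 k. \<lbrakk>V0 \<in> V; k \<in> hm A V0\<rbrakk> \<Longrightarrow> \<exists>k'\<in>hm B V0. k' \<cdot> x = k"
  shows "fills (stdt A B C x y \<delta>) (stdt A' B' C' x' y' \<delta>')"
  unfolding fills_def split
proof (intro ballI impI)
  note t = tri_hm[OF T(1)] tri_hm[OF T(2)]
  fix \<alpha> \<beta> assume ab: "\<alpha> \<in> L.hm A A'" "\<beta> \<in> L.hm B B'" "\<beta> \<odot> lc x = lc x' \<odot> \<alpha>"
  obtain a where a: "a \<in> hm A A'" "\<alpha> = lc a" using loc_full[OF U(1) T'(1) ab(1)] by blast
  obtain b where b: "b \<in> hm B B'" "\<beta> = lc b" using loc_full[OF U(2) T'(2) ab(2)] by blast
  note bx = cmp_hom[OF t(1) b(1)] and xa = cmp_hom[OF a(1) t(3)]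
  have "lc (b \<cdot> x) = lc (x' \<cdot> a)" using ab(3) lc_cmp[OF t(1) b(1)] lc_cmp[OF a(1) t(3)] a b by simp
  then have "through N A B' (b \<cdot> x \<plusminus> hn (x' \<cdot> a))" using loc_faithful[OF U(1) T'(2) bx xa] unfolding
      eqv_def by blast
  then have "through V A B' (b \<cdot> x \<plusminus> hn (x' \<cdot> a))" using through_N_V T'(2) by blast
  then obtain V0 k l where k: "V0 \<in> V" "k \<in> hm A V0" "l \<in> hm V0 B'" "b \<cdot> x \<plusminus> hn (x' \<cdot> a) = l \<cdot> k"
      unfolding through_def by blast
  obtain k' where k': "k' \<in> hm B V0" "k' \<cdot> x = k" using ext[OF k(1,2)] by blast
  \<comment> \<open>The correction \<open>l \<cdot> k'\<close> factors through \<open>V\<close>,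
    hence is invisible in the localization, and restricts along \<open>x\<close> to the error of the
    square.\<close>
  define b2 where "b2 = b \<plusminus> hn (l \<cdot> k')"
  have lk: "l \<cdot> k' \<in> hm B B'" using cmp_hom[OF k'(1) k(3)] .
  have b2: "b2 \<in> hm B B'" unfolding b2_def using add_hm[OF b(1) neg_hm[OF lk]] .
  have "b \<cdot> x = l \<cdot> k \<plusminus> x' \<cdot> a" unfolding k(4)[symmetric] using bx xa by (simp add: hm_iff aassoc)
  then have e: "b2 \<cdot> x = x' \<cdot> a"
    unfolding b2_def using b(1) lk k' k(2,3) t xa
    by (simp add: hm_iff distrib aassoc acomm[of "l \<cdot> k"])
  have "through N B B' (l \<cdot> k')" unfolding through_def using V_N[OF k(1)] k'(1) k(3) by blast
  moreover have "b \<plusminus> hn b2 = l \<cdot> k'" unfolding b2_def using b(1) lk neg_add[OF b(1) neg_hm[OF lk]]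
      by (simp add: hm_iff)
  ultimately have lb: "lc b = lc b2" using lc_eqv[of B B' b b2] b(1) b2 unfolding eqv_def by simp
  obtain c where c: "c \<in> hm C C'" "Em (Idn X C) a \<delta> = Em c (Idn X A') \<delta>'" "y' \<cdot> b2 = c \<cdot> y"
    using ET3'[OF T a(1) b2 e] by blast
  have 1: "lc c \<odot> lc y = lc y' \<odot> \<beta>"
    using lc_cmp[OF t(2) c(1)] lc_cmp[OF b2 t(4)] c(3) b(2) lb by simp
  have 2: "AMap Sh \<alpha> \<odot> lt C A \<delta> = lt C' A' \<delta>' \<odot> lc c"
    using lt_natural[OF triD(1)[OF T(1)] triD(1)[OF T(2)] triD(10)[OF T(1)] triD(10)[OF T(2)] a(1)
        c(1,2)] Sh_lc[OF a(1)] a(2) by simp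
  show "\<exists>\<gamma>\<in>L.hm C C'. \<gamma> \<odot> lc y = lc y' \<odot> \<beta> \<and> AMap Sh \<alpha> \<odot> lt C A \<delta> = lt C' A' \<delta>' \<odot> \<gamma>"
    using 1 2 lc_hm[OF c(1)] by blast
qed

lemma iso_lc_idn: "A \<in> Obj X \<Longrightarrow> L.iso_hm A A (lc (Idn X A))"
  by (simp add: lc_idn)

text \<open>Fibrant replacement of the first two terms of the target.\<close>

lemma fills_target_T:
  assumes S0: "tri A B C x y \<delta>" "A \<in> U" "B \<in> U" and T0: "tri A' B' C' x' y' \<delta>'"
    and ext: "\<And>V0 k. \<lbrakk>V0 \<in> V; k \<in> hm A V0\<rbrakk> \<Longrightarrow> \<exists>k'\<in>hm B V0. k' \<cdot> x = k"
  shows "fills (stdt A B C x y \<delta>) (stdt A' B' C' x' y' \<delta>')"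
proof -
  note t = triD[OF T0] and s = std_typed[OF S0(1)]
  note r = rr[OF t(1)]
  obtain S1 z \<epsilon> where S1: "tri A' (Ro A') S1 (rr A') z \<epsilon>" "S1 \<in> S" by (rule wC_E[OF r(1,2)])
  \<comment> \<open>The first end is made fibrant by a pushout, which keeps the last object and
    changes the middle one by a trivial cofibration.\<close>
  obtain M m1 m2 e1 e2 where M: "tri B' M S1 m1 e2 (Em (Idn X S1) x' \<epsilon>)" "tri (Ro A') M C' m2 e1 (Em
      (Idn X C') (rr A') \<delta>')"
    "m1 \<cdot> x' = m2 \<cdot> rr A'" "e1 \<cdot> m1 = y'"
    using tri_pushout[OF T0 S1(1)] by blast
  have l1: "liso (stdt A' B' C' x' y' \<delta>') (stdt (Ro A') M C' m2 e1 (Em (Idn X C') (rr A') \<delta>')) (lc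
      (rr A'), lc m1, lc (Idn X C'))"
    by (rule std_liso[OF T0 M(2) r(2) tri_hm(1)[OF M(1)] idn_hom[OF t(3)] M(3) _ _ rr_iso[OF t(1)]
          lc_iso[OF wC_W[OF wC_I[OF M(1) S1(2)]] tri_hm(1)[OF M(1)]] iso_lc_idn[OF t(3)]])
      (use M(4) t r(2,4) in \<open>simp_all add: hm_iff\<close>)
  note tM = triD[OF M(2)]
  note rM = rr[OF tM(2)]
  obtain S2 w \<kappa> where S2: "tri M (Ro M) S2 (rr M) w \<kappa>" "S2 \<in> S" by (rule wC_E[OF rM(1,2)])
  \<comment> \<open>The middle term is made fibrant by composing with its replacement; the last
    object then changes by a trivial cofibration.\<close>
  obtain E h' d e \<delta>'' where E: "tri (Ro A') (Ro M) E (rr M \<cdot> m2) h' \<delta>''" "tri C' E S2 d e (Em (Idn X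
      S2) e1 \<kappa>)"
     "d \<cdot> e1 = h' \<cdot> rr M" "Em d (Idn X (Ro A')) \<delta>'' = Em (Idn X C') (rr A') \<delta>'"
    using ET4'[OF M(2) S2(1)] by blast
  have l2: "liso (stdt (Ro A') M C' m2 e1 (Em (Idn X C') (rr A') \<delta>')) (stdt (Ro A') (Ro M) E (rr M \<cdot>
      m2) h' \<delta>'')
      (lc (Idn X (Ro A')), lc (rr M), lc d)"
    by (rule std_liso[OF M(2) E(1) idn_hom[OF r(4)] rM(2) tri_hm(1)[OF E(2)] _ E(3) _ iso_lc_idn[OF
        r(4)] rr_iso[OF tM(2)]
          lc_iso[OF wC_W[OF wC_I[OF E(2) S2(2)]] tri_hm(1)[OF E(2)]]])
      (use E(4) tM rM(2) r(4) t r(2) in \<open>simp_all add: hm_iff\<close>)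
  have "fills (stdt A B C x y \<delta>) (stdt (Ro A') (Ro M) E (rr M \<cdot> m2) h' \<delta>'')"
    by (rule fills_strict[OF S0(1) E(1) S0(2,3) r(3) rM(3) ext])
  then show ?thesis using fills_target[OF l1 fills_target[OF l2 _ s] s] by blast
qed

text \<open>Cofibrant replacement of the first two terms of the source. The middle term is enlarged by an
  object of \<open>V\<close> so that arrows into \<open>V\<close> extend along the inflation.\<close>

lemma fills_std:
  assumes S0: "tri A B C x y \<delta>" and T0: "tri A' B' C' x' y' \<delta>'"
  shows "fills (stdt A B C x y \<delta>) (stdt A' B' C' x' y' \<delta>')"
proof -
  note s = std_typed[OF T0]
  have U: "fills (stdt A B C x y \<delta>) (stdt A' B' C' x' y' \<delta>')"
    if S0: "tri A B C x y \<delta>" and B: "B \<in> U" for A B C x y \<delta>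
  proof -
    note t = triD[OF S0]
    note q = qr[OF t(1)]
    obtain V0 k \<kappa> where V0: "tri V0 (Qo A) A k (qr A) \<kappa>" "V0 \<in> V" by (rule wF_E[OF q(1,2)])
    obtain V1 U1 v1 u1 \<rho>1 where V1: "tri (Qo A) V1 U1 v1 u1 \<rho>1" "V1 \<in> V" "U1 \<in> U" by (rule
        UV.cot_right[OF q(4)])
    note t1 = triD[OF V1(1)]
    obtain P i j p r where P: "biproduct X V1 A P i j p r" using ex_biproduct t1 t by blast
    obtain P1 i1 j1 p1 r1 where P1: "biproduct X V1 B P1 i1 j1 p1 r1" using ex_biproduct t1 t by
        blast
    note b = biproductD[OF P] and b1 = biproductD[OF P1]
    \<comment> \<open>The triangle is replaced in two stages:
      \<open>Qo A \<rightarrow> V1 \<oplus> A\<close> with cone \<open>E0\<close>, followed by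
      \<open>x\<close> on the second summand, with cone \<open>C\<close>.\<close>
    obtain E0 h e where E0: "tri (Qo A) P E0 (i \<cdot> v1 \<plusminus> j \<cdot> qr A) h (Em e (Idn X (Qo A)) \<rho>1)"
      "tri A E0 U1 (h \<cdot> j) e (Em (Idn X U1) (hn (qr A)) \<rho>1)" using tri_cobase_change[OF V1(1) q(2)
          P] by blast
    have "E0 \<in> N"
    proof -
      obtain E h2 d e' \<epsilon> where E: "tri V0 V1 E (v1 \<cdot> k) h2 \<epsilon>" "tri A E U1 d e' (Em (Idn X U1) (qr A)
          \<rho>1)"
        using ET4'[OF V0(1) V1(1)] by blast
      have EN: "E \<in> N" using N_cone_V[OF E(1) V0(2) V_N[OF V1(2)]] .
      \<comment> \<open>The cone from (ET4) realizes the extension pushed along \<open>qr A\<close>,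
        and \<open>E0\<close> the one pushed along its negative; the automorphism -1 of
        \<open>U1\<close> matches them.\<close>
      have n: "hn (Idn X U1) \<in> hm U1 U1" "hn (Idn X U1) \<cdot> hn (Idn X U1) = Idn X U1" using t1 by
          (simp_all add: hm_iff)
      have "tri A E U1 (d \<cdot> Idn X A) (hn (Idn X U1) \<cdot> e') (Em (hn (Idn X U1)) (Idn X A) (Em (Idn X
          U1) (qr A) \<rho>1))"
        by (rule tri_transport[OF E(2) idn_hom[OF t(1)] idn_hom[OF t(1)] _ _ n(1) n(1) n(2) n(2)])
            (use t in simp_all)
      moreover have "Em (hn (Idn X U1)) (Idn X A) (Em (Idn X U1) (qr A) \<rho>1) = Em (Idn X U1) (hn (qr
          A)) \<rho>1"
        using t1 q(2) em_neg[of "Idn X U1" "qr A" \<rho>1] t(1) by (simp add: hm_iff)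
      ultimately obtain f where "iso_hm E E0 f" using tri_mid_unique[OF _ E0(2)] by metis
      then show ?thesis using N_iso EN by blast
    qed
    obtain Z where Z: "Z \<in> Obj X" "zero_object X Z" by (rule zero_objE)
    have PP: "tri P P1 C (i1 \<cdot> p \<plusminus> j1 \<cdot> x \<cdot> r) (y \<cdot> r1) (Em (Idn X C) j \<delta>)"
      using tri_sum[OF tri_zero_right[OF Z t1(2)] S0 P P1 biproduct_zero_left[OF t(3) Z(2)]] t t1 b
          b1 Z by simp
    obtain M h' d c \<delta>'' where M: "tri (Qo A) P1 M ((i1 \<cdot> p \<plusminus> j1 \<cdot> x \<cdot> r) \<cdot> (i \<cdot> v1 \<plusminus> j \<cdot> qr A)) h'
        \<delta>''"
      "tri E0 M C d c (Em (Idn X C) h (Em (Idn X C) j \<delta>))" "c \<cdot> h' = y \<cdot> r1"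
      "Em (Idn X M) (i \<cdot> v1 \<plusminus> j \<cdot> qr A) \<delta>'' = Em c (Idn X P) (Em (Idn X C) j \<delta>)"
      using ET4'[OF E0(1) PP] by blast
    define x1 where "x1 = (i1 \<cdot> p \<plusminus> j1 \<cdot> x \<cdot> r) \<cdot> (i \<cdot> v1 \<plusminus> j \<cdot> qr A)"
    have x1: "x1 = i1 \<cdot> v1 \<plusminus> j1 \<cdot> x \<cdot> qr A"
      unfolding x1_def using b b1 t t1 q(2) by (simp add: hm_iff distrib biproduct_re[OF P])
    note M1 = M(1)[folded x1_def]
    note m = triD(2,3)[OF M1] triD(7-10)[OF M1] triD(7-9)[OF M(2)]
    have r1: "r1 \<in> hm P1 B" "L.iso_hm P1 B (lc r1)"
      using b1 lc_iso[OF wF_W[OF proj_wF[OF P1 V1(2)]]] by (simp_all add: hm_iff)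
    \<comment> \<open>The fibre of \<open>M \<rightarrow> C\<close> is \<open>E0\<close>, so the
      enlarged triangle is isomorphic to the given one in the localization.\<close>
    have ci: "L.iso_hm M C (lc c)" by (rule lc_iso[OF deflation_N_W[OF M(2) \<open>E0 \<in> N\<close>] tri_hm(2)[OF
        M(2)]])
    \<comment> \<open>Arrows from \<open>Qo A\<close> to \<open>V\<close> extend along
      \<open>v1\<close> by orthogonality of \<open>U\<close> and \<open>V\<close>; the projection to
      the summand \<open>V1\<close> turns this into an extension along \<open>x1\<close>.\<close>
    have ext: "\<exists>k'\<in>hm P1 V0. k' \<cdot> x1 = k" if Vk: "V0 \<in> V" "k \<in> hm (Qo A) V0" for V0 k
    proof -
      have "Em (Idn X U1) k \<rho>1 = Eo U1 V0" using UV.cot_ext[OF V1(3) Vk(1)] t1 Vk(2) by (simp add: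
          hm_iff)
      then obtain k0 where k0: "k0 \<in> hm V1 V0" "k0 \<cdot> v1 = k" using tri_extend_iff[OF V1(1) Vk(2)] by
          blast
      have "V0 \<in> Obj X" using hm_obj k0 by blast
      then have "(k0 \<cdot> p1) \<cdot> x1 = k" unfolding x1 using k0 Vk(2) b1 t t1 q(2,4) by (simp add: hm_iff
          distrib biproduct_re[OF P1])
      then show ?thesis using k0(1) b1 by (intro bexI[of _ "k0 \<cdot> p1"]) (simp_all add: hm_iff)
    qed
    have PU: "P1 \<in> U"
      using UV.cot_left_extension[OF tri_biproduct[OF P1] UV.cot_left_extension[OF V1(1) q(3) V1(3)]
          B] .
    have 1: "r1 \<cdot> x1 = x \<cdot> qr A" unfolding x1 using b1 t t1 q(2,4) by (simp add: hm_iff distrib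
        biproduct_re[OF P1])
    have 2: "Em (Idn X M) (qr A) \<delta>'' = Em c (Idn X A) \<delta>"
    proof -
      have rq: "r \<cdot> (i \<cdot> v1 \<plusminus> j \<cdot> qr A) = qr A" using b t t1 q(2,4) by (simp add: hm_iff distrib
          biproduct_re[OF P])
      have "Em (Idn X M) (qr A) \<delta>'' = Em (Idn X M) r (Em (Idn X M) (i \<cdot> v1 \<plusminus> j \<cdot> qr A) \<delta>'')"
        using b t t1 q(2,4) m by (simp add: hm_iff rq)
      also have "\<dots> = Em c (Idn X A) \<delta>" unfolding M(4) using b t m by simp
      finally show ?thesis .
    qed
    have "liso (stdt (Qo A) P1 M x1 h' \<delta>'') (stdt A B C x y \<delta>) (lc (qr A), lc r1, lc c)"
      by (rule std_liso[OF M1 S0 q(2) r1(1) tri_hm(2)[OF M(2)] 1 M(3) 2 qr_iso[OF t(1)] r1(2) ci])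
    then show ?thesis
      using fills_source[OF liso_sym fills_target_T[OF M1 q(3) PU T0 ext] s] by blast
  qed
  note t = triD[OF S0]
  note q = qr[OF t(2)]
  \<comment> \<open>Reduction to a cofibrant middle term: precomposing \<open>y\<close> with
    \<open>qr B\<close> keeps \<open>C\<close> and changes the left end by a trivial
    fibration.\<close>
  obtain V0 k \<kappa> where V0: "tri V0 (Qo B) B k (qr B) \<kappa>" "V0 \<in> V" by (rule wF_E[OF q(1,2)])
  obtain E h' d e \<delta>'' where E: "tri E (Qo B) C h' (y \<cdot> qr B) \<delta>''" "tri V0 E A d e (Em x (Idn X V0)
      \<kappa>)"
     "qr B \<cdot> h' = x \<cdot> e" "\<delta> = Em (Idn X C) e \<delta>''"
    using ET4_op'[OF V0(1) S0] by blast
  have e: "e \<in> hm E A" "L.iso_hm E A (lc e)" using lc_iso[OF wF_W[OF wF_I[OF E(2) V0(2)]]]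
      tri_hm(2)[OF E(2)] by auto
  have "liso (stdt E (Qo B) C h' (y \<cdot> qr B) \<delta>'') (stdt A B C x y \<delta>) (lc e, lc (qr B), lc (Idn X C))"
    by (rule std_liso[OF E(1) S0 e(1) q(2) idn_hom[OF t(3)] E(3) _ _ e(2) qr_iso[OF t(2)]
        iso_lc_idn[OF t(3)]])
      (use t q(2) E(4) in \<open>simp_all add: hm_iff\<close>)
  then show ?thesis using fills_source[OF liso_sym U[OF E(1) q(3)] s] by blast
qed

lemma Dt_fills:
  assumes "(f, g, h) \<in> Dt" "(f', g', h') \<in> Dt"
  obtains A B C A' B' C' where "fills (A, B, C, f, g, h) (A', B', C', f', g', h')"
    "ltyped (A, B, C, f, g, h)" "ltyped (A', B', C', f', g', h')"
proof -
  obtain A B C A1 B1 C1 x y \<delta> a b c where 1: "tri A1 B1 C1 x y \<delta>"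
    "liso (A, B, C, f, g, h) (stdt A1 B1 C1 x y \<delta>) (a, b, c)" by (rule DtE[OF assms(1)])
  obtain A' B' C' A2 B2 C2 x' y' \<delta>' a' b' c' where 2: "tri A2 B2 C2 x' y' \<delta>'"
    "liso (A', B', C', f', g', h') (stdt A2 B2 C2 x' y' \<delta>') (a', b', c')" by (rule DtE[OF assms(2)])
  note d = lisoD(1-3)[OF 1(2)] lisoD(1-3)[OF 2(2)]
  have "fills (A, B, C, f, g, h) (stdt A2 B2 C2 x' y' \<delta>')" by (rule fills_source[OF 1(2)
      fills_std[OF 1(1) 2(1)] std_typed[OF 2(1)]])
  then have "fills (A, B, C, f, g, h) (A', B', C', f', g', h')" by (rule fills_target[OF 2(2) _
      d(1-3)])
  then show thesis using that d unfolding ltyped_def by simp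
qed

section \<open>The triangulation\<close>

text \<open>These notions only look at the underlying category, which the added fields of
  \<open>LA\<close> do not change.\<close>

lemma LA_transfer:
  "is_functor LA LA G \<longleftrightarrow> is_functor LL LL G" "iso_arr LA = iso_arr LL"
  "triangle LA G = triangle LL G" "triangle_morphism LA G = triangle_morphism LL G"
  "triangle_iso LA G = triangle_iso LL G"
  "auto_equivalence LA G \<longleftrightarrow> auto_equivalence LL G"
proof -
  have 1: "is_functor LA LA G \<longleftrightarrow> is_functor LL LL G" for G by (simp add: is_functor_def)
  have 2: "iso_arr LA = iso_arr LL" by (simp add: iso_arr_def inverse_arrows_def fun_eq_iff)
  have 3: "triangle LA G = triangle LL G" by (simp add: triangle_def fun_eq_iff)
  have 4: "triangle_morphism LA G = triangle_morphism LL G" by (simp add: triangle_morphism_def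
      fun_eq_iff)
  show "is_functor LA LA G \<longleftrightarrow> is_functor LL LL G" "iso_arr LA = iso_arr LL"
    "triangle LA G = triangle LL G" "triangle_morphism LA G = triangle_morphism LL G" by fact+
  show "triangle_iso LA G = triangle_iso LL G" by (simp add: triangle_iso_def fun_eq_iff 2 3 4)
  show "auto_equivalence LA G \<longleftrightarrow> auto_equivalence LL G"
    by (simp add: auto_equivalence_def naturally_isomorphic_def 1 2)
qed

lemma pretriangulated_LA: "pretriangulated LA Sh Dt"
proof (intro pretriangulated.intro pretriangulated_axioms.intro)
  show "acat LA" by unfold_locales
  show "additive_functor LA LA Sh"
    unfolding additive_functor_def LA_transfer using shift_props(1) Sh_add by simp
  show "auto_equivalence LA Sh" unfolding LA_transfer by (rule shift_equivalence)
  show "triangle LA Sh t" if "t \<in> Dt" for t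
    using that unfolding LA_transfer distinguished_triangles_def triangle_iso_def by blast
  show "t' \<in> Dt" if t: "t \<in> Dt" "triangle_iso LA Sh t t'" for t t'
  proof -
    obtain f g h f' g' h' where tt: "t = (f, g, h)" "t' = (f', g', h')" by (metis prod.exhaust)
    obtain A B C A' B' C' a b c where 1: "liso (A, B, C, f, g, h) (A', B', C', f', g', h') (a, b,
        c)"
      using triangle_isoE t(2) unfolding LA_transfer tt by blast
    obtain A2 B2 C2 A1 B1 C1 x y \<delta> a' b' c' where 2: "tri A1 B1 C1 x y \<delta>"
      "liso (A2, B2, C2, f, g, h) (stdt A1 B1 C1 x y \<delta>) (a', b', c')" by (rule DtE[OF t(1)[unfolded
          tt]])
    have "A2 = A" "B2 = B" "C2 = C" using lisoD(1,2)[OF 1] lisoD(1,2)[OF 2(2)] by (auto simp: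
        L.hm_iff)
    then show ?thesis unfolding tt(2) using DtI[OF 2(1) liso_trans[OF liso_sym[OF 1]]] 2(2) by blast
  qed
  show "(Idn LA A, hzero LA A Z, hzero LA Z (OMap Sh A)) \<in> Dt" if "A \<in> Obj LA" "zero_object LA Z"
      for A Z
    using Dt_idn[of A Z] that shift_props(2) by simp
  show "\<exists>g h. (f, g, h) \<in> Dt" if "f \<in> Arr LA" for f
    using Dt_ex[of f "Dom LL f" "Cod LL f"] that by (simp add: L.hm_iff)
  show "(g, h, hneg LA (AMap Sh f)) \<in> Dt" if "(f, g, h) \<in> Dt" for f g h by (rule Dt_rotate[OF that])
  show "\<exists>c. triangle_morphism LA Sh (f, g, h) (f', g', h') (a, b, c)"
    if D: "(f, g, h) \<in> Dt" "(f', g', h') \<in> Dt" and a: "a \<in> Hom LA (Dom LA f) (Dom LA f')"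
      and b: "b \<in> Hom LA (Cod LA f) (Cod LA f')" and e: "b \<cdot>\<^bsub>LA\<^esub> f = f' \<cdot>\<^bsub>LA\<^esub> a" for f g h f' g' h'
          a b
  proof -
    obtain A B C A' B' C' where F: "fills (A, B, C, f, g, h) (A', B', C', f', g', h')"
      "ltyped (A, B, C, f, g, h)" "ltyped (A', B', C', f', g', h')" by (rule Dt_fills[OF D])
    have t: "f \<in> L.hm A B" "g \<in> L.hm B C" "h \<in> L.hm C (Uo A)" "f' \<in> L.hm A' B'" "g' \<in> L.hm B' C'"
        "h' \<in> L.hm C' (Uo A')"
      using F(2,3) unfolding ltyped_def by auto
    have ab: "a \<in> L.hm A A'" "b \<in> L.hm B B'" "b \<odot> f = f' \<odot> a" using a b e t by (simp_all add:
        L.hm_iff)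
    obtain c where "c \<in> L.hm C C'" "c \<odot> g = g' \<odot> b" "AMap Sh a \<odot> h = h' \<odot> c"
      using F(1) ab unfolding fills_def split by blast
    then have "triangle_morphism LL Sh (f, g, h) (f', g', h') (a, b, c)"
      unfolding triangle_morphism_def using ab t by (simp add: L.hm_iff)
    then show ?thesis unfolding LA_transfer by blast
  qed
  show "\<exists>f' f'' g' g'' h' h'' d e. (f, f', f'') \<in> Dt \<and> (g, g', g'') \<in> Dt \<and> (g \<cdot>\<^bsub>LA\<^esub> f, h', h'') \<in> Dt
      \<and>
        d \<in> Hom LA (Cod LA f') (Cod LA h') \<and> e \<in> Hom LA (Cod LA h') (Cod LA g') \<and>
        (d, e, AMap Sh f' \<cdot>\<^bsub>LA\<^esub> g'') \<in> Dt \<and>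
        d \<cdot>\<^bsub>LA\<^esub> f' = h' \<cdot>\<^bsub>LA\<^esub> g \<and> h'' \<cdot>\<^bsub>LA\<^esub> d = f'' \<and> e \<cdot>\<^bsub>LA\<^esub> h' = g' \<and> g'' \<cdot>\<^bsub>LA\<^esub> e = AMap Sh f
            \<cdot>\<^bsub>LA\<^esub> h''"
    if "f \<in> Hom LA A B" "g \<in> Hom LA B D" for f g A B D
    using Dt_octahedron[of f A B g D] that unfolding LA_simps LA_Hom by blast
qed

end

theorem theorem6p20:
  fixes X :: "('o, 'm, 'e) ext_cat"
    and S T U V :: "'o set"
    and v u :: "'o \<Rightarrow> 'm"
    and \<rho> :: "'o \<Rightarrow> 'e"
    and uf :: "'m \<Rightarrow> 'm"
  assumes "extriangulated_category X"
    and "WIC X"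
    and "hovey_twin_cotorsion_pair X S T U V"
    and "shift_choice X U V v u \<rho> uf"
  shows "triangulation (localization X (weq X S V))
           (shift X (weq X S V) u uf)
           (distinguished_triangles X S V u \<rho> uf)"
proof -
  interpret hovey_shift X S T U V v u \<rho> uf
    using assms by (intro hovey_shift.intro hovey.intro xcat.intro hovey_axioms.intro
        hovey_shift_axioms.intro)
  show ?thesis
    \<comment> \<open>The existential is witnessed by \<open>ladd\<close> and \<open>lzero\<close>,
      through the definition of \<open>LA\<close>.\<close>
    unfolding triangulation_def
    using pretriangulated.triangulated[OF pretriangulated_LA] unfolding LA_def by blast
qed

end
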